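(* Let $H$ be a finite-dimensional Hopf algebra over a field $k$. Then $\{A_{par},A_{par}\}$, with the $H$-module algebra structure and the right $H$-coaction described in the context, is a braided commutative algebra in the category ${}_H\mathcal{YD}^H$ of left-right Yetter–Drinfeld modules. Consequently, $H_{glob}=\{A_{par},A_{par}\}\#H$ is a Hopf algebroid (with base algebra $\{A_{par},A_{par}\}$).
   Context: Notation: $H$ has antipode $S$ (invertible), counit $\epsilon$ and comultiplication $\Delta(h)=h_{(1)}\otimes h_{(2)}$ (Sweedler notation); $\otimes=\otimes_k$. A partial representation of $H$ in a $k$-algebra $B$ is a $k$-linear map $\pi:H\to B$ such that $\pi(1_H)=1_B$; $\pi(h)\pi(l_{(1)})\pi(S(l_{(2)}))=\pi(hl_{(1)})\pi(S(l_{(2)}))$; and $\pi(h_{(1)})\pi(S(h_{(2)}))\pi(l)=\pi(h_{(1)})\pi(S(h_{(2)})l)$ for all $h,l\in H$. A partial $H$-module is a vector space $M$ with a partial representation $\pi:H\to\mathrm{End}_k(M)$, $h\bullet m=\pi(h)(m)$; morphisms are linear maps commuting with $\bullet$; the category is ${}_H\mathsf{PMod}$. $H_{par}$ is the quotient of the tensor algebra of $H$ by the relations making the canonical map $[-]:H\to H_{par}$ a partial representation. Put $\varepsilon_h=[h_{(1)}][S(h_{(2)})]$; $A_{par}\subseteq H_{par}$ is the subalgebra generated by all $\varepsilon_h$, a partial $H$-module via $h\bullet a=[h_{(1)}]a[S(h_{(2)})]$. $\{A_{par},A_{par}\}=\mathrm{Hom}_{{}_H\mathsf{PMod}}(A_{par}\otimes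 H,A_{par})$, where $h\bullet(a\otimes l)=h_{(1)}\bullet a\otimes h_{(2)}l$. Its $H$-action is $(h'\rightharpoonup f)(a\otimes h)=f(a\otimes hh')$, its product is $(f\circ g)(a\otimes h)=g(f(a\otimes h_{(1)})\otimes h_{(2)})=f(a\otimes h_{(1)})g(1\otimes h_{(2)})$ and its unit is $a\otimes h\mapsto\epsilon(h)a$; this is an $H$-module algebra. $H_{glob}=\{A_{par},A_{par}\}\#H$ is the smash product: the vector space $\{A_{par},A_{par}\}\otimes H$ with product $(\varphi\#h)(\psi\#l)=\varphi\circ(h_{(1)}\rightharpoonup\psi)\#h_{(2)}l$. Coaction: the map $f\mapsto f(1_{A_{par}}\otimes-)$ identifies $\{A_{par},A_{par}\}$ with the space ${}_{(H)}\mathrm{Hom}(H,A_{par})$ of linear maps $g:H\to A_{par}$ satisfying $h_{(1)}\bullet g(S(h_{(2)})l)=h_{(1)}\bullet(S(h_{(2)})\bullet g(l))$. $A_{par}$ is a right $H$-comodule via $a\mapsto a^{(0)}\otimes a^{(1)}$, $$\varepsilon_{h^1}\cdots\varepsilon_{h^n}\mapsto\varepsilon_{h^1_{(2)}}\cdots\varepsilon_{h^n_{(2)}}\otimes h^n_{(3)}S^{-1}(h^n_{(1)})\cdots h^1_{(3)}S^{-1}(h^1_{(1)}).$$ The coaction $\rho(f)=f^{(0)}\otimes f^{(1)}$ on ${}_{(H)}\mathrm{Hom}(H,A_{par})$ is determined by $$f^{(0)}(l)\otimes f^{(1)}=f(l_{(2)})^{(0)}\otimes S^{-1}(l_{(3)})\,f(l_{(2)})^{(1)}\,l_{(1)}\qquad(l\in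 H).$$ An object of ${}_H\mathcal{YD}^H$ is a left $H$-module and right $H$-comodule $V$ with $(l\rightharpoonup v)^{(0)}\otimes(l\rightharpoonup v)^{(1)}=(l_{(2)}\rightharpoonup v^{(0)})\otimes l_{(3)}v^{(1)}S^{-1}(l_{(1)})$. An algebra in ${}_H\mathcal{YD}^H$ is such a $V$ that is also a left $H$-module algebra and a right $H^{op}$-comodule algebra (i.e. $(vw)^{(0)}\otimes(vw)^{(1)}=v^{(0)}w^{(0)}\otimes w^{(1)}v^{(1)}$, $\rho(1)=1\otimes1$); it is braided commutative if $v^{(0)}(v^{(1)}\rightharpoonup w)=wv$ for all $v,w$. Hopf algebroid is meant in the sense of Lu (as used by Brzeziński–Militaru): a bialgebroid $L$ over a base algebra $A$ with source $s$, target $t$, coproduct $\Delta$, counit $\varepsilon$, together with an algebra anti-automorphism $\tau$ of $L$ such that $\tau t=s$, $m(\tau\otimes\mathrm{id})\Delta=t\varepsilon\tau$, and there is a linear section $\gamma$ of the projection $L\otimes L\to L\otimes_AL$ with $m(\mathrm{id}\otimes\tau)\gamma\Delta=s\varepsilon$. *)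

theory Defs
  imports "HOL-Algebra.Module" "HOL-Algebra.QuotRing" "HOL-Algebra.Subrings"
begin

section \<open>Linear algebra over a field\<close>

text \<open>
  A vector space over \<open>K\<close> is a \<^locale>\<open>module\<close> over \<open>K\<close>; its fields \<^const>\<open>mult\<close> and
  \<^const>\<open>one\<close> are ignored unless it is stated to be an algebra.
\<close>

definition lin_hom ::
  "('k, 'a) ring_scheme \<Rightarrow> ('k, 'v, 'b) module_scheme \<Rightarrow> ('k, 'w, 'c) module_scheme \<Rightarrow> ('v \<Rightarrow> 'w) set"
  where "lin_hom K V W = {f \<in> carrier V \<rightarrow> carrier W.
     (\<forall>x\<in>carrier V. \<forall>y\<in>carrier V. f (x \<oplus>\<^bsub>V\<^esub> y) = f x \<oplus>\<^bsub>W\<^esub> f y) \<and>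
     (\<forall>a\<in>carrier K. \<forall>x\<in>carrier V. f (a \<odot>\<^bsub>V\<^esub> x) = a \<odot>\<^bsub>W\<^esub> f x)}"

definition lin_span ::
  "('k, 'a) ring_scheme \<Rightarrow> ('k, 'v, 'b) module_scheme \<Rightarrow> 'v set \<Rightarrow> 'v set"
  where "lin_span K V X = \<Inter>{U. submodule U K V \<and> X \<subseteq> U}"

definition finite_dimensional :: "('k, 'a) ring_scheme \<Rightarrow> ('k, 'v, 'b) module_scheme \<Rightarrow> bool"
  where "finite_dimensional K V \<longleftrightarrow>
     (\<exists>B. finite B \<and> B \<subseteq> carrier V \<and> lin_span K V B = carrier V)"

text \<open>
  Quotient by a submodule \<open>I\<close>, and also by a two-sided ideal \<open>I\<close> of an algebra: only the
  multiplication inherited from \<^const>\<open>FactRing\<close> needs \<open>I\<close> to be an ideal.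
\<close>

definition quot :: "('k, 'v, 'b) module_scheme \<Rightarrow> 'v set \<Rightarrow> ('k, 'v set) module"
  where "quot V I = ring.extend (V Quot I)
     (module.fields (\<lambda>a X. \<Union>x\<in>X. I +>\<^bsub>V\<^esub> (a \<odot>\<^bsub>V\<^esub> x)))"

definition free_mod :: "('k, 'a) ring_scheme \<Rightarrow> 'x set \<Rightarrow> ('k, 'x \<Rightarrow> 'k) module"
  where "free_mod K X =
    \<lparr>carrier = {f. (\<forall>x. f x \<in> carrier K) \<and> (\<forall>x. x \<notin> X \<longrightarrow> f x = \<zero>\<^bsub>K\<^esub>)
                 \<and> finite {x. f x \<noteq> \<zero>\<^bsub>K\<^esub>}},
     mult = undefined, one = undefined,
     zero = (\<lambda>x. \<zero>\<^bsub>K\<^esub>),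
     add = (\<lambda>f g x. f x \<oplus>\<^bsub>K\<^esub> g x),
     smult = (\<lambda>a f x. a \<otimes>\<^bsub>K\<^esub> f x)\<rparr>"

definition free_gen :: "('k, 'a) ring_scheme \<Rightarrow> 'x \<Rightarrow> 'x \<Rightarrow> 'k"
  where "free_gen K x = (\<lambda>y. if y = x then \<one>\<^bsub>K\<^esub> else \<zero>\<^bsub>K\<^esub>)"


subsection \<open>Tensor products over the field\<close>

type_synonym ('k, 'v, 'w) tensor = "('v \<times> 'w \<Rightarrow> 'k) set"

definition bilinear_rels ::
  "('k, 'a) ring_scheme \<Rightarrow> ('k, 'v, 'b) module_scheme \<Rightarrow> ('k, 'w, 'c) module_scheme
     \<Rightarrow> ('v \<times> 'w \<Rightarrow> 'k) set"
  where "bilinear_rels K V W =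
    (let F = free_mod K (carrier V \<times> carrier W); d = free_gen K in
       {d (v \<oplus>\<^bsub>V\<^esub> v', w) \<ominus>\<^bsub>F\<^esub> (d (v, w) \<oplus>\<^bsub>F\<^esub> d (v', w)) | v v' w.
          v \<in> carrier V \<and> v' \<in> carrier V \<and> w \<in> carrier W}
     \<union> {d (v, w \<oplus>\<^bsub>W\<^esub> w') \<ominus>\<^bsub>F\<^esub> (d (v, w) \<oplus>\<^bsub>F\<^esub> d (v, w')) | v w w'.
          v \<in> carrier V \<and> w \<in> carrier W \<and> w' \<in> carrier W}
     \<union> {d (a \<odot>\<^bsub>V\<^esub> v, w) \<ominus>\<^bsub>F\<^esub> (a \<odot>\<^bsub>F\<^esub> d (v, w)) | a v w.
          a \<in> carrier K \<and> v \<in> carrier V \<and> w \<in> carrier W}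
     \<union> {d (v, a \<odot>\<^bsub>W\<^esub> w) \<ominus>\<^bsub>F\<^esub> (a \<odot>\<^bsub>F\<^esub> d (v, w)) | a v w.
          a \<in> carrier K \<and> v \<in> carrier V \<and> w \<in> carrier W})"

definition tensor_null ::
  "('k, 'a) ring_scheme \<Rightarrow> ('k, 'v, 'b) module_scheme \<Rightarrow> ('k, 'w, 'c) module_scheme
     \<Rightarrow> ('v \<times> 'w \<Rightarrow> 'k) set"
  where "tensor_null K V W =
    lin_span K (free_mod K (carrier V \<times> carrier W)) (bilinear_rels K V W)"

definition tensor ::
  "('k, 'a) ring_scheme \<Rightarrow> ('k, 'v, 'b) module_scheme \<Rightarrow> ('k, 'w, 'c) module_scheme
     \<Rightarrow> ('k, ('k, 'v, 'w) tensor) module"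
  where "tensor K V W = quot (free_mod K (carrier V \<times> carrier W)) (tensor_null K V W)"

definition pure ::
  "('k, 'a) ring_scheme \<Rightarrow> ('k, 'v, 'b) module_scheme \<Rightarrow> ('k, 'w, 'c) module_scheme
     \<Rightarrow> 'v \<Rightarrow> 'w \<Rightarrow> ('k, 'v, 'w) tensor"
  where "pure K V W v w =
    tensor_null K V W +>\<^bsub>free_mod K (carrier V \<times> carrier W)\<^esub> free_gen K (v, w)"

text \<open>
  Sweedler notation: if \<open>t = \<Sum> v\<^sub>i \<otimes> w\<^sub>i\<close> is an element of \<open>V \<otimes> W\<close>, then
  \<open>sw K P t B = \<Sum> B v\<^sub>i w\<^sub>i\<close>, a sum in \<open>P\<close>.  It is evaluated on a chosen representative of
  \<open>t\<close> and does not depend on it when \<open>B\<close> is bilinear, as in all uses below; thus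
  \<open>sw K P (\<Delta> h) (\<lambda>h1 h2. B h1 h2)\<close> is the usual \<open>B(h\<^sub>(\<^sub>1\<^sub>), h\<^sub>(\<^sub>2\<^sub>))\<close>.
\<close>

definition sw ::
  "('k, 'a) ring_scheme \<Rightarrow> ('k, 'p, 'b) module_scheme \<Rightarrow> ('k, 'v, 'w) tensor
     \<Rightarrow> ('v \<Rightarrow> 'w \<Rightarrow> 'p) \<Rightarrow> 'p"
  where "sw K P t B = (let x = (SOME x. x \<in> t) in
     (\<Oplus>\<^bsub>P\<^esub>p\<in>{p. x p \<noteq> \<zero>\<^bsub>K\<^esub>}. x p \<odot>\<^bsub>P\<^esub> B (fst p) (snd p)))"


subsection \<open>Associative algebras\<close>

locale assoc_algebra = module + ring M +
  assumes smult_mult_l: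
      "\<lbrakk>a \<in> carrier R; x \<in> carrier M; y \<in> carrier M\<rbrakk> \<Longrightarrow>
        (a \<odot>\<^bsub>M\<^esub> x) \<otimes>\<^bsub>M\<^esub> y = a \<odot>\<^bsub>M\<^esub> (x \<otimes>\<^bsub>M\<^esub> y)"
    and smult_mult_r:
      "\<lbrakk>a \<in> carrier R; x \<in> carrier M; y \<in> carrier M\<rbrakk> \<Longrightarrow>
        x \<otimes>\<^bsub>M\<^esub> (a \<odot>\<^bsub>M\<^esub> y) = a \<odot>\<^bsub>M\<^esub> (x \<otimes>\<^bsub>M\<^esub> y)"

definition alg_hom ::
  "('k, 'a) ring_scheme \<Rightarrow> ('k, 'v, 'b) module_scheme \<Rightarrow> ('k, 'w, 'c) module_scheme \<Rightarrow> ('v \<Rightarrow> 'w) set"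
  where "alg_hom K A B = {f \<in> lin_hom K A B. f \<one>\<^bsub>A\<^esub> = \<one>\<^bsub>B\<^esub> \<and>
     (\<forall>x\<in>carrier A. \<forall>y\<in>carrier A. f (x \<otimes>\<^bsub>A\<^esub> y) = f x \<otimes>\<^bsub>B\<^esub> f y)}"

definition alg_antihom ::
  "('k, 'a) ring_scheme \<Rightarrow> ('k, 'v, 'b) module_scheme \<Rightarrow> ('k, 'w, 'c) module_scheme \<Rightarrow> ('v \<Rightarrow> 'w) set"
  where "alg_antihom K A B = {f \<in> lin_hom K A B. f \<one>\<^bsub>A\<^esub> = \<one>\<^bsub>B\<^esub> \<and>
     (\<forall>x\<in>carrier A. \<forall>y\<in>carrier A. f (x \<otimes>\<^bsub>A\<^esub> y) = f y \<otimes>\<^bsub>B\<^esub> f x)}"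

definition subalgebra_gen ::
  "('k, 'a) ring_scheme \<Rightarrow> ('k, 'v, 'b) module_scheme \<Rightarrow> 'v set \<Rightarrow> 'v set"
  where "subalgebra_gen K A X = \<Inter>{C. subring C A \<and> submodule C K A \<and> X \<subseteq> C}"

text \<open>
  The tensor algebra \<open>T(V)\<close> is the free algebra on words in elements of \<open>V\<close> modulo the linear
  relations; its degree-\<open>n\<close> part (words of length \<open>n\<close>) is the \<open>n\<close>-th tensor power of \<open>V\<close>.
\<close>

definition word_alg :: "('k, 'a) ring_scheme \<Rightarrow> 'x set \<Rightarrow> ('k, 'x list \<Rightarrow> 'k) module"
  where "word_alg K X = (free_mod K (lists X))
    \<lparr>mult := (\<lambda>f g w. \<Oplus>\<^bsub>K\<^esub>i\<in>{..length w}. f (take i w) \<otimes>\<^bsub>K\<^esub> g (drop i w)),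
     one := free_gen K []\<rparr>"

definition tensor_alg_null ::
  "('k, 'a) ring_scheme \<Rightarrow> ('k, 'v, 'b) module_scheme \<Rightarrow> ('v list \<Rightarrow> 'k) set"
  where "tensor_alg_null K V =
    (let F = word_alg K (carrier V); d = (\<lambda>v. free_gen K [v]) in
     genideal F
      ({d (v \<oplus>\<^bsub>V\<^esub> v') \<ominus>\<^bsub>F\<^esub> (d v \<oplus>\<^bsub>F\<^esub> d v') | v v'. v \<in> carrier V \<and> v' \<in> carrier V}
     \<union> {d (a \<odot>\<^bsub>V\<^esub> v) \<ominus>\<^bsub>F\<^esub> (a \<odot>\<^bsub>F\<^esub> d v) | a v. a \<in> carrier K \<and> v \<in> carrier V}))"

definition tensor_alg ::
  "('k, 'a) ring_scheme \<Rightarrow> ('k, 'v, 'b) module_scheme \<Rightarrow> ('k, ('v list \<Rightarrow> 'k) set) module"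
  where "tensor_alg K V = quot (word_alg K (carrier V)) (tensor_alg_null K V)"

definition tensor_alg_incl ::
  "('k, 'a) ring_scheme \<Rightarrow> ('k, 'v, 'b) module_scheme \<Rightarrow> 'v \<Rightarrow> ('v list \<Rightarrow> 'k) set"
  where "tensor_alg_incl K V v =
    tensor_alg_null K V +>\<^bsub>word_alg K (carrier V)\<^esub> free_gen K [v]"


section \<open>Hopf algebras, modules and comodules\<close>

record ('k, 'h) hopf = "('k, 'h) module" +
  comult :: "'h \<Rightarrow> ('k, 'h, 'h) tensor"
  counit :: "'h \<Rightarrow> 'k"
  antipode :: "'h \<Rightarrow> 'h"

locale hopf_algebra = field K + assoc_algebra K H
  for K :: "('k, 'a) ring_scheme" and H :: "('k, 'h) hopf" +
  assumes comult_lin: "comult H \<in> lin_hom K H (tensor K H H)"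
    and comult_coassoc: "\<And>h. h \<in> carrier H \<Longrightarrow>
      sw K (tensor K (tensor K H H) H) (comult H h)
        (\<lambda>x y. pure K (tensor K H H) H (comult H x) y) =
      sw K (tensor K (tensor K H H) H) (comult H h)
        (\<lambda>x y. sw K (tensor K (tensor K H H) H) (comult H y)
           (\<lambda>y1 y2. pure K (tensor K H H) H (pure K H H x y1) y2))"
    and counit_closed: "counit H \<in> carrier H \<rightarrow> carrier K"
    and counit_add: "\<And>x y. \<lbrakk>x \<in> carrier H; y \<in> carrier H\<rbrakk> \<Longrightarrow>
      counit H (x \<oplus>\<^bsub>H\<^esub> y) = counit H x \<oplus>\<^bsub>K\<^esub> counit H y"
    and counit_smult: "\<And>a x. \<lbrakk>a \<in> carrier K; x \<in> carrier H\<rbrakk> \<Longrightarrow>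
      counit H (a \<odot>\<^bsub>H\<^esub> x) = a \<otimes>\<^bsub>K\<^esub> counit H x"
    and counit_l: "\<And>h. h \<in> carrier H \<Longrightarrow>
      sw K H (comult H h) (\<lambda>h1 h2. counit H h1 \<odot>\<^bsub>H\<^esub> h2) = h"
    and counit_r: "\<And>h. h \<in> carrier H \<Longrightarrow>
      sw K H (comult H h) (\<lambda>h1 h2. counit H h2 \<odot>\<^bsub>H\<^esub> h1) = h"
    and comult_one: "comult H \<one>\<^bsub>H\<^esub> = pure K H H \<one>\<^bsub>H\<^esub> \<one>\<^bsub>H\<^esub>"
    and comult_mult: "\<And>h l. \<lbrakk>h \<in> carrier H; l \<in> carrier H\<rbrakk> \<Longrightarrow>
      comult H (h \<otimes>\<^bsub>H\<^esub> l) =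
      sw K (tensor K H H) (comult H h) (\<lambda>h1 h2. sw K (tensor K H H) (comult H l)
        (\<lambda>l1 l2. pure K H H (h1 \<otimes>\<^bsub>H\<^esub> l1) (h2 \<otimes>\<^bsub>H\<^esub> l2)))"
    and counit_one: "counit H \<one>\<^bsub>H\<^esub> = \<one>\<^bsub>K\<^esub>"
    and counit_mult: "\<And>h l. \<lbrakk>h \<in> carrier H; l \<in> carrier H\<rbrakk> \<Longrightarrow>
      counit H (h \<otimes>\<^bsub>H\<^esub> l) = counit H h \<otimes>\<^bsub>K\<^esub> counit H l"
    and antipode_lin: "antipode H \<in> lin_hom K H H"
    and antipode_l: "\<And>h. h \<in> carrier H \<Longrightarrow>
      sw K H (comult H h) (\<lambda>h1 h2. antipode H h1 \<otimes>\<^bsub>H\<^esub> h2) = counit H h \<odot>\<^bsub>H\<^esub> \<one>\<^bsub>H\<^esub>"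
    and antipode_r: "\<And>h. h \<in> carrier H \<Longrightarrow>
      sw K H (comult H h) (\<lambda>h1 h2. h1 \<otimes>\<^bsub>H\<^esub> antipode H h2) = counit H h \<odot>\<^bsub>H\<^esub> \<one>\<^bsub>H\<^esub>"

definition antipode_inv :: "('k, 'h) hopf \<Rightarrow> 'h \<Rightarrow> 'h"
  where "antipode_inv H = inv_into (carrier H) (antipode H)"

definition left_hmodule ::
  "('k, 'a) ring_scheme \<Rightarrow> ('k, 'h) hopf \<Rightarrow> ('k, 'v, 'b) module_scheme \<Rightarrow> ('h \<Rightarrow> 'v \<Rightarrow> 'v) \<Rightarrow> bool"
  where "left_hmodule K H V act \<longleftrightarrow> module K V \<and>
     (\<forall>h\<in>carrier H. act h \<in> lin_hom K V V) \<and>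
     (\<forall>v\<in>carrier V. (\<lambda>h. act h v) \<in> lin_hom K H V) \<and>
     (\<forall>v\<in>carrier V. act \<one>\<^bsub>H\<^esub> v = v) \<and>
     (\<forall>h\<in>carrier H. \<forall>l\<in>carrier H. \<forall>v\<in>carrier V. act (h \<otimes>\<^bsub>H\<^esub> l) v = act h (act l v))"

definition left_hmodule_algebra ::
  "('k, 'a) ring_scheme \<Rightarrow> ('k, 'h) hopf \<Rightarrow> ('k, 'v, 'b) module_scheme \<Rightarrow> ('h \<Rightarrow> 'v \<Rightarrow> 'v) \<Rightarrow> bool"
  where "left_hmodule_algebra K H V act \<longleftrightarrow> assoc_algebra K V \<and> left_hmodule K H V act \<and>
     (\<forall>h\<in>carrier H. \<forall>v\<in>carrier V. \<forall>w\<in>carrier V.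
        act h (v \<otimes>\<^bsub>V\<^esub> w) = sw K V (comult H h) (\<lambda>h1 h2. act h1 v \<otimes>\<^bsub>V\<^esub> act h2 w)) \<and>
     (\<forall>h\<in>carrier H. act h \<one>\<^bsub>V\<^esub> = counit H h \<odot>\<^bsub>V\<^esub> \<one>\<^bsub>V\<^esub>)"

definition right_hcomodule ::
  "('k, 'a) ring_scheme \<Rightarrow> ('k, 'h) hopf \<Rightarrow> ('k, 'v, 'b) module_scheme
     \<Rightarrow> ('v \<Rightarrow> ('k, 'v, 'h) tensor) \<Rightarrow> bool"
  where "right_hcomodule K H V \<rho> \<longleftrightarrow> module K V \<and> \<rho> \<in> lin_hom K V (tensor K V H) \<and>
     (\<forall>v\<in>carrier V.
        sw K (tensor K (tensor K V H) H) (\<rho> v) (\<lambda>v0 v1. pure K (tensor K V H) H (\<rho> v0) v1) =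
        sw K (tensor K (tensor K V H) H) (\<rho> v)
          (\<lambda>v0 v1. sw K (tensor K (tensor K V H) H) (comult H v1)
             (\<lambda>x y. pure K (tensor K V H) H (pure K V H v0 x) y))) \<and>
     (\<forall>v\<in>carrier V. sw K V (\<rho> v) (\<lambda>v0 v1. counit H v1 \<odot>\<^bsub>V\<^esub> v0) = v)"

definition right_hop_comodule_algebra ::
  "('k, 'a) ring_scheme \<Rightarrow> ('k, 'h) hopf \<Rightarrow> ('k, 'v, 'b) module_scheme
     \<Rightarrow> ('v \<Rightarrow> ('k, 'v, 'h) tensor) \<Rightarrow> bool"
  where "right_hop_comodule_algebra K H V \<rho> \<longleftrightarrow> assoc_algebra K V \<and> right_hcomodule K H V \<rho> \<and>
     (\<forall>v\<in>carrier V. \<forall>w\<in>carrier V. \<rho> (v \<otimes>\<^bsub>V\<^esub> w) =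
        sw K (tensor K V H) (\<rho> v) (\<lambda>v0 v1. sw K (tensor K V H) (\<rho> w)
          (\<lambda>w0 w1. pure K V H (v0 \<otimes>\<^bsub>V\<^esub> w0) (w1 \<otimes>\<^bsub>H\<^esub> v1)))) \<and>
     \<rho> \<one>\<^bsub>V\<^esub> = pure K V H \<one>\<^bsub>V\<^esub> \<one>\<^bsub>H\<^esub>"

definition yetter_drinfeld ::
  "('k, 'a) ring_scheme \<Rightarrow> ('k, 'h) hopf \<Rightarrow> ('k, 'v, 'b) module_scheme
     \<Rightarrow> ('h \<Rightarrow> 'v \<Rightarrow> 'v) \<Rightarrow> ('v \<Rightarrow> ('k, 'v, 'h) tensor) \<Rightarrow> bool"
  where "yetter_drinfeld K H V act \<rho> \<longleftrightarrow> left_hmodule K H V act \<and> right_hcomodule K H V \<rho> \<and>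
     (\<forall>l\<in>carrier H. \<forall>v\<in>carrier V. \<rho> (act l v) =
        sw K (tensor K V H) (comult H l) (\<lambda>l1 l'. sw K (tensor K V H) (comult H l')
          (\<lambda>l2 l3. sw K (tensor K V H) (\<rho> v)
             (\<lambda>v0 v1. pure K V H (act l2 v0) (l3 \<otimes>\<^bsub>H\<^esub> v1 \<otimes>\<^bsub>H\<^esub> antipode_inv H l1)))))"

definition yetter_drinfeld_algebra ::
  "('k, 'a) ring_scheme \<Rightarrow> ('k, 'h) hopf \<Rightarrow> ('k, 'v, 'b) module_scheme
     \<Rightarrow> ('h \<Rightarrow> 'v \<Rightarrow> 'v) \<Rightarrow> ('v \<Rightarrow> ('k, 'v, 'h) tensor) \<Rightarrow> bool"
  where "yetter_drinfeld_algebra K H V act \<rho> \<longleftrightarrow> yetter_drinfeld K H V act \<rho> \<and>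
     left_hmodule_algebra K H V act \<and> right_hop_comodule_algebra K H V \<rho>"

definition braided_commutative ::
  "('k, 'a) ring_scheme \<Rightarrow> ('k, 'v, 'b) module_scheme
     \<Rightarrow> ('h \<Rightarrow> 'v \<Rightarrow> 'v) \<Rightarrow> ('v \<Rightarrow> ('k, 'v, 'h) tensor) \<Rightarrow> bool"
  where "braided_commutative K V act \<rho> \<longleftrightarrow>
     (\<forall>v\<in>carrier V. \<forall>w\<in>carrier V. sw K V (\<rho> v) (\<lambda>v0 v1. v0 \<otimes>\<^bsub>V\<^esub> act v1 w) = w \<otimes>\<^bsub>V\<^esub> v)"

definition smash ::
  "('k, 'a) ring_scheme \<Rightarrow> ('k, 'h) hopf \<Rightarrow> ('k, 'v, 'b) module_scheme \<Rightarrow> ('h \<Rightarrow> 'v \<Rightarrow> 'v)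
     \<Rightarrow> ('k, ('k, 'v, 'h) tensor) module"
  where "smash K H V act = (tensor K V H)
    \<lparr>mult := (\<lambda>x y. sw K (tensor K V H) x (\<lambda>v h. sw K (tensor K V H) y
       (\<lambda>w l. sw K (tensor K V H) (comult H h)
          (\<lambda>h1 h2. pure K V H (v \<otimes>\<^bsub>V\<^esub> act h1 w) (h2 \<otimes>\<^bsub>H\<^esub> l))))),
     one := pure K V H \<one>\<^bsub>V\<^esub> \<one>\<^bsub>H\<^esub>\<rparr>"


section \<open>Partial modules, \<open>H\<^sub>p\<^sub>a\<^sub>r\<close> and \<open>A\<^sub>p\<^sub>a\<^sub>r\<close>\<close>

definition partial_rels ::
  "('k, 'a) ring_scheme \<Rightarrow> ('k, 'h) hopf \<Rightarrow> ('h list \<Rightarrow> 'k) set set"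
  where "partial_rels K H =
    (let T = tensor_alg K H; i = tensor_alg_incl K H; S = antipode H in
       {i \<one>\<^bsub>H\<^esub> \<ominus>\<^bsub>T\<^esub> \<one>\<^bsub>T\<^esub>}
     \<union> {sw K T (comult H l) (\<lambda>l1 l2. i h \<otimes>\<^bsub>T\<^esub> i l1 \<otimes>\<^bsub>T\<^esub> i (S l2))
          \<ominus>\<^bsub>T\<^esub> sw K T (comult H l) (\<lambda>l1 l2. i (h \<otimes>\<^bsub>H\<^esub> l1) \<otimes>\<^bsub>T\<^esub> i (S l2))
        | h l. h \<in> carrier H \<and> l \<in> carrier H}
     \<union> {sw K T (comult H h) (\<lambda>h1 h2. i h1 \<otimes>\<^bsub>T\<^esub> i (S h2) \<otimes>\<^bsub>T\<^esub> i l)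
          \<ominus>\<^bsub>T\<^esub> sw K T (comult H h) (\<lambda>h1 h2. i h1 \<otimes>\<^bsub>T\<^esub> i (S h2 \<otimes>\<^bsub>H\<^esub> l))
        | h l. h \<in> carrier H \<and> l \<in> carrier H})"

type_synonym ('k, 'h) par = "('h list \<Rightarrow> 'k) set set"

definition hpar :: "('k, 'a) ring_scheme \<Rightarrow> ('k, 'h) hopf \<Rightarrow> ('k, ('k, 'h) par) module"
  where "hpar K H = quot (tensor_alg K H) (genideal (tensor_alg K H) (partial_rels K H))"

definition br :: "('k, 'a) ring_scheme \<Rightarrow> ('k, 'h) hopf \<Rightarrow> 'h \<Rightarrow> ('k, 'h) par"
  where "br K H h =
    genideal (tensor_alg K H) (partial_rels K H) +>\<^bsub>tensor_alg K H\<^esub> tensor_alg_incl K H h"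

definition par_eps :: "('k, 'a) ring_scheme \<Rightarrow> ('k, 'h) hopf \<Rightarrow> 'h \<Rightarrow> ('k, 'h) par"
  where "par_eps K H h = sw K (hpar K H) (comult H h)
     (\<lambda>h1 h2. br K H h1 \<otimes>\<^bsub>hpar K H\<^esub> br K H (antipode H h2))"

definition apar :: "('k, 'a) ring_scheme \<Rightarrow> ('k, 'h) hopf \<Rightarrow> ('k, ('k, 'h) par) module"
  where "apar K H = (hpar K H)
    \<lparr>carrier := subalgebra_gen K (hpar K H) (par_eps K H ` carrier H)\<rparr>"

text \<open>The single summands \<open>[h\<^sub>(\<^sub>1\<^sub>)] a [S(h\<^sub>(\<^sub>2\<^sub>))]\<close> lie in \<open>H\<^sub>p\<^sub>a\<^sub>r\<close>, only their sum lies in \<open>A\<^sub>p\<^sub>a\<^sub>r\<close>.\<close>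

definition apar_act ::
  "('k, 'a) ring_scheme \<Rightarrow> ('k, 'h) hopf \<Rightarrow> 'h \<Rightarrow> ('k, 'h) par \<Rightarrow> ('k, 'h) par"
  where "apar_act K H h a = sw K (hpar K H) (comult H h)
     (\<lambda>h1 h2. br K H h1 \<otimes>\<^bsub>hpar K H\<^esub> a \<otimes>\<^bsub>hpar K H\<^esub> br K H (antipode H h2))"

text \<open>Morphisms of partial modules, as functions restricted to the carrier of the source.\<close>

definition pmod_hom ::
  "('k, 'a) ring_scheme \<Rightarrow> ('k, 'h) hopf
     \<Rightarrow> ('k, 'v, 'b) module_scheme \<Rightarrow> ('h \<Rightarrow> 'v \<Rightarrow> 'v)
     \<Rightarrow> ('k, 'w, 'c) module_scheme \<Rightarrow> ('h \<Rightarrow> 'w \<Rightarrow> 'w) \<Rightarrow> ('v \<Rightarrow> 'w) set"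
  where "pmod_hom K H V actV W actW = {f \<in> lin_hom K V W \<inter> extensional (carrier V).
     \<forall>h\<in>carrier H. \<forall>v\<in>carrier V. f (actV h v) = actW h (f v)}"

abbreviation apar_H ::
  "('k, 'a) ring_scheme \<Rightarrow> ('k, 'h) hopf \<Rightarrow> ('k, ('k, ('k, 'h) par, 'h) tensor) module"
  where "apar_H K H \<equiv> tensor K (apar K H) H"

definition apar_H_act ::
  "('k, 'a) ring_scheme \<Rightarrow> ('k, 'h) hopf
     \<Rightarrow> 'h \<Rightarrow> ('k, ('k, 'h) par, 'h) tensor \<Rightarrow> ('k, ('k, 'h) par, 'h) tensor"
  where "apar_H_act K H h x = sw K (apar_H K H) (comult H h)
     (\<lambda>h1 h2. sw K (apar_H K H) x
        (\<lambda>a l. pure K (apar K H) H (apar_act K H h1 a) (h2 \<otimes>\<^bsub>H\<^esub> l)))"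


section \<open>The algebra \<open>{A\<^sub>p\<^sub>a\<^sub>r, A\<^sub>p\<^sub>a\<^sub>r}\<close>\<close>

type_synonym ('k, 'h) parhom = "('k, ('k, 'h) par, 'h) tensor \<Rightarrow> ('k, 'h) par"

definition apar_homs :: "('k, 'a) ring_scheme \<Rightarrow> ('k, 'h) hopf \<Rightarrow> ('k, ('k, 'h) parhom) module"
  where "apar_homs K H = (let A = apar K H; X = apar_H K H in
    \<lparr>carrier = pmod_hom K H X (apar_H_act K H) A (apar_act K H),
     mult = (\<lambda>f g. \<lambda>x\<in>carrier X. sw K A x (\<lambda>a h. sw K A (comult H h)
        (\<lambda>h1 h2. g (pure K A H (f (pure K A H a h1)) h2)))),
     one = (\<lambda>x\<in>carrier X. sw K A x (\<lambda>a h. counit H h \<odot>\<^bsub>A\<^esub> a)),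
     zero = (\<lambda>x\<in>carrier X. \<zero>\<^bsub>A\<^esub>),
     add = (\<lambda>f g. \<lambda>x\<in>carrier X. f x \<oplus>\<^bsub>A\<^esub> g x),
     smult = (\<lambda>c f. \<lambda>x\<in>carrier X. c \<odot>\<^bsub>A\<^esub> f x)\<rparr>)"

definition apar_homs_act ::
  "('k, 'a) ring_scheme \<Rightarrow> ('k, 'h) hopf \<Rightarrow> 'h \<Rightarrow> ('k, 'h) parhom \<Rightarrow> ('k, 'h) parhom"
  where "apar_homs_act K H h' f = (\<lambda>x\<in>carrier (apar_H K H).
     sw K (apar K H) x (\<lambda>a h. f (pure K (apar K H) H a (h \<otimes>\<^bsub>H\<^esub> h'))))"

text \<open>
  The value of the coaction of \<open>A\<^sub>p\<^sub>a\<^sub>r\<close> on the product of the \<open>\<epsilon>\<^sub>h\<close>, \<open>h\<close> running through a list.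
\<close>

fun apar_coact_word ::
  "('k, 'a) ring_scheme \<Rightarrow> ('k, 'h) hopf \<Rightarrow> 'h list \<Rightarrow> ('k, ('k, 'h) par, 'h) tensor"
  where
    "apar_coact_word K H [] = pure K (apar K H) H \<one>\<^bsub>apar K H\<^esub> \<one>\<^bsub>H\<^esub>"
  | "apar_coact_word K H (h # hs) =
      sw K (apar_H K H) (comult H h) (\<lambda>h1 h'. sw K (apar_H K H) (comult H h')
        (\<lambda>h2 h3. sw K (apar_H K H) (apar_coact_word K H hs)
          (\<lambda>a x. pure K (apar K H) H (par_eps K H h2 \<otimes>\<^bsub>apar K H\<^esub> a)
             (x \<otimes>\<^bsub>H\<^esub> (h3 \<otimes>\<^bsub>H\<^esub> antipode_inv H h1)))))"

definition is_apar_coaction ::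
  "('k, 'a) ring_scheme \<Rightarrow> ('k, 'h) hopf
     \<Rightarrow> (('k, 'h) par \<Rightarrow> ('k, ('k, 'h) par, 'h) tensor) \<Rightarrow> bool"
  where "is_apar_coaction K H \<delta> \<longleftrightarrow> \<delta> \<in> lin_hom K (apar K H) (apar_H K H) \<and>
     (\<forall>hs\<in>lists (carrier H).
        \<delta> (foldr (\<lambda>h a. par_eps K H h \<otimes>\<^bsub>apar K H\<^esub> a) hs \<one>\<^bsub>apar K H\<^esub>) = apar_coact_word K H hs)"

text \<open>
  The identification of \<open>f\<close> with \<open>l \<mapsto> f(1 \<otimes> l)\<close> is written out, so \<open>f(l)\<close> in the defining formula
  of the coaction becomes \<open>f(1 \<otimes> l)\<close>.  On the carrier, this formula has at most one solution
  \<open>\<rho>\<close>, and \<^const>\<open>is_apar_coaction\<close> at most one solution \<open>\<delta>\<close>.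
\<close>

definition is_apar_homs_coaction ::
  "('k, 'a) ring_scheme \<Rightarrow> ('k, 'h) hopf
     \<Rightarrow> (('k, 'h) par \<Rightarrow> ('k, ('k, 'h) par, 'h) tensor)
     \<Rightarrow> (('k, 'h) parhom \<Rightarrow> ('k, ('k, 'h) parhom, 'h) tensor) \<Rightarrow> bool"
  where "is_apar_homs_coaction K H \<delta> \<rho> \<longleftrightarrow>
     (let A = apar K H; X = apar_H K H; ev = (\<lambda>f l. f (pure K A H \<one>\<^bsub>A\<^esub> l)) in
      \<rho> \<in> lin_hom K (apar_homs K H) (tensor K (apar_homs K H) H) \<and>
      (\<forall>f\<in>carrier (apar_homs K H). \<forall>l\<in>carrier H.
         sw K X (\<rho> f) (\<lambda>f0 f1. pure K A H (ev f0 l) f1) =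
         sw K X (comult H l) (\<lambda>l1 l'. sw K X (comult H l') (\<lambda>l2 l3. sw K X (\<delta> (ev f l2))
           (\<lambda>a0 a1. pure K A H a0 (antipode_inv H l3 \<otimes>\<^bsub>H\<^esub> a1 \<otimes>\<^bsub>H\<^esub> l1))))))"


section \<open>Hopf algebroids in the sense of Lu\<close>

text \<open>
  Tensor product \<open>M \<otimes>\<^sub>A N\<close> of a right \<open>A\<close>-module \<open>M\<close> (action \<open>ra\<close>) and a left \<open>A\<close>-module
  \<open>N\<close> (action \<open>la\<close>), as a quotient of \<open>M \<otimes> N\<close>.
\<close>

definition bal_null ::
  "('k, 'z) ring_scheme \<Rightarrow> ('k, 'a, 'y) module_scheme
     \<Rightarrow> ('k, 'm, 'b) module_scheme \<Rightarrow> ('m \<Rightarrow> 'a \<Rightarrow> 'm)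
     \<Rightarrow> ('k, 'n, 'c) module_scheme \<Rightarrow> ('a \<Rightarrow> 'n \<Rightarrow> 'n) \<Rightarrow> ('k, 'm, 'n) tensor set"
  where "bal_null K A M ra N la = lin_span K (tensor K M N)
     {pure K M N (ra m a) n \<ominus>\<^bsub>tensor K M N\<^esub> pure K M N m (la a n) | m a n.
        m \<in> carrier M \<and> a \<in> carrier A \<and> n \<in> carrier N}"

definition bal_tensor ::
  "('k, 'z) ring_scheme \<Rightarrow> ('k, 'a, 'y) module_scheme
     \<Rightarrow> ('k, 'm, 'b) module_scheme \<Rightarrow> ('m \<Rightarrow> 'a \<Rightarrow> 'm)
     \<Rightarrow> ('k, 'n, 'c) module_scheme \<Rightarrow> ('a \<Rightarrow> 'n \<Rightarrow> 'n) \<Rightarrow> ('k, ('k, 'm, 'n) tensor set) module"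
  where "bal_tensor K A M ra N la = quot (tensor K M N) (bal_null K A M ra N la)"

definition bal_proj ::
  "('k, 'z) ring_scheme \<Rightarrow> ('k, 'a, 'y) module_scheme
     \<Rightarrow> ('k, 'm, 'b) module_scheme \<Rightarrow> ('m \<Rightarrow> 'a \<Rightarrow> 'm)
     \<Rightarrow> ('k, 'n, 'c) module_scheme \<Rightarrow> ('a \<Rightarrow> 'n \<Rightarrow> 'n)
     \<Rightarrow> ('k, 'm, 'n) tensor \<Rightarrow> ('k, 'm, 'n) tensor set"
  where "bal_proj K A M ra N la x = bal_null K A M ra N la +>\<^bsub>tensor K M N\<^esub> x"

text \<open>
  Sweedler notation for elements of \<open>M \<otimes>\<^sub>A N\<close>: independent of the chosen representative in
  \<open>M \<otimes> N\<close> if \<open>B\<close> is moreover balanced, \<open>B (ra m a) n = B m (la a n)\<close>.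
\<close>

definition bal_sw ::
  "('k, 'z) ring_scheme \<Rightarrow> ('k, 'p, 'b) module_scheme \<Rightarrow> ('k, 'm, 'n) tensor set
     \<Rightarrow> ('m \<Rightarrow> 'n \<Rightarrow> 'p) \<Rightarrow> 'p"
  where "bal_sw K P X B = sw K P (SOME x. x \<in> X) B"

text \<open>
  \<open>L\<close> is an \<open>A\<close>-bimodule by \<open>a \<cdot> l \<cdot> b = s(a) t(b) l\<close>.  \<open>L2\<close> is \<open>L \<otimes>\<^sub>A L\<close>, with projection
  \<open>proj2\<close> from \<open>L \<otimes> L\<close>, and \<open>L3\<close> is \<open>(L \<otimes>\<^sub>A L) \<otimes>\<^sub>A L\<close>.
\<close>

locale bialgebroid_data =
  fixes K :: "('k, 'z) ring_scheme" and A :: "('k, 'a, 'y) module_scheme"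
    and L :: "('k, 'l, 'x) module_scheme" and s t :: "'a \<Rightarrow> 'l"
begin

definition L2 :: "('k, ('k, 'l, 'l) tensor set) module"
  where "L2 = bal_tensor K A L (\<lambda>x a. t a \<otimes>\<^bsub>L\<^esub> x) L (\<lambda>a x. s a \<otimes>\<^bsub>L\<^esub> x)"

definition proj2 :: "('k, 'l, 'l) tensor \<Rightarrow> ('k, 'l, 'l) tensor set"
  where "proj2 = bal_proj K A L (\<lambda>x a. t a \<otimes>\<^bsub>L\<^esub> x) L (\<lambda>a x. s a \<otimes>\<^bsub>L\<^esub> x)"

definition pure2 :: "'l \<Rightarrow> 'l \<Rightarrow> ('k, 'l, 'l) tensor set"
  where "pure2 x y = proj2 (pure K L L x y)"

definition ract2 :: "('k, 'l, 'l) tensor set \<Rightarrow> 'a \<Rightarrow> ('k, 'l, 'l) tensor set"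
  where "ract2 X a = bal_sw K L2 X (\<lambda>x y. pure2 x (t a \<otimes>\<^bsub>L\<^esub> y))"

definition L3 :: "('k, ('k, ('k, 'l, 'l) tensor set, 'l) tensor set) module"
  where "L3 = bal_tensor K A L2 ract2 L (\<lambda>a x. s a \<otimes>\<^bsub>L\<^esub> x)"

definition pure3 :: "('k, 'l, 'l) tensor set \<Rightarrow> 'l \<Rightarrow> ('k, ('k, 'l, 'l) tensor set, 'l) tensor set"
  where "pure3 X y = bal_proj K A L2 ract2 L (\<lambda>a x. s a \<otimes>\<^bsub>L\<^esub> x) (pure K L2 L X y)"

end

text \<open>
  The inner \<open>B\<close> in \<open>D_mult\<close> is not balanced: the product of representatives is well defined because of \<open>takeuchi\<close>
  (the image of \<open>D\<close> lies in the Takeuchi product).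
\<close>

locale bialgebroid = bialgebroid_data K A L s t
  for K :: "('k, 'z) ring_scheme" and A :: "('k, 'a, 'y) module_scheme"
    and L :: "('k, 'l, 'x) module_scheme" and s t :: "'a \<Rightarrow> 'l" +
  fixes D :: "'l \<Rightarrow> ('k, 'l, 'l) tensor set" and e :: "'l \<Rightarrow> 'a"
  assumes base_algebra: "assoc_algebra K A"
    and total_algebra: "assoc_algebra K L"
    and source: "s \<in> alg_hom K A L"
    and target: "t \<in> alg_antihom K A L"
    and source_target: "\<And>a b. \<lbrakk>a \<in> carrier A; b \<in> carrier A\<rbrakk> \<Longrightarrow>
      s a \<otimes>\<^bsub>L\<^esub> t b = t b \<otimes>\<^bsub>L\<^esub> s a"
    and D_lin: "D \<in> lin_hom K L L2"
    and D_bimodule: "\<And>a b l. \<lbrakk>a \<in> carrier A; b \<in> carrier A; l \<in> carrier L\<rbrakk> \<Longrightarrow>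
      D (s a \<otimes>\<^bsub>L\<^esub> t b \<otimes>\<^bsub>L\<^esub> l) =
      bal_sw K L2 (D l) (\<lambda>x y. pure2 (s a \<otimes>\<^bsub>L\<^esub> x) (t b \<otimes>\<^bsub>L\<^esub> y))"
    and D_coassoc: "\<And>l. l \<in> carrier L \<Longrightarrow>
      bal_sw K L3 (D l) (\<lambda>x y. pure3 (D x) y) =
      bal_sw K L3 (D l) (\<lambda>x y. bal_sw K L3 (D y) (\<lambda>y1 y2. pure3 (pure2 x y1) y2))"
    and e_lin: "e \<in> lin_hom K L A"
    and e_bimodule: "\<And>a b l. \<lbrakk>a \<in> carrier A; b \<in> carrier A; l \<in> carrier L\<rbrakk> \<Longrightarrow>
      e (s a \<otimes>\<^bsub>L\<^esub> t b \<otimes>\<^bsub>L\<^esub> l) = a \<otimes>\<^bsub>A\<^esub> e l \<otimes>\<^bsub>A\<^esub> b"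
    and e_l: "\<And>l. l \<in> carrier L \<Longrightarrow> bal_sw K L (D l) (\<lambda>x y. s (e x) \<otimes>\<^bsub>L\<^esub> y) = l"
    and e_r: "\<And>l. l \<in> carrier L \<Longrightarrow> bal_sw K L (D l) (\<lambda>x y. t (e y) \<otimes>\<^bsub>L\<^esub> x) = l"
    and takeuchi: "\<And>l a. \<lbrakk>l \<in> carrier L; a \<in> carrier A\<rbrakk> \<Longrightarrow>
      bal_sw K L2 (D l) (\<lambda>x y. pure2 (x \<otimes>\<^bsub>L\<^esub> t a) y) =
      bal_sw K L2 (D l) (\<lambda>x y. pure2 x (y \<otimes>\<^bsub>L\<^esub> s a))"
    and D_one: "D \<one>\<^bsub>L\<^esub> = pure2 \<one>\<^bsub>L\<^esub> \<one>\<^bsub>L\<^esub>"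
    and D_mult: "\<And>l l'. \<lbrakk>l \<in> carrier L; l' \<in> carrier L\<rbrakk> \<Longrightarrow>
      D (l \<otimes>\<^bsub>L\<^esub> l') = bal_sw K L2 (D l) (\<lambda>x y. bal_sw K L2 (D l')
         (\<lambda>x' y'. pure2 (x \<otimes>\<^bsub>L\<^esub> x') (y \<otimes>\<^bsub>L\<^esub> y')))"
    and e_one: "e \<one>\<^bsub>L\<^esub> = \<one>\<^bsub>A\<^esub>"
    and e_mult_s: "\<And>l l'. \<lbrakk>l \<in> carrier L; l' \<in> carrier L\<rbrakk> \<Longrightarrow>
      e (l \<otimes>\<^bsub>L\<^esub> l') = e (l \<otimes>\<^bsub>L\<^esub> s (e l'))"
    and e_mult_t: "\<And>l l'. \<lbrakk>l \<in> carrier L; l' \<in> carrier L\<rbrakk> \<Longrightarrow>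
      e (l \<otimes>\<^bsub>L\<^esub> l') = e (l \<otimes>\<^bsub>L\<^esub> t (e l'))"

locale lu_hopf_algebroid = bialgebroid K A L s t D e
  for K :: "('k, 'z) ring_scheme" and A :: "('k, 'a, 'y) module_scheme"
    and L :: "('k, 'l, 'x) module_scheme" and s t :: "'a \<Rightarrow> 'l"
    and D :: "'l \<Rightarrow> ('k, 'l, 'l) tensor set" and e :: "'l \<Rightarrow> 'a" +
  fixes \<tau> :: "'l \<Rightarrow> 'l"
  assumes tau_antihom: "\<tau> \<in> alg_antihom K L L"
    and tau_bij: "bij_betw \<tau> (carrier L) (carrier L)"
    and tau_t: "\<And>a. a \<in> carrier A \<Longrightarrow> \<tau> (t a) = s a"
    and tau_l: "\<And>l. l \<in> carrier L \<Longrightarrow>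
      bal_sw K L (D l) (\<lambda>x y. \<tau> x \<otimes>\<^bsub>L\<^esub> y) = t (e (\<tau> l))"
    and tau_r: "\<exists>\<gamma> \<in> lin_hom K L2 (tensor K L L).
      (\<forall>X\<in>carrier L2. proj2 (\<gamma> X) = X) \<and>
      (\<forall>l\<in>carrier L. sw K L (\<gamma> (D l)) (\<lambda>x y. x \<otimes>\<^bsub>L\<^esub> \<tau> y) = s (e l))"


subsection \<open>The structure maps on a smash product\<close>

text \<open>
  For a braided commutative algebra \<open>V\<close> in the Yetter-Drinfeld category, the structure of
  Brzezinski and Militaru on \<open>V # H\<close> is \<open>s(v) = v # 1\<close>, \<open>t(v) = v\<^sup>(\<^sup>0\<^sup>) # v\<^sup>(\<^sup>1\<^sup>)\<close> (so that
  \<open>t\<close> is the coaction \<open>\<rho>\<close> itself),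
  \<open>\<Delta>(v # h) = (v # h\<^sub>(\<^sub>1\<^sub>)) \<otimes>\<^sub>V (1 # h\<^sub>(\<^sub>2\<^sub>))\<close> and \<open>\<epsilon>(v # h) = \<epsilon>(h) v\<close>.
\<close>

definition smash_source ::
  "('k, 'a) ring_scheme \<Rightarrow> ('k, 'h) hopf \<Rightarrow> ('k, 'v, 'b) module_scheme
     \<Rightarrow> 'v \<Rightarrow> ('k, 'v, 'h) tensor"
  where "smash_source K H V v = pure K V H v \<one>\<^bsub>H\<^esub>"

definition smash_comult ::
  "('k, 'a) ring_scheme \<Rightarrow> ('k, 'h) hopf \<Rightarrow> ('k, 'v, 'b) module_scheme \<Rightarrow> ('h \<Rightarrow> 'v \<Rightarrow> 'v)
     \<Rightarrow> ('v \<Rightarrow> ('k, 'v, 'h) tensor)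
     \<Rightarrow> ('k, 'v, 'h) tensor \<Rightarrow> ('k, ('k, 'v, 'h) tensor, ('k, 'v, 'h) tensor) tensor set"
  where "smash_comult K H V act \<rho> x =
    (let L = smash K H V act; s = smash_source K H V; t = \<rho> in
     sw K (bialgebroid_data.L2 K V L s t) x
       (\<lambda>v h. sw K (bialgebroid_data.L2 K V L s t) (comult H h)
          (\<lambda>h1 h2. bialgebroid_data.pure2 K V L s t (pure K V H v h1) (pure K V H \<one>\<^bsub>V\<^esub> h2))))"

definition smash_counit ::
  "('k, 'a) ring_scheme \<Rightarrow> ('k, 'h) hopf \<Rightarrow> ('k, 'v, 'b) module_scheme
     \<Rightarrow> ('k, 'v, 'h) tensor \<Rightarrow> 'v"
  where "smash_counit K H V x = sw K V x (\<lambda>v h. counit H h \<odot>\<^bsub>V\<^esub> v)"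

end

theory Submission
  imports Defs
begin

text \<open>
  Write \<open>A\<close> for \<open>A\<^sub>p\<^sub>a\<^sub>r\<close> and \<open>B\<close> for \<open>{A, A}\<close>.  An element \<open>f\<close> of \<open>B\<close> is determined by the map
  \<open>l \<mapsto> f(1 \<otimes> l)\<close>, and the maps \<open>g\<close> that occur are the linear ones with
  \<open>h \<bullet> g(l) = \<epsilon>\<^sub>h\<^sub>1 g(h\<^sub>2 l)\<close>; the product becomes convolution and the action right translation.
  As \<open>H\<close> is finite-dimensional, evaluation at all \<open>l\<close> is also injective on \<open>B \<otimes> H\<close>, so all identities
  for the coaction of \<open>B\<close> can be checked there.

  The coaction of \<open>A\<close> is the restriction of the algebra map from \<open>H\<^sub>p\<^sub>a\<^sub>r\<close> to the tensor product of
  \<open>H\<^sub>p\<^sub>a\<^sub>r\<close> and the opposite algebra of \<open>H\<close> that sends \<open>[h]\<close> to \<open>[h\<^sub>2] \<otimes> S\<^sup>-\<^sup>1(h\<^sub>1)\<close>.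
  Its compatibility with the action of \<open>H\<close> shows that the slices along \<open>H\<close> of the formula for
  \<open>\<rho>(f)\<close> are equivariant again, so that \<open>\<rho>(f)\<close> exists by means of a dual basis of \<open>H\<close>.
  Braided commutativity amounts to \<open>f(1 \<otimes> l) x = x\<^sup>0 f(1 \<otimes> x\<^sup>1 l)\<close>.  The elements \<open>x\<close> of \<open>H\<^sub>p\<^sub>a\<^sub>r\<close>
  with this property form a subalgebra, which contains the generators \<open>[h]\<close>.

  For the second half let \<open>V\<close> be any braided commutative algebra in the Yetter-Drinfeld category.
  Then \<open>\<tau>(v # h) = (1 # S(h)) (1 # S\<^sup>2(v\<^sup>1)) (v\<^sup>0 # 1)\<close> is an antihomomorphism with inverse
  \<open>v # h \<mapsto> (1 # S\<^sup>-\<^sup>1(h)) t(v)\<close>, and \<open>x \<otimes> (v # h) \<mapsto> t(v) x \<otimes> (1 # h)\<close> induces the section \<open>\<gamma>\<close>.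
\<close>

subsection \<open>Linear maps, quotients and free modules\<close>

text \<open>A formula on products of generators of \<open>A\<close> is not visibly well defined,
  because the relations among these generators are known only implicitly. \<open>hpar\<close> is
  given by a presentation, so a map out of it exists as soon as the unit condition and the two
  relations of a partial representation hold; hence the coaction is built there and restricted
  afterwards. The restriction takes values in the larger tensor product with \<open>H\<close>, and
  slicing along \<open>H\<close> shows that the smaller one embeds. A second obstacle is that a
  Sweedler sum is evaluated on a chosen representative, so most manipulations carry a linearity
  obligation in each leg. The closure rules for \<open>lin_hom\<close> are therefore simplification
  rules, and iterated coproducts have a right-nested normal form. For the antipode of the smash
  product the inverse is the accessible map: its antimultiplicativity follows from the commutation
  rules for source, target and 1 # h, and passes to \<tau> by bijectivity. The square of the
  antipode of \<open>H\<close> in \<tau> is what this inverse forces.\<close>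

lemma lin_homI:
  assumes "\<And>x. x \<in> carrier V \<Longrightarrow> f x \<in> carrier W"
    and "\<And>x y. \<lbrakk>x \<in> carrier V; y \<in> carrier V\<rbrakk> \<Longrightarrow> f (x \<oplus>\<^bsub>V\<^esub> y) = f x \<oplus>\<^bsub>W\<^esub> f y"
    and "\<And>a x. \<lbrakk>a \<in> carrier K; x \<in> carrier V\<rbrakk> \<Longrightarrow> f (a \<odot>\<^bsub>V\<^esub> x) = a \<odot>\<^bsub>W\<^esub> f x"
  shows "f \<in> lin_hom K V W"
  using assms by (auto simp: lin_hom_def)

lemma lin_hom_closed: "f \<in> lin_hom K V W \<Longrightarrow> x \<in> carrier V \<Longrightarrow> f x \<in> carrier W"
  and lin_hom_add: "f \<in> lin_hom K V W \<Longrightarrow> x \<in> carrier V \<Longrightarrow> y \<in> carrier V \<Longrightarrow>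
      f (x \<oplus>\<^bsub>V\<^esub> y) = f x \<oplus>\<^bsub>W\<^esub> f y"
  and lin_hom_smult: "f \<in> lin_hom K V W \<Longrightarrow> a \<in> carrier K \<Longrightarrow> x \<in> carrier V \<Longrightarrow>
      f (a \<odot>\<^bsub>V\<^esub> x) = a \<odot>\<^bsub>W\<^esub> f x"
  by (auto simp: lin_hom_def)

lemma lin_hom_zero:
  assumes "module K V" "module K W" "f \<in> lin_hom K V W"
  shows "f \<zero>\<^bsub>V\<^esub> = \<zero>\<^bsub>W\<^esub>"
proof -
  interpret V: module K V by fact
  interpret W: module K W by fact
  have "f (\<zero>\<^bsub>K\<^esub> \<odot>\<^bsub>V\<^esub> \<zero>\<^bsub>V\<^esub>) = \<zero>\<^bsub>K\<^esub> \<odot>\<^bsub>W\<^esub> f \<zero>\<^bsub>V\<^esub>"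
    by (rule lin_hom_smult[OF assms(3)]) auto
  then show ?thesis using lin_hom_closed[OF assms(3), of "\<zero>\<^bsub>V\<^esub>"] by simp
qed

lemma lin_hom_minus:
  assumes "module K V" "module K W" "f \<in> lin_hom K V W" "x \<in> carrier V" "y \<in> carrier V"
  shows "f (x \<ominus>\<^bsub>V\<^esub> y) = f x \<ominus>\<^bsub>W\<^esub> f y"
proof -
  interpret V: module K V by fact
  interpret W: module K W by fact
  have n: "\<ominus>\<^bsub>V\<^esub> y = (\<ominus>\<^bsub>K\<^esub> \<one>\<^bsub>K\<^esub>) \<odot>\<^bsub>V\<^esub> y" using assms by (simp add: V.smult_l_minus)
  have "f (\<ominus>\<^bsub>V\<^esub> y) = (\<ominus>\<^bsub>K\<^esub> \<one>\<^bsub>K\<^esub>) \<odot>\<^bsub>W\<^esub> f y"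
    unfolding n by (rule lin_hom_smult[OF assms(3)]) (use assms in auto)
  also have "\<dots> = \<ominus>\<^bsub>W\<^esub> f y" using assms lin_hom_closed[OF assms(3)] by (simp add: W.smult_l_minus)
  finally show ?thesis
    unfolding a_minus_def using assms by (subst lin_hom_add[OF assms(3)]) auto
qed

lemma lin_hom_finsum:
  assumes "module K V" "module K W" "f \<in> lin_hom K V W" "finite S"
    and "\<And>i. i \<in> S \<Longrightarrow> B i \<in> carrier V"
  shows "f (\<Oplus>\<^bsub>V\<^esub>i\<in>S. B i) = (\<Oplus>\<^bsub>W\<^esub>i\<in>S. f (B i))"
proof -
  interpret V: module K V by fact
  interpret W: module K W by fact
  show ?thesis using assms(4,5)
  proof (induction S)
    case empty
    then show ?case using lin_hom_zero[OF assms(1-3)] by simp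
  next
    case (insert i S)
    have "f (\<Oplus>\<^bsub>V\<^esub>j\<in>insert i S. B j) = f (B i \<oplus>\<^bsub>V\<^esub> (\<Oplus>\<^bsub>V\<^esub>j\<in>S. B j))"
      using insert by (subst V.M.finsum_insert) auto
    also have "\<dots> = f (B i) \<oplus>\<^bsub>W\<^esub> f (\<Oplus>\<^bsub>V\<^esub>j\<in>S. B j)"
      using insert by (intro lin_hom_add[OF assms(3)]) (auto intro!: V.M.finsum_closed)
    also have "\<dots> = (\<Oplus>\<^bsub>W\<^esub>j\<in>insert i S. f (B j))"
      using insert lin_hom_closed[OF assms(3)] by (subst W.M.finsum_insert) auto
    finally show ?case .
  qed
qed

lemma lin_span_mono_in: "X \<subseteq> lin_span K V X"
  by (auto simp: lin_span_def)

lemma lin_span_least: "submodule U K V \<Longrightarrow> X \<subseteq> U \<Longrightarrow> lin_span K V X \<subseteq> U"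
  by (auto simp: lin_span_def)

lemma lin_span_submodule:
  assumes "module K V" "X \<subseteq> carrier V"
  shows "submodule (lin_span K V X) K V"
proof -
  interpret V: module K V by fact
  have c: "submodule (carrier V) K V" by (rule V.carrier_is_submodule)
  show ?thesis
  proof (rule V.submoduleI)
    show "lin_span K V X \<subseteq> carrier V" by (rule lin_span_least[OF c assms(2)])
    show "\<zero>\<^bsub>V\<^esub> \<in> lin_span K V X"
      unfolding lin_span_def using subgroup.one_closed[OF submodule.axioms(1)] by fastforce
  qed (auto simp: lin_span_def V.submoduleE)
qed

text \<open>Stated for an equalizer; the instance with the zero map shows that a linear map which
  kills a set of relations kills their span.\<close>

lemma kernel_submodule:
  assumes "module K V" "module K W" "f \<in> lin_hom K V W" "g \<in> lin_hom K V W"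
  shows "submodule {x \<in> carrier V. f x = g x} K V"
proof -
  interpret V: module K V by fact
  interpret W: module K W by fact
  have n: "h (\<ominus>\<^bsub>V\<^esub> y) = \<ominus>\<^bsub>W\<^esub> h y" if "h \<in> lin_hom K V W" "y \<in> carrier V" for h y
    using lin_hom_minus[OF assms(1,2) that(1), of "\<zero>\<^bsub>V\<^esub>" y] that lin_hom_zero[OF assms(1,2) that(1)]
      lin_hom_closed[OF that]
    by (simp add: a_minus_def)
  show ?thesis
    using lin_hom_zero[OF assms(1,2,3)] lin_hom_zero[OF assms(1,2,4)] n[OF assms(3)] n[OF assms(4)] assms
    by (intro V.submoduleI) (auto simp: lin_hom_add lin_hom_smult)
qed

locale quotient_module = module K V for K (structure) and V (structure) +
  fixes I assumes sub: "submodule I K V"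
begin

abbreviation q where "q x \<equiv> I +>\<^bsub>V\<^esub> x"

sublocale abelian_subgroup I V
  using sub by (intro abelian_subgroupI3 additive_subgroupI) (auto simp: submodule_def intro: abelian_group_axioms)

lemma quot_carrier: "carrier (quot V I) = q ` carrier V"
  by (auto simp: quot_def FactRing_def ring.defs module.defs A_RCOSETS_def' a_r_coset_def)

lemma q_closed: "x \<in> carrier V \<Longrightarrow> q x \<in> carrier (quot V I)" by (simp add: quot_carrier)

lemma q_add: "x \<in> carrier V \<Longrightarrow> y \<in> carrier V \<Longrightarrow> q (x \<oplus>\<^bsub>V\<^esub> y) = q x \<oplus>\<^bsub>quot V I\<^esub> q y"
  by (simp add: quot_def FactRing_def ring.defs a_rcos_sum)

lemma q_eq: "x \<in> carrier V \<Longrightarrow> y \<in> carrier V \<Longrightarrow> q x = q y \<longleftrightarrow> x \<ominus>\<^bsub>V\<^esub> y \<in> I"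
proof -
  assume a: "x \<in> carrier V" "y \<in> carrier V"
  have "q x = q y \<longleftrightarrow> x \<in> q y"
    by (metis a a_rcos_self a_repr_independence' M.a_repr_independence sub submodule_def is_additive_subgroup additive_subgroup.a_subgroup)
  also have "\<dots> \<longleftrightarrow> x \<ominus>\<^bsub>V\<^esub> y \<in> I"
    using a a_rcos_module[of y x] by (simp add: a_minus_def abelian_group_axioms)
  finally show ?thesis .
qed

lemma in_q: "x \<in> carrier V \<Longrightarrow> y \<in> q x \<Longrightarrow> y \<in> carrier V \<and> q y = q x"
  by (metis a_elemrcos_carrier a_repr_independence' abelian_group_axioms)

text \<open>In \<open>quot\<close> a scalar multiple is a union over all members of the coset.
  Members differ by elements of \<open>I\<close>, so all sets in the union are the same coset, and
  since a coset is nonempty the union equals it.\<close>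

lemma q_smult: "a \<in> carrier K \<Longrightarrow> x \<in> carrier V \<Longrightarrow> q (a \<odot>\<^bsub>V\<^esub> x) = a \<odot>\<^bsub>quot V I\<^esub> q x"
proof -
  assume a: "a \<in> carrier K" "x \<in> carrier V"
  have "q (a \<odot>\<^bsub>V\<^esub> y) = q (a \<odot>\<^bsub>V\<^esub> x)" if y: "y \<in> q x" for y
  proof -
    have y': "y \<in> carrier V" "q y = q x" using in_q[OF a(2) y] by auto
    have "a \<odot>\<^bsub>V\<^esub> (y \<ominus>\<^bsub>V\<^esub> x) \<in> I"
      using y' a q_eq submodule.smult_closed[OF sub] by auto
    also have "a \<odot>\<^bsub>V\<^esub> (y \<ominus>\<^bsub>V\<^esub> x) = a \<odot>\<^bsub>V\<^esub> y \<ominus>\<^bsub>V\<^esub> a \<odot>\<^bsub>V\<^esub> x"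
      using y' a by (simp add: a_minus_def smult_r_distr smult_r_minus)
    finally show ?thesis using q_eq y' a by simp
  qed
  moreover have "q x \<noteq> {}" using a a_rcos_self by blast
  ultimately have "(\<Union>y\<in>q x. q (a \<odot>\<^bsub>V\<^esub> y)) = q (a \<odot>\<^bsub>V\<^esub> x)"
    by (rule SUP_eq_const[rotated])
  then show ?thesis by (simp add: quot_def FactRing_def ring.defs module.defs)
qed

lemma quot_zero: "\<zero>\<^bsub>quot V I\<^esub> = q \<zero>\<^bsub>V\<^esub>"
  using M.a_coset_join2[OF M.zero_closed a_subgroup zero_closed] by (simp add: quot_def FactRing_def ring.defs)

lemma quot_module: "module K (quot V I)"
proof (rule moduleI)
  show "cring K" by (rule R.is_cring)
  note s = q_add[symmetric] q_smult[symmetric]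
  have c: "q (x \<oplus>\<^bsub>V\<^esub> y) = q (y \<oplus>\<^bsub>V\<^esub> x)" if "x \<in> carrier V" "y \<in> carrier V" for x y
    using that by (simp add: M.a_comm)
  show "abelian_group (quot V I)"
  proof (rule abelian_groupI)
    fix X assume "X \<in> carrier (quot V I)"
    then obtain x where x: "x \<in> carrier V" "X = q x" by (auto simp: quot_carrier)
    then have "q (\<ominus>\<^bsub>V\<^esub> x) \<oplus>\<^bsub>quot V I\<^esub> X = \<zero>\<^bsub>quot V I\<^esub>" by (simp add: s quot_zero M.l_neg)
    then show "\<exists>Y\<in>carrier (quot V I). Y \<oplus>\<^bsub>quot V I\<^esub> X = \<zero>\<^bsub>quot V I\<^esub>" using x q_closed by blast
  qed (auto simp: quot_carrier s quot_zero M.a_assoc c)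
qed (auto simp: quot_carrier q_add[symmetric] q_smult[symmetric] smult_l_distr smult_r_distr smult_assoc1)

lemma q_lin: "q \<in> lin_hom K V (quot V I)"
  by (rule lin_homI) (auto simp: q_closed q_add q_smult)

end

lemma quotient_moduleI: "module K V \<Longrightarrow> submodule I K V \<Longrightarrow> quotient_module K V I"
  by (simp add: quotient_module_def quotient_module_axioms_def)

section \<open>Free modules and linear extension from a basis\<close>

lemma free_mod_simps:
  "\<zero>\<^bsub>free_mod K X\<^esub> = (\<lambda>x. \<zero>\<^bsub>K\<^esub>)"
  "f \<oplus>\<^bsub>free_mod K X\<^esub> g = (\<lambda>x. f x \<oplus>\<^bsub>K\<^esub> g x)"
  "a \<odot>\<^bsub>free_mod K X\<^esub> f = (\<lambda>x. a \<otimes>\<^bsub>K\<^esub> f x)"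
  by (simp_all add: free_mod_def)

lemma free_mod_carrier: "f \<in> carrier (free_mod K X) \<longleftrightarrow> (\<forall>x. f x \<in> carrier K) \<and>
    (\<forall>x. x \<notin> X \<longrightarrow> f x = \<zero>\<^bsub>K\<^esub>) \<and> finite {x. f x \<noteq> \<zero>\<^bsub>K\<^esub>}"
  by (simp add: free_mod_def)

lemma free_mod_module:
  assumes "cring K" shows "module K (free_mod K X)"
proof -
  interpret cring K by fact
  have fin: "finite {x. f x \<oplus>\<^bsub>K\<^esub> g x \<noteq> \<zero>\<^bsub>K\<^esub>}"
    if "finite {x. f x \<noteq> \<zero>\<^bsub>K\<^esub>}" "finite {x. g x \<noteq> \<zero>\<^bsub>K\<^esub>}" for f g
    by (rule finite_subset[OF _ finite_UnI[OF that]]) auto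
  have fin2: "finite {x. a \<otimes>\<^bsub>K\<^esub> f x \<noteq> \<zero>\<^bsub>K\<^esub>}"
    if "finite {x. f x \<noteq> \<zero>\<^bsub>K\<^esub>}" "a \<in> carrier K" for f a
    by (rule finite_subset[OF _ that(1)]) (use that in auto)
  have fin3: "finite {x. \<ominus>\<^bsub>K\<^esub> f x \<noteq> \<zero>\<^bsub>K\<^esub>}" if "finite {x. f x \<noteq> \<zero>\<^bsub>K\<^esub>}" for f
    by (rule finite_subset[OF _ that(1)]) auto
  show ?thesis
  proof (rule moduleI)
    show "abelian_group (free_mod K X)"
    proof (rule abelian_groupI)
      fix f assume f: "f \<in> carrier (free_mod K X)"
      then have "(\<lambda>x. \<ominus>\<^bsub>K\<^esub> f x) \<in> carrier (free_mod K X)" by (auto simp: free_mod_carrier fin3)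
      moreover have "(\<lambda>x. \<ominus>\<^bsub>K\<^esub> f x) \<oplus>\<^bsub>free_mod K X\<^esub> f = \<zero>\<^bsub>free_mod K X\<^esub>"
        using f by (auto simp: free_mod_carrier free_mod_simps l_neg)
      ultimately show "\<exists>g\<in>carrier (free_mod K X). g \<oplus>\<^bsub>free_mod K X\<^esub> f = \<zero>\<^bsub>free_mod K X\<^esub>" by blast
    qed (auto simp: free_mod_carrier free_mod_simps fin a_ac)
  qed (auto simp: free_mod_carrier free_mod_simps fin fin2 l_distr r_distr m_assoc is_cring)
qed

lemma free_gen_closed: "cring K \<Longrightarrow> x \<in> X \<Longrightarrow> free_gen K x \<in> carrier (free_mod K X)"
proof -
  assume a: "cring K" "x \<in> X"
  interpret cring K by fact
  have "{y. free_gen K x y \<noteq> \<zero>\<^bsub>K\<^esub>} \<subseteq> {x}" by (auto simp: free_gen_def)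
  then have "finite {y. free_gen K x y \<noteq> \<zero>\<^bsub>K\<^esub>}" using finite_subset by blast
  then show ?thesis using a by (auto simp: free_mod_carrier) (auto simp: free_gen_def)
qed

lemma free_mod_induct:
  assumes "cring K" "f \<in> carrier (free_mod K X)"
    and zero: "P \<zero>\<^bsub>free_mod K X\<^esub>"
    and gen: "\<And>x. x \<in> X \<Longrightarrow> P (free_gen K x)"
    and add: "\<And>f g. \<lbrakk>f \<in> carrier (free_mod K X); g \<in> carrier (free_mod K X); P f; P g\<rbrakk> \<Longrightarrow> P (f \<oplus>\<^bsub>free_mod K X\<^esub> g)"
    and smult: "\<And>a f. \<lbrakk>a \<in> carrier K; f \<in> carrier (free_mod K X); P f\<rbrakk> \<Longrightarrow> P (a \<odot>\<^bsub>free_mod K X\<^esub> f)"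
  shows "P f"
proof -
  interpret cring K by fact
  interpret F: module K "free_mod K X" by (rule free_mod_module) fact
  \<comment> \<open>Induction on a finite set containing the support: resetting the coefficient at
    \<open>s\<close> to zero shrinks the set, and the part removed is a multiple of a basis vector,
    or nothing if \<open>s\<close> lies outside \<open>X\<close>.\<close>
  have "\<forall>f. f \<in> carrier (free_mod K X) \<longrightarrow> {x. f x \<noteq> \<zero>\<^bsub>K\<^esub>} \<subseteq> S \<longrightarrow> P f" if "finite S" for S
    using that
  proof (induction S)
    case empty
    have "f = \<zero>\<^bsub>free_mod K X\<^esub>" if "{x. f x \<noteq> \<zero>\<^bsub>K\<^esub>} \<subseteq> {}" for f
      using that by (auto simp: free_mod_simps)
    then show ?case using zero by blast
  next
    case (insert s S)
    show ?case
    proof (intro allI impI)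
      fix f assume f: "f \<in> carrier (free_mod K X)" "{x. f x \<noteq> \<zero>\<^bsub>K\<^esub>} \<subseteq> insert s S"
      have sub: "{x. (f(s := \<zero>\<^bsub>K\<^esub>)) x \<noteq> \<zero>\<^bsub>K\<^esub>} \<subseteq> {x. f x \<noteq> \<zero>\<^bsub>K\<^esub>}" by auto
      have g: "f(s := \<zero>\<^bsub>K\<^esub>) \<in> carrier (free_mod K X)"
        using f(1) finite_subset[OF sub] by (auto simp: free_mod_carrier)
      have "{x. (f(s := \<zero>\<^bsub>K\<^esub>)) x \<noteq> \<zero>\<^bsub>K\<^esub>} \<subseteq> S" using f(2) by auto
      then have Pg: "P (f(s := \<zero>\<^bsub>K\<^esub>))" using insert.IH g by blast
      show "P f"
      proof (cases "s \<in> X")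
        case True
        have "f = f(s := \<zero>\<^bsub>K\<^esub>) \<oplus>\<^bsub>free_mod K X\<^esub> (f s \<odot>\<^bsub>free_mod K X\<^esub> free_gen K s)"
          using f(1) by (auto simp: free_mod_simps free_mod_carrier free_gen_def)
        moreover have "f s \<in> carrier K" using f(1) by (simp add: free_mod_carrier)
        ultimately show ?thesis
          using add[OF g _ Pg, of "f s \<odot>\<^bsub>free_mod K X\<^esub> free_gen K s"] smult[OF _ _ gen[OF True], of "f s"]
            free_gen_closed[OF assms(1) True] by (metis F.smult_closed)
      next
        case False
        then have "f s = \<zero>\<^bsub>K\<^esub>" using f(1) by (auto simp: free_mod_carrier)
        then have "f(s := \<zero>\<^bsub>K\<^esub>) = f" by auto
        then show ?thesis using Pg by simp
      qed
    qed
  qed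
  then show ?thesis using assms(2) by (auto simp: free_mod_carrier)
qed

text \<open>The linear extension of \<open>B\<close> from the basis. The sum runs over the support,
  which is exactly how \<open>sw\<close> evaluates a representative.\<close>

definition free_ext ::
  "('k, 'a) ring_scheme \<Rightarrow> ('k, 'p, 'b) module_scheme \<Rightarrow> ('x \<Rightarrow> 'p) \<Rightarrow> ('x \<Rightarrow> 'k) \<Rightarrow> 'p"
  where "free_ext K P B f = (\<Oplus>\<^bsub>P\<^esub>x\<in>{x. f x \<noteq> \<zero>\<^bsub>K\<^esub>}. f x \<odot>\<^bsub>P\<^esub> B x)"

text \<open>Different functions have different supports; summing over a common larger finite set
  turns additivity into a termwise statement.\<close>

lemma free_ext_superset:
  assumes "module K P" "f \<in> carrier (free_mod K X)" "\<And>x. x \<in> X \<Longrightarrow> B x \<in> carrier P"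
    and "finite S" "{x. f x \<noteq> \<zero>\<^bsub>K\<^esub>} \<subseteq> S" "S \<subseteq> X"
  shows "free_ext K P B f = (\<Oplus>\<^bsub>P\<^esub>x\<in>S. f x \<odot>\<^bsub>P\<^esub> B x)"
proof -
  interpret P: module K P by fact
  show ?thesis unfolding free_ext_def
    by (rule P.M.add.finprod_mono_neutral_cong_left) (use assms in \<open>auto simp: free_mod_carrier subset_iff\<close>)
qed

lemma free_mod_supp: "f \<in> carrier (free_mod K X) \<Longrightarrow> {x. f x \<noteq> \<zero>\<^bsub>K\<^esub>} \<subseteq> X \<and> finite {x. f x \<noteq> \<zero>\<^bsub>K\<^esub>}"
  by (auto simp: free_mod_carrier)

lemma free_ext_lin:
  assumes "module K P" "\<And>x. x \<in> X \<Longrightarrow> B x \<in> carrier P"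
  shows "free_ext K P B \<in> lin_hom K (free_mod K X) P"
proof -
  interpret P: module K P by fact
  interpret F: module K "free_mod K X" by (rule free_mod_module) (rule P.R.is_cring)
  show ?thesis
  proof (rule lin_homI)
    fix f assume f: "f \<in> carrier (free_mod K X)"
    show "free_ext K P B f \<in> carrier P" unfolding free_ext_def
      using f assms(2) by (intro P.M.finsum_closed) (auto simp: free_mod_carrier)
    { fix g assume g: "g \<in> carrier (free_mod K X)"
      let ?S = "{x. f x \<noteq> \<zero>\<^bsub>K\<^esub>} \<union> {x. g x \<noteq> \<zero>\<^bsub>K\<^esub>}"
      have S: "finite ?S" "?S \<subseteq> X" using f g free_mod_supp by auto
      have fg: "f \<oplus>\<^bsub>free_mod K X\<^esub> g \<in> carrier (free_mod K X)" using f g by simp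
      have c: "f x \<in> carrier K" "g x \<in> carrier K" for x using f g by (auto simp: free_mod_carrier)
      have B: "B x \<in> carrier P" if "x \<in> ?S" for x using that S assms(2) by auto
      have "free_ext K P B (f \<oplus>\<^bsub>free_mod K X\<^esub> g) = (\<Oplus>\<^bsub>P\<^esub>x\<in>?S. (f x \<oplus>\<^bsub>K\<^esub> g x) \<odot>\<^bsub>P\<^esub> B x)"
        using c by (subst free_ext_superset[OF assms(1) fg assms(2) S(1) _ S(2)]) (auto simp: free_mod_simps)
      also have "\<dots> = (\<Oplus>\<^bsub>P\<^esub>x\<in>?S. f x \<odot>\<^bsub>P\<^esub> B x \<oplus>\<^bsub>P\<^esub> g x \<odot>\<^bsub>P\<^esub> B x)"
        using B c by (intro P.M.finsum_cong) (auto simp: P.smult_l_distr simp_implies_def)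
      also have "\<dots> = (\<Oplus>\<^bsub>P\<^esub>x\<in>?S. f x \<odot>\<^bsub>P\<^esub> B x) \<oplus>\<^bsub>P\<^esub> (\<Oplus>\<^bsub>P\<^esub>x\<in>?S. g x \<odot>\<^bsub>P\<^esub> B x)"
        by (rule P.M.finsum_addf) (use B c in auto)
      also have "\<dots> = free_ext K P B f \<oplus>\<^bsub>P\<^esub> free_ext K P B g"
        using free_ext_superset[OF assms(1) f assms(2) S(1) _ S(2)] free_ext_superset[OF assms(1) g assms(2) S(1) _ S(2)]
        by simp
      finally show "free_ext K P B (f \<oplus>\<^bsub>free_mod K X\<^esub> g) = free_ext K P B f \<oplus>\<^bsub>P\<^esub> free_ext K P B g" . }
    { fix a assume a: "a \<in> carrier K"
      let ?S = "{x. f x \<noteq> \<zero>\<^bsub>K\<^esub>}"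
      have S: "finite ?S" "?S \<subseteq> X" using f free_mod_supp by auto
      have fg: "a \<odot>\<^bsub>free_mod K X\<^esub> f \<in> carrier (free_mod K X)" using f a by simp
      have c: "f x \<in> carrier K" for x using f by (auto simp: free_mod_carrier)
      have B: "B x \<in> carrier P" if "x \<in> ?S" for x using that S assms(2) by auto
      have "free_ext K P B (a \<odot>\<^bsub>free_mod K X\<^esub> f) = (\<Oplus>\<^bsub>P\<^esub>x\<in>?S. (a \<otimes>\<^bsub>K\<^esub> f x) \<odot>\<^bsub>P\<^esub> B x)"
        using c a by (subst free_ext_superset[OF assms(1) fg assms(2) S(1) _ S(2)]) (auto simp: free_mod_simps)
      also have "\<dots> = (\<Oplus>\<^bsub>P\<^esub>x\<in>?S. a \<odot>\<^bsub>P\<^esub> (f x \<odot>\<^bsub>P\<^esub> B x))"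
        using B c a by (intro P.M.finsum_cong) (auto simp: P.smult_assoc1 simp_implies_def)
      also have "\<dots> = a \<odot>\<^bsub>P\<^esub> free_ext K P B f"
        unfolding free_ext_def by (rule P.finsum_smult_ldistr[symmetric]) (use S B c a in auto)
      finally show "free_ext K P B (a \<odot>\<^bsub>free_mod K X\<^esub> f) = a \<odot>\<^bsub>P\<^esub> free_ext K P B f" . }
  qed
qed

lemma free_ext_gen:
  assumes "module K P" "B x \<in> carrier P"
  shows "free_ext K P B (free_gen K x) = B x"
proof -
  interpret P: module K P by fact
  have "free_ext K P B (free_gen K x) = (\<Oplus>\<^bsub>P\<^esub>y\<in>{x}. free_gen K x y \<odot>\<^bsub>P\<^esub> B y)"
    by (rule free_ext_superset[OF assms(1), where X = "{x}"])
      (use assms free_gen_closed[OF P.R.is_cring, of x "{x}"] in \<open>auto simp: free_gen_def\<close>)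
  then show ?thesis using assms(2) by (simp add: free_gen_def)
qed

lemma free_lin_ext:
  assumes "module K P" "f \<in> lin_hom K (free_mod K X) P" "g \<in> lin_hom K (free_mod K X) P"
    and "\<And>x. x \<in> X \<Longrightarrow> f (free_gen K x) = g (free_gen K x)" "y \<in> carrier (free_mod K X)"
  shows "f y = g y"
proof -
  interpret P: module K P by fact
  have F: "module K (free_mod K X)" by (rule free_mod_module) (rule P.R.is_cring)
  show ?thesis
    by (rule free_mod_induct[OF P.R.is_cring assms(5)])
      (use assms lin_hom_zero[OF F assms(1,2)] lin_hom_zero[OF F assms(1,3)] in \<open>auto simp: lin_hom_add lin_hom_smult\<close>)
qed

subsection \<open>Tensor products\<close>

lemma (in abelian_group) minus_zero_iff:
  "x \<in> carrier G \<Longrightarrow> y \<in> carrier G \<Longrightarrow> x \<ominus> y = \<zero> \<longleftrightarrow> x = y"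
  by (metis a_minus_def minus_equality minus_minus r_neg a_inv_closed)

lemma lin_hom_zero_map: "module K V \<Longrightarrow> module K W \<Longrightarrow> (\<lambda>_. \<zero>\<^bsub>W\<^esub>) \<in> lin_hom K V W"
proof -
  assume "module K V" "module K W"
  then interpret W: module K W by simp
  show ?thesis by (rule lin_homI) auto
qed

lemma bilinear_rels_closed:
  assumes "module K V" "module K W"
  shows "bilinear_rels K V W \<subseteq> carrier (free_mod K (carrier V \<times> carrier W))"
proof -
  interpret V: module K V by fact
  interpret W: module K W by fact
  interpret F: module K "free_mod K (carrier V \<times> carrier W)" by (rule free_mod_module) (rule V.R.is_cring)
  have g: "free_gen K (v, w) \<in> carrier (free_mod K (carrier V \<times> carrier W))"
    if "v \<in> carrier V" "w \<in> carrier W" for v w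
    using that by (intro free_gen_closed) (auto intro: V.R.is_cring)
  show ?thesis unfolding bilinear_rels_def Let_def
    by (intro Un_least subsetI; elim CollectE exE conjE; hypsubst; intro F.M.minus_closed F.M.add.m_closed F.smult_closed g)
      auto
qed

lemma tensor_quotient:
  assumes "module K V" "module K W"
  shows "quotient_module K (free_mod K (carrier V \<times> carrier W)) (tensor_null K V W)"
proof -
  have "module K (free_mod K (carrier V \<times> carrier W))"
    using assms(1) by (intro free_mod_module) (simp add: module_def)
  then show ?thesis unfolding tensor_null_def
    by (intro quotient_moduleI lin_span_submodule bilinear_rels_closed assms)
qed

lemma tensor_module: "module K V \<Longrightarrow> module K W \<Longrightarrow> module K (tensor K V W)"
  unfolding tensor_def by (rule quotient_module.quot_module[OF tensor_quotient])

lemma pure_closed: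
  assumes "module K V" "module K W" "v \<in> carrier V" "w \<in> carrier W"
  shows "pure K V W v w \<in> carrier (tensor K V W)"
proof -
  have "cring K" using assms(1) by (simp add: module_def)
  then show ?thesis unfolding pure_def tensor_def using assms
    by (intro quotient_module.q_closed[OF tensor_quotient] free_gen_closed) auto
qed

context
  fixes K :: "('k, 'a) ring_scheme" and V :: "('k, 'v, 'b) module_scheme" and W :: "('k, 'w, 'c) module_scheme"
  assumes V: "module K V" and W: "module K W"
begin

interpretation Q: quotient_module K "free_mod K (carrier V \<times> carrier W)" "tensor_null K V W"
  by (rule tensor_quotient[OF V W])
interpretation V: module K V by (rule V)
interpretation W: module K W by (rule W)

lemma gen_closed: "v \<in> carrier V \<Longrightarrow> w \<in> carrier W \<Longrightarrow>
    free_gen K (v, w) \<in> carrier (free_mod K (carrier V \<times> carrier W))"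
  by (intro free_gen_closed) (auto intro: Q.R.is_cring)

lemma pure_lin_l0: "w \<in> carrier W \<Longrightarrow> (\<lambda>v. pure K V W v w) \<in> lin_hom K V (tensor K V W)"
proof (rule lin_homI)
  assume w: "w \<in> carrier W"
  fix v assume v: "v \<in> carrier V"
  show "pure K V W v w \<in> carrier (tensor K V W)" by (rule pure_closed[OF V W v w])
  { fix v' assume v': "v' \<in> carrier V"
    have "free_gen K (v \<oplus>\<^bsub>V\<^esub> v', w) \<ominus>\<^bsub>free_mod K (carrier V \<times> carrier W)\<^esub>
       (free_gen K (v, w) \<oplus>\<^bsub>free_mod K (carrier V \<times> carrier W)\<^esub> free_gen K (v', w)) \<in> tensor_null K V W"
      unfolding tensor_null_def
      by (rule subsetD[OF lin_span_mono_in], unfold bilinear_rels_def Let_def, rule UnI1, rule UnI1, rule UnI1) (use w v v' in blast)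
    then show "pure K V W (v \<oplus>\<^bsub>V\<^esub> v') w = pure K V W v w \<oplus>\<^bsub>tensor K V W\<^esub> pure K V W v' w"
      using w v v' unfolding pure_def tensor_def by (simp add: Q.q_add[symmetric] Q.q_eq gen_closed) }
  { fix a assume a: "a \<in> carrier K"
    have "free_gen K (a \<odot>\<^bsub>V\<^esub> v, w) \<ominus>\<^bsub>free_mod K (carrier V \<times> carrier W)\<^esub>
       (a \<odot>\<^bsub>free_mod K (carrier V \<times> carrier W)\<^esub> free_gen K (v, w)) \<in> tensor_null K V W"
      unfolding tensor_null_def
      by (rule subsetD[OF lin_span_mono_in], unfold bilinear_rels_def Let_def, rule UnI1, rule UnI2) (use w v a in blast)
    then show "pure K V W (a \<odot>\<^bsub>V\<^esub> v) w = a \<odot>\<^bsub>tensor K V W\<^esub> pure K V W v w"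
      using w v a unfolding pure_def tensor_def by (simp add: Q.q_smult[symmetric] Q.q_eq gen_closed) }
qed

lemma pure_lin_r0: "v \<in> carrier V \<Longrightarrow> (\<lambda>w. pure K V W v w) \<in> lin_hom K W (tensor K V W)"
proof (rule lin_homI)
  assume v: "v \<in> carrier V"
  fix w assume w: "w \<in> carrier W"
  show "pure K V W v w \<in> carrier (tensor K V W)" by (rule pure_closed[OF V W v w])
  { fix w' assume w': "w' \<in> carrier W"
    have "free_gen K (v, w \<oplus>\<^bsub>W\<^esub> w') \<ominus>\<^bsub>free_mod K (carrier V \<times> carrier W)\<^esub>
       (free_gen K (v, w) \<oplus>\<^bsub>free_mod K (carrier V \<times> carrier W)\<^esub> free_gen K (v, w')) \<in> tensor_null K V W"
      unfolding tensor_null_def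
      by (rule subsetD[OF lin_span_mono_in], unfold bilinear_rels_def Let_def, rule UnI1, rule UnI1, rule UnI2) (use w v w' in blast)
    then show "pure K V W v (w \<oplus>\<^bsub>W\<^esub> w') = pure K V W v w \<oplus>\<^bsub>tensor K V W\<^esub> pure K V W v w'"
      using w v w' unfolding pure_def tensor_def by (simp add: Q.q_add[symmetric] Q.q_eq gen_closed) }
  { fix a assume a: "a \<in> carrier K"
    have "free_gen K (v, a \<odot>\<^bsub>W\<^esub> w) \<ominus>\<^bsub>free_mod K (carrier V \<times> carrier W)\<^esub>
       (a \<odot>\<^bsub>free_mod K (carrier V \<times> carrier W)\<^esub> free_gen K (v, w)) \<in> tensor_null K V W"
      unfolding tensor_null_def
      by (rule subsetD[OF lin_span_mono_in], unfold bilinear_rels_def Let_def, rule UnI2) (use w v a in blast)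
    then show "pure K V W v (a \<odot>\<^bsub>W\<^esub> w) = a \<odot>\<^bsub>tensor K V W\<^esub> pure K V W v w"
      using w v a unfolding pure_def tensor_def by (simp add: Q.q_smult[symmetric] Q.q_eq gen_closed) }
qed

lemma tensor_cases:
  assumes "t \<in> carrier (tensor K V W)"
  obtains x where "x \<in> carrier (free_mod K (carrier V \<times> carrier W))"
    "t = tensor_null K V W +>\<^bsub>free_mod K (carrier V \<times> carrier W)\<^esub> x"
  using assms unfolding tensor_def Q.quot_carrier by auto

lemma tensor_some:
  assumes "t \<in> carrier (tensor K V W)"
  shows "(SOME x. x \<in> t) \<in> carrier (free_mod K (carrier V \<times> carrier W))"
    and "tensor_null K V W +>\<^bsub>free_mod K (carrier V \<times> carrier W)\<^esub> (SOME x. x \<in> t) = t"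
proof -
  obtain x where x: "x \<in> carrier (free_mod K (carrier V \<times> carrier W))"
    "t = tensor_null K V W +>\<^bsub>free_mod K (carrier V \<times> carrier W)\<^esub> x"
    using tensor_cases[OF assms] .
  then have "x \<in> t" by (simp add: Q.a_rcos_self)
  then have "(SOME x. x \<in> t) \<in> t" by (rule someI[where P = "\<lambda>x. x \<in> t"])
  from Q.in_q[OF x(1) this[unfolded x(2)]] x(2) 
  show "(SOME x. x \<in> t) \<in> carrier (free_mod K (carrier V \<times> carrier W))"
    "tensor_null K V W +>\<^bsub>free_mod K (carrier V \<times> carrier W)\<^esub> (SOME x. x \<in> t) = t"
    by auto
qed

lemma tensor_ext0:
  assumes "module K P" "f \<in> lin_hom K (tensor K V W) P" "g \<in> lin_hom K (tensor K V W) P"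
    and "\<And>v w. v \<in> carrier V \<Longrightarrow> w \<in> carrier W \<Longrightarrow> f (pure K V W v w) = g (pure K V W v w)"
    and "t \<in> carrier (tensor K V W)"
  shows "f t = g t"
proof -
  obtain x where x: "x \<in> carrier (free_mod K (carrier V \<times> carrier W))"
    "t = tensor_null K V W +>\<^bsub>free_mod K (carrier V \<times> carrier W)\<^esub> x"
    using tensor_cases[OF assms(5)] .
  have c: "(\<lambda>x. h (tensor_null K V W +>\<^bsub>free_mod K (carrier V \<times> carrier W)\<^esub> x)) \<in>
      lin_hom K (free_mod K (carrier V \<times> carrier W)) P" if "h \<in> lin_hom K (tensor K V W) P" for h
    using that by (intro lin_homI)
      (simp_all add: tensor_def Q.q_add Q.q_smult Q.q_closed lin_hom_add lin_hom_smult lin_hom_closed)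
  show ?thesis unfolding x(2)
    by (rule free_lin_ext[OF assms(1) c[OF assms(2)] c[OF assms(3)] _ x(1)])
      (use assms(4) in \<open>auto simp: pure_def\<close>)
qed

end

text \<open>
  Unlike \<^const>\<open>sw\<close>, whose value depends on \<open>B\<close> outside of the carriers, this version admits an
  unconditional congruence rule for the simplifier.
\<close>

definition tsw ::
  "('k, 'a) ring_scheme \<Rightarrow> ('k, 'v, 'b) module_scheme \<Rightarrow> ('k, 'w, 'c) module_scheme
     \<Rightarrow> ('k, 'p, 'd) module_scheme \<Rightarrow> ('k, 'v, 'w) tensor \<Rightarrow> ('v \<Rightarrow> 'w \<Rightarrow> 'p) \<Rightarrow> 'p"
  where "tsw K V W P t B =
    sw K P t (\<lambda>v w. if v \<in> carrier V \<and> w \<in> carrier W then B v w else \<zero>\<^bsub>P\<^esub>)"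

lemma tsw_cong [cong]:
  assumes "t = t'" "\<And>v w. v \<in> carrier V \<Longrightarrow> w \<in> carrier W \<Longrightarrow> B v w = B' v w"
  shows "tsw K V W P t B = tsw K V W P t' B'"
proof -
  have "(\<lambda>v w. if v \<in> carrier V \<and> w \<in> carrier W then B v w else \<zero>\<^bsub>P\<^esub>) =
    (\<lambda>v w. if v \<in> carrier V \<and> w \<in> carrier W then B' v w else \<zero>\<^bsub>P\<^esub>)"
    using assms(2) by (intro ext) auto
  then show ?thesis unfolding tsw_def assms(1) by simp
qed

context
  fixes K :: "('k, 'a) ring_scheme" and V :: "('k, 'v, 'b) module_scheme" and W :: "('k, 'w, 'c) module_scheme"
    and P :: "('k, 'p, 'd) module_scheme"
  assumes V: "module K V" and W: "module K W" and P: "module K P"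
begin

interpretation V: module K V by (rule V)
interpretation W: module K W by (rule W)
interpretation P: module K P by (rule P)

lemma tsw_support:
  assumes "t \<in> carrier (tensor K V W)" "p \<in> {p. (SOME x. x \<in> t) p \<noteq> \<zero>\<^bsub>K\<^esub>}"
  shows "fst p \<in> carrier V \<and> snd p \<in> carrier W \<and> (SOME x. x \<in> t) p \<in> carrier K"
proof -
  have "p \<in> carrier V \<times> carrier W \<and> (SOME x. x \<in> t) p \<in> carrier K"
    using tensor_some(1)[OF V W assms(1), unfolded free_mod_carrier] assms(2) by blast
  then show ?thesis by (simp add: mem_Times_iff)
qed

lemma tsw_finite: "t \<in> carrier (tensor K V W) \<Longrightarrow> finite {p. (SOME x. x \<in> t) p \<noteq> \<zero>\<^bsub>K\<^esub>}"
  using tensor_some(1)[OF V W, of t] unfolding free_mod_carrier by blast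

text \<open>The passage from \<open>sw\<close> to \<open>tsw\<close>: on the support of the
  representative both legs lie in the carriers, so the default value in \<open>tsw\<close> is never
  reached.\<close>

lemma sw_finsum:
  assumes "t \<in> carrier (tensor K V W)" "\<And>v w. v \<in> carrier V \<Longrightarrow> w \<in> carrier W \<Longrightarrow> B v w \<in> carrier P"
  shows "sw K P t B = tsw K V W P t B"
    and "tsw K V W P t B = (\<Oplus>\<^bsub>P\<^esub>p\<in>{p. (SOME x. x \<in> t) p \<noteq> \<zero>\<^bsub>K\<^esub>}. (SOME x. x \<in> t) p \<odot>\<^bsub>P\<^esub> B (fst p) (snd p))"
proof -
  note s = tsw_support[OF assms(1)]
  show 2: "tsw K V W P t B = (\<Oplus>\<^bsub>P\<^esub>p\<in>{p. (SOME x. x \<in> t) p \<noteq> \<zero>\<^bsub>K\<^esub>}. (SOME x. x \<in> t) p \<odot>\<^bsub>P\<^esub> B (fst p) (snd p))"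
    unfolding tsw_def sw_def Let_def
    by (rule P.M.finsum_cong') (use s assms(2) in \<open>auto simp del: split_paired_All\<close>)
  show "sw K P t B = tsw K V W P t B" unfolding 2 by (simp add: sw_def Let_def)
qed

lemma tsw_closed:
  assumes "t \<in> carrier (tensor K V W)" "\<And>v w. v \<in> carrier V \<Longrightarrow> w \<in> carrier W \<Longrightarrow> B v w \<in> carrier P"
  shows "tsw K V W P t B \<in> carrier P"
  using tsw_support[OF assms(1)] assms(2)
  by (subst sw_finsum(2)[OF assms]) (auto intro!: P.M.finsum_closed P.smult_closed)

lemma tsw_add:
  assumes t: "t \<in> carrier (tensor K V W)"
    and B: "\<And>v w. v \<in> carrier V \<Longrightarrow> w \<in> carrier W \<Longrightarrow> B v w \<in> carrier P"
    and C: "\<And>v w. v \<in> carrier V \<Longrightarrow> w \<in> carrier W \<Longrightarrow> C v w \<in> carrier P"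
  shows "tsw K V W P t (\<lambda>v w. B v w \<oplus>\<^bsub>P\<^esub> C v w) = tsw K V W P t B \<oplus>\<^bsub>P\<^esub> tsw K V W P t C"
proof -
  note s = tsw_support[OF t]
  show ?thesis
    apply (subst (1 2 3) sw_finsum(2)[OF t])
    using B C apply (auto)[3]
    apply (subst P.M.finsum_addf[symmetric])
    using B C s apply (auto)[2]
    apply (rule P.M.finsum_cong')
    using B C s by (auto simp: P.smult_r_distr)
qed

lemma tsw_smult:
  assumes t: "t \<in> carrier (tensor K V W)" and a: "a \<in> carrier K"
    and B: "\<And>v w. v \<in> carrier V \<Longrightarrow> w \<in> carrier W \<Longrightarrow> B v w \<in> carrier P"
  shows "tsw K V W P t (\<lambda>v w. a \<odot>\<^bsub>P\<^esub> B v w) = a \<odot>\<^bsub>P\<^esub> tsw K V W P t B"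
proof -
  note s = tsw_support[OF t]
  have cr: "cring K" using V by (simp add: module_def)
  show ?thesis
    apply (subst (1 2) sw_finsum(2)[OF t])
    using B a apply (auto)[2]
    apply (subst P.finsum_smult_ldistr[OF tsw_finite[OF t] a])
    using B a s apply (auto)[1]
    apply (rule P.M.finsum_cong')
    using B a s by (auto simp: P.smult_assoc1[symmetric] cring.cring_simprules(14)[OF cr])
qed

text \<open>For fixed \<open>t\<close> the representative is fixed, so the sum inherits linearity in
  the parameter from its terms.\<close>

lemma tsw_lin_arg:
  assumes t: "t \<in> carrier (tensor K V W)"
    and B: "\<And>v w. v \<in> carrier V \<Longrightarrow> w \<in> carrier W \<Longrightarrow> (\<lambda>x. B x v w) \<in> lin_hom K U P"
  shows "(\<lambda>x. tsw K V W P t (B x)) \<in> lin_hom K U P"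
proof (rule lin_homI)
  fix x assume x: "x \<in> carrier U"
  show "tsw K V W P t (B x) \<in> carrier P" using x by (intro tsw_closed[OF t] lin_hom_closed[OF B])
  { fix y assume y: "y \<in> carrier U"
    have "tsw K V W P t (B (x \<oplus>\<^bsub>U\<^esub> y)) = tsw K V W P t (\<lambda>v w. B x v w \<oplus>\<^bsub>P\<^esub> B y v w)"
      using x y by (intro tsw_cong refl lin_hom_add[OF B])
    also have "\<dots> = tsw K V W P t (B x) \<oplus>\<^bsub>P\<^esub> tsw K V W P t (B y)"
      using x y by (intro tsw_add[OF t] lin_hom_closed[OF B])
    finally show "tsw K V W P t (B (x \<oplus>\<^bsub>U\<^esub> y)) = tsw K V W P t (B x) \<oplus>\<^bsub>P\<^esub> tsw K V W P t (B y)" . }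
  { fix a assume a: "a \<in> carrier K"
    have "tsw K V W P t (B (a \<odot>\<^bsub>U\<^esub> x)) = tsw K V W P t (\<lambda>v w. a \<odot>\<^bsub>P\<^esub> B x v w)"
      using x a by (intro tsw_cong refl lin_hom_smult[OF B])
    also have "\<dots> = a \<odot>\<^bsub>P\<^esub> tsw K V W P t (B x)"
      using x a by (intro tsw_smult[OF t] lin_hom_closed[OF B])
    finally show "tsw K V W P t (B (a \<odot>\<^bsub>U\<^esub> x)) = a \<odot>\<^bsub>P\<^esub> tsw K V W P t (B x)" . }
qed

text \<open>Independence of the representative. The linear extension of \<open>B\<close> kills each
  bilinearity relation, hence their span, so the chosen member of the coset and \<open>x\<close>
  have the same image.\<close>

lemma tsw_coset:
  assumes x: "x \<in> carrier (free_mod K (carrier V \<times> carrier W))"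
    and B1: "\<And>w. w \<in> carrier W \<Longrightarrow> (\<lambda>v. B v w) \<in> lin_hom K V P"
    and B2: "\<And>v. v \<in> carrier V \<Longrightarrow> (\<lambda>w. B v w) \<in> lin_hom K W P"
  shows "tsw K V W P (tensor_null K V W +>\<^bsub>free_mod K (carrier V \<times> carrier W)\<^esub> x) B =
    free_ext K P (\<lambda>p. B (fst p) (snd p)) x"
proof -
  interpret Q: quotient_module K "free_mod K (carrier V \<times> carrier W)" "tensor_null K V W"
    by (rule tensor_quotient[OF V W])
  let ?F = "free_mod K (carrier V \<times> carrier W)"
  let ?E = "free_ext K P (\<lambda>p. B (fst p) (snd p))"
  let ?t = "Q.q x"
  have Bc: "B v w \<in> carrier P" if "v \<in> carrier V" "w \<in> carrier W" for v w
    using lin_hom_closed[OF B1] that by blast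
  have E: "?E \<in> lin_hom K ?F P" by (rule free_ext_lin[OF P]) (auto simp: Bc)
  have Eg: "?E (free_gen K (v, w)) = B v w" if "v \<in> carrier V" "w \<in> carrier W" for v w
    using free_ext_gen[OF P, of "\<lambda>p. B (fst p) (snd p)" "(v, w)"] Bc that by simp
  note g = gen_closed[OF V W]
  note Em = lin_hom_minus[OF Q.module_axioms P E] lin_hom_add[OF E] lin_hom_smult[OF E]
  have rels: "bilinear_rels K V W \<subseteq> {r. ?E r = \<zero>\<^bsub>P\<^esub>}"
    unfolding bilinear_rels_def Let_def
    by (intro Un_least subsetI; elim CollectE exE conjE; hypsubst; unfold mem_Collect_eq)
      (simp_all add: Em g Eg Bc lin_hom_add[OF B1] lin_hom_add[OF B2] lin_hom_smult[OF B1] lin_hom_smult[OF B2] P.M.minus_zero_iff)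
  have null: "?E y = \<zero>\<^bsub>P\<^esub>" if "y \<in> tensor_null K V W" for y
  proof -
    have "tensor_null K V W \<subseteq> {x \<in> carrier ?F. ?E x = \<zero>\<^bsub>P\<^esub>}" unfolding tensor_null_def
      by (rule lin_span_least[OF kernel_submodule[OF Q.module_axioms P E lin_hom_zero_map[OF Q.module_axioms P]]])
        (use bilinear_rels_closed[OF V W] rels in auto)
    then show ?thesis using that by auto
  qed
  have t: "?t \<in> carrier (tensor K V W)" unfolding tensor_def by (rule Q.q_closed[OF x])
  let ?y = "SOME x. x \<in> ?t"
  note y = tensor_some[OF V W t]
  have "?y \<ominus>\<^bsub>?F\<^esub> x \<in> tensor_null K V W" using Q.q_eq[OF y(1) x] y(2) by simp
  from null[OF this] have "?E ?y \<ominus>\<^bsub>P\<^esub> ?E x = \<zero>\<^bsub>P\<^esub>" unfolding Em(1)[OF y(1) x] .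
  then have "?E ?y = ?E x" using lin_hom_closed[OF E] y(1) x by (simp add: P.M.minus_zero_iff)
  then show ?thesis by (subst sw_finsum(2)[OF t Bc]) (auto simp: free_ext_def)
qed

lemma tsw_pure:
  assumes "\<And>w. w \<in> carrier W \<Longrightarrow> (\<lambda>v. B v w) \<in> lin_hom K V P"
    and "\<And>v. v \<in> carrier V \<Longrightarrow> (\<lambda>w. B v w) \<in> lin_hom K W P"
    and "v \<in> carrier V" "w \<in> carrier W"
  shows "tsw K V W P (pure K V W v w) B = B v w"
  unfolding pure_def using assms lin_hom_closed[OF assms(1)]
  by (simp add: tsw_coset gen_closed[OF V W] free_ext_gen[OF P])

lemma tsw_lin:
  assumes "\<And>w. w \<in> carrier W \<Longrightarrow> (\<lambda>v. B v w) \<in> lin_hom K V P"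
    and "\<And>v. v \<in> carrier V \<Longrightarrow> (\<lambda>w. B v w) \<in> lin_hom K W P"
  shows "(\<lambda>t. tsw K V W P t B) \<in> lin_hom K (tensor K V W) P"
proof -
  interpret Q: quotient_module K "free_mod K (carrier V \<times> carrier W)" "tensor_null K V W"
    by (rule tensor_quotient[OF V W])
  have c: "B v w \<in> carrier P" if "v \<in> carrier V" "w \<in> carrier W" for v w
    using lin_hom_closed[OF assms(1)] that by blast
  have E: "free_ext K P (\<lambda>p. B (fst p) (snd p)) \<in> lin_hom K (free_mod K (carrier V \<times> carrier W)) P"
    by (rule free_ext_lin[OF P]) (auto simp: c)
  show ?thesis unfolding tensor_def
    by (rule lin_homI)
      (auto simp: Q.quot_carrier Q.q_add[symmetric] Q.q_smult[symmetric] tsw_coset assms lin_hom_closed[OF E] lin_hom_add[OF E] lin_hom_smult[OF E])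
qed

end

text \<open>Both sides use the same representative of \<open>t\<close>, so this is linearity of
  \<open>f\<close> on a finite sum. Most rules that move an operation into a Sweedler sum are
  instances.\<close>

lemma tsw_hom:
  assumes V: "module K V" and W: "module K W" and P: "module K P" and Q: "module K Q"
    and f: "f \<in> lin_hom K P Q" and t: "t \<in> carrier (tensor K V W)"
    and B: "\<And>v w. v \<in> carrier V \<Longrightarrow> w \<in> carrier W \<Longrightarrow> B v w \<in> carrier P"
  shows "f (tsw K V W P t B) = tsw K V W Q t (\<lambda>v w. f (B v w))"
proof -
  interpret P: module K P by (rule P)
  interpret Q: module K Q by (rule Q)
  note s = tsw_support[OF V W P t]
  show ?thesis
    apply (subst sw_finsum(2)[OF V W P t B], assumption, assumption)
    apply (subst sw_finsum(2)[OF V W Q t])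
    using B lin_hom_closed[OF f] apply blast
    apply (subst lin_hom_finsum[OF P Q f tsw_finite[OF V W P t]])
    using s B apply blast
    apply (rule Q.M.finsum_cong')
    using s B lin_hom_closed[OF f] lin_hom_smult[OF f] by auto
qed

text \<open>Turns a tensor into a Sweedler sum, so that the rewriting rules for sums apply to it;
  both sides are linear and agree on pure tensors.\<close>

lemma tensor_id:
  assumes V: "module K V" and W: "module K W" and t: "t \<in> carrier (tensor K V W)"
  shows "tsw K V W (tensor K V W) t (pure K V W) = t"
proof (rule tensor_ext0[OF V W tensor_module[OF V W], where f = "\<lambda>t. tsw K V W (tensor K V W) t (pure K V W)" and g = "\<lambda>t. t"])
  show "(\<lambda>t. tsw K V W (tensor K V W) t (pure K V W)) \<in> lin_hom K (tensor K V W) (tensor K V W)"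
    by (intro tsw_lin V W tensor_module pure_lin_l0 pure_lin_r0)
  show "tsw K V W (tensor K V W) (pure K V W v w) (pure K V W) = pure K V W v w"
    if "v \<in> carrier V" "w \<in> carrier W" for v w
    by (intro tsw_pure V W tensor_module pure_lin_l0 pure_lin_r0 that)
qed (auto intro: lin_homI t)

text \<open>Fubini for two finite sums over fixed representatives. The outer sum is expanded and
  moved inside by induction on subsets of the support.\<close>

lemma tsw_swap:
  assumes V: "module K V" and W: "module K W" and V': "module K V'" and W': "module K W'" and P: "module K P"
    and t: "t \<in> carrier (tensor K V W)" and u: "u \<in> carrier (tensor K V' W')"
    and F: "\<And>a b c d. \<lbrakk>a \<in> carrier V; b \<in> carrier W; c \<in> carrier V'; d \<in> carrier W'\<rbrakk> \<Longrightarrow> F a b c d \<in> carrier P"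
  shows "tsw K V W P t (\<lambda>a b. tsw K V' W' P u (\<lambda>c d. F a b c d)) =
    tsw K V' W' P u (\<lambda>c d. tsw K V W P t (\<lambda>a b. F a b c d))"
proof -
  interpret P: module K P by (rule P)
  note s = tsw_support[OF V W P t]
  let ?S = "{p. (SOME x. x \<in> t) p \<noteq> \<zero>\<^bsub>K\<^esub>}" let ?y = "SOME x. x \<in> t"
  have F': "tsw K V' W' P u (\<lambda>c d. F a b c d) \<in> carrier P" if "a \<in> carrier V" "b \<in> carrier W" for a b
    using that by (intro tsw_closed V' W' P u F)
  have fs: "(\<Oplus>\<^bsub>P\<^esub>p\<in>T. ?y p \<odot>\<^bsub>P\<^esub> tsw K V' W' P u (\<lambda>c d. F (fst p) (snd p) c d)) =
     tsw K V' W' P u (\<lambda>c d. \<Oplus>\<^bsub>P\<^esub>p\<in>T. ?y p \<odot>\<^bsub>P\<^esub> F (fst p) (snd p) c d)" if "finite T" "T \<subseteq> ?S" for T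
    using that
  proof (induction T)
    case empty
    have "tsw K V' W' P u (\<lambda>c d. \<zero>\<^bsub>P\<^esub>) = tsw K V' W' P u (\<lambda>c d. \<zero>\<^bsub>K\<^esub> \<odot>\<^bsub>P\<^esub> \<zero>\<^bsub>P\<^esub>)" by simp
    also have "\<dots> = \<zero>\<^bsub>K\<^esub> \<odot>\<^bsub>P\<^esub> tsw K V' W' P u (\<lambda>c d. \<zero>\<^bsub>P\<^esub>)"
      by (rule tsw_smult[OF V' W' P u]) auto
    also have "\<dots> = \<zero>\<^bsub>P\<^esub>" using tsw_closed[OF V' W' P u, of "\<lambda>_ _. \<zero>\<^bsub>P\<^esub>"] by simp
    finally show ?case by simp
  next
    case (insert p T)
    have p: "fst p \<in> carrier V" "snd p \<in> carrier W" "?y p \<in> carrier K" using insert.prems s by auto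
    have T: "fst q \<in> carrier V" "snd q \<in> carrier W" "?y q \<in> carrier K" if "q \<in> T" for q
      using insert.prems s[of q] that by blast+
    have "(\<Oplus>\<^bsub>P\<^esub>p\<in>insert p T. ?y p \<odot>\<^bsub>P\<^esub> tsw K V' W' P u (\<lambda>c d. F (fst p) (snd p) c d)) =
      tsw K V' W' P u (\<lambda>c d. ?y p \<odot>\<^bsub>P\<^esub> F (fst p) (snd p) c d) \<oplus>\<^bsub>P\<^esub>
      tsw K V' W' P u (\<lambda>c d. \<Oplus>\<^bsub>P\<^esub>p\<in>T. ?y p \<odot>\<^bsub>P\<^esub> F (fst p) (snd p) c d)"
      using insert p T by (subst P.M.finsum_insert) (auto intro!: F' simp: tsw_smult[OF V' W' P u] F)
    also have "\<dots> = tsw K V' W' P u (\<lambda>c d. ?y p \<odot>\<^bsub>P\<^esub> F (fst p) (snd p) c d \<oplus>\<^bsub>P\<^esub>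
        (\<Oplus>\<^bsub>P\<^esub>p\<in>T. ?y p \<odot>\<^bsub>P\<^esub> F (fst p) (snd p) c d))"
      using p T F by (intro tsw_add[OF V' W' P u, symmetric]) (auto intro!: P.M.finsum_closed)
    also have "\<dots> = tsw K V' W' P u (\<lambda>c d. \<Oplus>\<^bsub>P\<^esub>p\<in>insert p T. ?y p \<odot>\<^bsub>P\<^esub> F (fst p) (snd p) c d)"
      using insert p T by (intro tsw_cong refl, subst P.M.finsum_insert) (auto intro!: F)
    finally show ?case .
  qed
  show ?thesis
    apply (subst sw_finsum(2)[OF V W P t F'], assumption, assumption)
    apply (subst fs[OF tsw_finite[OF V W P t] subset_refl])
    apply (intro tsw_cong refl)
    by (subst sw_finsum(2)[OF V W P t F]) auto
qed

subsection \<open>Simplification rules for sums in Sweedler notation\<close>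

text \<open>The ground field as a vector space over itself, so that the counit and linear
  functionals are members of \<open>lin_hom\<close>.\<close>

definition kmod :: "('k, 'a) ring_scheme \<Rightarrow> ('k, 'k) module"
  where "kmod K = \<lparr>carrier = carrier K, mult = mult K, one = one K, zero = zero K, add = add K, smult = mult K\<rparr>"

lemma kmod_simps [simp]: "carrier (kmod K) = carrier K" "add (kmod K) = add K" "smult (kmod K) = mult K"
  "zero (kmod K) = zero K"
  by (simp_all add: kmod_def)

lemma kmod_module [simp]: "cring K \<Longrightarrow> module K (kmod K)"
proof -
  assume "cring K"
  then interpret cring K .
  show ?thesis
    by (intro moduleI abelian_groupI is_cring)
      (auto simp: l_distr r_distr m_assoc a_ac intro: a_inv_closed l_neg
        intro!: bexI[of _ "\<ominus>\<^bsub>K\<^esub> x" for x])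
qed

lemma assoc_algebra_module: "assoc_algebra K A \<Longrightarrow> module K A"
  and assoc_algebra_ring: "assoc_algebra K A \<Longrightarrow> ring A"
  by (simp_all add: assoc_algebra_def)

lemma module_cring: "module K V \<Longrightarrow> cring K" by (simp add: module_def)

lemma ring_closed [simp]: "ring A \<Longrightarrow> x \<in> carrier A \<Longrightarrow> y \<in> carrier A \<Longrightarrow> x \<otimes>\<^bsub>A\<^esub> y \<in> carrier A"
  and ring_assoc [simp]: "ring A \<Longrightarrow> x \<in> carrier A \<Longrightarrow> y \<in> carrier A \<Longrightarrow> z \<in> carrier A \<Longrightarrow>
    (x \<otimes>\<^bsub>A\<^esub> y) \<otimes>\<^bsub>A\<^esub> z = x \<otimes>\<^bsub>A\<^esub> (y \<otimes>\<^bsub>A\<^esub> z)"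
  and ring_one [simp]: "ring A \<Longrightarrow> \<one>\<^bsub>A\<^esub> \<in> carrier A"
  and ring_l_one [simp]: "ring A \<Longrightarrow> x \<in> carrier A \<Longrightarrow> \<one>\<^bsub>A\<^esub> \<otimes>\<^bsub>A\<^esub> x = x"
  and ring_r_one [simp]: "ring A \<Longrightarrow> x \<in> carrier A \<Longrightarrow> x \<otimes>\<^bsub>A\<^esub> \<one>\<^bsub>A\<^esub> = x"
  by (simp_all add: ring.ring_simprules monoid.m_assoc ring.is_monoid)

declare tensor_module [simp] pure_closed [simp] tsw_closed [simp]

lemma lin_id [simp]: "(\<lambda>x. x) \<in> lin_hom K V V"
  by (rule lin_homI) auto

lemma lin_comp: "f \<in> lin_hom K V W \<Longrightarrow> g \<in> lin_hom K U V \<Longrightarrow> (\<lambda>x. f (g x)) \<in> lin_hom K U W"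
  by (rule lin_homI) (auto simp: lin_hom_closed lin_hom_add lin_hom_smult)

lemma lin_pure_l [simp]: "module K V \<Longrightarrow> module K W \<Longrightarrow> f \<in> lin_hom K U V \<Longrightarrow> w \<in> carrier W \<Longrightarrow>
    (\<lambda>x. pure K V W (f x) w) \<in> lin_hom K U (tensor K V W)"
  by (rule lin_comp[OF pure_lin_l0])

lemma lin_pure_r [simp]: "module K V \<Longrightarrow> module K W \<Longrightarrow> f \<in> lin_hom K U W \<Longrightarrow> v \<in> carrier V \<Longrightarrow>
    (\<lambda>x. pure K V W v (f x)) \<in> lin_hom K U (tensor K V W)"
  by (rule lin_comp[OF pure_lin_r0])

lemma lin_mult_l [simp]:
  assumes "assoc_algebra K A" "f \<in> lin_hom K U A" "c \<in> carrier A"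
  shows "(\<lambda>x. f x \<otimes>\<^bsub>A\<^esub> c) \<in> lin_hom K U A"
proof -
  interpret A: assoc_algebra K A by fact
  show ?thesis using assms(2,3) by (intro lin_homI)
    (auto simp: lin_hom_closed lin_hom_add lin_hom_smult A.l_distr A.smult_mult_l)
qed

lemma lin_mult_r [simp]:
  assumes "assoc_algebra K A" "f \<in> lin_hom K U A" "c \<in> carrier A"
  shows "(\<lambda>x. c \<otimes>\<^bsub>A\<^esub> f x) \<in> lin_hom K U A"
proof -
  interpret A: assoc_algebra K A by fact
  show ?thesis using assms(2,3) by (intro lin_homI)
    (auto simp: lin_hom_closed lin_hom_add lin_hom_smult A.r_distr A.smult_mult_r)
qed

lemma lin_smult [simp]:
  assumes "module K W" "f \<in> lin_hom K U W" "a \<in> carrier K"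
  shows "(\<lambda>x. a \<odot>\<^bsub>W\<^esub> f x) \<in> lin_hom K U W"
proof -
  interpret W: module K W by fact
  show ?thesis using assms(2,3) by (intro lin_homI)
    (auto simp: lin_hom_closed lin_hom_add lin_hom_smult W.smult_r_distr W.smult_assoc1[symmetric] W.R.m_comm)
qed

lemma lin_scal [simp]:
  assumes "module K W" "f \<in> lin_hom K U (kmod K)" "w \<in> carrier W"
  shows "(\<lambda>x. f x \<odot>\<^bsub>W\<^esub> w) \<in> lin_hom K U W"
proof -
  interpret W: module K W by fact
  have "f x \<in> carrier K" if "x \<in> carrier U" for x using lin_hom_closed[OF assms(2) that] by simp
  then show ?thesis using assms(3) lin_hom_add[OF assms(2)] lin_hom_smult[OF assms(2)]
    by (intro lin_homI) (auto simp: W.smult_l_distr W.smult_assoc1)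
qed

lemma lin_add [simp]:
  assumes "module K W" "f \<in> lin_hom K U W" "g \<in> lin_hom K U W"
  shows "(\<lambda>x. f x \<oplus>\<^bsub>W\<^esub> g x) \<in> lin_hom K U W"
proof -
  interpret W: module K W by fact
  show ?thesis using assms(2,3) by (intro lin_homI)
    (auto simp: lin_hom_closed lin_hom_add lin_hom_smult W.smult_r_distr W.a_ac)
qed

lemma lin_tsw_arg [simp]:
  "module K V \<Longrightarrow> module K W \<Longrightarrow> module K P \<Longrightarrow> t \<in> carrier (tensor K V W) \<Longrightarrow>
   (\<And>v w. v \<in> carrier V \<Longrightarrow> w \<in> carrier W \<Longrightarrow> (\<lambda>x. B x v w) \<in> lin_hom K U P) \<Longrightarrow>
   (\<lambda>x. tsw K V W P t (\<lambda>v w. B x v w)) \<in> lin_hom K U P"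
  by (rule tsw_lin_arg)

lemma lin_tsw [simp]:
  "module K V \<Longrightarrow> module K W \<Longrightarrow> module K P \<Longrightarrow> g \<in> lin_hom K U (tensor K V W) \<Longrightarrow>
   (\<And>w. w \<in> carrier W \<Longrightarrow> (\<lambda>v. B v w) \<in> lin_hom K V P) \<Longrightarrow>
   (\<And>v. v \<in> carrier V \<Longrightarrow> (\<lambda>w. B v w) \<in> lin_hom K W P) \<Longrightarrow>
   (\<lambda>x. tsw K V W P (g x) (\<lambda>v w. B v w)) \<in> lin_hom K U P"
  by (rule lin_comp[OF tsw_lin])

lemma tsw_pure_eval [simp]:
  "module K V \<Longrightarrow> module K W \<Longrightarrow> module K P \<Longrightarrow> v \<in> carrier V \<Longrightarrow> w \<in> carrier W \<Longrightarrow>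
   (\<And>w. w \<in> carrier W \<Longrightarrow> (\<lambda>v. B v w) \<in> lin_hom K V P) \<Longrightarrow>
   (\<And>v. v \<in> carrier V \<Longrightarrow> (\<lambda>w. B v w) \<in> lin_hom K W P) \<Longrightarrow>
   tsw K V W P (pure K V W v w) (\<lambda>v w. B v w) = B v w"
  by (rule tsw_pure)

lemma tsw_mult_l [simp]:
  assumes "module K V" "module K W" "assoc_algebra K A" "t \<in> carrier (tensor K V W)"
    "\<And>v w. v \<in> carrier V \<Longrightarrow> w \<in> carrier W \<Longrightarrow> B v w \<in> carrier A" "c \<in> carrier A"
  shows "tsw K V W A t B \<otimes>\<^bsub>A\<^esub> c = tsw K V W A t (\<lambda>v w. B v w \<otimes>\<^bsub>A\<^esub> c)"
  by (rule tsw_hom[where f = "\<lambda>x. x \<otimes>\<^bsub>A\<^esub> c"]) (use assms in \<open>simp_all add: assoc_algebra_module\<close>)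

lemma tsw_mult_r [simp]:
  assumes "module K V" "module K W" "assoc_algebra K A" "t \<in> carrier (tensor K V W)"
    "\<And>v w. v \<in> carrier V \<Longrightarrow> w \<in> carrier W \<Longrightarrow> B v w \<in> carrier A" "c \<in> carrier A"
  shows "c \<otimes>\<^bsub>A\<^esub> tsw K V W A t B = tsw K V W A t (\<lambda>v w. c \<otimes>\<^bsub>A\<^esub> B v w)"
  by (rule tsw_hom[where f = "\<lambda>x. c \<otimes>\<^bsub>A\<^esub> x"]) (use assms in \<open>simp_all add: assoc_algebra_module\<close>)

lemma tsw_pure_l [simp]:
  assumes "module K V" "module K W" "module K P" "module K Q" "t \<in> carrier (tensor K V W)"
    "\<And>v w. v \<in> carrier V \<Longrightarrow> w \<in> carrier W \<Longrightarrow> B v w \<in> carrier P" "c \<in> carrier Q"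
  shows "pure K P Q (tsw K V W P t B) c = tsw K V W (tensor K P Q) t (\<lambda>v w. pure K P Q (B v w) c)"
  by (rule tsw_hom[where f = "\<lambda>x. pure K P Q x c"]) (use assms in simp_all)

lemma tsw_smult_out [simp]:
  assumes "module K V" "module K W" "module K P" "t \<in> carrier (tensor K V W)" "a \<in> carrier K"
    "\<And>v w. v \<in> carrier V \<Longrightarrow> w \<in> carrier W \<Longrightarrow> B v w \<in> carrier P"
  shows "tsw K V W P t (\<lambda>v w. a \<odot>\<^bsub>P\<^esub> B v w) = a \<odot>\<^bsub>P\<^esub> tsw K V W P t (\<lambda>v w. B v w)"
  by (rule tsw_smult) (use assms in simp_all)

lemma tsw_tsw [simp]:
  assumes "module K V" "module K W" "module K V'" "module K W'" "module K P" "t \<in> carrier (tensor K V' W')"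
    "\<And>v w. v \<in> carrier V' \<Longrightarrow> w \<in> carrier W' \<Longrightarrow> C v w \<in> carrier (tensor K V W)"
    "\<And>w. w \<in> carrier W \<Longrightarrow> (\<lambda>v. B v w) \<in> lin_hom K V P"
    "\<And>v. v \<in> carrier V \<Longrightarrow> (\<lambda>w. B v w) \<in> lin_hom K W P"
  shows "tsw K V W P (tsw K V' W' (tensor K V W) t C) (\<lambda>v w. B v w) =
    tsw K V' W' P t (\<lambda>a b. tsw K V W P (C a b) (\<lambda>v w. B v w))"
  by (rule tsw_hom[where f = "\<lambda>x. tsw K V W P x B"]) (use assms in simp_all)

lemma mult_smult_l [simp]: "assoc_algebra K A \<Longrightarrow> a \<in> carrier K \<Longrightarrow> x \<in> carrier A \<Longrightarrow> y \<in> carrier A \<Longrightarrow>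
    (a \<odot>\<^bsub>A\<^esub> x) \<otimes>\<^bsub>A\<^esub> y = a \<odot>\<^bsub>A\<^esub> (x \<otimes>\<^bsub>A\<^esub> y)"
  and mult_smult_r [simp]: "assoc_algebra K A \<Longrightarrow> a \<in> carrier K \<Longrightarrow> x \<in> carrier A \<Longrightarrow> y \<in> carrier A \<Longrightarrow>
    x \<otimes>\<^bsub>A\<^esub> (a \<odot>\<^bsub>A\<^esub> y) = a \<odot>\<^bsub>A\<^esub> (x \<otimes>\<^bsub>A\<^esub> y)"
  for K :: "('k, 'a) ring_scheme"
  by (simp_all add: assoc_algebra.smult_mult_l assoc_algebra.smult_mult_r)

lemma tensor_ext:
  assumes "module K V" "module K W" "module K P" "t \<in> carrier (tensor K V W)"
    "(\<lambda>t. f t) \<in> lin_hom K (tensor K V W) P" "(\<lambda>t. g t) \<in> lin_hom K (tensor K V W) P"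
    "\<And>v w. v \<in> carrier V \<Longrightarrow> w \<in> carrier W \<Longrightarrow> f (pure K V W v w) = g (pure K V W v w)"
  shows "f t = g t"
  by (rule tensor_ext0[OF assms(1-3) assms(5,6,7) assms(4)])

lemma smult_pure [simp]:
  assumes "module K V" "module K W" "a \<in> carrier K" "v \<in> carrier V" "w \<in> carrier W"
  shows "pure K V W (a \<odot>\<^bsub>V\<^esub> v) w = a \<odot>\<^bsub>tensor K V W\<^esub> pure K V W v w"
    and "pure K V W v (a \<odot>\<^bsub>W\<^esub> w) = a \<odot>\<^bsub>tensor K V W\<^esub> pure K V W v w"
  using lin_hom_smult[OF pure_lin_l0[OF assms(1,2,5)] assms(3,4)]
    lin_hom_smult[OF pure_lin_r0[OF assms(1,2,4)] assms(3,5)] by auto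

subsection \<open>Hopf algebras with bijective antipode\<close>

locale hopf_bij = hopf_algebra K H for K :: "('k, 'a) ring_scheme" and H :: "('k, 'h) hopf" +
  assumes bij: "bij_betw (antipode H) (carrier H) (carrier H)"
begin

abbreviation cop where "cop P h B \<equiv> tsw K H H P (comult H h) B"
abbreviation hm (infixl "\<bullet>" 70) where "x \<bullet> y \<equiv> x \<otimes>\<^bsub>H\<^esub> y"
abbreviation S where "S \<equiv> antipode H"
abbreviation Si where "Si \<equiv> antipode_inv H"
abbreviation eps where "eps \<equiv> counit H"

lemma algH [simp]: "assoc_algebra K H" by (rule assoc_algebra_axioms)
lemma modH [simp]: "module K H" by (rule module_axioms)
lemma ringH [simp]: "ring H" by (rule ring_axioms)
lemma cringK [simp]: "cring K" by (rule module_cring[OF modH])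

lemma smc [simp]: "module K V \<Longrightarrow> a \<in> carrier K \<Longrightarrow> x \<in> carrier V \<Longrightarrow> a \<odot>\<^bsub>V\<^esub> x \<in> carrier V"
  and smone [simp]: "module K V \<Longrightarrow> x \<in> carrier V \<Longrightarrow> \<one>\<^bsub>K\<^esub> \<odot>\<^bsub>V\<^esub> x = x"
  and smassoc [simp]: "module K V \<Longrightarrow> a \<in> carrier K \<Longrightarrow> b \<in> carrier K \<Longrightarrow> x \<in> carrier V \<Longrightarrow> (a \<otimes>\<^bsub>K\<^esub> b) \<odot>\<^bsub>V\<^esub> x = a \<odot>\<^bsub>V\<^esub> (b \<odot>\<^bsub>V\<^esub> x)"
  by (simp_all add: module.smult_closed module.smult_one module.smult_assoc1)

lemma smult_comm: "module K V \<Longrightarrow> a \<in> carrier K \<Longrightarrow> b \<in> carrier K \<Longrightarrow> x \<in> carrier V \<Longrightarrow>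
    a \<odot>\<^bsub>V\<^esub> (b \<odot>\<^bsub>V\<^esub> x) = b \<odot>\<^bsub>V\<^esub> (a \<odot>\<^bsub>V\<^esub> x)"
  by (metis smassoc cring.cring_simprules(14)[OF cringK])

lemma comult_closed [simp]: "h \<in> carrier H \<Longrightarrow> comult H h \<in> carrier (tensor K H H)"
  by (rule lin_hom_closed[OF comult_lin])
lemma lin_comult [simp]: "f \<in> lin_hom K U H \<Longrightarrow> (\<lambda>x. comult H (f x)) \<in> lin_hom K U (tensor K H H)"
  by (rule lin_comp[OF comult_lin])
lemma lin_comult0 [simp]: "comult H \<in> lin_hom K H (tensor K H H)" by (rule comult_lin)
lemma S_closed [simp]: "h \<in> carrier H \<Longrightarrow> S h \<in> carrier H"
  by (rule lin_hom_closed[OF antipode_lin])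
lemma lin_S [simp]: "f \<in> lin_hom K U H \<Longrightarrow> (\<lambda>x. S (f x)) \<in> lin_hom K U H"
  by (rule lin_comp[OF antipode_lin])
lemma lin_S0 [simp]: "S \<in> lin_hom K H H" by (rule antipode_lin)
lemma eps_closed [simp]: "h \<in> carrier H \<Longrightarrow> eps h \<in> carrier K"
  using counit_closed by auto
lemma lin_eps0 [simp]: "eps \<in> lin_hom K H (kmod K)"
  by (rule lin_homI) (auto simp: counit_add counit_smult)
lemma lin_eps [simp]: "f \<in> lin_hom K U H \<Longrightarrow> (\<lambda>x. eps (f x)) \<in> lin_hom K U (kmod K)"
  by (rule lin_comp[OF lin_eps0])
declare counit_one [simp] counit_mult [simp]

lemma Si_S [simp]: "h \<in> carrier H \<Longrightarrow> Si (S h) = h"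
  unfolding antipode_inv_def using bij by (auto simp: bij_betw_def)
lemma S_Si [simp]: "h \<in> carrier H \<Longrightarrow> S (Si h) = h"
  unfolding antipode_inv_def using bij by (auto simp: bij_betw_def f_inv_into_f)
lemma Si_closed [simp]: "h \<in> carrier H \<Longrightarrow> Si h \<in> carrier H"
  unfolding antipode_inv_def using bij by (metis bij_betw_def inv_into_into)
lemma S_inj: "S x = S y \<Longrightarrow> x \<in> carrier H \<Longrightarrow> y \<in> carrier H \<Longrightarrow> x = y"
  by (metis Si_S)
lemma lin_Si0 [simp]: "Si \<in> lin_hom K H H"
proof (rule lin_homI)
  fix x y assume "x \<in> carrier H" "y \<in> carrier H"
  then show "Si (x \<oplus>\<^bsub>H\<^esub> y) = Si x \<oplus>\<^bsub>H\<^esub> Si y"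
    by (intro S_inj[of "Si (x \<oplus>\<^bsub>H\<^esub> y)"]) (simp_all add: lin_hom_add[OF antipode_lin])
next
  fix a x assume "a \<in> carrier K" "x \<in> carrier H"
  then show "Si (a \<odot>\<^bsub>H\<^esub> x) = a \<odot>\<^bsub>H\<^esub> Si x"
    by (intro S_inj[of "Si (a \<odot>\<^bsub>H\<^esub> x)"]) (simp_all add: lin_hom_smult[OF antipode_lin])
qed simp

lemma sw_cop: "h \<in> carrier H \<Longrightarrow> module K P \<Longrightarrow>
    (\<And>a b. a \<in> carrier H \<Longrightarrow> b \<in> carrier H \<Longrightarrow> B a b \<in> carrier P) \<Longrightarrow> sw K P (comult H h) B = cop P h B"
  by (rule sw_finsum(1)) auto

text \<open>The axiom lives in the triple tensor product; applying the linear map induced by the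
  trilinear \<open>F\<close> carries it to any target. As a rewrite rule it nests iterated
  coproducts to the right.\<close>

lemma coassoc [simp]:
  assumes h: "h \<in> carrier H" and P: "module K P"
    and F: "\<And>b c. b \<in> carrier H \<Longrightarrow> c \<in> carrier H \<Longrightarrow> (\<lambda>a. F a b c) \<in> lin_hom K H P"
      "\<And>a c. a \<in> carrier H \<Longrightarrow> c \<in> carrier H \<Longrightarrow> (\<lambda>b. F a b c) \<in> lin_hom K H P"
      "\<And>a b. a \<in> carrier H \<Longrightarrow> b \<in> carrier H \<Longrightarrow> (\<lambda>c. F a b c) \<in> lin_hom K H P"
  shows "cop P h (\<lambda>x c. cop P x (\<lambda>a b. F a b c)) = cop P h (\<lambda>a y. cop P y (\<lambda>b c. F a b c))"
proof -
  let ?T = "tensor K H H" and ?TT = "tensor K (tensor K H H) H"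
  have Fc: "F a b c \<in> carrier P" if "a \<in> carrier H" "b \<in> carrier H" "c \<in> carrier H" for a b c
    using lin_hom_closed[OF F(1)] that by blast
  have *: "cop ?TT h (\<lambda>x y. pure K ?T H (comult H x) y) = cop ?TT h
        (\<lambda>x y. cop ?TT y (\<lambda>y1 y2. pure K ?T H (pure K H H x y1) y2))"
    using comult_coassoc[OF h] h by (simp add: sw_cop P)
  from arg_cong[OF this, of "\<lambda>t. tsw K ?T H P t (\<lambda>u c. tsw K H H P u (\<lambda>a b. F a b c))"]
  show ?thesis using h P F Fc by simp
qed

lemma counit_l' [simp]:
  assumes "h \<in> carrier H" "module K P" "(\<lambda>a. F a) \<in> lin_hom K H P"
  shows "cop P h (\<lambda>a b. eps a \<odot>\<^bsub>P\<^esub> F b) = F h"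
proof -
  have "F h = F (cop H h (\<lambda>a b. eps a \<odot>\<^bsub>H\<^esub> b))"
    using counit_l[OF assms(1)] assms by (simp add: sw_cop)
  also have "\<dots> = cop P h (\<lambda>a b. F (eps a \<odot>\<^bsub>H\<^esub> b))"
    by (rule tsw_hom) (use assms in simp_all)
  also have "\<dots> = cop P h (\<lambda>a b. eps a \<odot>\<^bsub>P\<^esub> F b)"
    by (rule tsw_cong) (simp_all add: lin_hom_smult[OF assms(3)])
  finally show ?thesis by simp
qed

lemma counit_r' [simp]:
  assumes "h \<in> carrier H" "module K P" "(\<lambda>a. F a) \<in> lin_hom K H P"
  shows "cop P h (\<lambda>a b. eps b \<odot>\<^bsub>P\<^esub> F a) = F h"
proof -
  have "F h = F (cop H h (\<lambda>a b. eps b \<odot>\<^bsub>H\<^esub> a))"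
    using counit_r[OF assms(1)] assms by (simp add: sw_cop)
  also have "\<dots> = cop P h (\<lambda>a b. F (eps b \<odot>\<^bsub>H\<^esub> a))"
    by (rule tsw_hom) (use assms in simp_all)
  also have "\<dots> = cop P h (\<lambda>a b. eps b \<odot>\<^bsub>P\<^esub> F a)"
    by (rule tsw_cong) (simp_all add: lin_hom_smult[OF assms(3)])
  finally show ?thesis by simp
qed

text \<open>
  The contraction rules take the function \<open>G\<close> as an explicit parameter, since the simplifier cannot
  find it by unification.
\<close>

lemma contract_aux:
  assumes h: "h \<in> carrier H" and P: "module K P" and G: "(\<lambda>x. G x) \<in> lin_hom K H P"
    and m: "sw K H (comult H h) (\<lambda>x y. m x y) = eps h \<odot>\<^bsub>H\<^esub> \<one>\<^bsub>H\<^esub>"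
    and mc: "\<And>x y. x \<in> carrier H \<Longrightarrow> y \<in> carrier H \<Longrightarrow> m x y \<in> carrier H"
    and F: "\<And>x y. x \<in> carrier H \<Longrightarrow> y \<in> carrier H \<Longrightarrow> F x y = G (m x y)"
  shows "cop P h F = eps h \<odot>\<^bsub>P\<^esub> G \<one>\<^bsub>H\<^esub>"
proof -
  have "cop P h F = cop P h (\<lambda>x y. G (m x y))" by (rule tsw_cong) (simp_all add: F)
  also have "\<dots> = G (cop H h m)" by (rule tsw_hom[symmetric]) (use h P G mc in simp_all)
  also have "cop H h m = eps h \<odot>\<^bsub>H\<^esub> \<one>\<^bsub>H\<^esub>" using m h mc by (simp add: sw_cop)
  finally show ?thesis using h by (simp add: lin_hom_smult[OF G])
qed

lemma contract_Sl:
  assumes "h \<in> carrier H" "module K P" "(\<lambda>x. G x) \<in> lin_hom K H P"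
    and "\<And>x y. x \<in> carrier H \<Longrightarrow> y \<in> carrier H \<Longrightarrow> F x y = G (S x \<bullet> y)"
  shows "cop P h F = eps h \<odot>\<^bsub>P\<^esub> G \<one>\<^bsub>H\<^esub>"
  by (rule contract_aux[OF assms(1-3) antipode_l[OF assms(1)]]) (use assms in simp_all)

lemma contract_Sr:
  assumes "h \<in> carrier H" "module K P" "(\<lambda>x. G x) \<in> lin_hom K H P"
    and "\<And>x y. x \<in> carrier H \<Longrightarrow> y \<in> carrier H \<Longrightarrow> F x y = G (x \<bullet> S y)"
  shows "cop P h F = eps h \<odot>\<^bsub>P\<^esub> G \<one>\<^bsub>H\<^esub>"
  by (rule contract_aux[OF assms(1-3) antipode_r[OF assms(1)]]) (use assms in simp_all)

lemma cop_mult [simp]: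
  assumes "h \<in> carrier H" "l \<in> carrier H" "module K P"
    "\<And>b. b \<in> carrier H \<Longrightarrow> (\<lambda>a. F a b) \<in> lin_hom K H P"
    "\<And>a. a \<in> carrier H \<Longrightarrow> (\<lambda>b. F a b) \<in> lin_hom K H P"
  shows "cop P (h \<bullet> l) (\<lambda>a b. F a b) = cop P h (\<lambda>h1 h2. cop P l (\<lambda>l1 l2. F (h1 \<bullet> l1) (h2 \<bullet> l2)))"
proof -
  have *: "comult H (h \<bullet> l) = cop (tensor K H H) h (\<lambda>h1 h2. cop (tensor K H H) l
        (\<lambda>l1 l2. pure K H H (h1 \<otimes>\<^bsub>H\<^esub> l1) (h2 \<otimes>\<^bsub>H\<^esub> l2)))"
    using comult_mult[OF assms(1,2)] assms by (simp add: sw_cop)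
  show ?thesis unfolding * using assms lin_hom_closed[OF assms(4)] by simp
qed

lemma cop_one [simp]:
  assumes "module K P"
    "\<And>b. b \<in> carrier H \<Longrightarrow> (\<lambda>a. F a b) \<in> lin_hom K H P"
    "\<And>a. a \<in> carrier H \<Longrightarrow> (\<lambda>b. F a b) \<in> lin_hom K H P"
  shows "cop P \<one>\<^bsub>H\<^esub> (\<lambda>a b. F a b) = F \<one>\<^bsub>H\<^esub> \<one>\<^bsub>H\<^esub>"
  using assms lin_hom_closed[OF assms(2)] by (simp add: comult_one)

end

section \<open>The antipode as an antihomomorphism of algebras and coalgebras\<close>

context hopf_bij
begin

text \<open>A sum standing between the two coproducts hides the pattern of \<open>coassoc\<close>;
  interchanging the sums exposes it. \<open>coassoc_ff\<close> handles two such sums and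
  \<open>coassoc2\<close> the case where the second leg is split first.\<close>

lemma coassoc_f [simp]:
  assumes h: "h \<in> carrier H" and P: "module K P" and V: "module K V" "module K W" "t \<in> carrier (tensor K V W)"
    and F: "\<And>b e c d. \<lbrakk>b \<in> carrier H; e \<in> carrier H; c \<in> carrier V; d \<in> carrier W\<rbrakk> \<Longrightarrow> (\<lambda>a. F a b e c d) \<in> lin_hom K H P"
      "\<And>a e c d. \<lbrakk>a \<in> carrier H; e \<in> carrier H; c \<in> carrier V; d \<in> carrier W\<rbrakk> \<Longrightarrow> (\<lambda>b. F a b e c d) \<in> lin_hom K H P"
      "\<And>a b c d. \<lbrakk>a \<in> carrier H; b \<in> carrier H; c \<in> carrier V; d \<in> carrier W\<rbrakk> \<Longrightarrow> (\<lambda>e. F a b e c d) \<in> lin_hom K H P"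
  shows "cop P h (\<lambda>x e. tsw K V W P t (\<lambda>c d. cop P x (\<lambda>a b. F a b e c d))) =
    cop P h (\<lambda>a y. cop P y (\<lambda>b e. tsw K V W P t (\<lambda>c d. F a b e c d)))"
proof -
  have Fc: "F a b e c d \<in> carrier P" if "a \<in> carrier H" "b \<in> carrier H" "e \<in> carrier H" "c \<in> carrier V" "d \<in> carrier W" for a b c d e
    using lin_hom_closed[OF F(1)] that by blast
  have "cop P h (\<lambda>x e. tsw K V W P t (\<lambda>c d. cop P x (\<lambda>a b. F a b e c d))) =
     cop P h (\<lambda>x e. cop P x (\<lambda>a b. tsw K V W P t (\<lambda>c d. F a b e c d)))"
    by (intro tsw_cong refl tsw_swap) (use P V Fc in simp_all)
  also have "\<dots> = cop P h (\<lambda>a y. cop P y (\<lambda>b e. tsw K V W P t (\<lambda>c d. F a b e c d)))"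
    by (rule coassoc) (use h P V F in simp_all)
  finally show ?thesis .
qed

lemma coassoc_ff [simp]:
  assumes h: "h \<in> carrier H" and P: "module K P" and V: "module K V" "module K W" "t \<in> carrier (tensor K V W)"
    and V': "module K V'" "module K W'" "\<And>c d. \<lbrakk>c \<in> carrier V; d \<in> carrier W\<rbrakk> \<Longrightarrow> u c d \<in> carrier (tensor K V' W')"
    and F: "\<And>b e c d i j. \<lbrakk>b \<in> carrier H; e \<in> carrier H; c \<in> carrier V; d \<in> carrier W; i \<in> carrier V'; j \<in> carrier W'\<rbrakk> \<Longrightarrow> (\<lambda>a. F a b e c d i j) \<in> lin_hom K H P"
      "\<And>a e c d i j. \<lbrakk>a \<in> carrier H; e \<in> carrier H; c \<in> carrier V; d \<in> carrier W; i \<in> carrier V'; j \<in> carrier W'\<rbrakk> \<Longrightarrow> (\<lambda>b. F a b e c d i j) \<in> lin_hom K H P"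
      "\<And>a b c d i j. \<lbrakk>a \<in> carrier H; b \<in> carrier H; c \<in> carrier V; d \<in> carrier W; i \<in> carrier V'; j \<in> carrier W'\<rbrakk> \<Longrightarrow> (\<lambda>e. F a b e c d i j) \<in> lin_hom K H P"
  shows "cop P h (\<lambda>x e. tsw K V W P t (\<lambda>c d. tsw K V' W' P (u c d) (\<lambda>i j. cop P x (\<lambda>a b. F a b e c d i j)))) =
    cop P h (\<lambda>a y. cop P y (\<lambda>b e. tsw K V W P t (\<lambda>c d. tsw K V' W' P (u c d) (\<lambda>i j. F a b e c d i j))))"
proof -
  have Fc: "F a b e c d i j \<in> carrier P" if "a \<in> carrier H" "b \<in> carrier H" "e \<in> carrier H" "c \<in> carrier V" "d \<in> carrier W" "i \<in> carrier V'" "j \<in> carrier W'" for a b c d e i j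
    using lin_hom_closed[OF F(1)] that by blast
  have "cop P h (\<lambda>x e. tsw K V W P t (\<lambda>c d. tsw K V' W' P (u c d) (\<lambda>i j. cop P x (\<lambda>a b. F a b e c d i j)))) =
     cop P h (\<lambda>x e. tsw K V W P t (\<lambda>c d. cop P x (\<lambda>a b. tsw K V' W' P (u c d) (\<lambda>i j. F a b e c d i j))))"
    by (intro tsw_cong refl tsw_swap) (use P V V' Fc in simp_all)
  also have "\<dots> = cop P h (\<lambda>a y. cop P y (\<lambda>b e. tsw K V W P t (\<lambda>c d. tsw K V' W' P (u c d) (\<lambda>i j. F a b e c d i j))))"
    by (rule coassoc_f) (use h P V V' F in simp_all)
  finally show ?thesis .
qed

lemma coassoc2 [simp]:
  assumes h: "h \<in> carrier H" and P: "module K P"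
    and F: "\<And>b c d. \<lbrakk>b \<in> carrier H; c \<in> carrier H; d \<in> carrier H\<rbrakk> \<Longrightarrow> (\<lambda>a. F a b c d) \<in> lin_hom K H P"
      "\<And>a c d. \<lbrakk>a \<in> carrier H; c \<in> carrier H; d \<in> carrier H\<rbrakk> \<Longrightarrow> (\<lambda>b. F a b c d) \<in> lin_hom K H P"
      "\<And>a b d. \<lbrakk>a \<in> carrier H; b \<in> carrier H; d \<in> carrier H\<rbrakk> \<Longrightarrow> (\<lambda>c. F a b c d) \<in> lin_hom K H P"
      "\<And>a b c. \<lbrakk>a \<in> carrier H; b \<in> carrier H; c \<in> carrier H\<rbrakk> \<Longrightarrow> (\<lambda>d. F a b c d) \<in> lin_hom K H P"
  shows "cop P h (\<lambda>x y. cop P y (\<lambda>c d. cop P x (\<lambda>a b. F a b c d))) =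
    cop P h (\<lambda>a z. cop P z (\<lambda>b y. cop P y (\<lambda>c d. F a b c d)))"
proof -
  have Fc: "F a b c d \<in> carrier P" if "a \<in> carrier H" "b \<in> carrier H" "c \<in> carrier H" "d \<in> carrier H" for a b c d
    using lin_hom_closed[OF F(1)] that by blast
  have "cop P h (\<lambda>x y. cop P y (\<lambda>c d. cop P x (\<lambda>a b. F a b c d))) =
     cop P h (\<lambda>x y. cop P x (\<lambda>a b. cop P y (\<lambda>c d. F a b c d)))"
    by (intro tsw_cong refl tsw_swap) (use P Fc in simp_all)
  also have "\<dots> = cop P h (\<lambda>a z. cop P z (\<lambda>b y. cop P y (\<lambda>c d. F a b c d)))"
    by (rule coassoc) (use h P F in simp_all)
  finally show ?thesis .
qed

text \<open>Uniqueness of convolution inverses: both sides invert the multiplication map in the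
  convolution algebra of maps from the tensor square of \<open>H\<close> to \<open>H\<close>.
  \<open>?X\<close> is the threefold convolution of left side, multiplication and right side.
  Contracting the last two factors gives one side, contracting the first two the other.\<close>

lemma S_mult [simp]:
  assumes h: "h \<in> carrier H" and l: "l \<in> carrier H"
  shows "S (h \<bullet> l) = S l \<bullet> S h"
proof -
  let ?X = "cop H h (\<lambda>h1 h'. cop H h' (\<lambda>h2 h3. cop H l (\<lambda>l1 l'. cop H l' (\<lambda>l2 l3.
    S (h1 \<bullet> l1) \<bullet> (h2 \<bullet> (l2 \<bullet> (S l3 \<bullet> S h3)))))))"
  have A1: "cop H l' (\<lambda>l2 l3. S (h1 \<bullet> l1) \<bullet> (h2 \<bullet> (l2 \<bullet> (S l3 \<bullet> S h3)))) = eps l' \<odot>\<^bsub>H\<^esub> (S (h1 \<bullet> l1) \<bullet> (h2 \<bullet> S h3))"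
    if "h1 \<in> carrier H" "h2 \<in> carrier H" "h3 \<in> carrier H" "l1 \<in> carrier H" "l' \<in> carrier H" for h1 h2 h3 l1 l'
    by (subst contract_Sr[where G = "\<lambda>z. S (h1 \<bullet> l1) \<bullet> (h2 \<bullet> (z \<bullet> S h3))"]) (use that in simp_all)
  have A2: "cop H h' (\<lambda>h2 h3. S (h1 \<bullet> l) \<bullet> (h2 \<bullet> S h3)) = eps h' \<odot>\<^bsub>H\<^esub> S (h1 \<bullet> l)"
    if "h1 \<in> carrier H" "h' \<in> carrier H" for h1 h'
    by (subst contract_Sr[where G = "\<lambda>z. S (h1 \<bullet> l) \<bullet> z"]) (use that l in simp_all)
  have "?X = S (h \<bullet> l)" using h l by (simp add: A1 A2)
  moreover have "?X = cop H h (\<lambda>x h3. cop H l (\<lambda>y l3. cop H (x \<bullet> y) (\<lambda>a b. S a \<bullet> (b \<bullet> (S l3 \<bullet> S h3)))))"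
    using h l by simp
  moreover have "\<dots> = S l \<bullet> S h"
  proof -
    have "cop H z (\<lambda>a b. S a \<bullet> (b \<bullet> (S l3 \<bullet> S h3))) = eps z \<odot>\<^bsub>H\<^esub> (S l3 \<bullet> S h3)"
      if "z \<in> carrier H" "l3 \<in> carrier H" "h3 \<in> carrier H" for z h3 l3
      by (subst contract_Sl[where G = "\<lambda>z. z \<bullet> (S l3 \<bullet> S h3)"]) (use that in simp_all)
    then show ?thesis using h l by (simp del: cop_mult)
  qed
  ultimately show ?thesis by simp
qed

lemma S_one [simp]: "S \<one>\<^bsub>H\<^esub> = \<one>\<^bsub>H\<^esub>"
proof -
  have "cop H \<one>\<^bsub>H\<^esub> (\<lambda>a b. S a \<bullet> b) = eps \<one>\<^bsub>H\<^esub> \<odot>\<^bsub>H\<^esub> \<one>\<^bsub>H\<^esub>"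
    by (rule contract_Sl[where G = "\<lambda>z. z"]) simp_all
  then show ?thesis by simp
qed

lemma eps_cop: "h \<in> carrier H \<Longrightarrow> f \<in> lin_hom K H (kmod K) \<Longrightarrow> cop (kmod K) h (\<lambda>a b. f a \<otimes>\<^bsub>K\<^esub> eps b) = f h"
  using counit_r'[of h "kmod K" f] lin_hom_closed[of f K H "kmod K"]
  by (simp add: cring.cring_simprules(14)[OF cringK])

text \<open>A counit on a second leg is inserted; the two scalars combine to the counit of
  \<open>S x\<close> times \<open>y\<close>, where the antipode axiom applies.\<close>

lemma eps_S [simp]: assumes h: "h \<in> carrier H" shows "eps (S h) = eps h"
proof -
  have "eps (S h) = cop (kmod K) h (\<lambda>a b. eps (S a) \<otimes>\<^bsub>K\<^esub> eps b)"
    using eps_cop[of h "\<lambda>a. eps (S a)"] h by simp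
  also have "\<dots> = eps h \<odot>\<^bsub>kmod K\<^esub> eps \<one>\<^bsub>H\<^esub>"
    by (rule contract_Sl[where G = "eps"]) (use h in simp_all)
  finally show ?thesis using h by (simp add: cring.cring_simprules)
qed

text \<open>Again uniqueness of convolution inverses, now for maps from \<open>H\<close> to its
  tensor square: the coproduct of \<open>S h\<close> and the flipped image of the coproduct under
  \<open>S\<close> both invert the comultiplication. \<open>?X\<close> is the threefold convolution,
  contracted from the right by \<open>A1\<close> and \<open>A2\<close> and from the left
  afterwards.\<close>

lemma cop_S [simp]:
  assumes h: "h \<in> carrier H" and P: "module K P"
    and F: "\<And>b. b \<in> carrier H \<Longrightarrow> (\<lambda>a. F a b) \<in> lin_hom K H P" "\<And>a. a \<in> carrier H \<Longrightarrow> (\<lambda>b. F a b) \<in> lin_hom K H P"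
  shows "cop P (S h) (\<lambda>a b. F a b) = cop P h (\<lambda>a b. F (S b) (S a))"
proof -
  note F' = lin_comp[OF F(1)] lin_comp[OF F(2)] lin_hom_closed[OF F(1)]
  let ?X = "cop P h (\<lambda>h1 z. cop P z (\<lambda>h2 z. cop P z (\<lambda>h3 z. cop P z (\<lambda>h4 h5.
      cop P (S h1) (\<lambda>u v. F (u \<bullet> (h2 \<bullet> S h5)) (v \<bullet> (h3 \<bullet> S h4)))))))"
  have A1: "cop P z (\<lambda>h3 z. cop P z (\<lambda>h4 h5. cop P (S h1) (\<lambda>u v. F (u \<bullet> (h2 \<bullet> S h5)) (v \<bullet> (h3 \<bullet> S h4))))) =
     cop P (S h1) (\<lambda>u v. F (u \<bullet> (h2 \<bullet> S z)) v)"
    if "h1 \<in> carrier H" "h2 \<in> carrier H" "z \<in> carrier H" for h1 h2 z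
  proof -
    have "cop P z (\<lambda>h3 z. cop P z (\<lambda>h4 h5. cop P (S h1) (\<lambda>u v. F (u \<bullet> (h2 \<bullet> S h5)) (v \<bullet> (h3 \<bullet> S h4))))) =
       cop P z (\<lambda>x h5. cop P x (\<lambda>h3 h4. cop P (S h1) (\<lambda>u v. F (u \<bullet> (h2 \<bullet> S h5)) (v \<bullet> (h3 \<bullet> S h4)))))"
      by (rule coassoc[symmetric]) (use that P in \<open>simp_all add: F'\<close>)
    also have "\<dots> = cop P z (\<lambda>x h5. eps x \<odot>\<^bsub>P\<^esub> cop P (S h1) (\<lambda>u v. F (u \<bullet> (h2 \<bullet> S h5)) v))"
      by (intro tsw_cong refl, subst contract_Sr[where G = "\<lambda>z. cop P (S h1) (\<lambda>u v. F (u \<bullet> (h2 \<bullet> S w)) (v \<bullet> z))" for w])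
        (use that P in \<open>simp_all add: F'\<close>)
    also have "\<dots> = cop P (S h1) (\<lambda>u v. F (u \<bullet> (h2 \<bullet> S z)) v)"
      by (rule counit_l') (use that P in \<open>simp_all add: F'\<close>)
    finally show ?thesis .
  qed
  have A2: "cop P z (\<lambda>h2 h3. cop P (S h1) (\<lambda>u v. F (u \<bullet> (h2 \<bullet> S h3)) v)) = eps z \<odot>\<^bsub>P\<^esub> cop P (S h1) (\<lambda>u v. F u v)"
    if "h1 \<in> carrier H" "z \<in> carrier H" for h1 z
    by (subst contract_Sr[where G = "\<lambda>z. cop P (S h1) (\<lambda>u v. F (u \<bullet> z) v)"]) (use that P in \<open>simp_all add: F'\<close>)
  have "?X = cop P (S h) F" using h P by (simp add: A1 A2 F' F)
  moreover have "?X = cop P h (\<lambda>x z. cop P z (\<lambda>h4 h5. cop P x (\<lambda>a b. cop P (S a \<bullet> b) (\<lambda>u v. F (u \<bullet> S h5) (v \<bullet> S h4)))))"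
  proof -
    have "cop P h (\<lambda>x z. cop P z (\<lambda>h4 h5. cop P x (\<lambda>a b. cop P (S a \<bullet> b) (\<lambda>u v. F (u \<bullet> S h5) (v \<bullet> S h4))))) =
      cop P h (\<lambda>x z. cop P z (\<lambda>h4 h5. cop P x (\<lambda>a b. cop P b (\<lambda>c d. cop P (S a) (\<lambda>u v. F (u \<bullet> (c \<bullet> S h5)) (v \<bullet> (d \<bullet> S h4)))))))"
      by (rule tsw_cong[OF refl], rule tsw_cong[OF refl], rule tsw_cong[OF refl], rule trans[OF cop_mult trans[OF tsw_swap]]) (use P in \<open>simp_all add: F'\<close>)
    also have "\<dots> = cop P h (\<lambda>a y. cop P y (\<lambda>b z. cop P z (\<lambda>h4 h5. cop P b (\<lambda>c d. cop P (S a) (\<lambda>u v. F (u \<bullet> (c \<bullet> S h5)) (v \<bullet> (d \<bullet> S h4)))))))"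
      by (rule coassoc2) (use h P in \<open>simp_all add: F'\<close>)
    also have "\<dots> = ?X"
      by (rule tsw_cong[OF refl], rule coassoc2) (use h P in \<open>simp_all add: F'\<close>)
    finally show ?thesis by simp
  qed
  moreover have "\<dots> = cop P h (\<lambda>a b. F (S b) (S a))"
  proof -
    have "cop P x (\<lambda>a b. cop P (S a \<bullet> b) (\<lambda>u v. F (u \<bullet> S h5) (v \<bullet> S h4))) = eps x \<odot>\<^bsub>P\<^esub> F (S h5) (S h4)"
      if "x \<in> carrier H" "h4 \<in> carrier H" "h5 \<in> carrier H" for x h4 h5
      by (subst contract_Sl[where G = "\<lambda>z. cop P z (\<lambda>u v. F (u \<bullet> S h5) (v \<bullet> S h4))"])
        (use that P in \<open>simp_all add: F' del: cop_mult\<close>)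
    then have "cop P h (\<lambda>x z. cop P z (\<lambda>h4 h5. cop P x (\<lambda>a b. cop P (S a \<bullet> b) (\<lambda>u v. F (u \<bullet> S h5) (v \<bullet> S h4))))) =
       cop P h (\<lambda>x z. cop P z (\<lambda>h4 h5. eps x \<odot>\<^bsub>P\<^esub> F (S h5) (S h4)))"
      by (intro tsw_cong refl)
    also have "\<dots> = cop P h (\<lambda>x z. eps x \<odot>\<^bsub>P\<^esub> cop P z (\<lambda>h4 h5. F (S h5) (S h4)))"
      using P by (simp add: F')
    also have "\<dots> = cop P h (\<lambda>a b. F (S b) (S a))"
      by (rule counit_l') (use h P in \<open>simp_all add: F'\<close>)
    finally show ?thesis .
  qed
  ultimately show ?thesis by simp
qed

lemma Si_mult [simp]: "h \<in> carrier H \<Longrightarrow> l \<in> carrier H \<Longrightarrow> Si (h \<bullet> l) = Si l \<bullet> Si h"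
  by (rule S_inj) simp_all

lemma Si_one [simp]: "Si \<one>\<^bsub>H\<^esub> = \<one>\<^bsub>H\<^esub>"
  by (rule S_inj) simp_all

lemma eps_Si [simp]: "h \<in> carrier H \<Longrightarrow> eps (Si h) = eps h"
  using eps_S[of "Si h"] by simp

lemma cop_Si [simp]:
  assumes h: "h \<in> carrier H" and P: "module K P"
    and F: "\<And>b. b \<in> carrier H \<Longrightarrow> (\<lambda>a. F a b) \<in> lin_hom K H P" "\<And>a. a \<in> carrier H \<Longrightarrow> (\<lambda>b. F a b) \<in> lin_hom K H P"
  shows "cop P (Si h) (\<lambda>a b. F a b) = cop P h (\<lambda>a b. F (Si b) (Si a))"
proof -
  note [simp] = lin_comp[OF F(1)] lin_comp[OF F(2)]
  show ?thesis using cop_S[of "Si h" P "\<lambda>a b. F (Si b) (Si a)"] h P by simp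
qed

text \<open>The inverse antipode, being antimultiplicative, is applied to the antipode axiom; this
  is why the legs appear in reversed order.\<close>

lemma contract_Sil:
  assumes "h \<in> carrier H" "module K P" "(\<lambda>x. G x) \<in> lin_hom K H P"
    and "\<And>x y. x \<in> carrier H \<Longrightarrow> y \<in> carrier H \<Longrightarrow> F x y = G (Si y \<bullet> x)"
  shows "cop P h F = eps h \<odot>\<^bsub>P\<^esub> G \<one>\<^bsub>H\<^esub>"
  using contract_Sl[of h P "\<lambda>z. G (Si z)" F] assms(1,2,4) by (simp add: lin_comp[OF assms(3)])

lemma contract_Sir:
  assumes "h \<in> carrier H" "module K P" "(\<lambda>x. G x) \<in> lin_hom K H P"
    and "\<And>x y. x \<in> carrier H \<Longrightarrow> y \<in> carrier H \<Longrightarrow> F x y = G (y \<bullet> Si x)"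
  shows "cop P h F = eps h \<odot>\<^bsub>P\<^esub> G \<one>\<^bsub>H\<^esub>"
  using contract_Sr[of h P "\<lambda>z. G (Si z)" F] assms(1,2,4) by (simp add: lin_comp[OF assms(3)])

end

subsection \<open>The smash product\<close>

lemma tsw_swap2:
  assumes "module K V" "module K W" "module K V'" "module K W'" "module K V''" "module K W''" "module K P"
    "t \<in> carrier (tensor K V W)" "u \<in> carrier (tensor K V' W')"
    "\<And>c d. c \<in> carrier V' \<Longrightarrow> d \<in> carrier W' \<Longrightarrow> w c d \<in> carrier (tensor K V'' W'')"
    "\<And>a b c d e f. \<lbrakk>a \<in> carrier V; b \<in> carrier W; c \<in> carrier V'; d \<in> carrier W'; e \<in> carrier V''; f \<in> carrier W''\<rbrakk> \<Longrightarrow> F a b c d e f \<in> carrier P"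
  shows "tsw K V W P t (\<lambda>a b. tsw K V' W' P u (\<lambda>c d. tsw K V'' W'' P (w c d) (\<lambda>e f. F a b c d e f))) =
    tsw K V' W' P u (\<lambda>c d. tsw K V'' W'' P (w c d) (\<lambda>e f. tsw K V W P t (\<lambda>a b. F a b c d e f)))"
  by (rule trans[OF tsw_swap], simp_all add: assms, rule tsw_cong[OF refl], rule tsw_swap) (simp_all add: assms)

lemmas (in hopf_bij) mult_smult_K [simp] = mult_smult_l[where K = K] mult_smult_r[where K = K]

locale hmod_alg = hopf_bij K H for K :: "('k, 'a) ring_scheme" and H :: "('k, 'h) hopf" +
  fixes V :: "('k, 'v, 'b) module_scheme" and act :: "'h \<Rightarrow> 'v \<Rightarrow> 'v"
  assumes hmod_alg: "left_hmodule_algebra K H V act"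
begin

abbreviation vm (infixl "\<star>" 70) where "v \<star> w \<equiv> v \<otimes>\<^bsub>V\<^esub> w"

lemma algV [simp]: "assoc_algebra K V" using hmod_alg by (simp add: left_hmodule_algebra_def)
lemma modV [simp]: "module K V" by (rule assoc_algebra_module) simp
lemma ringV [simp]: "ring V" by (rule assoc_algebra_ring[OF algV])

lemma act_lin0: "h \<in> carrier H \<Longrightarrow> act h \<in> lin_hom K V V"
  and act_lin1: "v \<in> carrier V \<Longrightarrow> (\<lambda>h. act h v) \<in> lin_hom K H V"
  and act_one [simp]: "v \<in> carrier V \<Longrightarrow> act \<one>\<^bsub>H\<^esub> v = v"
  and act_mult [simp]: "h \<in> carrier H \<Longrightarrow> l \<in> carrier H \<Longrightarrow> v \<in> carrier V \<Longrightarrow> act (h \<bullet> l) v = act h (act l v)"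
  using hmod_alg by (auto simp: left_hmodule_algebra_def left_hmodule_def)

declare act_lin0 [simp]

lemma act_closed [simp]: "h \<in> carrier H \<Longrightarrow> v \<in> carrier V \<Longrightarrow> act h v \<in> carrier V"
  by (rule lin_hom_closed[OF act_lin0])

lemma lin_act_l [simp]: "f \<in> lin_hom K U H \<Longrightarrow> v \<in> carrier V \<Longrightarrow> (\<lambda>x. act (f x) v) \<in> lin_hom K U V"
  by (rule lin_comp[OF act_lin1])

lemma lin_act_r [simp]: "h \<in> carrier H \<Longrightarrow> f \<in> lin_hom K U V \<Longrightarrow> (\<lambda>x. act h (f x)) \<in> lin_hom K U V"
  by (rule lin_comp[OF act_lin0])

lemma act_alg [simp]: "h \<in> carrier H \<Longrightarrow> v \<in> carrier V \<Longrightarrow> w \<in> carrier V \<Longrightarrow>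
    act h (v \<star> w) = cop V h (\<lambda>h1 h2. act h1 v \<star> act h2 w)"
  using hmod_alg by (simp add: left_hmodule_algebra_def sw_cop)

lemma act_unit [simp]: "h \<in> carrier H \<Longrightarrow> act h \<one>\<^bsub>V\<^esub> = eps h \<odot>\<^bsub>V\<^esub> \<one>\<^bsub>V\<^esub>"
  using hmod_alg by (simp add: left_hmodule_algebra_def)

abbreviation T where "T \<equiv> tensor K V H"
abbreviation L where "L \<equiv> smash K H V act"
abbreviation lm (infixl "\<diamondop>" 70) where "x \<diamondop> y \<equiv> x \<otimes>\<^bsub>L\<^esub> y"
abbreviation s where "s \<equiv> smash_source K H V"
text \<open>The inclusion of \<open>H\<close>. Every pure tensor factors as a product of values of
  \<open>s\<close> and \<open>j\<close>, so computations in \<open>L\<close> reduce to rewriting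
  with the commutation rule \<open>js\<close>.\<close>

definition j where "j h = pure K V H \<one>\<^bsub>V\<^esub> h"

lemma L_simps: "carrier L = carrier T" "add L = add T" "zero L = zero T" "smult L = smult T"
  "\<one>\<^bsub>L\<^esub> = pure K V H \<one>\<^bsub>V\<^esub> \<one>\<^bsub>H\<^esub>"
  by (simp_all add: smash_def)

lemma lin_hom_L: "lin_hom K U L = lin_hom K U T" "lin_hom K L U = lin_hom K T U"
  by (auto simp: lin_hom_def L_simps)

lemma sw_T: "x \<in> carrier T \<Longrightarrow> module K P \<Longrightarrow> (\<And>v h. v \<in> carrier V \<Longrightarrow> h \<in> carrier H \<Longrightarrow> B v h \<in> carrier P) \<Longrightarrow>
    sw K P x B = tsw K V H P x B"
  by (rule sw_finsum(1)) simp_all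

lemma L_mult: "x \<in> carrier T \<Longrightarrow> y \<in> carrier T \<Longrightarrow>
  x \<diamondop> y = tsw K V H T x (\<lambda>v h. tsw K V H T y
       (\<lambda>w l. cop T h (\<lambda>h1 h2. pure K V H (v \<star> act h1 w) (h2 \<bullet> l))))"
proof -
  assume x: "x \<in> carrier T" and y: "y \<in> carrier T"
  show ?thesis unfolding smash_def using x y by (simp add: sw_cop sw_T)
qed

lemma pure_mult: "v \<in> carrier V \<Longrightarrow> h \<in> carrier H \<Longrightarrow> w \<in> carrier V \<Longrightarrow> l \<in> carrier H \<Longrightarrow>
  pure K V H v h \<diamondop> pure K V H w l = cop T h (\<lambda>h1 h2. pure K V H (v \<star> act h1 w) (h2 \<bullet> l))"
  by (simp add: L_mult)

lemma L_mult_lin_l: "y \<in> carrier T \<Longrightarrow> (\<lambda>x. x \<diamondop> y) \<in> lin_hom K T T"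
  and L_mult_lin_r: "x \<in> carrier T \<Longrightarrow> (\<lambda>y. x \<diamondop> y) \<in> lin_hom K T T"
proof -
  have c: "f \<in> lin_hom K T T \<Longrightarrow> (\<And>x. x \<in> carrier T \<Longrightarrow> g x = f x) \<Longrightarrow> g \<in> lin_hom K T T" for f g
  proof -
    assume a: "f \<in> lin_hom K T T" "\<And>x. x \<in> carrier T \<Longrightarrow> g x = f x"
    interpret T: module K T by simp
    show "g \<in> lin_hom K T T" using a by (intro lin_homI) (simp_all add: lin_hom_closed lin_hom_add lin_hom_smult)
  qed
  show "y \<in> carrier T \<Longrightarrow> (\<lambda>x. x \<diamondop> y) \<in> lin_hom K T T"
    by (rule c[rotated], rule L_mult) simp_all
  show "x \<in> carrier T \<Longrightarrow> (\<lambda>y. x \<diamondop> y) \<in> lin_hom K T T"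
    by (rule c[rotated], rule L_mult) simp_all
qed

text \<open>By linearity in each variable associativity is tested on pure tensors. There the module
  algebra axiom and coassociativity give the same expression, up to the order of the sums over the
  coproducts of \<open>h\<close> and \<open>l\<close>.\<close>

lemma algL [simp]: "assoc_algebra K L"
proof -
  interpret T: module K T by simp
  have [simp]: "x \<diamondop> y \<in> carrier T" if "x \<in> carrier T" "y \<in> carrier T" for x y
    using lin_hom_closed[OF L_mult_lin_l] that by blast
  note [simp] = lin_comp[OF L_mult_lin_l] lin_comp[OF L_mult_lin_r] L_mult_lin_l L_mult_lin_r
  have push: "tsw K H H T t B \<diamondop> x = tsw K H H T t (\<lambda>v w. B v w \<diamondop> x)"
    "x \<diamondop> tsw K H H T t B = tsw K H H T t (\<lambda>v w. x \<diamondop> B v w)"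
    if "x \<in> carrier T" "t \<in> carrier (tensor K H H)" "\<And>v w. v \<in> carrier H \<Longrightarrow> w \<in> carrier H \<Longrightarrow> B v w \<in> carrier T" for x t B
    using that by (simp_all add: tsw_hom[OF _ _ _ _ L_mult_lin_l] tsw_hom[OF _ _ _ _ L_mult_lin_r])
  have assoc: "(x \<diamondop> y) \<diamondop> z = x \<diamondop> (y \<diamondop> z)" if "x \<in> carrier T" "y \<in> carrier T" "z \<in> carrier T" for x y z
  proof (rule tensor_ext[where P = T and f = "\<lambda>x. (x \<diamondop> y) \<diamondop> z" and g = "\<lambda>x. x \<diamondop> (y \<diamondop> z)"])
    fix v h assume vh: "v \<in> carrier V" "h \<in> carrier H"
    show "pure K V H v h \<diamondop> y \<diamondop> z = pure K V H v h \<diamondop> (y \<diamondop> z)"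
    proof (rule tensor_ext[where P = T and f = "\<lambda>y. (pure K V H v h \<diamondop> y) \<diamondop> z" and g = "\<lambda>y. pure K V H v h \<diamondop> (y \<diamondop> z)"])
      fix w l assume wl: "w \<in> carrier V" "l \<in> carrier H"
      show "pure K V H v h \<diamondop> pure K V H w l \<diamondop> z = pure K V H v h \<diamondop> (pure K V H w l \<diamondop> z)"
      proof (rule tensor_ext[where P = T and f = "\<lambda>z. (pure K V H v h \<diamondop> pure K V H w l) \<diamondop> z" and g = "\<lambda>z. pure K V H v h \<diamondop> (pure K V H w l \<diamondop> z)"])
        fix u m assume um: "u \<in> carrier V" "m \<in> carrier H"
        show "pure K V H v h \<diamondop> pure K V H w l \<diamondop> pure K V H u m = pure K V H v h \<diamondop> (pure K V H w l \<diamondop> pure K V H u m)"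
          using vh wl um by (simp add: pure_mult push, subst tsw_swap2) simp_all
      qed (use vh wl that in simp_all)
    qed (use vh that in simp_all)
  qed (use that in simp_all)
  have one_l: "\<one>\<^bsub>L\<^esub> \<diamondop> x = x" if "x \<in> carrier T" for x
    by (rule tensor_ext[where P = T and f = "\<lambda>x. \<one>\<^bsub>L\<^esub> \<diamondop> x" and g = "\<lambda>x. x", OF modV modH])
      (use that in \<open>simp_all add: pure_mult L_simps\<close>)
  have one_r: "x \<diamondop> \<one>\<^bsub>L\<^esub> = x" if "x \<in> carrier T" for x
    by (rule tensor_ext[where P = T and f = "\<lambda>x. x \<diamondop> \<one>\<^bsub>L\<^esub>" and g = "\<lambda>x. x", OF modV modH])
      (use that in \<open>simp_all add: pure_mult L_simps\<close>)
  have inv: "\<exists>y\<in>carrier T. y \<oplus>\<^bsub>T\<^esub> x = \<zero>\<^bsub>T\<^esub>" if "x \<in> carrier T" for x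
    using that by (intro bexI[of _ "\<ominus>\<^bsub>T\<^esub> x"]) (simp_all add: T.M.l_neg)
  have "ring L"
    by (intro ringI abelian_groupI monoidI)
      (use assoc one_l one_r lin_hom_add[OF L_mult_lin_l] lin_hom_add[OF L_mult_lin_r] inv in \<open>simp_all add: L_simps T.M.a_ac\<close>)
  moreover have "module K L"
    by (intro moduleI abelian_groupI cringK)
     (use inv in \<open>simp_all add: L_simps T.M.a_ac T.smult_l_distr T.smult_r_distr\<close>)
  ultimately show ?thesis unfolding assoc_algebra_def assoc_algebra_axioms_def
    by (simp add: L_simps lin_hom_smult[OF L_mult_lin_l] lin_hom_smult[OF L_mult_lin_r])
qed

lemma modL [simp]: "module K L" by (rule assoc_algebra_module) simp
lemma ringL [simp]: "ring L" by (rule assoc_algebra_ring[OF algL])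

text \<open>Sums see only addition, zero and scalar action, which \<open>smash\<close> takes over
  from the tensor product.\<close>

lemma tsw_L: "tsw K U W T t B = tsw K U W L t B"
  by (simp add: tsw_def sw_def finsum_def add_pow_def L_simps finprod_def cong: if_cong)

lemma s_closed [simp]: "v \<in> carrier V \<Longrightarrow> s v \<in> carrier L"
  and j_closed [simp]: "h \<in> carrier H \<Longrightarrow> j h \<in> carrier L"
  by (simp_all add: smash_source_def j_def L_simps)

lemma lin_s [simp]: "f \<in> lin_hom K U V \<Longrightarrow> (\<lambda>x. s (f x)) \<in> lin_hom K U L"
  and lin_j [simp]: "g \<in> lin_hom K U H \<Longrightarrow> (\<lambda>x. j (g x)) \<in> lin_hom K U L"
  by (simp_all add: smash_source_def j_def lin_hom_L)

lemma lin_s0 [simp]: "s \<in> lin_hom K V L" and lin_j0 [simp]: "j \<in> lin_hom K H L"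
  using lin_s[OF lin_id] lin_j[OF lin_id] by simp_all

lemma s_tsw [simp]: "module K U \<Longrightarrow> module K W \<Longrightarrow> t \<in> carrier (tensor K U W) \<Longrightarrow>
    (\<And>v w. v \<in> carrier U \<Longrightarrow> w \<in> carrier W \<Longrightarrow> B v w \<in> carrier V) \<Longrightarrow>
    s (tsw K U W V t B) = tsw K U W L t (\<lambda>v w. s (B v w))"
  by (rule tsw_hom) simp_all

lemma s_smult [simp]: "a \<in> carrier K \<Longrightarrow> v \<in> carrier V \<Longrightarrow> s (a \<odot>\<^bsub>V\<^esub> v) = a \<odot>\<^bsub>L\<^esub> s v"
  by (rule lin_hom_smult[OF lin_s0])

lemma s_one [simp]: "s \<one>\<^bsub>V\<^esub> = \<one>\<^bsub>L\<^esub>" and j_one [simp]: "j \<one>\<^bsub>H\<^esub> = \<one>\<^bsub>L\<^esub>"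
  by (simp_all add: smash_source_def j_def L_simps)

lemma s_mult: "v \<in> carrier V \<Longrightarrow> w \<in> carrier V \<Longrightarrow> s v \<diamondop> s w = s (v \<star> w)"
  by (simp add: smash_source_def pure_mult)

lemma j_mult: "h \<in> carrier H \<Longrightarrow> l \<in> carrier H \<Longrightarrow> j h \<diamondop> j l = j (h \<bullet> l)"
  by (simp add: j_def pure_mult)

lemma sj: "v \<in> carrier V \<Longrightarrow> h \<in> carrier H \<Longrightarrow> s v \<diamondop> j h = pure K V H v h"
  by (simp add: smash_source_def j_def pure_mult)

lemma js: "h \<in> carrier H \<Longrightarrow> v \<in> carrier V \<Longrightarrow> j h \<diamondop> s v = cop L h (\<lambda>h1 h2. s (act h1 v) \<diamondop> j h2)"
  by (simp add: sj tsw_L[symmetric]) (simp add: smash_source_def j_def pure_mult)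

lemma s_mult' [simp]: "v \<in> carrier V \<Longrightarrow> w \<in> carrier V \<Longrightarrow> x \<in> carrier L \<Longrightarrow> s v \<diamondop> (s w \<diamondop> x) = s (v \<star> w) \<diamondop> x"
  using ring_assoc[OF ringL, of "s v" "s w" x] by (simp add: s_mult)

lemma j_mult' [simp]: "h \<in> carrier H \<Longrightarrow> l \<in> carrier H \<Longrightarrow> x \<in> carrier L \<Longrightarrow> j h \<diamondop> (j l \<diamondop> x) = j (h \<bullet> l) \<diamondop> x"
  using ring_assoc[OF ringL, of "j h" "j l" x] by (simp add: j_mult)

lemma js' [simp]: assumes "h \<in> carrier H" "v \<in> carrier V" "x \<in> carrier L"
  shows "j h \<diamondop> (s v \<diamondop> x) = cop L h (\<lambda>h1 h2. s (act h1 v) \<diamondop> (j h2 \<diamondop> x))"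
proof -
  have "j h \<diamondop> (s v \<diamondop> x) = (j h \<diamondop> s v) \<diamondop> x" using assms by (simp del: ring_assoc add: ring_assoc[symmetric])
  also have "\<dots> = cop L h (\<lambda>h1 h2. s (act h1 v) \<diamondop> (j h2 \<diamondop> x))" using assms by (simp add: js)
  finally show ?thesis .
qed

declare s_mult [simp] j_mult [simp] js [simp]

lemma L_ext:
  assumes "module K P" "l \<in> carrier L" "(\<lambda>l. f l) \<in> lin_hom K L P" "(\<lambda>l. g l) \<in> lin_hom K L P"
    "\<And>v h. v \<in> carrier V \<Longrightarrow> h \<in> carrier H \<Longrightarrow> f (s v \<diamondop> j h) = g (s v \<diamondop> j h)"
  shows "f l = g l"
  by (rule tensor_ext[where P = P and f = f and g = g, OF modV modH]) (use assms in \<open>simp_all add: lin_hom_L L_simps sj\<close>)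

end

section \<open>Cancellation in iterated coproducts\<close>

context hopf_bij
begin

text \<open>Cancels the first two of three legs. In the right-nested normal form they do not come
  from one coproduct, so coassociativity is first used backwards; \<open>contr\<close> then leaves a
  counit, which is absorbed. For the last two legs, in \<open>chain_r\<close>, the contraction
  applies directly.\<close>

lemma chain_l:
  assumes h: "h \<in> carrier H" and P: "module K P"
    and contr: "\<And>u Q. u \<in> carrier H \<Longrightarrow> (\<lambda>x. Q x) \<in> lin_hom K H P \<Longrightarrow> cop P u (\<lambda>x y. Q (m x y)) = eps u \<odot>\<^bsub>P\<^esub> Q \<one>\<^bsub>H\<^esub>"
    and m: "\<And>y. y \<in> carrier H \<Longrightarrow> (\<lambda>x. m x y) \<in> lin_hom K H H" "\<And>x. x \<in> carrier H \<Longrightarrow> (\<lambda>y. m x y) \<in> lin_hom K H H"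
    and G: "\<And>z. z \<in> carrier H \<Longrightarrow> (\<lambda>w. G w z) \<in> lin_hom K H P" "\<And>w. w \<in> carrier H \<Longrightarrow> (\<lambda>z. G w z) \<in> lin_hom K H P"
    and F: "\<And>x y z. \<lbrakk>x \<in> carrier H; y \<in> carrier H; z \<in> carrier H\<rbrakk> \<Longrightarrow> F x y z = G (m x y) z"
  shows "cop P h (\<lambda>x u. cop P u (\<lambda>y z. F x y z)) = G \<one>\<^bsub>H\<^esub> h"
proof -
  note [simp] = lin_comp[OF G(1)] lin_comp[OF G(2)] G m lin_hom_closed[OF m(1)] lin_hom_closed[OF G(1)] contr
  have "cop P h (\<lambda>x u. cop P u (\<lambda>y z. F x y z)) = cop P h (\<lambda>x u. cop P u (\<lambda>y z. G (m x y) z))"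
    by (simp add: F)
  also have "\<dots> = cop P h (\<lambda>u z. cop P u (\<lambda>x y. G (m x y) z))"
    by (rule coassoc[symmetric]) (use h P in simp_all)
  also have "\<dots> = cop P h (\<lambda>u z. eps u \<odot>\<^bsub>P\<^esub> G \<one>\<^bsub>H\<^esub> z)"
    by (rule tsw_cong[OF refl]) (use contr[OF _ G(1)] in simp)
  also have "\<dots> = G \<one>\<^bsub>H\<^esub> h" using h P by simp
  finally show ?thesis .
qed

lemma chain_r:
  assumes h: "h \<in> carrier H" and P: "module K P"
    and contr: "\<And>u Q. u \<in> carrier H \<Longrightarrow> (\<lambda>x. Q x) \<in> lin_hom K H P \<Longrightarrow> cop P u (\<lambda>x y. Q (m x y)) = eps u \<odot>\<^bsub>P\<^esub> Q \<one>\<^bsub>H\<^esub>"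
    and G: "\<And>z. z \<in> carrier H \<Longrightarrow> (\<lambda>w. G w z) \<in> lin_hom K H P" "\<And>w. w \<in> carrier H \<Longrightarrow> (\<lambda>z. G w z) \<in> lin_hom K H P"
    and F: "\<And>x y z. \<lbrakk>x \<in> carrier H; y \<in> carrier H; z \<in> carrier H\<rbrakk> \<Longrightarrow> F x y z = G x (m y z)"
  shows "cop P h (\<lambda>x u. cop P u (\<lambda>y z. F x y z)) = G h \<one>\<^bsub>H\<^esub>"
proof -
  have "cop P h (\<lambda>x u. cop P u (\<lambda>y z. F x y z)) = cop P h (\<lambda>x u. cop P u (\<lambda>y z. G x (m y z)))"
    by (simp add: F)
  also have "\<dots> = cop P h (\<lambda>x u. eps u \<odot>\<^bsub>P\<^esub> G x \<one>\<^bsub>H\<^esub>)"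
    by (rule tsw_cong[OF refl]) (use contr[OF _ G(2)] in simp)
  also have "\<dots> = G h \<one>\<^bsub>H\<^esub>" using h P G by simp
  finally show ?thesis .
qed

lemma contract0:
  assumes "module K P" "u \<in> carrier H" "(\<lambda>x. Q x) \<in> lin_hom K H P"
  shows "cop P u (\<lambda>x y. Q (S x \<bullet> y)) = eps u \<odot>\<^bsub>P\<^esub> Q \<one>\<^bsub>H\<^esub>"
    "cop P u (\<lambda>x y. Q (x \<bullet> S y)) = eps u \<odot>\<^bsub>P\<^esub> Q \<one>\<^bsub>H\<^esub>"
    "cop P u (\<lambda>x y. Q (Si y \<bullet> x)) = eps u \<odot>\<^bsub>P\<^esub> Q \<one>\<^bsub>H\<^esub>"
    "cop P u (\<lambda>x y. Q (y \<bullet> Si x)) = eps u \<odot>\<^bsub>P\<^esub> Q \<one>\<^bsub>H\<^esub>"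
  by (rule contract_Sl[OF assms(2,1,3)], simp) (rule contract_Sr[OF assms(2,1,3)], simp, rule contract_Sil[OF assms(2,1,3)], simp, rule contract_Sir[OF assms(2,1,3)], simp)

text \<open>The names record which pair of legs is cancelled (\<open>l\<close> the first two,
  \<open>r\<close> the last two) and the product that cancels: \<open>Sl\<close> for
  \<open>S x \<bullet> y\<close>, \<open>Sr\<close> for \<open>x \<bullet> S y\<close>,
  \<open>Sil\<close> for \<open>Si y \<bullet> x\<close>, \<open>Sir\<close> for
  \<open>y \<bullet> Si x\<close>.\<close>

lemmas chain_l_Sl = chain_l[where m = "\<lambda>x y. S x \<bullet> y", OF _ _ contract0(1)] and chain_l_Sr = chain_l[where m = "\<lambda>x y. x \<bullet> S y", OF _ _ contract0(2)]
  and chain_l_Sil = chain_l[where m = "\<lambda>x y. Si y \<bullet> x", OF _ _ contract0(3)] and chain_l_Sir = chain_l[where m = "\<lambda>x y. y \<bullet> Si x", OF _ _ contract0(4)]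
  and chain_r_Sl = chain_r[where m = "\<lambda>x y. S x \<bullet> y", OF _ _ contract0(1)] and chain_r_Sr = chain_r[where m = "\<lambda>x y. x \<bullet> S y", OF _ _ contract0(2)]
  and chain_r_Sil = chain_r[where m = "\<lambda>x y. Si y \<bullet> x", OF _ _ contract0(3)] and chain_r_Sir = chain_r[where m = "\<lambda>x y. y \<bullet> Si x", OF _ _ contract0(4)]

end

subsection \<open>Braided commutative algebras\<close>

locale yd_alg = hmod_alg K H V act for K :: "('k, 'a) ring_scheme" and H :: "('k, 'h) hopf"
    and V :: "('k, 'v, 'b) module_scheme" and act :: "'h \<Rightarrow> 'v \<Rightarrow> 'v" +
  fixes \<rho> :: "'v \<Rightarrow> ('k, 'v, 'h) tensor"
  assumes yda: "yetter_drinfeld_algebra K H V act \<rho>" and bc: "braided_commutative K V act \<rho>"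
begin

abbreviation rsw where "rsw P v B \<equiv> tsw K V H P (\<rho> v) B"

lemma rhc: "right_hcomodule K H V \<rho>" and rho_lin: "\<rho> \<in> lin_hom K V T"
  using yda by (auto simp: yetter_drinfeld_algebra_def yetter_drinfeld_def right_hcomodule_def)

lemma rho_closed [simp]: "v \<in> carrier V \<Longrightarrow> \<rho> v \<in> carrier T" by (rule lin_hom_closed[OF rho_lin])
lemma lin_rho [simp]: "f \<in> lin_hom K U V \<Longrightarrow> (\<lambda>x. \<rho> (f x)) \<in> lin_hom K U T" by (rule lin_comp[OF rho_lin])
lemma lin_rho0 [simp]: "\<rho> \<in> lin_hom K V T" by (rule rho_lin)

lemma rho_coassoc [simp]:
  assumes v: "v \<in> carrier V" and P: "module K P"
    and F: "\<And>b c. b \<in> carrier H \<Longrightarrow> c \<in> carrier H \<Longrightarrow> (\<lambda>a. F a b c) \<in> lin_hom K V P"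
      "\<And>a c. a \<in> carrier V \<Longrightarrow> c \<in> carrier H \<Longrightarrow> (\<lambda>b. F a b c) \<in> lin_hom K H P"
      "\<And>a b. a \<in> carrier V \<Longrightarrow> b \<in> carrier H \<Longrightarrow> (\<lambda>c. F a b c) \<in> lin_hom K H P"
  shows "rsw P v (\<lambda>x c. rsw P x (\<lambda>a b. F a b c)) = rsw P v (\<lambda>a y. cop P y (\<lambda>b c. F a b c))"
proof -
  let ?TT = "tensor K T H"
  have Fc: "F a b c \<in> carrier P" if "a \<in> carrier V" "b \<in> carrier H" "c \<in> carrier H" for a b c
    using lin_hom_closed[OF F(1)] that by blast
  have *: "rsw ?TT v (\<lambda>x y. pure K T H (\<rho> x) y) = rsw ?TT v
        (\<lambda>x y. cop ?TT y (\<lambda>y1 y2. pure K T H (pure K V H x y1) y2))"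
    using rhc v by (simp add: right_hcomodule_def sw_cop sw_T)
  from arg_cong[OF this, of "\<lambda>t. tsw K T H P t (\<lambda>u c. tsw K V H P u (\<lambda>a b. F a b c))"]
  show ?thesis using v P F Fc by simp
qed

lemma rho_coassoc2 [simp]:
  assumes v: "v \<in> carrier V" and P: "module K P"
    and F: "\<And>b c d. \<lbrakk>b \<in> carrier H; c \<in> carrier H; d \<in> carrier H\<rbrakk> \<Longrightarrow> (\<lambda>a. F a b c d) \<in> lin_hom K V P"
      "\<And>a c d. \<lbrakk>a \<in> carrier V; c \<in> carrier H; d \<in> carrier H\<rbrakk> \<Longrightarrow> (\<lambda>b. F a b c d) \<in> lin_hom K H P"
      "\<And>a b d. \<lbrakk>a \<in> carrier V; b \<in> carrier H; d \<in> carrier H\<rbrakk> \<Longrightarrow> (\<lambda>c. F a b c d) \<in> lin_hom K H P"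
      "\<And>a b c. \<lbrakk>a \<in> carrier V; b \<in> carrier H; c \<in> carrier H\<rbrakk> \<Longrightarrow> (\<lambda>d. F a b c d) \<in> lin_hom K H P"
  shows "rsw P v (\<lambda>x y. cop P y (\<lambda>c d. rsw P x (\<lambda>a b. F a b c d))) =
    rsw P v (\<lambda>a z. cop P z (\<lambda>b y. cop P y (\<lambda>c d. F a b c d)))"
proof -
  have Fc: "F a b c d \<in> carrier P" if "a \<in> carrier V" "b \<in> carrier H" "c \<in> carrier H" "d \<in> carrier H" for a b c d
    using lin_hom_closed[OF F(1)] that by blast
  have "rsw P v (\<lambda>x y. cop P y (\<lambda>c d. rsw P x (\<lambda>a b. F a b c d))) =
     rsw P v (\<lambda>x y. rsw P x (\<lambda>a b. cop P y (\<lambda>c d. F a b c d)))"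
    by (rule tsw_cong[OF refl], rule tsw_swap) (use P Fc in simp_all)
  also have "\<dots> = rsw P v (\<lambda>a z. cop P z (\<lambda>b y. cop P y (\<lambda>c d. F a b c d)))"
    by (rule rho_coassoc) (use v P F in simp_all)
  finally show ?thesis .
qed

lemma rho_counit [simp]:
  assumes "v \<in> carrier V" "module K P" "(\<lambda>a. F a) \<in> lin_hom K V P"
  shows "rsw P v (\<lambda>a b. eps b \<odot>\<^bsub>P\<^esub> F a) = F v"
proof -
  have "F v = F (rsw V v (\<lambda>a b. eps b \<odot>\<^bsub>V\<^esub> a))"
    using rhc assms by (simp add: right_hcomodule_def sw_T)
  also have "\<dots> = rsw P v (\<lambda>a b. F (eps b \<odot>\<^bsub>V\<^esub> a))"
    by (rule tsw_hom) (use assms in simp_all)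
  also have "\<dots> = rsw P v (\<lambda>a b. eps b \<odot>\<^bsub>P\<^esub> F a)"
    by (rule tsw_cong) (simp_all add: lin_hom_smult[OF assms(3)])
  finally show ?thesis by simp
qed

lemma rho_mult [simp]:
  assumes "v \<in> carrier V" "w \<in> carrier V" "module K P"
    "\<And>b. b \<in> carrier H \<Longrightarrow> (\<lambda>a. F a b) \<in> lin_hom K V P"
    "\<And>a. a \<in> carrier V \<Longrightarrow> (\<lambda>b. F a b) \<in> lin_hom K H P"
  shows "rsw P (v \<star> w) (\<lambda>a b. F a b) = rsw P v (\<lambda>v0 v1. rsw P w (\<lambda>w0 w1. F (v0 \<star> w0) (w1 \<bullet> v1)))"
proof -
  have *: "\<rho> (v \<star> w) = rsw T v (\<lambda>v0 v1. rsw T w (\<lambda>w0 w1. pure K V H (v0 \<star> w0) (w1 \<bullet> v1)))"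
    using yda assms by (simp add: yetter_drinfeld_algebra_def right_hop_comodule_algebra_def sw_T)
  show ?thesis unfolding * using assms lin_hom_closed[OF assms(4)] by simp
qed

lemma rho_one [simp]:
  assumes "module K P"
    "\<And>b. b \<in> carrier H \<Longrightarrow> (\<lambda>a. F a b) \<in> lin_hom K V P"
    "\<And>a. a \<in> carrier V \<Longrightarrow> (\<lambda>b. F a b) \<in> lin_hom K H P"
  shows "rsw P \<one>\<^bsub>V\<^esub> (\<lambda>a b. F a b) = F \<one>\<^bsub>V\<^esub> \<one>\<^bsub>H\<^esub>"
  using assms lin_hom_closed[OF assms(2)] yda
  by (simp add: yetter_drinfeld_algebra_def right_hop_comodule_algebra_def)

lemma rho_act [simp]:
  assumes "l \<in> carrier H" "v \<in> carrier V" "module K P"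
    "\<And>b. b \<in> carrier H \<Longrightarrow> (\<lambda>a. F a b) \<in> lin_hom K V P"
    "\<And>a. a \<in> carrier V \<Longrightarrow> (\<lambda>b. F a b) \<in> lin_hom K H P"
  shows "rsw P (act l v) (\<lambda>a b. F a b) = cop P l (\<lambda>l1 l'. cop P l' (\<lambda>l2 l3. rsw P v
     (\<lambda>v0 v1. F (act l2 v0) (l3 \<bullet> (v1 \<bullet> Si l1)))))"
proof -
  have *: "\<rho> (act l v) = cop T l (\<lambda>l1 l'. cop T l' (\<lambda>l2 l3. rsw T v (\<lambda>v0 v1. pure K V H (act l2 v0) (l3 \<bullet> (v1 \<bullet> Si l1)))))"
    using yda assms by (simp add: yetter_drinfeld_algebra_def yetter_drinfeld_def sw_T sw_cop)
  show ?thesis unfolding * using assms lin_hom_closed[OF assms(4)] by simp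
qed

lemma rho_braided: "v \<in> carrier V \<Longrightarrow> w \<in> carrier V \<Longrightarrow> rsw V v (\<lambda>a b. a \<star> act b w) = w \<star> v"
  using bc by (simp add: braided_commutative_def sw_T)

text \<open>The target map. As an element \<open>tt v\<close> is \<open>\<rho> v\<close>; written
  through \<open>s\<close> and \<open>j\<close> it takes part in the rewriting of products.\<close>

definition tt where "tt v = rsw L v (\<lambda>a b. s a \<diamondop> j b)"

lemma tt_rho: "v \<in> carrier V \<Longrightarrow> tt v = \<rho> v"
  using tensor_id[of K V H "\<rho> v"] by (simp add: tt_def sj tsw_L[symmetric])

lemma tt_closed [simp]: "v \<in> carrier V \<Longrightarrow> tt v \<in> carrier L" by (simp add: tt_def)
lemma lin_tt [simp]: "f \<in> lin_hom K U V \<Longrightarrow> (\<lambda>x. tt (f x)) \<in> lin_hom K U L" by (simp add: tt_def)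
lemma lin_tt0 [simp]: "tt \<in> lin_hom K V L" using lin_tt[OF lin_id] by simp
lemma tt_one [simp]: "tt \<one>\<^bsub>V\<^esub> = \<one>\<^bsub>L\<^esub>" by (simp add: tt_def)
lemma tt_smult [simp]: "a \<in> carrier K \<Longrightarrow> v \<in> carrier V \<Longrightarrow> tt (a \<odot>\<^bsub>V\<^esub> v) = a \<odot>\<^bsub>L\<^esub> tt v"
  by (rule lin_hom_smult[OF lin_tt0])
lemma tt_tsw [simp]: "module K U \<Longrightarrow> module K W \<Longrightarrow> t \<in> carrier (tensor K U W) \<Longrightarrow>
    (\<And>v w. v \<in> carrier U \<Longrightarrow> w \<in> carrier W \<Longrightarrow> B v w \<in> carrier V) \<Longrightarrow>
    tt (tsw K U W V t B) = tsw K U W L t (\<lambda>v w. tt (B v w))"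
  by (rule tsw_hom) simp_all

text \<open>Braided commutativity is precisely the commutation of source and target: moving
  \<open>s b\<close> through the \<open>H\<close>-leg makes that leg act on \<open>b\<close>, and
  coassociativity of the coaction exposes the expression that equals \<open>b\<close> times the
  remaining factor.\<close>

lemma tt_s: assumes a: "a \<in> carrier V" and b: "b \<in> carrier V" shows "tt a \<diamondop> s b = s b \<diamondop> tt a"
proof -
  have "tt a \<diamondop> s b = rsw L a (\<lambda>a0 z. cop L z (\<lambda>x y. s (a0 \<star> act x b) \<diamondop> j y))"
    using a b by (simp add: tt_def)
  also have "\<dots> = rsw L a (\<lambda>w y. rsw L w (\<lambda>a0 x. s (a0 \<star> act x b) \<diamondop> j y))"
    using a b by simp
  also have "\<dots> = rsw L a (\<lambda>w y. s (rsw V w (\<lambda>a0 x. a0 \<star> act x b)) \<diamondop> j y)"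
    by (rule tsw_cong[OF refl]) (use b in simp)
  also have "\<dots> = s b \<diamondop> tt a"
    using a b by (simp add: rho_braided tt_def)
  finally show ?thesis .
qed

lemma tt_s' [simp]: "a \<in> carrier V \<Longrightarrow> b \<in> carrier V \<Longrightarrow> x \<in> carrier L \<Longrightarrow> tt a \<diamondop> (s b \<diamondop> x) = s b \<diamondop> (tt a \<diamondop> x)"
  using ring_assoc[OF ringL, of "tt a" "s b" x] ring_assoc[OF ringL, of "s b" "tt a" x] by (simp add: tt_s)

text \<open>In the product of the targets, \<open>tt b\<close> passes the source part of
  \<open>tt a\<close> by \<open>tt_s\<close>. The two \<open>H\<close>-legs are then multiplied in
  opposite order, as an algebra coaction over the opposite algebra of \<open>H\<close>
  demands.\<close>

lemma tt_mult: assumes a: "a \<in> carrier V" and b: "b \<in> carrier V" shows "tt (a \<star> b) = tt b \<diamondop> tt a"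
proof -
  have "tt b \<diamondop> tt a = rsw L a (\<lambda>a0 a1. tt b \<diamondop> (s a0 \<diamondop> j a1))"
    unfolding tt_def[of a] using a b by (simp del: tt_s')
  also have "\<dots> = rsw L a (\<lambda>a0 a1. s a0 \<diamondop> (tt b \<diamondop> j a1))"
    using a b by simp
  also have "\<dots> = tt (a \<star> b)" using a b by (simp add: tt_def)
  finally show ?thesis by simp
qed

text \<open>The Yetter-Drinfeld condition in multiplicative form: acting on the argument of the
  target is conjugation twisted by the inverse antipode.\<close>

lemma tt_act: assumes h: "h \<in> carrier H" and b: "b \<in> carrier V"
  shows "tt (act h b) = cop L h (\<lambda>x y. j y \<diamondop> (tt b \<diamondop> j (Si x)))"
proof -
  have "cop L h (\<lambda>x y. j y \<diamondop> (tt b \<diamondop> j (Si x))) = cop L h (\<lambda>x y. rsw L b (\<lambda>b0 b1. cop L y (\<lambda>y1 y2. s (act y1 b0) \<diamondop> j (y2 \<bullet> (b1 \<bullet> Si x)))))"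
    using h b by (simp add: tt_def)
  also have "\<dots> = cop L h (\<lambda>x y. cop L y (\<lambda>y1 y2. rsw L b (\<lambda>b0 b1. s (act y1 b0) \<diamondop> j (y2 \<bullet> (b1 \<bullet> Si x)))))"
    by (rule tsw_cong[OF refl], rule tsw_swap) (use b in simp_all)
  also have "\<dots> = tt (act h b)" using h b by (simp add: tt_def)
  finally show ?thesis by simp
qed

text \<open>Cancelling the inverse antipode in \<open>tt_act\<close> against a leg on the right
  gives a rule for moving the target past \<open>j\<close>; \<open>Si_tt_act\<close> cancels it on
  the left.\<close>

lemma tt_act_j: assumes h: "h \<in> carrier H" and b: "b \<in> carrier V"
  shows "cop L h (\<lambda>x y. tt (act y b) \<diamondop> j x) = j h \<diamondop> tt b"
proof -
  have "cop L h (\<lambda>x y. tt (act y b) \<diamondop> j x) = cop L h (\<lambda>x u. cop L u (\<lambda>y z. j z \<diamondop> (tt b \<diamondop> j (Si y \<bullet> x))))"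
    using h b by (simp add: tt_act del: js')
  also have "\<dots> = j h \<diamondop> (tt b \<diamondop> j \<one>\<^bsub>H\<^esub>)"
    by (rule chain_l_Sil[where G = "\<lambda>w z. j z \<diamondop> (tt b \<diamondop> j w)"]) (use h b in simp_all)
  finally show ?thesis using h b by simp
qed

lemma Si_tt_act: assumes h: "h \<in> carrier H" and b: "b \<in> carrier V"
  shows "cop L h (\<lambda>x y. j (Si y) \<diamondop> tt (act x b)) = tt b \<diamondop> j (Si h)"
proof -
  have "cop L h (\<lambda>x y. j (Si y) \<diamondop> tt (act x b)) = cop L h (\<lambda>x u. cop L u (\<lambda>y z. j (Si z \<bullet> y) \<diamondop> (tt b \<diamondop> j (Si x))))"
    using h b by (simp add: tt_act)
  also have "\<dots> = j \<one>\<^bsub>H\<^esub> \<diamondop> (tt b \<diamondop> j (Si h))"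
    by (rule chain_r_Sil[where G = "\<lambda>x w. j w \<diamondop> (tt b \<diamondop> j (Si x))"]) (use h b in simp_all)
  finally show ?thesis using h b by simp
qed

subsubsection \<open>The antipode of the smash product and its inverse\<close>

text \<open>The inverse of the antipode. It exchanges source for target and inverts the antipode on
  \<open>H\<close>, so on a product \<open>s a\<close>, \<open>j h\<close> its value is forced by
  antimultiplicativity.\<close>

definition taui where "taui l = tsw K V H L l (\<lambda>a h. j (Si h) \<diamondop> tt a)"

lemma taui_lin: "taui \<in> lin_hom K L L"
  unfolding taui_def lin_hom_L(2) by simp

lemma taui_closed [simp]: "l \<in> carrier L \<Longrightarrow> taui l \<in> carrier L" by (rule lin_hom_closed[OF taui_lin])
lemma lin_taui [simp]: "f \<in> lin_hom K U L \<Longrightarrow> (\<lambda>x. taui (f x)) \<in> lin_hom K U L" by (rule lin_comp[OF taui_lin])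
lemma taui_sj [simp]: "a \<in> carrier V \<Longrightarrow> h \<in> carrier H \<Longrightarrow> taui (s a \<diamondop> j h) = j (Si h) \<diamondop> tt a"
  unfolding taui_def by (simp add: sj)
lemma taui_tsw [simp]: "module K U \<Longrightarrow> module K W \<Longrightarrow> t \<in> carrier (tensor K U W) \<Longrightarrow>
    (\<And>v w. v \<in> carrier U \<Longrightarrow> w \<in> carrier W \<Longrightarrow> B v w \<in> carrier L) \<Longrightarrow>
    taui (tsw K U W L t B) = tsw K U W L t (\<lambda>v w. taui (B v w))"
  by (rule tsw_hom[OF _ _ _ _ taui_lin]) simp_all
lemma taui_s [simp]: "a \<in> carrier V \<Longrightarrow> taui (s a) = tt a" using taui_sj[of a "\<one>\<^bsub>H\<^esub>"] by simp
lemma taui_j [simp]: "h \<in> carrier H \<Longrightarrow> taui (j h) = j (Si h)" using taui_sj[of "\<one>\<^bsub>V\<^esub>" h] by simp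

text \<open>On generators the product creates the target of \<open>act x b\<close> next to
  \<open>j (Si y)\<close>, and \<open>Si_tt_act\<close> turns this sum into the separated product
  \<open>tt b\<close>, \<open>j (Si h)\<close>.\<close>

lemma taui_mult: assumes x: "x \<in> carrier L" and y: "y \<in> carrier L" shows "taui (x \<diamondop> y) = taui y \<diamondop> taui x"
proof (rule L_ext[OF modL x])
  fix a h assume a: "a \<in> carrier V" and h: "h \<in> carrier H"
  show "taui (s a \<diamondop> j h \<diamondop> y) = taui y \<diamondop> taui (s a \<diamondop> j h)"
  proof (rule L_ext[OF modL y])
    fix b k assume b: "b \<in> carrier V" and k: "k \<in> carrier H"
    have "taui (s a \<diamondop> j h \<diamondop> (s b \<diamondop> j k)) = j (Si k) \<diamondop> (cop L h (\<lambda>x y. j (Si y) \<diamondop> tt (act x b)) \<diamondop> tt a)"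
      using a b h k by (simp add: tt_mult)
    also have "\<dots> = taui (s b \<diamondop> j k) \<diamondop> taui (s a \<diamondop> j h)"
      using a b h k by (simp add: Si_tt_act)
    finally show "taui (s a \<diamondop> j h \<diamondop> (s b \<diamondop> j k)) = taui (s b \<diamondop> j k) \<diamondop> taui (s a \<diamondop> j h)" .
  qed (use a h in simp_all)
qed (use y in simp_all)

text \<open>The value of the antipode at \<open>s a\<close>. Applying \<open>taui\<close> must
  return \<open>s a\<close>: it turns the double antipode into a single one and \<open>s a0\<close>
  into a target, whose \<open>H\<close>-leg then cancels against it.\<close>

definition sg where "sg a = rsw L a (\<lambda>a0 a1. j (S (S a1)) \<diamondop> s a0)"

lemma sg_closed [simp]: "v \<in> carrier V \<Longrightarrow> sg v \<in> carrier L" by (simp add: sg_def)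
lemma lin_sg [simp]: "f \<in> lin_hom K U V \<Longrightarrow> (\<lambda>x. sg (f x)) \<in> lin_hom K U L" by (simp add: sg_def del: js)
lemma lin_sg0 [simp]: "sg \<in> lin_hom K V L" using lin_sg[OF lin_id] by simp
lemma sg_one [simp]: "sg \<one>\<^bsub>V\<^esub> = \<one>\<^bsub>L\<^esub>" by (simp add: sg_def del: js)

text \<open>The left side is the antipode applied to the target of \<open>a\<close>, written out on
  generators; the two adjacent \<open>H\<close>-legs cancel under the antipode axiom.\<close>

lemma sg_S: assumes a: "a \<in> carrier V" shows "rsw L a (\<lambda>a0 a1. j (S a1) \<diamondop> sg a0) = s a"
proof -
  have "rsw L a (\<lambda>a0 a1. j (S a1) \<diamondop> sg a0) = rsw L a (\<lambda>a0 y. cop L y (\<lambda>b c. j (S (S b \<bullet> c)) \<diamondop> s a0))"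
    using a by (simp add: sg_def del: js)
  also have "\<dots> = rsw L a (\<lambda>a0 y. eps y \<odot>\<^bsub>L\<^esub> (j (S \<one>\<^bsub>H\<^esub>) \<diamondop> s a0))"
    by (rule tsw_cong[OF refl], rule contract0(1)[where Q = "\<lambda>w. j (S w) \<diamondop> s a0" for a0]) simp_all
  finally show ?thesis using a by simp
qed

text \<open>The counterpart of \<open>tt_act\<close>. The Yetter-Drinfeld condition places
  \<open>S k1\<close> on the left of the source factor; moving it to the right makes one of its legs
  act there, where it cancels against \<open>k2\<close>.\<close>

lemma sg_act: assumes k: "k \<in> carrier H" and a: "a \<in> carrier V"
  shows "sg (act k a) = cop L k (\<lambda>x y. j (S (S y)) \<diamondop> (sg a \<diamondop> j (S x)))"
proof -
  have "sg (act k a) = cop L k (\<lambda>k1 k'. cop L k' (\<lambda>k2 k3. rsw L a (\<lambda>a0 a1. j (S (S k3) \<bullet> S (S a1)) \<diamondop> (j (S k1) \<diamondop> s (act k2 a0)))))"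
    using a k by (simp add: sg_def del: js)
  also have "\<dots> = cop L k (\<lambda>k1 k'. cop L k' (\<lambda>k2 k3. rsw L a (\<lambda>a0 a1. j (S (S k3) \<bullet> S (S a1)) \<diamondop> cop L k1 (\<lambda>u v. s (act (S v \<bullet> k2) a0) \<diamondop> j (S u)))))"
    using a k by (simp add: js[of "S k1" for k1] del: js js')
  also have "\<dots> = cop L k (\<lambda>k1 k'. cop L k' (\<lambda>k2 k3. cop L k1 (\<lambda>u v. rsw L a (\<lambda>a0 a1. j (S (S k3) \<bullet> S (S a1)) \<diamondop> (s (act (S v \<bullet> k2) a0) \<diamondop> j (S u))))))"
    by (rule tsw_cong[OF refl], rule tsw_cong[OF refl], rule trans[OF _ tsw_swap]) (use a k in \<open>simp_all del: js' act_mult\<close>)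
  also have "\<dots> = cop L k (\<lambda>u w. cop L w (\<lambda>v k'. cop L k' (\<lambda>k2 k3. rsw L a (\<lambda>a0 a1. j (S (S k3) \<bullet> S (S a1)) \<diamondop> (s (act (S v \<bullet> k2) a0) \<diamondop> j (S u))))))"
    by (rule coassoc2) (use a k in \<open>simp_all del: js' act_mult\<close>)
  also have "\<dots> = cop L k (\<lambda>u w. rsw L a (\<lambda>a0 a1. j (S (S w) \<bullet> S (S a1)) \<diamondop> (s (act \<one>\<^bsub>H\<^esub> a0) \<diamondop> j (S u))))"
    by (rule tsw_cong[OF refl], rule chain_l_Sl[where G = "\<lambda>z w. rsw L a (\<lambda>a0 a1. j (S (S w) \<bullet> S (S a1)) \<diamondop> (s (act z a0) \<diamondop> j (S u)))" for u])
      (use a k in \<open>simp_all del: js' act_mult\<close>)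
  also have "\<dots> = cop L k (\<lambda>x y. j (S (S y)) \<diamondop> (sg a \<diamondop> j (S x)))"
    using a k by (simp add: sg_def del: js js')
  finally show ?thesis .
qed

text \<open>Places \<open>sg a\<close> in the image of the target map, which is what allows the
  counit of an antipode value to be computed in \<open>ee_tau\<close>.\<close>

lemma tt_sg: assumes a: "a \<in> carrier V" shows "tt (rsw V a (\<lambda>a0 a1. act (S (S a1)) a0)) = sg a"
proof -
  have "tt (rsw V a (\<lambda>a0 a1. act (S (S a1)) a0)) =
     rsw L a (\<lambda>a0 z. cop L z (\<lambda>w y. cop L y (\<lambda>p q. j (S (S q)) \<diamondop> (s a0 \<diamondop> j (w \<bullet> S p)))))"
    using a by (simp add: tt_act del: js js') (simp add: tt_def del: js js')
  also have "\<dots> = rsw L a (\<lambda>a0 z. j (S (S z)) \<diamondop> (s a0 \<diamondop> j \<one>\<^bsub>H\<^esub>))"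
    by (rule tsw_cong[OF refl], rule chain_l_Sr[where G = "\<lambda>w z. j (S (S z)) \<diamondop> (s a0 \<diamondop> j w)" for a0])
      (use a in \<open>simp_all del: js js'\<close>)
  finally show ?thesis using a by (simp add: sg_def del: js js')
qed

definition tau where "tau l = tsw K V H L l (\<lambda>a h. j (S h) \<diamondop> sg a)"

lemma tau_lin: "tau \<in> lin_hom K L L"
  unfolding tau_def lin_hom_L(2) by simp
lemma tau_closed [simp]: "l \<in> carrier L \<Longrightarrow> tau l \<in> carrier L" by (rule lin_hom_closed[OF tau_lin])
lemma lin_tau [simp]: "f \<in> lin_hom K U L \<Longrightarrow> (\<lambda>x. tau (f x)) \<in> lin_hom K U L" by (rule lin_comp[OF tau_lin])
lemma tau_sj [simp]: "a \<in> carrier V \<Longrightarrow> h \<in> carrier H \<Longrightarrow> tau (s a \<diamondop> j h) = j (S h) \<diamondop> sg a"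
  unfolding tau_def by (simp add: sj)
lemma tau_j [simp]: "h \<in> carrier H \<Longrightarrow> tau (j h) = j (S h)" using tau_sj[of "\<one>\<^bsub>V\<^esub>" h] by simp
lemma tau_tsw [simp]: "module K U \<Longrightarrow> module K W \<Longrightarrow> t \<in> carrier (tensor K U W) \<Longrightarrow>
    (\<And>v w. v \<in> carrier U \<Longrightarrow> w \<in> carrier W \<Longrightarrow> B v w \<in> carrier L) \<Longrightarrow>
    tau (tsw K U W L t B) = tsw K U W L t (\<lambda>v w. tau (B v w))"
  by (rule tsw_hom[OF _ _ _ _ tau_lin]) simp_all

lemma taui_tau: assumes l: "l \<in> carrier L" shows "taui (tau l) = l"
proof (rule L_ext[OF modL l])
  fix a h assume a: "a \<in> carrier V" and h: "h \<in> carrier H"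
  have "taui (sg a) = rsw L a (\<lambda>a0 y. cop L y (\<lambda>b c. s a0 \<diamondop> j (b \<bullet> S c)))"
    using a by (simp add: sg_def taui_mult del: js) (simp add: tt_def)
  also have "\<dots> = rsw L a (\<lambda>a0 y. eps y \<odot>\<^bsub>L\<^esub> (s a0 \<diamondop> j \<one>\<^bsub>H\<^esub>))"
    by (rule tsw_cong[OF refl], rule contract0(2)[where Q = "\<lambda>w. s a0 \<diamondop> j w" for a0]) simp_all
  finally have "taui (sg a) = s a" using a by simp
  then show "taui (tau (s a \<diamondop> j h)) = s a \<diamondop> j h" using a h by (simp add: taui_mult)
qed simp_all

lemma tau_taui: assumes l: "l \<in> carrier L" shows "tau (taui l) = l"
proof (rule L_ext[OF modL l])
  fix a h assume a: "a \<in> carrier V" and h: "h \<in> carrier H"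
  \<comment> \<open>The cancellation rule for \<open>sg\<close> that corresponds to
    \<open>Si_tt_act\<close>: the leg produced by \<open>sg_act\<close> meets \<open>S z\<close> and
    disappears.\<close>
  have 1: "cop L k (\<lambda>u z. j (S b \<bullet> S z) \<diamondop> sg (act u c)) = j (S b) \<diamondop> (sg c \<diamondop> j (S k))"
    if k: "k \<in> carrier H" and b: "b \<in> carrier H" and c: "c \<in> carrier V" for k b c
  proof -
    have "cop L k (\<lambda>u z. j (S b \<bullet> S z) \<diamondop> sg (act u c)) =
        cop L k (\<lambda>x u. cop L u (\<lambda>y z. j (S b) \<diamondop> (j (S (S y \<bullet> z)) \<diamondop> (sg c \<diamondop> j (S x)))))"
      using that by (simp add: sg_act)
    also have "\<dots> = j (S b) \<diamondop> (j (S \<one>\<^bsub>H\<^esub>) \<diamondop> (sg c \<diamondop> j (S k)))"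
      by (rule chain_r_Sl[where G = "\<lambda>x w. j (S b) \<diamondop> (j (S w) \<diamondop> (sg c \<diamondop> j (S x)))"]) (use that in simp_all)
    finally show ?thesis using that by simp
  qed
  have "tau (taui (s a \<diamondop> j h)) = rsw L a (\<lambda>a0 a1. cop L (Si h) (\<lambda>u z. j (S a1 \<bullet> S z) \<diamondop> sg (act u a0)))"
    using a h by (simp add: tt_def)
  also have "\<dots> = rsw L a (\<lambda>a0 a1. j (S a1) \<diamondop> (sg a0 \<diamondop> j h))"
    by (rule tsw_cong[OF refl]) (use h in \<open>simp add: 1 del: cop_Si\<close>)
  also have "\<dots> = rsw L a (\<lambda>a0 a1. j (S a1) \<diamondop> sg a0) \<diamondop> j h" using a h by simp
  finally show "tau (taui (s a \<diamondop> j h)) = s a \<diamondop> j h" using a h by (simp add: sg_S)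
qed simp_all

text \<open>Carried over from \<open>taui_mult\<close> along the bijection, which avoids a direct
  computation with double antipodes.\<close>

lemma tau_mult: assumes x: "x \<in> carrier L" and y: "y \<in> carrier L" shows "tau (x \<diamondop> y) = tau y \<diamondop> tau x"
proof -
  have "tau (x \<diamondop> y) = tau (taui (tau x) \<diamondop> taui (tau y))" using x y by (simp add: taui_tau)
  also have "\<dots> = tau (taui (tau y \<diamondop> tau x))" using x y by (simp add: taui_mult)
  finally show ?thesis using x y by (simp add: tau_taui)
qed

lemma tau_tt: "a \<in> carrier V \<Longrightarrow> tau (tt a) = s a"
  using tau_taui[of "s a"] by simp

end

subsection \<open>Balanced tensor products\<close>

lemma bal_quotient:
  assumes "module K M" "module K N"
    and "\<And>m a. m \<in> carrier M \<Longrightarrow> a \<in> carrier A \<Longrightarrow> ra m a \<in> carrier M"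
    and "\<And>n a. n \<in> carrier N \<Longrightarrow> a \<in> carrier A \<Longrightarrow> la a n \<in> carrier N"
  shows "quotient_module K (tensor K M N) (bal_null K A M ra N la)"
proof -
  interpret Tm: module K "tensor K M N" using assms by simp
  show ?thesis unfolding bal_null_def
    by (intro quotient_moduleI lin_span_submodule Tm.module_axioms) (use assms in \<open>auto intro!: Tm.M.minus_closed\<close>)
qed

text \<open>The argument of \<open>tsw_coset\<close> once more: the form induced by \<open>B\<close>
  kills the balancing relations, so any representative in the coset gives the same value.\<close>

lemma bal_sw_eval:
  assumes M: "module K M" and N: "module K N" and P: "module K P"
    and ra: "\<And>m a. m \<in> carrier M \<Longrightarrow> a \<in> carrier A \<Longrightarrow> ra m a \<in> carrier M"
    and la: "\<And>n a. n \<in> carrier N \<Longrightarrow> a \<in> carrier A \<Longrightarrow> la a n \<in> carrier N"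
    and z: "z \<in> carrier (tensor K M N)"
    and B: "\<And>n. n \<in> carrier N \<Longrightarrow> (\<lambda>m. B m n) \<in> lin_hom K M P" "\<And>m. m \<in> carrier M \<Longrightarrow> (\<lambda>n. B m n) \<in> lin_hom K N P"
    and bal: "\<And>m a n. m \<in> carrier M \<Longrightarrow> a \<in> carrier A \<Longrightarrow> n \<in> carrier N \<Longrightarrow> B (ra m a) n = B m (la a n)"
  shows "bal_sw K P (bal_proj K A M ra N la z) B = tsw K M N P z B"
proof -
  interpret Q: quotient_module K "tensor K M N" "bal_null K A M ra N la" by (rule bal_quotient[OF M N ra la])
  interpret P: module K P by (rule P)
  let ?f = "\<lambda>z. tsw K M N P z B"
  have f: "?f \<in> lin_hom K (tensor K M N) P" by (rule tsw_lin[OF M N P B])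
  note Bc = lin_hom_closed[OF B(1)]
  have "{pure K M N (ra m a) n \<ominus>\<^bsub>tensor K M N\<^esub> pure K M N m (la a n) | m a n.
        m \<in> carrier M \<and> a \<in> carrier A \<and> n \<in> carrier N} \<subseteq> {z \<in> carrier (tensor K M N). ?f z = \<zero>\<^bsub>P\<^esub>}"
    using M N P ra la by (auto intro!: Q.M.minus_closed simp: lin_hom_minus[OF Q.module_axioms P f] B bal Bc P.M.minus_zero_iff)
  then have null: "?f n = \<zero>\<^bsub>P\<^esub>" if "n \<in> bal_null K A M ra N la" for n
    using that lin_span_least[OF kernel_submodule[OF Q.module_axioms P f lin_hom_zero_map[OF Q.module_axioms P]]]
    unfolding bal_null_def by blast
  have "z \<in> Q.q z" using z by (simp add: Q.a_rcos_self)
  then have "(SOME x. x \<in> Q.q z) \<in> Q.q z" by (rule someI[where P = "\<lambda>x. x \<in> Q.q z"])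
  then have y: "(SOME x. x \<in> Q.q z) \<in> carrier (tensor K M N)" "Q.q (SOME x. x \<in> Q.q z) = Q.q z"
    using Q.in_q[OF z] by auto
  then have "?f (SOME x. x \<in> Q.q z) \<ominus>\<^bsub>P\<^esub> ?f z = \<zero>\<^bsub>P\<^esub>"
    using Q.q_eq[OF y(1) z] null z by (simp add: lin_hom_minus[OF Q.module_axioms P f, symmetric])
  then have "?f (SOME x. x \<in> Q.q z) = ?f z" using z y lin_hom_closed[OF f] by (simp add: P.M.minus_zero_iff)
  then show ?thesis unfolding bal_sw_def bal_proj_def
    using y(1) by (subst sw_finsum(1)[OF M N P]) (simp_all add: Bc)
qed

section \<open>The bialgebroid structure of the smash product\<close>

context yd_alg
begin

interpretation bialgebroid_data K V L s \<rho> .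

lemma rho_mult_tt [simp]: "a \<in> carrier V \<Longrightarrow> \<rho> a \<diamondop> x = tt a \<diamondop> x" "a \<in> carrier V \<Longrightarrow> x \<diamondop> \<rho> a = x \<diamondop> tt a"
  by (simp_all add: tt_rho)

abbreviation TL where "TL \<equiv> tensor K L L"

lemma q2: "quotient_module K TL (bal_null K V L (\<lambda>x a. \<rho> a \<diamondop> x) L (\<lambda>a x. s a \<diamondop> x))"
  by (rule bal_quotient) simp_all

lemma modL2 [simp]: "module K L2"
  unfolding L2_def bal_tensor_def by (rule quotient_module.quot_module[OF q2])

lemma proj2_lin [simp]: "proj2 \<in> lin_hom K TL L2"
  unfolding L2_def bal_tensor_def proj2_def bal_proj_def by (rule quotient_module.q_lin[OF q2])

lemma proj2_closed [simp]: "z \<in> carrier TL \<Longrightarrow> proj2 z \<in> carrier L2" by (rule lin_hom_closed[OF proj2_lin])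

lemma L2_cases: assumes "X \<in> carrier L2" obtains z where "z \<in> carrier TL" "X = proj2 z"
  using assms unfolding L2_def bal_tensor_def quotient_module.quot_carrier[OF q2] proj2_def bal_proj_def by auto

lemma L2_some: assumes "X \<in> carrier L2"
  shows "(SOME z. z \<in> X) \<in> carrier TL" "proj2 (SOME z. z \<in> X) = X"
proof -
  interpret Q: quotient_module K TL "bal_null K V L (\<lambda>x a. \<rho> a \<diamondop> x) L (\<lambda>a x. s a \<diamondop> x)" by (rule q2)
  obtain z where z: "z \<in> carrier TL" "X = proj2 z" using L2_cases[OF assms] .
  have p: "proj2 = Q.q" by (rule ext) (simp add: proj2_def bal_proj_def)
  have "z \<in> X" using z by (simp add: p Q.a_rcos_self)
  then have "(SOME x. x \<in> X) \<in> X" by (rule someI[where P = "\<lambda>x. x \<in> X"])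
  then show "(SOME z. z \<in> X) \<in> carrier TL" "proj2 (SOME z. z \<in> X) = X"
    using Q.in_q[OF z(1)] z by (auto simp: p)
qed

lemma pure2_closed [simp]: "x \<in> carrier L \<Longrightarrow> y \<in> carrier L \<Longrightarrow> pure2 x y \<in> carrier L2"
  by (simp add: pure2_def)
lemma lin_pure2_l [simp]: "f \<in> lin_hom K U L \<Longrightarrow> y \<in> carrier L \<Longrightarrow> (\<lambda>x. pure2 (f x) y) \<in> lin_hom K U L2"
  and lin_pure2_r [simp]: "f \<in> lin_hom K U L \<Longrightarrow> y \<in> carrier L \<Longrightarrow> (\<lambda>x. pure2 y (f x)) \<in> lin_hom K U L2"
  unfolding pure2_def by (rule lin_comp[OF proj2_lin], simp)+
lemma pure2_tsw [simp]:
  "module K U \<Longrightarrow> module K W \<Longrightarrow> t \<in> carrier (tensor K U W) \<Longrightarrow>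
    (\<And>v w. v \<in> carrier U \<Longrightarrow> w \<in> carrier W \<Longrightarrow> B v w \<in> carrier L) \<Longrightarrow> y \<in> carrier L \<Longrightarrow>
    pure2 (tsw K U W L t B) y = tsw K U W L2 t (\<lambda>v w. pure2 (B v w) y)"
  "module K U \<Longrightarrow> module K W \<Longrightarrow> t \<in> carrier (tensor K U W) \<Longrightarrow>
    (\<And>v w. v \<in> carrier U \<Longrightarrow> w \<in> carrier W \<Longrightarrow> B v w \<in> carrier L) \<Longrightarrow> y \<in> carrier L \<Longrightarrow>
    pure2 y (tsw K U W L t B) = tsw K U W L2 t (\<lambda>v w. pure2 y (B v w))"
  by (rule tsw_hom[where f = "\<lambda>x. pure2 x y"], simp_all) (rule tsw_hom[where f = "\<lambda>x. pure2 y x"], simp_all)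
lemma proj2_tsw [simp]:
  "module K U \<Longrightarrow> module K W \<Longrightarrow> t \<in> carrier (tensor K U W) \<Longrightarrow>
    (\<And>v w. v \<in> carrier U \<Longrightarrow> w \<in> carrier W \<Longrightarrow> B v w \<in> carrier TL) \<Longrightarrow>
    proj2 (tsw K U W TL t B) = tsw K U W L2 t (\<lambda>v w. proj2 (B v w))"
  by (rule tsw_hom) simp_all
lemma proj2_pure [simp]: "proj2 (pure K L L x y) = pure2 x y" by (simp add: pure2_def)

text \<open>The bilinear forms that factor through \<open>L2\<close>, hence those whose
  \<open>bal_sw\<close> is independent of the representative.\<close>

definition balanced where "balanced P B \<longleftrightarrow> module K P \<and> (\<forall>y\<in>carrier L. (\<lambda>x. B x y) \<in> lin_hom K L P) \<and>
  (\<forall>x\<in>carrier L. (\<lambda>y. B x y) \<in> lin_hom K L P) \<and>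
  (\<forall>a\<in>carrier V. \<forall>x\<in>carrier L. \<forall>y\<in>carrier L. B (tt a \<diamondop> x) y = B x (s a \<diamondop> y))"

lemma balancedI:
  assumes "module K P" "\<And>y. y \<in> carrier L \<Longrightarrow> (\<lambda>x. B x y) \<in> lin_hom K L P"
    "\<And>x. x \<in> carrier L \<Longrightarrow> (\<lambda>y. B x y) \<in> lin_hom K L P"
    "\<And>a x y. a \<in> carrier V \<Longrightarrow> x \<in> carrier L \<Longrightarrow> y \<in> carrier L \<Longrightarrow> B (tt a \<diamondop> x) y = B x (s a \<diamondop> y)"
  shows "balanced P (\<lambda>x y. B x y)"
  using assms by (simp add: balanced_def)

lemma bsw_proj2:
  assumes "balanced P B" "z \<in> carrier TL"
  shows "bal_sw K P (proj2 z) B = tsw K L L P z B"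
  unfolding proj2_def by (rule bal_sw_eval) (use assms in \<open>simp_all add: balanced_def\<close>)

lemma bsw_tsw:
  assumes "X \<in> carrier L2" "module K P" "\<And>x y. x \<in> carrier L \<Longrightarrow> y \<in> carrier L \<Longrightarrow> B x y \<in> carrier P"
  shows "bal_sw K P X B = tsw K L L P (SOME z. z \<in> X) B"
  unfolding bal_sw_def by (rule sw_finsum(1)) (use assms L2_some in simp_all)

text \<open>Both sides are evaluated on one and the same chosen representative, so agreement on the
  carriers is enough; this also covers forms that are not balanced.\<close>

lemma bsw_cong:
  assumes "X \<in> carrier L2" "module K P" "\<And>x y. x \<in> carrier L \<Longrightarrow> y \<in> carrier L \<Longrightarrow> B' x y \<in> carrier P"
    "\<And>x y. x \<in> carrier L \<Longrightarrow> y \<in> carrier L \<Longrightarrow> B x y = B' x y"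
  shows "bal_sw K P X B = bal_sw K P X B'"
proof -
  have "bal_sw K P X B = tsw K L L P (SOME z. z \<in> X) B" by (rule bsw_tsw) (use assms in simp_all)
  also have "\<dots> = tsw K L L P (SOME z. z \<in> X) B'" by (rule tsw_cong) (simp_all add: assms)
  also have "\<dots> = bal_sw K P X B'" by (rule bsw_tsw[symmetric]) (use assms in simp_all)
  finally show ?thesis .
qed

lemma balancedD:
  assumes "balanced P B"
  shows "module K P" "y \<in> carrier L \<Longrightarrow> (\<lambda>x. B x y) \<in> lin_hom K L P"
    "x \<in> carrier L \<Longrightarrow> (\<lambda>y. B x y) \<in> lin_hom K L P" "x \<in> carrier L \<Longrightarrow> y \<in> carrier L \<Longrightarrow> B x y \<in> carrier P"
  using assms lin_hom_closed[of "B x" K L P y] by (auto simp: balanced_def)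

lemma bsw_lin: assumes "balanced P B" shows "(\<lambda>X. bal_sw K P X B) \<in> lin_hom K L2 P"
proof (rule lin_homI)
  interpret Tm: module K TL by simp
  have f: "(\<lambda>z. tsw K L L P z B) \<in> lin_hom K TL P" using balancedD[OF assms] by simp
  fix X assume X: "X \<in> carrier L2"
  obtain z where z: "z \<in> carrier TL" "X = proj2 z" using L2_cases[OF X] .
  show "bal_sw K P X B \<in> carrier P" using lin_hom_closed[OF f] z by (simp add: bsw_proj2[OF assms])
  { fix Y assume Y: "Y \<in> carrier L2"
    obtain y where y: "y \<in> carrier TL" "Y = proj2 y" using L2_cases[OF Y] .
    show "bal_sw K P (X \<oplus>\<^bsub>L2\<^esub> Y) B = bal_sw K P X B \<oplus>\<^bsub>P\<^esub> bal_sw K P Y B"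
      using z y lin_hom_add[OF f] by (simp add: bsw_proj2[OF assms] lin_hom_add[OF proj2_lin, symmetric]) }
  { fix a assume a: "a \<in> carrier K"
    show "bal_sw K P (a \<odot>\<^bsub>L2\<^esub> X) B = a \<odot>\<^bsub>P\<^esub> bal_sw K P X B"
      using z a lin_hom_smult[OF f] by (simp add: bsw_proj2[OF assms] lin_hom_smult[OF proj2_lin, symmetric]) }
qed

lemma proj2_bal:
  assumes "x \<in> carrier L" "a \<in> carrier V" "y \<in> carrier L"
  shows "pure2 (tt a \<diamondop> x) y = pure2 x (s a \<diamondop> y)"
proof -
  interpret Q: quotient_module K TL "bal_null K V L (\<lambda>x a. \<rho> a \<diamondop> x) L (\<lambda>a x. s a \<diamondop> x)" by (rule q2)
  have "pure K L L (\<rho> a \<diamondop> x) y \<ominus>\<^bsub>TL\<^esub> pure K L L x (s a \<diamondop> y) \<in> bal_null K V L (\<lambda>x a. \<rho> a \<diamondop> x) L (\<lambda>a x. s a \<diamondop> x)"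
    unfolding bal_null_def by (rule subsetD[OF lin_span_mono_in]) (use assms in blast)
  then show ?thesis using assms unfolding pure2_def proj2_def bal_proj_def by (simp add: Q.q_eq)
qed

abbreviation D where "D \<equiv> smash_comult K H V act \<rho>"
abbreviation ee where "ee \<equiv> smash_counit K H V"

lemma tsw_sj [simp]:
  "module K P \<Longrightarrow> v \<in> carrier V \<Longrightarrow> h \<in> carrier H \<Longrightarrow>
   (\<And>w. w \<in> carrier H \<Longrightarrow> (\<lambda>v. B v w) \<in> lin_hom K V P) \<Longrightarrow>
   (\<And>v. v \<in> carrier V \<Longrightarrow> (\<lambda>w. B v w) \<in> lin_hom K H P) \<Longrightarrow>
   tsw K V H P (s v \<diamondop> j h) (\<lambda>v w. B v w) = B v h"
  by (simp add: sj)

lemma D_def': "l \<in> carrier L \<Longrightarrow> D l = tsw K V H L2 l (\<lambda>v h. cop L2 h (\<lambda>h1 h2. pure2 (s v \<diamondop> j h1) (j h2)))"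
proof -
  assume l: "l \<in> carrier L"
  then have "l \<in> carrier T" by (simp add: L_simps)
  then show ?thesis unfolding smash_comult_def Let_def by (simp add: sj[symmetric] sw_T sw_cop)
qed

lemma D_lin: "D \<in> lin_hom K L L2"
proof -
  have f: "(\<lambda>l. tsw K V H L2 l (\<lambda>v h. cop L2 h (\<lambda>h1 h2. pure2 (s v \<diamondop> j h1) (j h2)))) \<in> lin_hom K L L2"
    unfolding lin_hom_L(2) by simp
  show ?thesis using f by (intro lin_homI) (simp_all add: D_def' lin_hom_closed[OF f] lin_hom_add[OF f] lin_hom_smult[OF f] module.smult_closed[OF modL]
     abelian_monoid.a_closed[OF abelian_group.axioms(1)[OF module.axioms(2)[OF modL]]])
qed

lemma D_closed [simp]: "l \<in> carrier L \<Longrightarrow> D l \<in> carrier L2" by (rule lin_hom_closed[OF D_lin])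
lemma lin_D [simp]: "f \<in> lin_hom K U L \<Longrightarrow> (\<lambda>x. D (f x)) \<in> lin_hom K U L2" by (rule lin_comp[OF D_lin])
lemma D_sj [simp]: "v \<in> carrier V \<Longrightarrow> h \<in> carrier H \<Longrightarrow> D (s v \<diamondop> j h) = cop L2 h (\<lambda>h1 h2. pure2 (s v \<diamondop> j h1) (j h2))"
  by (simp add: D_def')
lemma D_tsw [simp]: "module K U \<Longrightarrow> module K W \<Longrightarrow> t \<in> carrier (tensor K U W) \<Longrightarrow>
    (\<And>v w. v \<in> carrier U \<Longrightarrow> w \<in> carrier W \<Longrightarrow> B v w \<in> carrier L) \<Longrightarrow>
    D (tsw K U W L t B) = tsw K U W L2 t (\<lambda>v w. D (B v w))"
  by (rule tsw_hom[OF _ _ _ _ D_lin]) simp_all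

lemma bsw_D:
  assumes B: "balanced P (\<lambda>x y. B x y)" and l: "l \<in> carrier L"
  shows "bal_sw K P (D l) (\<lambda>x y. B x y) = tsw K V H P l (\<lambda>v h. cop P h (\<lambda>h1 h2. B (s v \<diamondop> j h1) (j h2)))"
proof -
  note [simp] = balancedD[OF B] lin_comp[OF balancedD(2)[OF B]] lin_comp[OF balancedD(3)[OF B]]
  have l': "l \<in> carrier T" using l by (simp add: L_simps)
  have "D l = proj2 (tsw K V H TL l (\<lambda>v h. cop TL h (\<lambda>h1 h2. pure K L L (s v \<diamondop> j h1) (j h2))))"
    using l l' by (simp add: D_def')
  moreover have "bal_sw K P (proj2 (tsw K V H TL l (\<lambda>v h. cop TL h (\<lambda>h1 h2. pure K L L (s v \<diamondop> j h1) (j h2))))) (\<lambda>x y. B x y) =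
     tsw K V H P l (\<lambda>v h. cop P h (\<lambda>h1 h2. B (s v \<diamondop> j h1) (j h2)))"
    using l' by (subst bsw_proj2[OF B]) simp_all
  ultimately show ?thesis by simp
qed

lemma bsw_D_lin:
  assumes B: "balanced P (\<lambda>x y. B x y)"
  shows "(\<lambda>l. bal_sw K P (D l) (\<lambda>x y. B x y)) \<in> lin_hom K L P"
  by (rule lin_comp[OF bsw_lin[OF B] D_lin])

lemma bsw_D_sj:
  assumes B: "balanced P (\<lambda>x y. B x y)" and "v \<in> carrier V" "h \<in> carrier H"
  shows "bal_sw K P (D (s v \<diamondop> j h)) (\<lambda>x y. B x y) = cop P h (\<lambda>h1 h2. B (s v \<diamondop> j h1) (j h2))"
proof -
  note [simp] = balancedD[OF B] lin_comp[OF balancedD(2)[OF B]] lin_comp[OF balancedD(3)[OF B]]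
  show ?thesis using assms by (subst bsw_D[OF B]) simp_all
qed

text \<open>The main device for the bialgebroid axioms: a balanced form evaluated at
  \<open>D l\<close> is linear in \<open>l\<close>, so an identity is tested on generators, where
  \<open>D\<close> has an explicit representative.\<close>

lemma bsw_D_ext:
  assumes B: "balanced P (\<lambda>x y. B x y)" and l: "l \<in> carrier L" and G: "(\<lambda>l. G l) \<in> lin_hom K L P"
    and e: "\<And>v h. v \<in> carrier V \<Longrightarrow> h \<in> carrier H \<Longrightarrow> cop P h (\<lambda>h1 h2. B (s v \<diamondop> j h1) (j h2)) = G (s v \<diamondop> j h)"
  shows "bal_sw K P (D l) (\<lambda>x y. B x y) = G l"
  by (rule L_ext[OF balancedD(1)[OF B] l bsw_D_lin[OF B] G]) (simp add: bsw_D_sj[OF B] e del: D_sj)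

lemma ee_lin: "ee \<in> lin_hom K L V"
proof -
  interpret L: module K L by simp
  have "(\<lambda>x. tsw K V H V x (\<lambda>v h. eps h \<odot>\<^bsub>V\<^esub> v)) \<in> lin_hom K L V" unfolding lin_hom_L(2) by simp
  moreover have "ee x = tsw K V H V x (\<lambda>v h. eps h \<odot>\<^bsub>V\<^esub> v)" if "x \<in> carrier L" for x
    using that by (simp add: smash_counit_def sw_T L_simps)
  ultimately show ?thesis by (auto simp: lin_hom_def Pi_def)
qed
lemma ee_closed [simp]: "l \<in> carrier L \<Longrightarrow> ee l \<in> carrier V" by (rule lin_hom_closed[OF ee_lin])
lemma lin_ee [simp]: "f \<in> lin_hom K U L \<Longrightarrow> (\<lambda>x. ee (f x)) \<in> lin_hom K U V" by (rule lin_comp[OF ee_lin])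
lemma ee_sj [simp]: "v \<in> carrier V \<Longrightarrow> h \<in> carrier H \<Longrightarrow> ee (s v \<diamondop> j h) = eps h \<odot>\<^bsub>V\<^esub> v"
  by (simp add: smash_counit_def sj sw_T)
lemma ee_s [simp]: "v \<in> carrier V \<Longrightarrow> ee (s v) = v" using ee_sj[of v "\<one>\<^bsub>H\<^esub>"] by simp
lemma ee_j [simp]: "h \<in> carrier H \<Longrightarrow> ee (j h) = eps h \<odot>\<^bsub>V\<^esub> \<one>\<^bsub>V\<^esub>" using ee_sj[of "\<one>\<^bsub>V\<^esub>" h] by simp
lemma ee_tsw [simp]: "module K U \<Longrightarrow> module K W \<Longrightarrow> t \<in> carrier (tensor K U W) \<Longrightarrow>
    (\<And>v w. v \<in> carrier U \<Longrightarrow> w \<in> carrier W \<Longrightarrow> B v w \<in> carrier L) \<Longrightarrow>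
    ee (tsw K U W L t B) = tsw K U W V t (\<lambda>v w. ee (B v w))"
  by (rule tsw_hom[OF _ _ _ _ ee_lin]) simp_all

interpretation bialgebroid_data K V L s \<rho> .

lemma tt_tt: "a \<in> carrier V \<Longrightarrow> b \<in> carrier V \<Longrightarrow> x \<in> carrier L \<Longrightarrow> tt a \<diamondop> (tt b \<diamondop> x) = tt (b \<star> a) \<diamondop> x"
  using ring_assoc[OF ringL, of "tt a" "tt b" x] by (simp add: tt_mult)

lemma lin_pure2_0: "x \<in> carrier L \<Longrightarrow> pure2 x \<in> lin_hom K L L2"
  using lin_pure2_r[OF lin_id] by simp

lemma bal_st: "a \<in> carrier V \<Longrightarrow> b \<in> carrier V \<Longrightarrow> balanced L2 (\<lambda>x y. pure2 (s a \<diamondop> x) (tt b \<diamondop> y))"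
proof (rule balancedI, simp_all, goal_cases)
  case (1 c x y)
  have "pure2 (s a \<diamondop> (tt c \<diamondop> x)) (tt b \<diamondop> y) = pure2 (tt c \<diamondop> (s a \<diamondop> x)) (tt b \<diamondop> y)" using 1 by simp
  also have "\<dots> = pure2 (s a \<diamondop> x) (s c \<diamondop> (tt b \<diamondop> y))" using 1 by (simp add: proj2_bal del: tt_s')
  finally show ?case .
qed

text \<open>The source part of \<open>tt b\<close> on the second leg slides across the balanced
  tensor product as a target on the first leg. Coassociativity of the coaction then recombines both
  \<open>H\<close>-legs into the coproduct of a product.\<close>

lemma D_st:
  assumes a: "a \<in> carrier V" and b: "b \<in> carrier V" and l: "l \<in> carrier L"
  shows "D (s a \<diamondop> (tt b \<diamondop> l)) = bal_sw K L2 (D l) (\<lambda>x y. pure2 (s a \<diamondop> x) (tt b \<diamondop> y))"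
proof (rule sym, rule bsw_D_ext[OF bal_st[OF a b] l])
  show "(\<lambda>l. D (s a \<diamondop> (tt b \<diamondop> l))) \<in> lin_hom K L L2" using a b by simp
next
  fix v h assume v: "v \<in> carrier V" and h: "h \<in> carrier H"
  have "cop L2 h (\<lambda>h1 h2. pure2 (s a \<diamondop> (s v \<diamondop> j h1)) (tt b \<diamondop> j h2)) =
     cop L2 h (\<lambda>h1 h2. rsw L2 b (\<lambda>x c. pure2 (s (a \<star> v) \<diamondop> j h1) (s x \<diamondop> j (c \<bullet> h2))))"
    using a b v h by (simp add: tt_def)
  also have "\<dots> = cop L2 h (\<lambda>h1 h2. rsw L2 b (\<lambda>x c. pure2 (s (a \<star> v) \<diamondop> (tt x \<diamondop> j h1)) (j (c \<bullet> h2))))"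
    using a b v h by (simp add: proj2_bal[symmetric])
  also have "\<dots> = cop L2 h (\<lambda>h1 h2. rsw L2 b (\<lambda>x c. rsw L2 x (\<lambda>b0 b1. pure2 (s (a \<star> v \<star> b0) \<diamondop> j (b1 \<bullet> h1)) (j (c \<bullet> h2)))))"
    using a b v h by (simp add: tt_def)
  also have "\<dots> = cop L2 h (\<lambda>h1 h2. rsw L2 b (\<lambda>b0 z. cop L2 z (\<lambda>b1 c. pure2 (s (a \<star> v \<star> b0) \<diamondop> j (b1 \<bullet> h1)) (j (c \<bullet> h2)))))"
    using a b v h by simp
  also have "\<dots> = rsw L2 b (\<lambda>b0 z. cop L2 z (\<lambda>b1 c. cop L2 h (\<lambda>h1 h2. pure2 (s (a \<star> v \<star> b0) \<diamondop> j (b1 \<bullet> h1)) (j (c \<bullet> h2)))))"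
    by (rule tsw_swap2) (use a b v h in simp_all)
  also have "\<dots> = D (s a \<diamondop> (tt b \<diamondop> (s v \<diamondop> j h)))"
    using a b v h by simp (simp add: tt_def)
  finally show "cop L2 h (\<lambda>h1 h2. pure2 (s a \<diamondop> (s v \<diamondop> j h1)) (tt b \<diamondop> j h2)) = D (s a \<diamondop> (tt b \<diamondop> (s v \<diamondop> j h)))" .
qed

lemma D_tt: assumes "b \<in> carrier V" "l \<in> carrier L" shows "D (tt b \<diamondop> l) = bal_sw K L2 (D l) (\<lambda>x y. pure2 x (\<rho> b \<diamondop> y))"
  using D_st[of "\<one>\<^bsub>V\<^esub>" b l] assms
  by (simp add: bsw_cong[OF D_closed modL2, of l "\<lambda>x y. pure2 (\<one>\<^bsub>L\<^esub> \<diamondop> x) (tt b \<diamondop> y)" "\<lambda>x y. pure2 x (tt b \<diamondop> y)", symmetric])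

text \<open>Moving \<open>s c\<close> to the left of \<open>j h2\<close> makes a leg act on
  \<open>c\<close>; balancing transfers the result to the first factor as a target, and
  \<open>tt_act_j\<close> moves it behind \<open>j h1\<close>. The right factors \<open>x'\<close>
  and \<open>y'\<close> are kept arbitrary for the proof of \<open>D_product\<close>.\<close>

lemma takeuchi_aux:
  assumes v: "v \<in> carrier V" and h: "h \<in> carrier H" and c: "c \<in> carrier V" and x: "x' \<in> carrier L" and y: "y' \<in> carrier L"
  shows "cop L2 h (\<lambda>h1 h2. pure2 (s v \<diamondop> (j h1 \<diamondop> (tt c \<diamondop> x'))) (j h2 \<diamondop> y')) =
    cop L2 h (\<lambda>h1 h2. pure2 (s v \<diamondop> (j h1 \<diamondop> x')) (j h2 \<diamondop> (s c \<diamondop> y')))"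
proof -
  have "cop L2 h (\<lambda>h1 h2. pure2 (s v \<diamondop> (j h1 \<diamondop> x')) (j h2 \<diamondop> (s c \<diamondop> y'))) =
     cop L2 h (\<lambda>h1 h2. cop L2 h2 (\<lambda>p q. pure2 (s v \<diamondop> (j h1 \<diamondop> x')) (s (act p c) \<diamondop> (j q \<diamondop> y'))))"
    using assms by simp
  also have "\<dots> = cop L2 h (\<lambda>u q. cop L2 u (\<lambda>h1 p. pure2 (s v \<diamondop> (tt (act p c) \<diamondop> (j h1 \<diamondop> x'))) (j q \<diamondop> y')))"
    using assms by (simp add: proj2_bal[symmetric])
  also have "\<dots> = cop L2 h (\<lambda>u q. pure2 (s v \<diamondop> (cop L u (\<lambda>h1 p. tt (act p c) \<diamondop> j h1) \<diamondop> x')) (j q \<diamondop> y'))"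
    by (rule tsw_cong[OF refl]) (use assms in simp)
  also have "\<dots> = cop L2 h (\<lambda>u q. pure2 (s v \<diamondop> (j u \<diamondop> (tt c \<diamondop> x'))) (j q \<diamondop> y'))"
    by (rule tsw_cong[OF refl]) (use assms in \<open>simp add: tt_act_j\<close>)
  finally show ?thesis by simp
qed

text \<open>The inner form is not balanced for single \<open>x\<close>, \<open>y\<close>; it becomes
  so only after summation over \<open>D l\<close>. Hence the inner representative is frozen, the
  outer sum is evaluated on its explicit representative, and only then is the inner one exchanged
  for the explicit one.\<close>

lemma D_product:
  assumes l: "l \<in> carrier L" and l': "l' \<in> carrier L"
  shows "D (l \<diamondop> l') = bal_sw K L2 (D l) (\<lambda>x y. bal_sw K L2 (D l') (\<lambda>x' y'. pure2 (x \<diamondop> x') (y \<diamondop> y')))"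
proof -
  \<comment> \<open>The representative that \<open>bal_sw\<close> selects, named so that the inner
    sum becomes an ordinary Sweedler sum over a fixed tensor.\<close>
  define r where "r = (SOME z. z \<in> D l')"
  have r [simp]: "r \<in> carrier TL" using L2_some[OF D_closed[OF l']] by (simp add: r_def)
  have lT: "l \<in> carrier T" and lT': "l' \<in> carrier T" using l l' by (simp_all add: L_simps)
  have inner: "bal_sw K L2 (D l') B = tsw K L L L2 r B" if "\<And>x y. x \<in> carrier L \<Longrightarrow> y \<in> carrier L \<Longrightarrow> B x y \<in> carrier L2" for B
    unfolding r_def by (rule bsw_tsw) (use l' that in simp_all)
  have bal1: "balanced L2 (\<lambda>x y. tsw K L L L2 r (\<lambda>x' y'. pure2 (x \<diamondop> x') (y \<diamondop> y')))"
    by (rule balancedI) (simp_all add: proj2_bal)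
  let ?C = "\<lambda>v h x' y'. cop L2 h (\<lambda>h1 h2. pure2 (s v \<diamondop> (j h1 \<diamondop> x')) (j h2 \<diamondop> y'))"
  \<comment> \<open>After summation over the coproduct of \<open>h\<close> the form in the inner
    variables is balanced; this is the Takeuchi condition.\<close>
  have bal2: "balanced L2 (?C v h)" if "v \<in> carrier V" "h \<in> carrier H" for v h
    by (rule balancedI) (use that in \<open>simp_all add: takeuchi_aux del: js'\<close>)
  have "bal_sw K L2 (D l) (\<lambda>x y. bal_sw K L2 (D l') (\<lambda>x' y'. pure2 (x \<diamondop> x') (y \<diamondop> y'))) =
     bal_sw K L2 (D l) (\<lambda>x y. tsw K L L L2 r (\<lambda>x' y'. pure2 (x \<diamondop> x') (y \<diamondop> y')))"
    by (rule bsw_cong) (use l in \<open>simp_all add: inner\<close>)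
  also have "\<dots> = tsw K V H L2 l (\<lambda>v h. cop L2 h (\<lambda>h1 h2. tsw K L L L2 r (\<lambda>x' y'. pure2 (s v \<diamondop> j h1 \<diamondop> x') (j h2 \<diamondop> y'))))"
    by (rule bsw_D[OF bal1 l])
  also have "\<dots> = tsw K V H L2 l (\<lambda>v h. tsw K L L L2 r (?C v h))"
    by (rule tsw_cong[OF refl], rule trans[OF tsw_swap]) simp_all
  also have "\<dots> = tsw K V H L2 l (\<lambda>v h. tsw K V H L2 l' (\<lambda>v' h'. cop L2 h' (\<lambda>a b. ?C v h (s v' \<diamondop> j a) (j b))))"
    by (rule tsw_cong[OF refl], subst inner[symmetric], simp, rule bsw_D[OF bal2 l']) simp_all
  also have "\<dots> = D (l \<diamondop> l')"
  proof (rule L_ext[where P = L2 and f = "\<lambda>l. tsw K V H L2 l (\<lambda>v h. tsw K V H L2 l' (\<lambda>v' h'. cop L2 h' (\<lambda>a b. ?C v h (s v' \<diamondop> j a) (j b))))" and g = "\<lambda>l. D (l \<diamondop> l')", OF _ l])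
    show "(\<lambda>l. tsw K V H L2 l (\<lambda>v h. tsw K V H L2 l' (\<lambda>v' h'. cop L2 h' (\<lambda>a b. ?C v h (s v' \<diamondop> j a) (j b))))) \<in> lin_hom K L L2"
      unfolding lin_hom_L(2) using lT' by simp
    fix v h assume v: "v \<in> carrier V" and h: "h \<in> carrier H"
    have "tsw K V H L2 l' (\<lambda>v' h'. cop L2 h' (\<lambda>a b. ?C v h (s v' \<diamondop> j a) (j b))) = D (s v \<diamondop> j h \<diamondop> l')"
    proof (rule L_ext[where P = L2 and f = "\<lambda>l'. tsw K V H L2 l' (\<lambda>v' h'. cop L2 h' (\<lambda>a b. ?C v h (s v' \<diamondop> j a) (j b)))" and g = "\<lambda>l'. D (s v \<diamondop> j h \<diamondop> l')", OF _ l'])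
      show "(\<lambda>l'. tsw K V H L2 l' (\<lambda>v' h'. cop L2 h' (\<lambda>a b. ?C v h (s v' \<diamondop> j a) (j b)))) \<in> lin_hom K L L2"
        unfolding lin_hom_L(2) using v h by simp
      fix v' h' assume v': "v' \<in> carrier V" and h': "h' \<in> carrier H"
      have "cop L2 h' (\<lambda>a b. ?C v h (s v' \<diamondop> j a) (j b)) = cop L2 h (\<lambda>h1 z. cop L2 z (\<lambda>p q. cop L2 h' (\<lambda>a b. pure2 (s (v \<star> act h1 v') \<diamondop> j (p \<bullet> a)) (j (q \<bullet> b)))))"
        using v h v' h' by simp (rule tsw_swap2; simp)
      also have "\<dots> = D (s v \<diamondop> j h \<diamondop> (s v' \<diamondop> j h'))" using v h v' h' by simp
      finally show "tsw K V H L2 (s v' \<diamondop> j h') (\<lambda>v' h'. cop L2 h' (\<lambda>a b. ?C v h (s v' \<diamondop> j a) (j b))) = D (s v \<diamondop> j h \<diamondop> (s v' \<diamondop> j h'))"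
        using v h v' h' by simp
    qed (use v h in simp_all)
    then show "tsw K V H L2 (s v \<diamondop> j h) (\<lambda>v h. tsw K V H L2 l' (\<lambda>v' h'. cop L2 h' (\<lambda>a b. ?C v h (s v' \<diamondop> j a) (j b)))) = D (s v \<diamondop> j h \<diamondop> l')"
      using v h lT' by simp
  qed (use l' in simp_all)
  finally show ?thesis by simp
qed

section \<open>The counit on products and the antipode axioms\<close>

lemma ee_st:
  assumes a: "a \<in> carrier V" and b: "b \<in> carrier V" and l: "l \<in> carrier L"
  shows "ee (s a \<diamondop> (tt b \<diamondop> l)) = a \<star> (ee l \<star> b)"
proof (rule L_ext[where f = "\<lambda>l. ee (s a \<diamondop> (tt b \<diamondop> l))" and g = "\<lambda>l. a \<star> (ee l \<star> b)", OF modV l])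
  fix v h assume "v \<in> carrier V" "h \<in> carrier H"
  then show "ee (s a \<diamondop> (tt b \<diamondop> (s v \<diamondop> j h))) = a \<star> (ee (s v \<diamondop> j h) \<star> b)"
    using a b by simp (simp add: tt_def)
qed (use a b in simp_all)

lemma ee_smult [simp]: "a \<in> carrier K \<Longrightarrow> l \<in> carrier L \<Longrightarrow> ee (a \<odot>\<^bsub>L\<^esub> l) = a \<odot>\<^bsub>V\<^esub> ee l"
  by (rule lin_hom_smult[OF ee_lin])

lemma ee_product_s: assumes l: "l \<in> carrier L" and l': "l' \<in> carrier L" shows "ee (l \<diamondop> l') = ee (l \<diamondop> s (ee l'))"
proof (rule L_ext[where f = "\<lambda>l. ee (l \<diamondop> l')" and g = "\<lambda>l. ee (l \<diamondop> s (ee l'))", OF modV l])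
  fix v h assume v: "v \<in> carrier V" and h: "h \<in> carrier H"
  show "ee (s v \<diamondop> j h \<diamondop> l') = ee (s v \<diamondop> j h \<diamondop> s (ee l'))"
    by (rule L_ext[where f = "\<lambda>l'. ee (s v \<diamondop> j h \<diamondop> l')" and g = "\<lambda>l'. ee (s v \<diamondop> j h \<diamondop> s (ee l'))", OF modV l'])
      (use v h in simp_all)
qed (use l' in simp_all)

lemma ee_product_t: assumes l: "l \<in> carrier L" and l': "l' \<in> carrier L" shows "ee (l \<diamondop> l') = ee (l \<diamondop> tt (ee l'))"
proof (rule L_ext[where f = "\<lambda>l. ee (l \<diamondop> l')" and g = "\<lambda>l. ee (l \<diamondop> tt (ee l'))", OF modV l])
  fix v h assume v: "v \<in> carrier V" and h: "h \<in> carrier H"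
  show "ee (s v \<diamondop> j h \<diamondop> l') = ee (s v \<diamondop> j h \<diamondop> tt (ee l'))"
  proof (rule L_ext[where f = "\<lambda>l'. ee (s v \<diamondop> j h \<diamondop> l')" and g = "\<lambda>l'. ee (s v \<diamondop> j h \<diamondop> tt (ee l'))", OF modV l'])
    fix w k assume w: "w \<in> carrier V" and k: "k \<in> carrier H"
    \<comment> \<open>The counit falls on the \<open>H\<close>-leg of \<open>tt w\<close>, and the
      comodule counit axiom returns \<open>w\<close> itself.\<close>
    have "ee (s v \<diamondop> j h \<diamondop> tt w) = v \<star> act h w" using v w h by (simp add: tt_def)
    then show "ee (s v \<diamondop> j h \<diamondop> (s w \<diamondop> j k)) = ee (s v \<diamondop> j h \<diamondop> tt (ee (s w \<diamondop> j k)))"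
      using v h w k lin_hom_smult[OF ee_lin, of "eps k" "s v \<diamondop> (j h \<diamondop> tt w)"] by simp
  qed (use v h in simp_all)
qed (use l' in simp_all)

text \<open>The form is balanced because \<tau> sends target to source. Writing \<open>sg v\<close>
  as the target of \<open>?u\<close> makes the counit of the antipode value equal to
  \<open>S h\<close> acting on \<open>?u\<close>; expanding that target by \<open>tt_act\<close>
  gives the left side, since the inverse antipode cancels one \<open>S\<close>.\<close>

lemma ee_tau: assumes l: "l \<in> carrier L"
  shows "bal_sw K L (D l) (\<lambda>x y. tau x \<diamondop> y) = tt (ee (tau l))"
proof (rule bsw_D_ext[OF _ l])
  show "balanced L (\<lambda>x y. tau x \<diamondop> y)" by (rule balancedI) (simp_all add: tau_mult tau_tt)
  show "(\<lambda>l. tt (ee (tau l))) \<in> lin_hom K L L" using tau_lin by simp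
  fix v h assume v: "v \<in> carrier V" and h: "h \<in> carrier H"
  let ?u = "rsw V v (\<lambda>a0 a1. act (S (S a1)) a0)"
  have u [simp]: "?u \<in> carrier V" using v by simp
  have sg: "sg v = tt ?u" using tt_sg[OF v] by simp
  have e: "ee (j k \<diamondop> tt u) = act k u" if "k \<in> carrier H" "u \<in> carrier V" for k u
    using that by (simp add: tt_def)
  have "ee (tau (s v \<diamondop> j h)) = act (S h) ?u" using v h e[of "S h" ?u] u by (simp add: sg)
  then have "tt (ee (tau (s v \<diamondop> j h))) = cop L h (\<lambda>x y. j (S x) \<diamondop> (sg v \<diamondop> j y))"
    using h tt_act[of "S h" ?u] u by (simp add: sg del: tt_tsw)
  then show "cop L h (\<lambda>h1 h2. tau (s v \<diamondop> j h1) \<diamondop> j h2) = tt (ee (tau (s v \<diamondop> j h)))"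
    using v h by simp
qed

text \<open>Normal form of a balanced tensor: the \<open>V\<close>-part of the second factor is
  pushed to the first as a target, leaving an element of \<open>H\<close> on the right.\<close>

definition gam where "gam x y = tsw K V H TL y (\<lambda>a h. pure K L L (tt a \<diamondop> x) (j h))"

lemma gam_sj [simp]: "x \<in> carrier L \<Longrightarrow> a \<in> carrier V \<Longrightarrow> h \<in> carrier H \<Longrightarrow> gam x (s a \<diamondop> j h) = pure K L L (tt a \<diamondop> x) (j h)"
  unfolding gam_def by simp

lemma gam_j [simp]: "x \<in> carrier L \<Longrightarrow> h \<in> carrier H \<Longrightarrow> gam x (j h) = pure K L L x (j h)"
  using gam_sj[of x "\<one>\<^bsub>V\<^esub>" h] by simp

lemma gam_lin_r: "x \<in> carrier L \<Longrightarrow> (\<lambda>y. gam x y) \<in> lin_hom K L TL"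
  unfolding gam_def lin_hom_L(2) by simp

lemma gam_lin_l: "y \<in> carrier L \<Longrightarrow> (\<lambda>x. gam x y) \<in> lin_hom K L TL"
proof -
  assume "y \<in> carrier L"
  then have "y \<in> carrier T" by (simp add: L_simps)
  then show ?thesis unfolding gam_def by simp
qed

text \<open>Pushing a product of two elements of \<open>V\<close> across yields the target of the
  product, which by antimultiplicativity is the same as pushing them one after the other.\<close>

lemma gam_balanced: "balanced TL (\<lambda>x y. gam x y)"
proof (rule balancedI)
  fix c x y assume c: "c \<in> carrier V" and x: "x \<in> carrier L" and y: "y \<in> carrier L"
  show "gam (tt c \<diamondop> x) y = gam x (s c \<diamondop> y)"
    by (rule L_ext[where P = TL and f = "\<lambda>y. gam (tt c \<diamondop> x) y" and g = "\<lambda>y. gam x (s c \<diamondop> y)", OF _ y])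
     (use c x in \<open>simp_all add: gam_lin_r tt_tt lin_comp[OF gam_lin_r[OF x]]\<close>)
qed (simp_all add: gam_lin_l gam_lin_r)

lemma tau_right:
  "\<exists>\<gamma> \<in> lin_hom K L2 TL. (\<forall>X\<in>carrier L2. proj2 (\<gamma> X) = X) \<and>
      (\<forall>l\<in>carrier L. sw K L (\<gamma> (D l)) (\<lambda>x y. x \<diamondop> tau y) = s (ee l))"
proof (intro bexI conjI ballI)
  let ?g = "\<lambda>X. bal_sw K TL X (\<lambda>x y. gam x y)"
  note gc [simp] = lin_hom_closed[OF gam_lin_r]
  show g: "?g \<in> lin_hom K L2 TL" by (rule bsw_lin[OF gam_balanced])
  { fix X assume "X \<in> carrier L2"
    then obtain z where z: "z \<in> carrier TL" "X = proj2 z" using L2_cases by blast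
    have pg: "proj2 (gam x y) = pure2 x y" if x: "x \<in> carrier L" and y: "y \<in> carrier L" for x y
      by (rule L_ext[where P = L2 and f = "\<lambda>y. proj2 (gam x y)" and g = "\<lambda>y. pure2 x y", OF _ y])
        (use x in \<open>simp_all add: proj2_bal lin_pure2_0 lin_comp[OF proj2_lin gam_lin_r[OF x]]\<close>)
    have "proj2 (?g X) = tsw K L L L2 z (\<lambda>x y. pure2 x y)"
      using z by (simp add: bsw_proj2[OF gam_balanced] pg)
    also have "\<dots> = proj2 (tsw K L L TL z (pure K L L))" using z by simp
    finally show "proj2 (?g X) = X" using z by (simp add: tensor_id del: proj2_tsw) }
  { fix l assume l: "l \<in> carrier L"
    have lin: "(\<lambda>z. tsw K L L L z (\<lambda>x y. x \<diamondop> tau y)) \<in> lin_hom K TL L" using tau_lin by simp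
    have gD: "?g (D l) \<in> carrier TL" by (rule lin_hom_closed[OF g]) (use l in simp)
    have "sw K L (?g (D l)) (\<lambda>x y. x \<diamondop> tau y) = tsw K L L L (?g (D l)) (\<lambda>x y. x \<diamondop> tau y)"
      by (rule sw_finsum(1)) (use gD in simp_all)
    also have "\<dots> = s (ee l)"
    proof (rule L_ext[where f = "\<lambda>l. tsw K L L L (?g (D l)) (\<lambda>x y. x \<diamondop> tau y)" and g = "\<lambda>l. s (ee l)", OF _ l])
      show "(\<lambda>l. tsw K L L L (?g (D l)) (\<lambda>x y. x \<diamondop> tau y)) \<in> lin_hom K L L"
        by (rule lin_comp[OF lin lin_comp[OF g D_lin]])
      fix v h assume v: "v \<in> carrier V" and h: "h \<in> carrier H"
      \<comment> \<open>The representative that defines \<open>D\<close> already is in normal form,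
        its second legs being values of \<open>j\<close>, so the section returns it and only
        \<open>h1 \<bullet> S h2\<close> remains to be contracted.\<close>
      have "tsw K L L L (?g (D (s v \<diamondop> j h))) (\<lambda>x y. x \<diamondop> tau y) = cop L h (\<lambda>h1 h2. s v \<diamondop> j (h1 \<bullet> S h2))"
        using v h tau_lin by (simp add: bsw_D_sj[OF gam_balanced] del: D_sj)
      also have "\<dots> = eps h \<odot>\<^bsub>L\<^esub> (s v \<diamondop> j \<one>\<^bsub>H\<^esub>)"
        by (rule contract0(2)[where Q = "\<lambda>w. s v \<diamondop> j w"]) (use v h in simp_all)
      finally show "tsw K L L L (?g (D (s v \<diamondop> j h))) (\<lambda>x y. x \<diamondop> tau y) = s (ee (s v \<diamondop> j h))"
        using v h by simp
    qed simp_all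
    finally show "sw K L (?g (D l)) (\<lambda>x y. x \<diamondop> tau y) = s (ee l)" . }
qed

subsubsection \<open>Coassociativity and the Hopf algebroid structure\<close>

lemma ract2_pure2: "x \<in> carrier L \<Longrightarrow> y \<in> carrier L \<Longrightarrow> a \<in> carrier V \<Longrightarrow> ract2 (pure2 x y) a = pure2 x (tt a \<diamondop> y)"
proof -
  assume xy: "x \<in> carrier L" "y \<in> carrier L" and a: "a \<in> carrier V"
  have b: "balanced L2 (\<lambda>x y. pure2 x (tt a \<diamondop> y))"
    by (rule balancedI) (use a in \<open>simp_all add: proj2_bal del: tt_s'\<close>, use a in \<open>simp add: tt_s'\<close>)
  have "ract2 (pure2 x y) a = bal_sw K L2 (pure2 x y) (\<lambda>x y. pure2 x (tt a \<diamondop> y))"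
    unfolding ract2_def using a by simp
  then show ?thesis using xy a bsw_proj2[OF b, of "pure K L L x y"] by simp
qed

lemma ract2_closed: "X \<in> carrier L2 \<Longrightarrow> a \<in> carrier V \<Longrightarrow> ract2 X a \<in> carrier L2"
  unfolding ract2_def by (subst bsw_tsw) (simp_all add: L2_some)

lemma q3: "quotient_module K (tensor K L2 L) (bal_null K V L2 ract2 L (\<lambda>a x. s a \<diamondop> x))"
  by (rule bal_quotient) (simp_all add: ract2_closed)

lemma modL3 [simp]: "module K L3"
  unfolding L3_def bal_tensor_def by (rule quotient_module.quot_module[OF q3])

lemma pure3_proj: "(\<lambda>z. bal_proj K V L2 ract2 L (\<lambda>a x. s a \<diamondop> x) z) \<in> lin_hom K (tensor K L2 L) L3"
  unfolding L3_def bal_tensor_def bal_proj_def by (rule quotient_module.q_lin[OF q3])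

lemma lin_pure3_l [simp]: "f \<in> lin_hom K U L2 \<Longrightarrow> y \<in> carrier L \<Longrightarrow> (\<lambda>x. pure3 (f x) y) \<in> lin_hom K U L3"
  and lin_pure3_r [simp]: "g \<in> lin_hom K U L \<Longrightarrow> X \<in> carrier L2 \<Longrightarrow> (\<lambda>x. pure3 X (g x)) \<in> lin_hom K U L3"
  unfolding pure3_def by (rule lin_comp[OF pure3_proj], simp)+

lemma pure3_tsw [simp]: "module K U \<Longrightarrow> module K W \<Longrightarrow> t \<in> carrier (tensor K U W) \<Longrightarrow>
    (\<And>v w. v \<in> carrier U \<Longrightarrow> w \<in> carrier W \<Longrightarrow> B v w \<in> carrier L2) \<Longrightarrow> y \<in> carrier L \<Longrightarrow>
    pure3 (tsw K U W L2 t B) y = tsw K U W L3 t (\<lambda>v w. pure3 (B v w) y)"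
  by (rule tsw_hom[where f = "\<lambda>X. pure3 X y"]) simp_all

lemma pure3_bal:
  assumes "X \<in> carrier L2" "a \<in> carrier V" "y \<in> carrier L"
  shows "pure3 (ract2 X a) y = pure3 X (s a \<diamondop> y)"
proof -
  interpret Q: quotient_module K "tensor K L2 L" "bal_null K V L2 ract2 L (\<lambda>a x. s a \<diamondop> x)" by (rule q3)
  have "pure K L2 L (ract2 X a) y \<ominus>\<^bsub>tensor K L2 L\<^esub> pure K L2 L X (s a \<diamondop> y) \<in> bal_null K V L2 ract2 L (\<lambda>a x. s a \<diamondop> x)"
    unfolding bal_null_def by (rule subsetD[OF lin_span_mono_in]) (use assms in blast)
  then show ?thesis using assms ract2_closed unfolding pure3_def bal_proj_def by (simp add: Q.q_eq)
qed

text \<open>Once both sides are recognised as balanced forms evaluated at \<open>D l\<close>, the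
  comparison on generators is coassociativity of \<open>H\<close>.\<close>

lemma D_coassociative: assumes l: "l \<in> carrier L"
  shows "bal_sw K L3 (D l) (\<lambda>x y. pure3 (D x) y) =
      bal_sw K L3 (D l) (\<lambda>x y. bal_sw K L3 (D y) (\<lambda>y1 y2. pure3 (pure2 x y1) y2))"
proof -
  \<comment> \<open>Balancing on this side is compatibility of \<open>D\<close> with the right
    \<open>V\<close>-action, that is \<open>D_tt\<close>.\<close>
  have b1: "balanced L3 (\<lambda>x y. pure3 (D x) y)"
  proof (rule balancedI)
    fix a x y assume "a \<in> carrier V" "x \<in> carrier L" "y \<in> carrier L"
    then show "pure3 (D (tt a \<diamondop> x)) y = pure3 (D x) (s a \<diamondop> y)"
      by (simp only: D_tt ract2_def[symmetric] pure3_bal D_closed)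
  qed simp_all
  have b2: "balanced L3 (\<lambda>y1 y2. pure3 (pure2 x y1) y2)" if "x \<in> carrier L" for x
    by (rule balancedI) (use that in \<open>simp_all add: ract2_pure2[symmetric] pure3_bal lin_pure2_0\<close>)
  have i: "bal_sw K L3 (D y) (\<lambda>y1 y2. pure3 (pure2 x y1) y2) = tsw K V H L3 y (\<lambda>v h. cop L3 h (\<lambda>a b. pure3 (pure2 x (s v \<diamondop> j a)) (j b)))"
    if "x \<in> carrier L" "y \<in> carrier L" for x y
    by (rule bsw_D[OF b2]) (use that in simp_all)
  \<comment> \<open>The inner coproduct written out over \<open>y\<close>, so that its linearity in
    \<open>y\<close> can be derived from the rules for \<open>tsw\<close>.\<close>
  let ?B = "\<lambda>x y. tsw K V H L3 y (\<lambda>v h. cop L3 h (\<lambda>a b. pure3 (pure2 x (s v \<diamondop> j a)) (j b)))"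
  have Blin: "(\<lambda>y. ?B x y) \<in> lin_hom K L L3" if "x \<in> carrier L" for x
    unfolding lin_hom_L(2) using that by simp
  have b3: "balanced L3 ?B"
  proof (rule balancedI)
    fix y assume "y \<in> carrier L"
    then have "y \<in> carrier T" by (simp add: L_simps)
    then show "(\<lambda>x. ?B x y) \<in> lin_hom K L L3" by simp
  next
    fix a x y assume a: "a \<in> carrier V" and x: "x \<in> carrier L" and y: "y \<in> carrier L"
    have bl: "(\<lambda>y. ?B x (s a \<diamondop> y)) \<in> lin_hom K L L3"
      by (rule lin_comp[OF Blin[OF x]]) (use a in simp)
    show "?B (tt a \<diamondop> x) y = ?B x (s a \<diamondop> y)"
      by (rule L_ext[where P = L3 and f = "\<lambda>y. ?B (tt a \<diamondop> x) y" and g = "\<lambda>y. ?B x (s a \<diamondop> y)", OF modL3 y Blin bl])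
        (use a x in \<open>simp_all add: proj2_bal\<close>)
  qed (simp_all add: Blin)
  have "bal_sw K L3 (D l) (\<lambda>x y. bal_sw K L3 (D y) (\<lambda>y1 y2. pure3 (pure2 x y1) y2)) = bal_sw K L3 (D l) ?B"
    by (rule bsw_cong) (use l balancedD(4)[OF b3] in \<open>simp_all add: i\<close>)
  moreover have "bal_sw K L3 (D l) (\<lambda>x y. pure3 (D x) y) = bal_sw K L3 (D l) ?B"
  proof (rule bsw_D_ext[OF b1 l bsw_D_lin[OF b3]])
    fix v h assume v: "v \<in> carrier V" and h: "h \<in> carrier H"
    have j0: "?B x (j k) = cop L3 k (\<lambda>a b. pure3 (pure2 x (j a)) (j b))" if "x \<in> carrier L" "k \<in> carrier H" for x k
      using tsw_sj[of L3 "\<one>\<^bsub>V\<^esub>" k "\<lambda>v h. cop L3 h (\<lambda>a b. pure3 (pure2 x (s v \<diamondop> j a)) (j b))"] that by simp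
    show "cop L3 h (\<lambda>h1 h2. pure3 (D (s v \<diamondop> j h1)) (j h2)) = bal_sw K L3 (D (s v \<diamondop> j h)) ?B"
      unfolding bsw_D_sj[OF b3 v h] using v h by (simp add: j0)
  qed
  ultimately show ?thesis by simp
qed

lemma D_one: "D \<one>\<^bsub>L\<^esub> = pure2 \<one>\<^bsub>L\<^esub> \<one>\<^bsub>L\<^esub>"
  using D_sj[of "\<one>\<^bsub>V\<^esub>" "\<one>\<^bsub>H\<^esub>"] by (simp add: lin_pure2_0 del: D_sj)

lemma D_counit_l: assumes l: "l \<in> carrier L" shows "bal_sw K L (D l) (\<lambda>x y. s (ee x) \<diamondop> y) = l"
proof (rule bsw_D_ext[OF _ l])
  show "balanced L (\<lambda>x y. s (ee x) \<diamondop> y)"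
    by (rule balancedI) (use ee_st[of "\<one>\<^bsub>V\<^esub>"] in simp_all)
qed simp_all

lemma D_counit_r: assumes l: "l \<in> carrier L" shows "bal_sw K L (D l) (\<lambda>x y. tt (ee y) \<diamondop> x) = l"
proof (rule bsw_D_ext[OF _ l])
  have "ee (s a \<diamondop> y) = a \<star> ee y" if "a \<in> carrier V" "y \<in> carrier L" for a y
    using ee_st[of a "\<one>\<^bsub>V\<^esub>" y] that by simp
  then show "balanced L (\<lambda>x y. tt (ee y) \<diamondop> x)" by (intro balancedI) (simp_all add: tt_tt)
qed simp_all

text \<open>On generators this is \<open>takeuchi_aux\<close> with both right factors equal to the
  unit.\<close>

lemma D_takeuchi: assumes l: "l \<in> carrier L" and a: "a \<in> carrier V"
  shows "bal_sw K L2 (D l) (\<lambda>x y. pure2 (x \<diamondop> tt a) y) = bal_sw K L2 (D l) (\<lambda>x y. pure2 x (y \<diamondop> s a))"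
proof (rule bsw_D_ext[OF _ l])
  have b: "balanced L2 (\<lambda>x y. pure2 x (y \<diamondop> s a))"
    by (rule balancedI) (use a in \<open>simp_all add: proj2_bal lin_pure2_0\<close>)
  then show "(\<lambda>l. bal_sw K L2 (D l) (\<lambda>x y. pure2 x (y \<diamondop> s a))) \<in> lin_hom K L L2" by (rule bsw_D_lin)
  show "balanced L2 (\<lambda>x y. pure2 (x \<diamondop> tt a) y)"
    by (rule balancedI) (use a in \<open>simp_all add: proj2_bal lin_pure2_0\<close>)
  fix v h assume v: "v \<in> carrier V" and h: "h \<in> carrier H"
  show "cop L2 h (\<lambda>h1 h2. pure2 (s v \<diamondop> j h1 \<diamondop> tt a) (j h2)) = bal_sw K L2 (D (s v \<diamondop> j h)) (\<lambda>x y. pure2 x (y \<diamondop> s a))"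
    unfolding bsw_D_sj[OF b v h] using takeuchi_aux[OF v h a, of "\<one>\<^bsub>L\<^esub>" "\<one>\<^bsub>L\<^esub>"] v h a by (simp del: js js')
qed

theorem smash_lu_hopf_algebroid: "lu_hopf_algebroid K V L s \<rho> D ee tau"
proof -
  \<comment> \<open>The axioms contain \<open>\<rho>\<close> where the lemmas contain
    \<open>tt\<close>. The two are interchanged inside a sum by \<open>bsw_cong\<close>, because
    they agree only on carriers.\<close>
  have r: "bal_sw K L (D l) (\<lambda>x y. \<rho> (ee y) \<diamondop> x) = l" if "l \<in> carrier L" for l
    using bsw_cong[OF D_closed[OF that] modL, of "\<lambda>x y. tt (ee y) \<diamondop> x" "\<lambda>x y. \<rho> (ee y) \<diamondop> x"] that by (simp add: D_counit_r)
  have st: "bal_sw K L2 (D l) (\<lambda>x y. pure2 (s a \<diamondop> x) (\<rho> b \<diamondop> y)) = D (s a \<diamondop> \<rho> b \<diamondop> l)"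
    if "a \<in> carrier V" "b \<in> carrier V" "l \<in> carrier L" for a b l
    using D_st[of a b l] that by simp
  have bialg: "bialgebroid K V L s \<rho> D ee"
  proof (rule bialgebroid.intro)
    show "s \<in> alg_hom K V L" by (simp add: alg_hom_def)
    show "\<rho> \<in> alg_antihom K V L"
      using tt_mult by (simp add: alg_antihom_def lin_hom_L tt_rho[symmetric])
    show "D (s a \<diamondop> \<rho> b \<diamondop> l) = bal_sw K L2 (D l) (\<lambda>x y. pure2 (s a \<diamondop> x) (\<rho> b \<diamondop> y))"
      if "a \<in> carrier V" "b \<in> carrier V" "l \<in> carrier L" for a b l
      using that by (rule st[symmetric])
    show "ee (s a \<diamondop> \<rho> b \<diamondop> l) = a \<star> ee l \<star> b" if "a \<in> carrier V" "b \<in> carrier V" "l \<in> carrier L" for a b l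
      using that by (simp add: ee_st)
    show "ee (l \<diamondop> l') = ee (l \<diamondop> \<rho> (ee l'))" if "l \<in> carrier L" "l' \<in> carrier L" for l l'
      using ee_product_t[OF that] that by simp
    show "bal_sw K L2 (D l) (\<lambda>x y. pure2 (x \<diamondop> \<rho> a) y) = bal_sw K L2 (D l) (\<lambda>x y. pure2 x (y \<diamondop> s a))"
      if "l \<in> carrier L" "a \<in> carrier V" for l a using D_takeuchi[OF that] that by simp
    show "s a \<diamondop> \<rho> b = \<rho> b \<diamondop> s a" if "a \<in> carrier V" "b \<in> carrier V" for a b
      using tt_s[OF that(2,1)] that by simp
  qed (fact D_lin ee_lin algV algL D_coassociative D_counit_l r D_one D_product ee_product_s ee_s[OF ring_one[OF ringV], simplified])+
  show ?thesis
    unfolding lu_hopf_algebroid_def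
  proof (intro conjI bialg lu_hopf_algebroid_axioms.intro)
    show "tau \<in> alg_antihom K L L" using tau_lin tau_mult tau_j[of "\<one>\<^bsub>H\<^esub>"] by (simp add: alg_antihom_def)
    show "bij_betw tau (carrier L) (carrier L)"
      by (rule bij_betw_byWitness[where f' = taui]) (auto simp: taui_tau tau_taui)
  qed (simp_all add: tau_tt tt_rho[symmetric] ee_tau tau_right)
qed

end

subsection \<open>Quotient algebras and free algebras\<close>

lemma alg_homI:
  assumes "f \<in> lin_hom K A B" "f \<one>\<^bsub>A\<^esub> = \<one>\<^bsub>B\<^esub>"
    "\<And>x y. x \<in> carrier A \<Longrightarrow> y \<in> carrier A \<Longrightarrow> f (x \<otimes>\<^bsub>A\<^esub> y) = f x \<otimes>\<^bsub>B\<^esub> f y"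
  shows "f \<in> alg_hom K A B"
  using assms by (simp add: alg_hom_def)

lemma alg_homD:
  assumes "f \<in> alg_hom K A B"
  shows "f \<in> lin_hom K A B" "f \<one>\<^bsub>A\<^esub> = \<one>\<^bsub>B\<^esub>"
    "x \<in> carrier A \<Longrightarrow> y \<in> carrier A \<Longrightarrow> f (x \<otimes>\<^bsub>A\<^esub> y) = f x \<otimes>\<^bsub>B\<^esub> f y"
    "x \<in> carrier A \<Longrightarrow> f x \<in> carrier B"
  using assms lin_hom_closed[of f K A B x] by (simp_all add: alg_hom_def)

text \<open>A scalar multiple of \<open>x\<close> is the product of a multiple of the unit with
  \<open>x\<close>, so ideals absorb scalars.\<close>

lemma ideal_submodule:
  assumes A: "assoc_algebra K A" and I: "ideal I A"
  shows "submodule I K A"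
proof -
  interpret A: assoc_algebra K A by fact
  interpret I: ideal I A by fact
  show ?thesis
  proof (rule A.submoduleI)
    fix a x assume a: "a \<in> carrier K" and x: "x \<in> I"
    have "(a \<odot>\<^bsub>A\<^esub> \<one>\<^bsub>A\<^esub>) \<otimes>\<^bsub>A\<^esub> x \<in> I" using a x by (intro I.I_l_closed) simp_all
    then show "a \<odot>\<^bsub>A\<^esub> x \<in> I" using a x I.a_Hcarr by (simp add: A.smult_mult_l)
  qed (use I.a_subset in auto)
qed

locale quotient_algebra = assoc_algebra K A for K and A +
  fixes I assumes I: "ideal I A"
begin

sublocale Q: quotient_module K A I
  by (rule quotient_moduleI[OF module_axioms ideal_submodule[OF assoc_algebra_axioms I]])

lemma q_mult: "x \<in> carrier A \<Longrightarrow> y \<in> carrier A \<Longrightarrow> Q.q (x \<otimes>\<^bsub>A\<^esub> y) = Q.q x \<otimes>\<^bsub>quot A I\<^esub> Q.q y"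
  by (simp add: quot_def FactRing_def ring.defs ideal.rcoset_mult_add[OF I])

lemma q_one: "\<one>\<^bsub>quot A I\<^esub> = Q.q \<one>\<^bsub>A\<^esub>"
  by (simp add: quot_def FactRing_def ring.defs)

lemma quot_algebra: "assoc_algebra K (quot A I)"
proof -
  interpret QM: module K "quot A I" by (rule Q.quot_module)
  have "ring (quot A I)"
    by (intro ringI monoidI QM.abelian_group_axioms)
      (auto simp: Q.quot_carrier q_mult[symmetric] q_one Q.q_add[symmetric] l_distr r_distr ring_assoc[OF ring_axioms])
  then show ?thesis unfolding assoc_algebra_def assoc_algebra_axioms_def
    by (auto simp: QM.module_axioms Q.quot_carrier q_mult[symmetric] Q.q_smult[symmetric] smult_mult_l smult_mult_r)
qed

lemma q_alg_hom: "(\<lambda>x. Q.q x) \<in> alg_hom K A (quot A I)"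
  by (rule alg_homI) (simp_all add: Q.q_lin q_one q_mult)

lemma quot_alg_hom:
  assumes f: "f \<in> alg_hom K A B" and 0: "\<And>x. x \<in> I \<Longrightarrow> f x = \<zero>\<^bsub>B\<^esub>" and B: "assoc_algebra K B"
  shows "\<exists>g \<in> alg_hom K (quot A I) B. \<forall>x\<in>carrier A. g (Q.q x) = f x"
proof -
  interpret B: assoc_algebra K B by fact
  define g where "g Y = f (SOME x. x \<in> Y)" for Y
  have g: "g (Q.q x) = f x" if x: "x \<in> carrier A" for x
  proof -
    have "x \<in> Q.q x" using x by (simp add: Q.a_rcos_self)
    then have "(SOME y. y \<in> Q.q x) \<in> Q.q x" by (rule someI[where P = "\<lambda>y. y \<in> Q.q x"])
    then have y: "(SOME y. y \<in> Q.q x) \<in> carrier A" "Q.q (SOME y. y \<in> Q.q x) = Q.q x"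
      using Q.in_q[OF x] by auto
    then have "f (SOME y. y \<in> Q.q x) \<ominus>\<^bsub>B\<^esub> f x = \<zero>\<^bsub>B\<^esub>"
      using Q.q_eq[OF y(1) x] 0 x
      by (simp add: lin_hom_minus[OF module_axioms B.module_axioms alg_homD(1)[OF f], symmetric])
    then show ?thesis using x y alg_homD(4)[OF f] by (simp add: g_def B.M.minus_zero_iff)
  qed
  have "g \<in> alg_hom K (quot A I) B"
  proof (rule alg_homI)
    show "g \<in> lin_hom K (quot A I) B"
      by (rule lin_homI)
       (auto simp: Q.quot_carrier Q.q_add[symmetric] Q.q_smult[symmetric] g alg_homD[OF f] lin_hom_add[OF alg_homD(1)[OF f]] lin_hom_smult[OF alg_homD(1)[OF f]])
  qed (auto simp: Q.quot_carrier q_mult[symmetric] q_one g alg_homD[OF f])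
  then show ?thesis using g by blast
qed

end

text \<open>The kernel of an algebra map is an ideal, and the generated ideal is the least one
  containing \<open>X\<close>.\<close>

lemma genideal_vanish:
  assumes A: "assoc_algebra K A" and B: "assoc_algebra K B" and f: "f \<in> alg_hom K A B"
    and X: "X \<subseteq> carrier A" "\<And>x. x \<in> X \<Longrightarrow> f x = \<zero>\<^bsub>B\<^esub>" and x: "x \<in> genideal A X"
  shows "f x = \<zero>\<^bsub>B\<^esub>"
proof -
  interpret A: assoc_algebra K A by fact
  interpret B: assoc_algebra K B by fact
  note fl = alg_homD(1)[OF f]
  have "ideal {x \<in> carrier A. f x = \<zero>\<^bsub>B\<^esub>} A"
  proof (rule idealI)
    have "submodule {x \<in> carrier A. f x = \<zero>\<^bsub>B\<^esub>} K A"
      using kernel_submodule[OF A.module_axioms B.module_axioms fl lin_hom_zero_map[OF A.module_axioms B.module_axioms]] .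
    then show "subgroup {x \<in> carrier A. f x = \<zero>\<^bsub>B\<^esub>} (add_monoid A)" by (rule submodule.axioms(1))
  qed (auto simp: alg_homD[OF f] A.ring_axioms)
  then show ?thesis using A.genideal_minimal[of _ X] X x by blast
qed

section \<open>The free algebra on words\<close>

context
  fixes K :: "('k, 'a) ring_scheme" and X :: "'x set"
  assumes K: "cring K"
begin

interpretation K: cring K by (rule K)
abbreviation (input) "FM0 \<equiv> free_mod K (lists X)"
abbreviation (input) "WA0 \<equiv> word_alg K X"
interpretation F: module K "free_mod K (lists X)" by (rule free_mod_module[OF K])

lemma word_simps: "carrier WA0 = carrier FM0" "add WA0 = add FM0" "zero WA0 = zero FM0" "smult WA0 = smult FM0"
  "\<one>\<^bsub>WA0\<^esub> = free_gen K []"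
  "f \<otimes>\<^bsub>WA0\<^esub> g = (\<lambda>w. \<Oplus>\<^bsub>K\<^esub>i\<in>{..length w}. f (take i w) \<otimes>\<^bsub>K\<^esub> g (drop i w))"
  by (simp_all add: word_alg_def)

lemma word_lin: "lin_hom K WA0 U = lin_hom K FM0 U" "lin_hom K U WA0 = lin_hom K U FM0"
  by (auto simp: lin_hom_def word_simps(1-4))

lemma word_mult_closed:
  assumes f: "f \<in> carrier FM0" and g: "g \<in> carrier FM0" shows "f \<otimes>\<^bsub>WA0\<^esub> g \<in> carrier FM0"
proof -
  note f' = f[unfolded free_mod_carrier] and g' = g[unfolded free_mod_carrier]
  have z: "(f \<otimes>\<^bsub>WA0\<^esub> g) w = \<zero>\<^bsub>K\<^esub>" if "\<And>i. i \<le> length w \<Longrightarrow> f (take i w) = \<zero>\<^bsub>K\<^esub> \<or> g (drop i w) = \<zero>\<^bsub>K\<^esub>" for w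
    unfolding word_simps
  proof (rule K.add.finprod_one_eqI)
    fix i assume "i \<in> {..length w}"
    then show "f (take i w) \<otimes>\<^bsub>K\<^esub> g (drop i w) = \<zero>\<^bsub>K\<^esub>" using that[of i] f' g' by auto
  qed
  \<comment> \<open>A coefficient of the product at \<open>w\<close> is nonzero only if some cut of
    \<open>w\<close> meets both supports; hence the support consists of concatenations of words from
    two finite sets.\<close>
  have "{w. (f \<otimes>\<^bsub>WA0\<^esub> g) w \<noteq> \<zero>\<^bsub>K\<^esub>} \<subseteq> (\<lambda>(u, v). u @ v) ` ({u. f u \<noteq> \<zero>\<^bsub>K\<^esub>} \<times> {v. g v \<noteq> \<zero>\<^bsub>K\<^esub>})"
  proof
    fix w assume "w \<in> {w. (f \<otimes>\<^bsub>WA0\<^esub> g) w \<noteq> \<zero>\<^bsub>K\<^esub>}"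
    then obtain i where "f (take i w) \<noteq> \<zero>\<^bsub>K\<^esub>" "g (drop i w) \<noteq> \<zero>\<^bsub>K\<^esub>" using z by blast
    then show "w \<in> (\<lambda>(u, v). u @ v) ` ({u. f u \<noteq> \<zero>\<^bsub>K\<^esub>} \<times> {v. g v \<noteq> \<zero>\<^bsub>K\<^esub>})"
      by (intro image_eqI[of _ _ "(take i w, drop i w)"]) auto
  qed
  moreover have "finite ((\<lambda>(u, v). u @ v) ` ({u. f u \<noteq> \<zero>\<^bsub>K\<^esub>} \<times> {v. g v \<noteq> \<zero>\<^bsub>K\<^esub>}))"
    using f' g' by (intro finite_imageI finite_cartesian_product) auto
  ultimately have "finite {w. (f \<otimes>\<^bsub>WA0\<^esub> g) w \<noteq> \<zero>\<^bsub>K\<^esub>}" using finite_subset by blast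
  moreover have "(f \<otimes>\<^bsub>WA0\<^esub> g) w = \<zero>\<^bsub>K\<^esub>" if "w \<notin> lists X" for w
  proof (rule z)
    fix i
    have "take i w \<notin> lists X \<or> drop i w \<notin> lists X"
      using that append_in_lists_conv[of "take i w" "drop i w" X] by simp
    then show "f (take i w) = \<zero>\<^bsub>K\<^esub> \<or> g (drop i w) = \<zero>\<^bsub>K\<^esub>" using f' g' by blast
  qed
  moreover have "(f \<otimes>\<^bsub>WA0\<^esub> g) w \<in> carrier K" for w
    unfolding word_simps using f' g' by (intro K.finsum_closed) auto
  ultimately show ?thesis by (simp add: free_mod_carrier)
qed

lemma word_mult_lin_l: "g \<in> carrier FM0 \<Longrightarrow> (\<lambda>f. f \<otimes>\<^bsub>WA0\<^esub> g) \<in> lin_hom K FM0 FM0"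
  and word_mult_lin_r: "f \<in> carrier FM0 \<Longrightarrow> (\<lambda>g. f \<otimes>\<^bsub>WA0\<^esub> g) \<in> lin_hom K FM0 FM0"
proof -
  have a: "(\<Oplus>\<^bsub>K\<^esub>i\<in>A. x i \<oplus>\<^bsub>K\<^esub> y i) = (\<Oplus>\<^bsub>K\<^esub>i\<in>A. x i) \<oplus>\<^bsub>K\<^esub> (\<Oplus>\<^bsub>K\<^esub>i\<in>A. y i)"
    if "\<And>i. x i \<in> carrier K" "\<And>i. y i \<in> carrier K" for x y and A :: "nat set"
    by (rule K.finsum_addf) (use that in auto)
  have b: "(\<Oplus>\<^bsub>K\<^esub>i\<in>A. a \<otimes>\<^bsub>K\<^esub> x i) = a \<otimes>\<^bsub>K\<^esub> (\<Oplus>\<^bsub>K\<^esub>i\<in>A. x i)"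
    if "a \<in> carrier K" "\<And>i. x i \<in> carrier K" "finite A" for a x and A :: "nat set"
    by (rule K.finsum_rdistr[symmetric]) (use that in auto)
  show "g \<in> carrier FM0 \<Longrightarrow> (\<lambda>f. f \<otimes>\<^bsub>WA0\<^esub> g) \<in> lin_hom K FM0 FM0"
  proof (rule lin_homI)
    assume g: "g \<in> carrier FM0" fix f assume f: "f \<in> carrier FM0"
    show "f \<otimes>\<^bsub>WA0\<^esub> g \<in> carrier FM0" by (rule word_mult_closed[OF f g])
    have gc [simp]: "g w \<in> carrier K" and fc [simp]: "f w \<in> carrier K" for w using f g by (auto simp: free_mod_carrier)
    { fix f' assume "f' \<in> carrier FM0"
      then have [simp]: "f' w \<in> carrier K" for w by (auto simp: free_mod_carrier)
      show "(f \<oplus>\<^bsub>FM0\<^esub> f') \<otimes>\<^bsub>WA0\<^esub> g = f \<otimes>\<^bsub>WA0\<^esub> g \<oplus>\<^bsub>FM0\<^esub> f' \<otimes>\<^bsub>WA0\<^esub> g"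
        by (simp add: word_simps free_mod_simps K.l_distr a) }
    { fix c assume "c \<in> carrier K"
      then show "(c \<odot>\<^bsub>FM0\<^esub> f) \<otimes>\<^bsub>WA0\<^esub> g = c \<odot>\<^bsub>FM0\<^esub> (f \<otimes>\<^bsub>WA0\<^esub> g)"
        by (simp add: word_simps free_mod_simps K.m_assoc b) }
  qed
  show "f \<in> carrier FM0 \<Longrightarrow> (\<lambda>g. f \<otimes>\<^bsub>WA0\<^esub> g) \<in> lin_hom K FM0 FM0"
  proof (rule lin_homI)
    assume f: "f \<in> carrier FM0" fix g assume g: "g \<in> carrier FM0"
    show "f \<otimes>\<^bsub>WA0\<^esub> g \<in> carrier FM0" by (rule word_mult_closed[OF f g])
    have gc [simp]: "g w \<in> carrier K" and fc [simp]: "f w \<in> carrier K" for w using f g by (auto simp: free_mod_carrier)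
    { fix f' assume "f' \<in> carrier FM0"
      then have [simp]: "f' w \<in> carrier K" for w by (auto simp: free_mod_carrier)
      show "f \<otimes>\<^bsub>WA0\<^esub> (g \<oplus>\<^bsub>FM0\<^esub> f') = f \<otimes>\<^bsub>WA0\<^esub> g \<oplus>\<^bsub>FM0\<^esub> f \<otimes>\<^bsub>WA0\<^esub> f'"
        by (simp add: word_simps free_mod_simps K.r_distr a) }
    { fix c assume "c \<in> carrier K"
      then show "f \<otimes>\<^bsub>WA0\<^esub> (c \<odot>\<^bsub>FM0\<^esub> g) = c \<odot>\<^bsub>FM0\<^esub> (f \<otimes>\<^bsub>WA0\<^esub> g)"
        by (simp add: word_simps free_mod_simps K.m_lcomm b) }
  qed
qed

text \<open>Among all cuts of \<open>w\<close> only the one after \<open>length u\<close> letters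
  can contribute; if \<open>w\<close> is shorter, it is not the concatenation either.\<close>

lemma word_mult_gen: "free_gen K u \<otimes>\<^bsub>WA0\<^esub> free_gen K v = free_gen K (u @ v)"
proof
  fix w
  have "(free_gen K u \<otimes>\<^bsub>WA0\<^esub> free_gen K v) w =
     (\<Oplus>\<^bsub>K\<^esub>i\<in>{..length w}. if length u = i then (if w = u @ v then \<one>\<^bsub>K\<^esub> else \<zero>\<^bsub>K\<^esub>) else \<zero>\<^bsub>K\<^esub>)"
    unfolding word_simps
  proof (rule K.finsum_cong')
    fix i assume i: "i \<in> {..length w}"
    then have "take i w = u \<and> drop i w = v \<longleftrightarrow> length u = i \<and> w = u @ v"
      using append_take_drop_id[of i w] by (auto simp: min_def)
    then show "free_gen K u (take i w) \<otimes>\<^bsub>K\<^esub> free_gen K v (drop i w) =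
      (if length u = i then (if w = u @ v then \<one>\<^bsub>K\<^esub> else \<zero>\<^bsub>K\<^esub>) else \<zero>\<^bsub>K\<^esub>)"
      by (auto simp: free_gen_def)
  qed auto
  also have "\<dots> = free_gen K (u @ v) w"
  proof (cases "length u \<le> length w")
    case True
    then show ?thesis
      by (subst K.finsum_singleton) (auto simp: free_gen_def)
  next
    case False
    then have "w \<noteq> u @ v" by auto
    then show ?thesis by (auto simp: free_gen_def intro!: K.add.finprod_one_eqI)
  qed
  finally show "(free_gen K u \<otimes>\<^bsub>WA0\<^esub> free_gen K v) w = free_gen K (u @ v) w" .
qed

text \<open>The product is bilinear and concatenates basis words, so associativity and the unit laws
  reduce to those of lists.\<close>

lemma word_algebra: "assoc_algebra K WA0"
proof -
  note mc = word_mult_closed and ll = word_mult_lin_l and lr = word_mult_lin_r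
  have gc: "free_gen K u \<in> carrier FM0" if "u \<in> lists X" for u by (rule free_gen_closed[OF K that])
  have assoc: "f \<otimes>\<^bsub>WA0\<^esub> g \<otimes>\<^bsub>WA0\<^esub> h = f \<otimes>\<^bsub>WA0\<^esub> (g \<otimes>\<^bsub>WA0\<^esub> h)" if f: "f \<in> carrier FM0" and g: "g \<in> carrier FM0" and h: "h \<in> carrier FM0" for f g h
  proof (rule free_lin_ext[OF F.module_axioms lin_comp[OF ll[OF h] ll[OF g]] ll[OF mc[OF g h]] _ f])
    fix u assume u: "u \<in> lists X"
    show "free_gen K u \<otimes>\<^bsub>WA0\<^esub> g \<otimes>\<^bsub>WA0\<^esub> h = free_gen K u \<otimes>\<^bsub>WA0\<^esub> (g \<otimes>\<^bsub>WA0\<^esub> h)"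
    proof (rule free_lin_ext[OF F.module_axioms lin_comp[OF ll[OF h] lr[OF gc[OF u]]] lin_comp[OF lr[OF gc[OF u]] ll[OF h]] _ g])
      fix v assume v: "v \<in> lists X"
      have uv: "u @ v \<in> lists X" using u v by simp
      show "free_gen K u \<otimes>\<^bsub>WA0\<^esub> free_gen K v \<otimes>\<^bsub>WA0\<^esub> h = free_gen K u \<otimes>\<^bsub>WA0\<^esub> (free_gen K v \<otimes>\<^bsub>WA0\<^esub> h)"
        unfolding word_mult_gen
        by (rule free_lin_ext[OF F.module_axioms lr[OF gc[OF uv]] lin_comp[OF lr[OF gc[OF u]] lr[OF gc[OF v]]] _ h])
          (simp add: word_mult_gen)
    qed
  qed
  have nil: "[] \<in> lists X" by simp
  have one: "\<one>\<^bsub>WA0\<^esub> \<otimes>\<^bsub>WA0\<^esub> f = f" "f \<otimes>\<^bsub>WA0\<^esub> \<one>\<^bsub>WA0\<^esub> = f" if f: "f \<in> carrier FM0" for f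
    unfolding word_simps(5)
    using free_lin_ext[OF F.module_axioms lr[OF gc[OF nil]] lin_id _ f] free_lin_ext[OF F.module_axioms ll[OF gc[OF nil]] lin_id _ f]
    by (simp_all add: word_mult_gen)
  have m: "module K WA0"
    by (intro moduleI abelian_groupI K)
     (use F.M.l_neg in \<open>auto simp: word_simps(1-4) F.M.a_ac F.smult_l_distr F.smult_r_distr F.smult_assoc1 intro!: bexI[of _ "\<ominus>\<^bsub>FM0\<^esub> x" for x]\<close>)
  have "ring WA0"
    by (intro ringI monoidI module.axioms(2)[OF m])
      (simp_all add: assoc one mc gc word_simps(1-5) lin_hom_add[OF ll] lin_hom_add[OF lr] del: word_simps(6), simp_all add: word_simps(5)[symmetric] one)
  then show ?thesis unfolding assoc_algebra_def assoc_algebra_axioms_def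
    by (simp add: m word_simps(1-4) lin_hom_smult[OF ll] lin_hom_smult[OF lr])
qed

lemma word_alg_hom:
  assumes B: "assoc_algebra K B" and i: "\<And>x. x \<in> X \<Longrightarrow> i x \<in> carrier B"
  shows "\<exists>f\<in>alg_hom K WA0 B. \<forall>x\<in>X. f (free_gen K [x]) = i x"
proof -
  interpret B: assoc_algebra K B by fact
  define b where "b w = foldr (\<lambda>x y. i x \<otimes>\<^bsub>B\<^esub> y) w \<one>\<^bsub>B\<^esub>" for w
  have bc: "b w \<in> carrier B" if "w \<in> lists X" for w using that by (induction w) (auto simp: b_def i)
  have ba: "b (u @ v) = b u \<otimes>\<^bsub>B\<^esub> b v" if "u \<in> lists X" "v \<in> lists X" for u v
    using that
  proof (induction u)
    case Nil then show ?case using bc by (simp add: b_def)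
  next
    case (Cons x u)
    then have "b (x # u @ v) = i x \<otimes>\<^bsub>B\<^esub> (b u \<otimes>\<^bsub>B\<^esub> b v)" by (simp add: b_def)
    then show ?case using Cons bc[of u] bc[of v] i by (simp add: b_def B.m_assoc)
  qed
  let ?f = "free_ext K B b"
  have f: "?f \<in> lin_hom K FM0 B" by (rule free_ext_lin[OF B.module_axioms bc])
  have fg: "?f (free_gen K w) = b w" if "w \<in> lists X" for w by (rule free_ext_gen) (simp_all add: B.module_axioms bc that)
  have gc: "free_gen K u \<in> carrier FM0" if "u \<in> lists X" for u by (rule free_gen_closed[OF K that])
  have fm: "?f (x \<otimes>\<^bsub>WA0\<^esub> y) = ?f x \<otimes>\<^bsub>B\<^esub> ?f y" if x: "x \<in> carrier FM0" and y: "y \<in> carrier FM0" for x y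
  proof (rule free_lin_ext[OF B.module_axioms lin_comp[OF f word_mult_lin_l[OF y]] lin_mult_l[OF B f lin_hom_closed[OF f y]] _ x])
    fix u assume u: "u \<in> lists X"
    show "?f (free_gen K u \<otimes>\<^bsub>WA0\<^esub> y) = ?f (free_gen K u) \<otimes>\<^bsub>B\<^esub> ?f y"
      by (rule free_lin_ext[OF B.module_axioms lin_comp[OF f word_mult_lin_r[OF gc[OF u]]] lin_mult_r[OF B f lin_hom_closed[OF f gc[OF u]]] _ y])
        (use u in \<open>simp add: word_mult_gen fg ba\<close>)
  qed
  have "?f \<in> alg_hom K WA0 B"
    by (rule alg_homI) (simp_all add: word_lin f fm word_simps(1,5) fg b_def)
  moreover have "?f (free_gen K [x]) = i x" if "x \<in> X" for x using that i by (simp add: fg b_def)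
  ultimately show ?thesis by blast
qed

end

subsection \<open>The algebra \<open>H\<^sub>p\<^sub>a\<^sub>r\<close>\<close>

context hopf_bij
begin

abbreviation WA where "WA \<equiv> word_alg K (carrier H)"
abbreviation TA where "TA \<equiv> tensor_alg K H"
abbreviation HP where "HP \<equiv> hpar K H"
abbreviation tin where "tin \<equiv> tensor_alg_incl K H"
abbreviation brk where "brk \<equiv> br K H"

lemma word_gen_closed: "w \<in> lists (carrier H) \<Longrightarrow> free_gen K w \<in> carrier WA"
  by (simp add: word_simps[OF cringK] free_gen_closed)

lemma TA_quot: "quotient_algebra K WA (tensor_alg_null K H)"
proof -
  interpret WA: assoc_algebra K WA by (rule word_algebra[OF cringK])
  show ?thesis
    unfolding quotient_algebra_def quotient_algebra_axioms_def tensor_alg_null_def Let_def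
    by (intro conjI WA.assoc_algebra_axioms WA.genideal_ideal Un_least subsetI; elim CollectE exE conjE; hypsubst;
        intro WA.M.minus_closed WA.M.add.m_closed WA.smult_closed word_gen_closed) auto
qed

lemma TA_gens:
  "v \<in> carrier H \<Longrightarrow> v' \<in> carrier H \<Longrightarrow> free_gen K [v \<oplus>\<^bsub>H\<^esub> v'] \<ominus>\<^bsub>WA\<^esub> (free_gen K [v] \<oplus>\<^bsub>WA\<^esub> free_gen K [v']) \<in> tensor_alg_null K H"
  "a \<in> carrier K \<Longrightarrow> v \<in> carrier H \<Longrightarrow> free_gen K [a \<odot>\<^bsub>H\<^esub> v] \<ominus>\<^bsub>WA\<^esub> (a \<odot>\<^bsub>WA\<^esub> free_gen K [v]) \<in> tensor_alg_null K H"
  unfolding tensor_alg_null_def Let_def genideal_def by blast+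

lemma tin_def': "tin h = tensor_alg_null K H +>\<^bsub>WA\<^esub> free_gen K [h]"
  by (simp add: tensor_alg_incl_def)

lemma algTA [simp]: "assoc_algebra K TA"
  unfolding tensor_alg_def by (rule quotient_algebra.quot_algebra[OF TA_quot])
lemma modTA [simp]: "module K TA" by (rule assoc_algebra_module[OF algTA])
lemma ringTA [simp]: "ring TA" by (rule assoc_algebra_ring[OF algTA])

lemma tin_lin [simp]: "tin \<in> lin_hom K H TA"
proof -
  interpret Q: quotient_algebra K WA "tensor_alg_null K H" by (rule TA_quot)
  have g: "free_gen K [h] \<in> carrier WA" if "h \<in> carrier H" for h using that by (simp add: word_gen_closed)
  show ?thesis
    by (rule lin_homI)
     (simp_all add: tensor_alg_def tin_def' Q.Q.q_closed g Q.Q.q_add[symmetric] Q.Q.q_smult[symmetric] Q.Q.q_eq TA_gens)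
qed

lemma tin_closed [simp]: "h \<in> carrier H \<Longrightarrow> tin h \<in> carrier TA" by (rule lin_hom_closed[OF tin_lin])

lemma TA_universal:
  assumes B: "assoc_algebra K B" and i: "i \<in> lin_hom K H B"
  shows "\<exists>f\<in>alg_hom K TA B. \<forall>h\<in>carrier H. f (tin h) = i h"
proof -
  interpret Q: quotient_algebra K WA "tensor_alg_null K H" by (rule TA_quot)
  interpret B: assoc_algebra K B by (rule B)
  obtain f where f: "f \<in> alg_hom K WA B" "\<And>h. h \<in> carrier H \<Longrightarrow> f (free_gen K [h]) = i h"
    using word_alg_hom[OF cringK B, of "carrier H" i] lin_hom_closed[OF i] by blast
  note fl = alg_homD(1)[OF f(1)]
  have g: "free_gen K [h] \<in> carrier WA" if "h \<in> carrier H" for h using that by (simp add: word_gen_closed)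
  have "f x = \<zero>\<^bsub>B\<^esub>" if x: "x \<in> tensor_alg_null K H" for x
  proof (rule genideal_vanish[OF word_algebra[OF cringK] B f(1) _ _ x[unfolded tensor_alg_null_def Let_def]])
    show "{free_gen K [v \<oplus>\<^bsub>H\<^esub> v'] \<ominus>\<^bsub>WA\<^esub> (free_gen K [v] \<oplus>\<^bsub>WA\<^esub> free_gen K [v']) |v v'. v \<in> carrier H \<and> v' \<in> carrier H} \<union>
      {free_gen K [a \<odot>\<^bsub>H\<^esub> v] \<ominus>\<^bsub>WA\<^esub> a \<odot>\<^bsub>WA\<^esub> free_gen K [v] |a v. a \<in> carrier K \<and> v \<in> carrier H} \<subseteq> carrier WA"
      using g by (auto intro!: Q.M.minus_closed)
  next
    fix y assume "y \<in> {free_gen K [v \<oplus>\<^bsub>H\<^esub> v'] \<ominus>\<^bsub>WA\<^esub> (free_gen K [v] \<oplus>\<^bsub>WA\<^esub> free_gen K [v']) |v v'. v \<in> carrier H \<and> v' \<in> carrier H} \<union>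
      {free_gen K [a \<odot>\<^bsub>H\<^esub> v] \<ominus>\<^bsub>WA\<^esub> a \<odot>\<^bsub>WA\<^esub> free_gen K [v] |a v. a \<in> carrier K \<and> v \<in> carrier H}"
    then show "f y = \<zero>\<^bsub>B\<^esub>"
      using lin_hom_closed[OF i] g
      by (auto simp: lin_hom_minus[OF Q.module_axioms B.module_axioms fl] lin_hom_add[OF fl] lin_hom_smult[OF fl] f(2)
          lin_hom_add[OF i] lin_hom_smult[OF i] B.M.minus_zero_iff)
  qed
  from Q.quot_alg_hom[OF f(1) this B] obtain g' where
    "g' \<in> alg_hom K TA B" "\<And>x. x \<in> carrier WA \<Longrightarrow> g' (tensor_alg_null K H +>\<^bsub>WA\<^esub> x) = f x"
    unfolding tensor_alg_def by blast
  then show ?thesis using f(2) g by (intro bexI[of _ g']) (simp_all add: tin_def')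
qed

section \<open>Partial representations and the presentation of \<open>hpar\<close>\<close>

definition prep where "prep B \<pi> \<longleftrightarrow> assoc_algebra K B \<and> \<pi> \<in> lin_hom K H B \<and> \<pi> \<one>\<^bsub>H\<^esub> = \<one>\<^bsub>B\<^esub> \<and>
  (\<forall>h\<in>carrier H. \<forall>l\<in>carrier H. cop B l (\<lambda>l1 l2. \<pi> h \<otimes>\<^bsub>B\<^esub> (\<pi> l1 \<otimes>\<^bsub>B\<^esub> \<pi> (S l2))) = cop B l (\<lambda>l1 l2. \<pi> (h \<bullet> l1) \<otimes>\<^bsub>B\<^esub> \<pi> (S l2))) \<and>
  (\<forall>h\<in>carrier H. \<forall>l\<in>carrier H. cop B h (\<lambda>h1 h2. \<pi> h1 \<otimes>\<^bsub>B\<^esub> (\<pi> (S h2) \<otimes>\<^bsub>B\<^esub> \<pi> l)) = cop B h (\<lambda>h1 h2. \<pi> h1 \<otimes>\<^bsub>B\<^esub> \<pi> (S h2 \<bullet> l)))"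

text \<open>The relations in the normal form of the simplifier: triple products bracketed to the
  right and sums in terms of \<open>tsw\<close>, matching \<open>prep\<close>.\<close>

lemma partial_rels_eq: "partial_rels K H = {tin \<one>\<^bsub>H\<^esub> \<ominus>\<^bsub>TA\<^esub> \<one>\<^bsub>TA\<^esub>}
     \<union> {cop TA l (\<lambda>l1 l2. tin h \<otimes>\<^bsub>TA\<^esub> (tin l1 \<otimes>\<^bsub>TA\<^esub> tin (S l2))) \<ominus>\<^bsub>TA\<^esub> cop TA l (\<lambda>l1 l2. tin (h \<bullet> l1) \<otimes>\<^bsub>TA\<^esub> tin (S l2))
        | h l. h \<in> carrier H \<and> l \<in> carrier H}
     \<union> {cop TA h (\<lambda>h1 h2. tin h1 \<otimes>\<^bsub>TA\<^esub> (tin (S h2) \<otimes>\<^bsub>TA\<^esub> tin l)) \<ominus>\<^bsub>TA\<^esub> cop TA h (\<lambda>h1 h2. tin h1 \<otimes>\<^bsub>TA\<^esub> tin (S h2 \<bullet> l))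
        | h l. h \<in> carrier H \<and> l \<in> carrier H}"
proof -
  have "sw K TA (comult H l) (\<lambda>l1 l2. tin h \<otimes>\<^bsub>TA\<^esub> tin l1 \<otimes>\<^bsub>TA\<^esub> tin (S l2)) = cop TA l (\<lambda>l1 l2. tin h \<otimes>\<^bsub>TA\<^esub> (tin l1 \<otimes>\<^bsub>TA\<^esub> tin (S l2)))"
    "sw K TA (comult H l) (\<lambda>l1 l2. tin (h \<bullet> l1) \<otimes>\<^bsub>TA\<^esub> tin (S l2)) = cop TA l (\<lambda>l1 l2. tin (h \<bullet> l1) \<otimes>\<^bsub>TA\<^esub> tin (S l2))"
    "sw K TA (comult H h) (\<lambda>h1 h2. tin h1 \<otimes>\<^bsub>TA\<^esub> tin (S h2) \<otimes>\<^bsub>TA\<^esub> tin l) = cop TA h (\<lambda>h1 h2. tin h1 \<otimes>\<^bsub>TA\<^esub> (tin (S h2) \<otimes>\<^bsub>TA\<^esub> tin l))"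
    "sw K TA (comult H h) (\<lambda>h1 h2. tin h1 \<otimes>\<^bsub>TA\<^esub> tin (S h2 \<bullet> l)) = cop TA h (\<lambda>h1 h2. tin h1 \<otimes>\<^bsub>TA\<^esub> tin (S h2 \<bullet> l))"
    if "h \<in> carrier H" "l \<in> carrier H" for h l
    using that by (simp_all add: sw_cop)
  note e = this
  show ?thesis unfolding partial_rels_def Let_def
    by (intro arg_cong2[where f = "(\<union>)"] refl Collect_cong iff_exI; auto simp: e)
qed

lemma partial_rels_closed: "partial_rels K H \<subseteq> carrier TA"
proof -
  interpret TA: assoc_algebra K TA by simp
  show ?thesis unfolding partial_rels_eq
    by (intro Un_least subsetI; (elim CollectE exE conjE singletonE)?; hypsubst; intro TA.M.minus_closed) simp_all
qed

abbreviation JP where "JP \<equiv> genideal TA (partial_rels K H)"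

lemma HP_quot: "quotient_algebra K TA JP"
proof -
  interpret TA: assoc_algebra K TA by simp
  show ?thesis unfolding quotient_algebra_def quotient_algebra_axioms_def
    by (intro conjI algTA TA.genideal_ideal partial_rels_closed)
qed

lemma algHP [simp]: "assoc_algebra K HP"
  unfolding hpar_def by (rule quotient_algebra.quot_algebra[OF HP_quot])
lemma modHP [simp]: "module K HP" by (rule assoc_algebra_module[OF algHP])
lemma ringHP [simp]: "ring HP" by (rule assoc_algebra_ring[OF algHP])

lemma HP_proj: "(\<lambda>x. JP +>\<^bsub>TA\<^esub> x) \<in> alg_hom K TA HP"
  unfolding hpar_def by (rule quotient_algebra.q_alg_hom[OF HP_quot])

lemma br_lin [simp]: "brk \<in> lin_hom K H HP"
  using lin_comp[OF alg_homD(1)[OF HP_proj] tin_lin] by (simp add: br_def[abs_def])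
lemma br_closed [simp]: "h \<in> carrier H \<Longrightarrow> brk h \<in> carrier HP" by (rule lin_hom_closed[OF br_lin])
lemma lin_br [simp]: "f \<in> lin_hom K U H \<Longrightarrow> (\<lambda>x. brk (f x)) \<in> lin_hom K U HP" by (rule lin_comp[OF br_lin])

lemma HP_rel: "x \<in> carrier TA \<Longrightarrow> y \<in> carrier TA \<Longrightarrow> x \<ominus>\<^bsub>TA\<^esub> y \<in> partial_rels K H \<Longrightarrow> JP +>\<^bsub>TA\<^esub> x = JP +>\<^bsub>TA\<^esub> y"
proof -
  interpret Q: quotient_algebra K TA JP by (rule HP_quot)
  assume "x \<in> carrier TA" "y \<in> carrier TA" "x \<ominus>\<^bsub>TA\<^esub> y \<in> partial_rels K H"
  then show ?thesis using Q.genideal_self[OF partial_rels_closed] by (auto simp: Q.Q.q_eq)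
qed

lemma br_prep: "prep HP brk"
proof -
  note p = alg_homD[OF HP_proj]
  have c: "JP +>\<^bsub>TA\<^esub> (cop TA h B) = cop HP h (\<lambda>a b. JP +>\<^bsub>TA\<^esub> B a b)"
    if "h \<in> carrier H" "\<And>a b. a \<in> carrier H \<Longrightarrow> b \<in> carrier H \<Longrightarrow> B a b \<in> carrier TA" for h B
    by (rule tsw_hom[OF _ _ _ _ p(1)]) (use that in simp_all)
  have b: "brk h = JP +>\<^bsub>TA\<^esub> tin h" for h by (simp add: br_def)
  show ?thesis unfolding prep_def
  proof (intro conjI ballI)
    have "JP +>\<^bsub>TA\<^esub> tin \<one>\<^bsub>H\<^esub> = JP +>\<^bsub>TA\<^esub> \<one>\<^bsub>TA\<^esub>" by (rule HP_rel) (simp_all add: partial_rels_eq)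
    then show "brk \<one>\<^bsub>H\<^esub> = \<one>\<^bsub>HP\<^esub>" using p(2) by (simp add: b)
  next
    fix h l assume h: "h \<in> carrier H" and l: "l \<in> carrier H"
    have "JP +>\<^bsub>TA\<^esub> cop TA l (\<lambda>l1 l2. tin h \<otimes>\<^bsub>TA\<^esub> (tin l1 \<otimes>\<^bsub>TA\<^esub> tin (S l2))) = JP +>\<^bsub>TA\<^esub> cop TA l (\<lambda>l1 l2. tin (h \<bullet> l1) \<otimes>\<^bsub>TA\<^esub> tin (S l2))"
      by (rule HP_rel) (use h l in \<open>auto simp: partial_rels_eq\<close>)
    then show "cop HP l (\<lambda>l1 l2. brk h \<otimes>\<^bsub>HP\<^esub> (brk l1 \<otimes>\<^bsub>HP\<^esub> brk (S l2))) = cop HP l (\<lambda>l1 l2. brk (h \<bullet> l1) \<otimes>\<^bsub>HP\<^esub> brk (S l2))"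
      using h l by (simp add: c p(3) b[symmetric])
    have "JP +>\<^bsub>TA\<^esub> cop TA h (\<lambda>h1 h2. tin h1 \<otimes>\<^bsub>TA\<^esub> (tin (S h2) \<otimes>\<^bsub>TA\<^esub> tin l)) = JP +>\<^bsub>TA\<^esub> cop TA h (\<lambda>h1 h2. tin h1 \<otimes>\<^bsub>TA\<^esub> tin (S h2 \<bullet> l))"
      by (rule HP_rel) (use h l in \<open>auto simp: partial_rels_eq\<close>)
    then show "cop HP h (\<lambda>h1 h2. brk h1 \<otimes>\<^bsub>HP\<^esub> (brk (S h2) \<otimes>\<^bsub>HP\<^esub> brk l)) = cop HP h (\<lambda>h1 h2. brk h1 \<otimes>\<^bsub>HP\<^esub> brk (S h2 \<bullet> l))"
      using h l by (simp add: c p(3) b[symmetric])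
  qed simp_all
qed

lemma br_one [simp]: "brk \<one>\<^bsub>H\<^esub> = \<one>\<^bsub>HP\<^esub>" using br_prep by (simp add: prep_def)

text \<open>The generators of the ideal are the differences of the two sides of the conditions in
  \<open>prep\<close>, so the map induced on the tensor algebra kills the ideal.\<close>

theorem hpar_universal:
  assumes \<pi>: "prep B \<pi>"
  shows "\<exists>f\<in>alg_hom K HP B. \<forall>h\<in>carrier H. f (brk h) = \<pi> h"
proof -
  interpret Q: quotient_algebra K TA JP by (rule HP_quot)
  have algB [simp]: "assoc_algebra K B" and l [simp]: "\<pi> \<in> lin_hom K H B" using \<pi> by (simp_all add: prep_def)
  interpret B: assoc_algebra K B by simp
  have [simp]: "ring B" "module K B" by (simp_all add: B.ring_axioms B.module_axioms)
  note [simp] = lin_hom_closed[OF l] lin_comp[OF l]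
  obtain f where f: "f \<in> alg_hom K TA B" "\<And>h. h \<in> carrier H \<Longrightarrow> f (tin h) = \<pi> h"
    using TA_universal[OF algB l] by blast
  note fl = alg_homD(1)[OF f(1)]
  have c: "f (cop TA h C) = cop B h (\<lambda>a b. f (C a b))"
    if "h \<in> carrier H" "\<And>a b. a \<in> carrier H \<Longrightarrow> b \<in> carrier H \<Longrightarrow> C a b \<in> carrier TA" for h C
    by (rule tsw_hom[OF _ _ _ _ fl]) (use that in simp_all)
  have v: "f x = \<zero>\<^bsub>B\<^esub>" if x: "x \<in> JP" for x
  proof (rule genideal_vanish[OF algTA algB f(1) partial_rels_closed _ x])
    fix y assume "y \<in> partial_rels K H"
    then show "f y = \<zero>\<^bsub>B\<^esub>" unfolding partial_rels_eq
      by (elim UnE CollectE exE conjE singletonE; hypsubst)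
        (use \<pi> in \<open>simp_all add: lin_hom_minus[OF Q.module_axioms B.module_axioms fl] c alg_homD(2,3)[OF f(1)] f(2) prep_def B.M.minus_zero_iff\<close>)
  qed
  from Q.quot_alg_hom[OF f(1) v algB] obtain g where
    "g \<in> alg_hom K HP B" "\<And>x. x \<in> carrier TA \<Longrightarrow> g (JP +>\<^bsub>TA\<^esub> x) = f x"
    unfolding hpar_def by blast
  then show ?thesis using f(2) by (intro bexI[of _ g]) (simp_all add: br_def)
qed

text \<open>Products of brackets span \<open>hpar\<close>. The unit is the bracket of the unit of
  \<open>H\<close>, and zero is its zero multiple, so neither needs a separate case.\<close>

lemma hpar_induct:
  assumes x: "x \<in> carrier HP"
    and P: "\<And>h. h \<in> carrier H \<Longrightarrow> P (brk h)" "\<And>x y. \<lbrakk>x \<in> carrier HP; y \<in> carrier HP; P x; P y\<rbrakk> \<Longrightarrow> P (x \<oplus>\<^bsub>HP\<^esub> y)"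
      "\<And>a x. \<lbrakk>a \<in> carrier K; x \<in> carrier HP; P x\<rbrakk> \<Longrightarrow> P (a \<odot>\<^bsub>HP\<^esub> x)"
      "\<And>x y. \<lbrakk>x \<in> carrier HP; y \<in> carrier HP; P x; P y\<rbrakk> \<Longrightarrow> P (x \<otimes>\<^bsub>HP\<^esub> y)"
  shows "P x"
proof -
  interpret Q1: quotient_algebra K WA "tensor_alg_null K H" by (rule TA_quot)
  interpret Q2: quotient_algebra K TA JP by (rule HP_quot)
  interpret HP: module K HP by simp
  let ?p = "\<lambda>w. JP +>\<^bsub>TA\<^esub> (tensor_alg_null K H +>\<^bsub>WA\<^esub> w)"
  have l: "(\<lambda>w. tensor_alg_null K H +>\<^bsub>WA\<^esub> w) \<in> alg_hom K WA TA" unfolding tensor_alg_def by (rule Q1.q_alg_hom)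
  have p: "?p \<in> lin_hom K WA HP" by (rule lin_comp[OF alg_homD(1)[OF HP_proj] alg_homD(1)[OF l]])
  have pm: "?p (u \<otimes>\<^bsub>WA\<^esub> v) = ?p u \<otimes>\<^bsub>HP\<^esub> ?p v" if "u \<in> carrier WA" "v \<in> carrier WA" for u v
    using that by (simp add: alg_homD[OF HP_proj] alg_homD[OF l])
  have P1: "P \<one>\<^bsub>HP\<^esub>" using P(1)[of "\<one>\<^bsub>H\<^esub>"] by simp
  have P0: "P \<zero>\<^bsub>HP\<^esub>" using P(3)[OF _ _ P1, of "\<zero>\<^bsub>K\<^esub>"] by simp
  have word: "P (?p (free_gen K w))" if "w \<in> lists (carrier H)" for w
    using that
  proof (induction w)
    case Nil
    have "?p (free_gen K []) = \<one>\<^bsub>HP\<^esub>" using alg_homD(2)[OF l] alg_homD(2)[OF HP_proj] by (simp add: word_simps(5)[OF cringK])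
    then show ?case using P1 by simp
  next
    case (Cons h w)
    have "?p (free_gen K (h # w)) = brk h \<otimes>\<^bsub>HP\<^esub> ?p (free_gen K w)"
      using pm[of "free_gen K [h]" "free_gen K w"] Cons by (simp add: word_gen_closed word_mult_gen[OF cringK] br_def tin_def')
    then show ?case using Cons P(1)[of h] P(4) lin_hom_closed[OF p word_gen_closed, of w] by simp
  qed
  have "x \<in> (\<lambda>u. JP +>\<^bsub>TA\<^esub> u) ` carrier TA" using x Q2.Q.quot_carrier by (simp add: hpar_def)
  moreover have "carrier TA = (\<lambda>w. tensor_alg_null K H +>\<^bsub>WA\<^esub> w) ` carrier WA"
    using Q1.Q.quot_carrier by (simp add: tensor_alg_def)
  ultimately obtain w where w: "w \<in> carrier (free_mod K (lists (carrier H)))" "x = ?p w"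
    by (auto simp: word_simps(1)[OF cringK])
  note ws = word_simps(1-4)[OF cringK, of "carrier H"]
  have "P (?p w)"
  proof (rule free_mod_induct[OF cringK w(1)])
    show "P (?p \<zero>\<^bsub>free_mod K (lists (carrier H))\<^esub>)"
      using lin_hom_zero[OF Q1.module_axioms HP.module_axioms p] P0 by (simp add: ws)
    show "P (?p (f \<oplus>\<^bsub>free_mod K (lists (carrier H))\<^esub> g))"
      if "f \<in> carrier (free_mod K (lists (carrier H)))" "g \<in> carrier (free_mod K (lists (carrier H)))" "P (?p f)" "P (?p g)" for f g
      using that P(2) lin_hom_add[OF p, of f g] lin_hom_closed[OF p] by (simp add: ws)
    show "P (?p (a \<odot>\<^bsub>free_mod K (lists (carrier H))\<^esub> f))"
      if "a \<in> carrier K" "f \<in> carrier (free_mod K (lists (carrier H)))" "P (?p f)" for a f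
      using that P(3) lin_hom_smult[OF p, of a f] lin_hom_closed[OF p] by (simp add: ws)
  qed (rule word)
  then show ?thesis using w(2) by simp
qed

subsection \<open>The partial module algebra \<open>A\<^sub>p\<^sub>a\<^sub>r\<close>\<close>

abbreviation AP where "AP \<equiv> apar K H"
abbreviation pm (infixl "\<cdot>" 70) where "x \<cdot> y \<equiv> x \<otimes>\<^bsub>HP\<^esub> y"
abbreviation e where "e \<equiv> par_eps K H"
abbreviation ac where "ac \<equiv> apar_act K H"

lemma e_eq: "h \<in> carrier H \<Longrightarrow> e h = cop HP h (\<lambda>a b. brk a \<cdot> brk (S b))"
  by (simp add: par_eps_def sw_cop)

lemma e_one [simp]: "e \<one>\<^bsub>H\<^esub> = \<one>\<^bsub>HP\<^esub>" by (simp add: e_eq)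

lemma ac_eq: "h \<in> carrier H \<Longrightarrow> x \<in> carrier HP \<Longrightarrow> ac h x = cop HP h (\<lambda>a b. brk a \<cdot> (x \<cdot> brk (S b)))"
  by (simp add: apar_act_def sw_cop)

lemma e_closedP [simp]: "h \<in> carrier H \<Longrightarrow> e h \<in> carrier HP" by (simp add: e_eq)
lemma ac_closedP [simp]: "h \<in> carrier H \<Longrightarrow> x \<in> carrier HP \<Longrightarrow> ac h x \<in> carrier HP" by (simp add: ac_eq)

lemma lin_congI: "f \<in> lin_hom K U W \<Longrightarrow> (\<And>x. x \<in> carrier U \<Longrightarrow> g x = f x) \<Longrightarrow> module K U \<Longrightarrow> g \<in> lin_hom K U W"
  by (rule lin_homI) (simp_all add: lin_hom_closed lin_hom_add lin_hom_smult abelian_monoid.a_closed[OF abelian_group.axioms(1)[OF module.axioms(2)]])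

lemma e_linP [simp]: "e \<in> lin_hom K H HP"
  by (rule lin_congI[where f = "\<lambda>h. cop HP h (\<lambda>a b. brk a \<cdot> brk (S b))"]) (simp_all add: e_eq)
lemma lin_eP [simp]: "f \<in> lin_hom K U H \<Longrightarrow> (\<lambda>x. e (f x)) \<in> lin_hom K U HP" by (rule lin_comp[OF e_linP])
lemma ac_linP1: "x \<in> carrier HP \<Longrightarrow> (\<lambda>h. ac h x) \<in> lin_hom K H HP"
  by (rule lin_congI[where f = "\<lambda>h. cop HP h (\<lambda>a b. brk a \<cdot> (x \<cdot> brk (S b)))"]) (simp_all add: ac_eq)
lemma ac_linP2: "h \<in> carrier H \<Longrightarrow> (\<lambda>x. ac h x) \<in> lin_hom K HP HP"
  by (rule lin_congI[where f = "\<lambda>x. cop HP h (\<lambda>a b. brk a \<cdot> (x \<cdot> brk (S b)))"]) (simp_all add: ac_eq)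
lemma lin_acP1 [simp]: "f \<in> lin_hom K U H \<Longrightarrow> x \<in> carrier HP \<Longrightarrow> (\<lambda>u. ac (f u) x) \<in> lin_hom K U HP"
  by (rule lin_comp[OF ac_linP1])
lemma lin_acP2 [simp]: "h \<in> carrier H \<Longrightarrow> f \<in> lin_hom K U HP \<Longrightarrow> (\<lambda>u. ac h (f u)) \<in> lin_hom K U HP"
  by (rule lin_comp[OF ac_linP2])

section \<open>Commutation rules for brackets and the generators of \<open>apar\<close>\<close>

lemma br_e: "h \<in> carrier H \<Longrightarrow> l \<in> carrier H \<Longrightarrow> brk h \<cdot> e l = cop HP l (\<lambda>l1 l2. brk (h \<bullet> l1) \<cdot> brk (S l2))"
  using br_prep by (simp add: e_eq prep_def)

lemma e_br: "h \<in> carrier H \<Longrightarrow> l \<in> carrier H \<Longrightarrow> e h \<cdot> brk l = cop HP h (\<lambda>h1 h2. brk h1 \<cdot> brk (S h2 \<bullet> l))"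
  using br_prep by (simp add: e_eq prep_def)

text \<open>Expanding the right side by \<open>e_br\<close> produces
  \<open>S q \<bullet> (S y \<bullet> z)\<close>, whose last two factors cancel; what remains is the
  first relation of a partial representation.\<close>

lemma br_e': assumes h: "h \<in> carrier H" and l: "l \<in> carrier H"
  shows "brk h \<cdot> e l = cop HP h (\<lambda>h1 h2. e (h1 \<bullet> l) \<cdot> brk h2)"
proof -
  have "cop HP h (\<lambda>h1 h2. e (h1 \<bullet> l) \<cdot> brk h2) = cop HP h (\<lambda>x u. cop HP u (\<lambda>y z. cop HP l (\<lambda>p q. brk (x \<bullet> p) \<cdot> brk (S q \<bullet> (S y \<bullet> z)))))"
    using h l by (simp add: e_br)
  also have "\<dots> = cop HP l (\<lambda>p q. brk (h \<bullet> p) \<cdot> brk (S q \<bullet> \<one>\<^bsub>H\<^esub>))"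
    by (rule chain_r_Sl[where G = "\<lambda>x w. cop HP l (\<lambda>p q. brk (x \<bullet> p) \<cdot> brk (S q \<bullet> w))"]) (use h l in simp_all)
  finally show ?thesis using h l by (simp add: br_e)
qed

text \<open>Measures the failure of brackets to be multiplicative. Expanding \<open>e h1\<close> by
  the second relation lets \<open>S y \<bullet> z\<close> cancel.\<close>

lemma br_br: assumes h: "h \<in> carrier H" and k: "k \<in> carrier H"
  shows "brk h \<cdot> brk k = cop HP h (\<lambda>h1 h2. e h1 \<cdot> brk (h2 \<bullet> k))"
proof -
  have "cop HP h (\<lambda>h1 h2. e h1 \<cdot> brk (h2 \<bullet> k)) = cop HP h (\<lambda>x u. cop HP u (\<lambda>y z. brk x \<cdot> brk (S y \<bullet> z \<bullet> k)))"
    using h k by (simp add: e_br)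
  also have "\<dots> = brk h \<cdot> brk (\<one>\<^bsub>H\<^esub> \<bullet> k)"
    by (rule chain_r_Sl[where G = "\<lambda>x w. brk x \<cdot> brk (w \<bullet> k)"]) (use h k in simp_all)
  finally show ?thesis using h k by simp
qed

text \<open>The inverse of \<open>br_e'\<close>: substituting that rule on the right leaves
  \<open>y \<bullet> Si x\<close>, which cancels.\<close>

lemma e_br': assumes m: "m \<in> carrier H" and l: "l \<in> carrier H"
  shows "e m \<cdot> brk l = cop HP l (\<lambda>l1 l2. brk l2 \<cdot> e (Si l1 \<bullet> m))"
proof -
  have "cop HP l (\<lambda>l1 l2. brk l2 \<cdot> e (Si l1 \<bullet> m)) = cop HP l (\<lambda>x u. cop HP u (\<lambda>y z. e (y \<bullet> Si x \<bullet> m) \<cdot> brk z))"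
    using m l by (simp add: br_e')
  also have "\<dots> = e (\<one>\<^bsub>H\<^esub> \<bullet> m) \<cdot> brk l"
    by (rule chain_l_Sir[where G = "\<lambda>w z. e (w \<bullet> m) \<cdot> brk z"]) (use m l in simp_all)
  finally show ?thesis using m l by simp
qed

lemma AP_simps: "mult AP = mult HP" "one AP = one HP" "add AP = add HP" "zero AP = zero HP" "smult AP = smult HP"
  "carrier AP = subalgebra_gen K HP (e ` carrier H)"
  by (simp_all add: apar_def)

lemma AP_sub: "subring (carrier AP) HP" "submodule (carrier AP) K HP" "e ` carrier H \<subseteq> carrier AP"
  and AP_least: "\<lbrakk>subring C HP; submodule C K HP; e ` carrier H \<subseteq> C\<rbrakk> \<Longrightarrow> carrier AP \<subseteq> C"
proof -
  interpret HP: assoc_algebra K HP by simp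
  let ?F = "{C. subring C HP \<and> submodule C K HP \<and> e ` carrier H \<subseteq> C}"
  have top: "carrier HP \<in> ?F"
    using HP.carrier_is_subring HP.carrier_is_submodule by auto
  have sub: "\<Inter>?F \<subseteq> carrier HP" using top by blast
  show "subring (carrier AP) HP" unfolding AP_simps subalgebra_gen_def
    by (rule HP.subringI) (use sub in \<open>auto simp: HP.ring_axioms intro: subringE\<close>)
  show "submodule (carrier AP) K HP" unfolding AP_simps subalgebra_gen_def
    by (rule HP.submoduleI) (use sub in \<open>auto simp: HP.submoduleE dest: subringE\<close>)
  show "e ` carrier H \<subseteq> carrier AP" unfolding AP_simps subalgebra_gen_def by auto
  show "carrier AP \<subseteq> C" if "subring C HP" "submodule C K HP" "e ` carrier H \<subseteq> C"
    unfolding AP_simps subalgebra_gen_def using that by auto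
qed

lemma AP_HP [simp]: "x \<in> carrier AP \<Longrightarrow> x \<in> carrier HP"
  using subringE(1)[OF AP_sub(1)] by auto

lemma modAP [simp]: "module K AP"
  using submodule.submodule_is_module[OF AP_sub(2) modHP] by (simp add: apar_def)

lemma AP_closed:
  "x \<in> carrier AP \<Longrightarrow> y \<in> carrier AP \<Longrightarrow> x \<cdot> y \<in> carrier AP"
  "\<one>\<^bsub>HP\<^esub> \<in> carrier AP"
  "h \<in> carrier H \<Longrightarrow> e h \<in> carrier AP"
  using subringE(3,6)[OF AP_sub(1)] AP_sub(3) by blast+

lemma algAP [simp]: "assoc_algebra K AP"
proof -
  interpret HP: assoc_algebra K HP by simp
  interpret AP: module K AP by simp
  have "ring AP" using ring.subring_is_ring[OF ringHP AP_sub(1)] by (simp add: apar_def)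
  then show ?thesis unfolding assoc_algebra_def assoc_algebra_axioms_def
    by (simp add: AP.module_axioms AP_simps(1-5) HP.smult_mult_l HP.smult_mult_r)
qed
lemma ringAP [simp]: "ring AP" by (rule assoc_algebra_ring[OF algAP])

lemma lin_AP: "f \<in> lin_hom K U AP \<longleftrightarrow> f \<in> lin_hom K U HP \<and> f \<in> carrier U \<rightarrow> carrier AP"
  by (auto simp: lin_hom_def AP_simps(1-5) Pi_iff intro: AP_HP)

lemma lin_AP_HP: "f \<in> lin_hom K U AP \<Longrightarrow> f \<in> lin_hom K U HP" by (simp add: lin_AP)

lemma incl_AP: "(\<lambda>x. x) \<in> lin_hom K AP HP" using lin_id[of K AP] unfolding lin_AP by simp

lemma tsw_AP: "module K U \<Longrightarrow> module K W \<Longrightarrow> t \<in> carrier (tensor K U W) \<Longrightarrow>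
    (\<And>v w. v \<in> carrier U \<Longrightarrow> w \<in> carrier W \<Longrightarrow> B v w \<in> carrier AP) \<Longrightarrow>
    tsw K U W HP t B = tsw K U W AP t B"
  by (rule tsw_hom[OF _ _ _ _ incl_AP, symmetric]) simp_all

lemma tsw_AP_closed: "module K U \<Longrightarrow> module K W \<Longrightarrow> t \<in> carrier (tensor K U W) \<Longrightarrow>
    (\<And>v w. v \<in> carrier U \<Longrightarrow> w \<in> carrier W \<Longrightarrow> B v w \<in> carrier AP) \<Longrightarrow>
    tsw K U W HP t B \<in> carrier AP"
  by (simp add: tsw_AP)

text \<open>Only left multiplication by a single generator has to be treated. The elements whose
  left multiplication preserves \<open>P\<close> form a subalgebra; it contains the generators,
  hence all of \<open>apar\<close>, and is then applied to the unit.\<close>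

lemma apar_induct:
  assumes a: "a \<in> carrier AP"
    and add: "\<And>x y. \<lbrakk>x \<in> carrier AP; y \<in> carrier AP; P x; P y\<rbrakk> \<Longrightarrow> P (x \<oplus>\<^bsub>HP\<^esub> y)"
    and smult: "\<And>c x. \<lbrakk>c \<in> carrier K; x \<in> carrier AP; P x\<rbrakk> \<Longrightarrow> P (c \<odot>\<^bsub>HP\<^esub> x)"
    and one: "P \<one>\<^bsub>HP\<^esub>"
    and step: "\<And>m b. \<lbrakk>m \<in> carrier H; b \<in> carrier AP; P b\<rbrakk> \<Longrightarrow> P (e m \<cdot> b)"
  shows "P a"
proof -
  interpret HP: assoc_algebra K HP by simp
  interpret R: subring "carrier AP" HP by (rule AP_sub(1))
  note sm = HP.submoduleE[OF AP_sub(2)] submodule.smult_closed[OF AP_sub(2)]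
  let ?R = "{a \<in> carrier AP. \<forall>b\<in>carrier AP. P b \<longrightarrow> P (a \<cdot> b)}"
  have m1: "\<ominus>\<^bsub>HP\<^esub> x = (\<ominus>\<^bsub>K\<^esub> \<one>\<^bsub>K\<^esub>) \<odot>\<^bsub>HP\<^esub> x" if "x \<in> carrier HP" for x
    using that by (simp add: HP.smult_l_minus)
  have sc: "c \<odot>\<^bsub>HP\<^esub> x \<in> ?R" if "c \<in> carrier K" "x \<in> ?R" for c x
    using that smult by (auto simp: HP.smult_mult_l AP_closed sm)
  have ng: "\<ominus>\<^bsub>HP\<^esub> x \<in> ?R" if "x \<in> ?R" for x
    using sc[OF _ that, of "\<ominus>\<^bsub>K\<^esub> \<one>\<^bsub>K\<^esub>"] m1[of x] that by auto
  have ad: "x \<oplus>\<^bsub>HP\<^esub> y \<in> ?R" if "x \<in> ?R" "y \<in> ?R" for x y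
    using that add by (auto simp: HP.l_distr AP_closed sm)
  have on: "\<one>\<^bsub>HP\<^esub> \<in> ?R" by (auto simp: AP_closed)
  have "\<zero>\<^bsub>K\<^esub> \<odot>\<^bsub>HP\<^esub> \<one>\<^bsub>HP\<^esub> \<in> ?R" by (rule sc[OF _ on]) simp
  then have ze: "\<zero>\<^bsub>HP\<^esub> \<in> ?R" by (simp only: HP.smult_l_null[OF HP.one_closed])
  have "carrier AP \<subseteq> ?R"
  proof (rule AP_least)
    show "subring ?R HP"
      by (rule HP.subringI) (use ng ad on in \<open>auto simp: AP_closed\<close>)
    show "submodule ?R K HP"
    proof (rule HP.submoduleI)
      show "?R \<subseteq> carrier HP" by auto
    qed (fact ze ng ad sc)+
    show "e ` carrier H \<subseteq> ?R" using AP_closed(3) step by blast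
  qed
  then have "P (a \<cdot> \<one>\<^bsub>HP\<^esub>)" using a one AP_closed(2) by blast
  then show ?thesis using a by simp
qed

text \<open>For the unit in place of \<open>a\<close> this is the second relation of a partial
  representation. A left factor \<open>e m\<close> is carried out past \<open>brk x\<close> by
  \<open>br_e'\<close>, which leaves the same identity for a shorter product.\<close>

lemma a_br_S:
  assumes a: "a \<in> carrier AP" and h: "h \<in> carrier H" and l: "l \<in> carrier H"
  shows "cop HP h (\<lambda>x y. brk x \<cdot> (a \<cdot> (brk (S y) \<cdot> brk l))) = cop HP h (\<lambda>x y. brk x \<cdot> (a \<cdot> brk (S y \<bullet> l)))"
proof -
  have "\<forall>h\<in>carrier H. cop HP h (\<lambda>x y. brk x \<cdot> (a \<cdot> (brk (S y) \<cdot> brk l))) = cop HP h (\<lambda>x y. brk x \<cdot> (a \<cdot> brk (S y \<bullet> l)))"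
  proof (rule apar_induct[OF a])
    interpret HP: assoc_algebra K HP by simp
    show "\<forall>h\<in>carrier H. cop HP h (\<lambda>xa ya. brk xa \<cdot> ((x \<oplus>\<^bsub>HP\<^esub> y) \<cdot> (brk (S ya) \<cdot> brk l))) = cop HP h (\<lambda>xa ya. brk xa \<cdot> ((x \<oplus>\<^bsub>HP\<^esub> y) \<cdot> brk (S ya \<bullet> l)))"
      if "\<forall>h\<in>carrier H. cop HP h (\<lambda>xa y. brk xa \<cdot> (x \<cdot> (brk (S y) \<cdot> brk l))) = cop HP h (\<lambda>xa y. brk xa \<cdot> (x \<cdot> brk (S y \<bullet> l)))"
        "\<forall>h\<in>carrier H. cop HP h (\<lambda>x ya. brk x \<cdot> (y \<cdot> (brk (S ya) \<cdot> brk l))) = cop HP h (\<lambda>x ya. brk x \<cdot> (y \<cdot> brk (S ya \<bullet> l)))"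
        "x \<in> carrier AP" "y \<in> carrier AP" for x y
      using that l by (simp add: HP.l_distr HP.r_distr tsw_add)
    show "\<forall>h\<in>carrier H. cop HP h (\<lambda>x y. brk x \<cdot> (\<one>\<^bsub>HP\<^esub> \<cdot> (brk (S y) \<cdot> brk l))) = cop HP h (\<lambda>x y. brk x \<cdot> (\<one>\<^bsub>HP\<^esub> \<cdot> brk (S y \<bullet> l)))"
      using br_prep l by (simp add: prep_def)
    fix m b assume m: "m \<in> carrier H" and b: "b \<in> carrier AP"
      and IH: "\<forall>h\<in>carrier H. cop HP h (\<lambda>x y. brk x \<cdot> (b \<cdot> (brk (S y) \<cdot> brk l))) = cop HP h (\<lambda>x y. brk x \<cdot> (b \<cdot> brk (S y \<bullet> l)))"
    show "\<forall>h\<in>carrier H. cop HP h (\<lambda>x y. brk x \<cdot> (e m \<cdot> b \<cdot> (brk (S y) \<cdot> brk l))) = cop HP h (\<lambda>x y. brk x \<cdot> (e m \<cdot> b \<cdot> brk (S y \<bullet> l)))"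
    proof
      fix h assume h: "h \<in> carrier H"
      have *: "cop HP h (\<lambda>x y. brk x \<cdot> (e m \<cdot> b \<cdot> B y)) = cop HP h (\<lambda>x u. e (x \<bullet> m) \<cdot> cop HP u (\<lambda>x2 y. brk x2 \<cdot> (b \<cdot> B y)))"
        if B: "B \<in> lin_hom K H HP" for B
      proof -
        note [simp] = lin_hom_closed[OF B] B
        have "cop HP h (\<lambda>x y. brk x \<cdot> (e m \<cdot> b \<cdot> B y)) = cop HP h (\<lambda>x y. (brk x \<cdot> e m) \<cdot> (b \<cdot> B y))"
          using m b by simp
        also have "\<dots> = cop HP h (\<lambda>x u. e (x \<bullet> m) \<cdot> cop HP u (\<lambda>x2 y. brk x2 \<cdot> (b \<cdot> B y)))"
          using m b h by (simp add: br_e' del: ring_assoc) simp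
        finally show ?thesis .
      qed
      show "cop HP h (\<lambda>x y. brk x \<cdot> (e m \<cdot> b \<cdot> (brk (S y) \<cdot> brk l))) = cop HP h (\<lambda>x y. brk x \<cdot> (e m \<cdot> b \<cdot> brk (S y \<bullet> l)))"
        by (subst (1 2) *) (use l IH in simp_all)
    qed
  qed (use l in simp)
  then show ?thesis using h by blast
qed

text \<open>Extends \<open>br_e'\<close> from generators to all of \<open>apar\<close>. In the
  action followed by a bracket, \<open>a_br_S\<close> merges the two rightmost brackets, and
  \<open>S y \<bullet> z\<close> cancels.\<close>

lemma br_a: assumes a: "a \<in> carrier AP" and k: "k \<in> carrier H"
  shows "brk k \<cdot> a = cop HP k (\<lambda>k1 k2. ac k1 a \<cdot> brk k2)"
proof -
  have "cop HP k (\<lambda>k1 k2. ac k1 a \<cdot> brk k2) = cop HP k (\<lambda>u z. cop HP u (\<lambda>x y. brk x \<cdot> (a \<cdot> (brk (S y) \<cdot> brk z))))"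
    using a k by (simp add: ac_eq del: coassoc)
  also have "\<dots> = cop HP k (\<lambda>u z. cop HP u (\<lambda>x y. brk x \<cdot> (a \<cdot> brk (S y \<bullet> z))))"
    by (rule tsw_cong[OF refl], rule a_br_S[OF a])
  also have "\<dots> = cop HP k (\<lambda>x u. cop HP u (\<lambda>y z. brk x \<cdot> (a \<cdot> brk (S y \<bullet> z))))"
    by (rule coassoc) (use a k in simp_all)
  also have "\<dots> = brk k \<cdot> (a \<cdot> brk \<one>\<^bsub>H\<^esub>)"
    by (rule chain_r_Sl[where G = "\<lambda>x w. brk x \<cdot> (a \<cdot> brk w)"]) (use a k in simp_all)
  finally show ?thesis using a k by simp
qed

lemma ac_e_mult: assumes m: "m \<in> carrier H" and b: "b \<in> carrier HP" and h: "h \<in> carrier H"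
  shows "ac h (e m \<cdot> b) = cop HP h (\<lambda>u y. e (u \<bullet> m) \<cdot> ac y b)"
proof -
  have "ac h (e m \<cdot> b) = cop HP h (\<lambda>x y. (brk x \<cdot> e m) \<cdot> (b \<cdot> brk (S y)))" using assms by (simp add: ac_eq)
  also have "\<dots> = cop HP h (\<lambda>u y. e (u \<bullet> m) \<cdot> ac y b)"
    using assms by (simp add: br_e' ac_eq del: ring_assoc) simp
  finally show ?thesis .
qed

lemma ac_one [simp]: "h \<in> carrier H \<Longrightarrow> ac h \<one>\<^bsub>HP\<^esub> = e h" by (simp add: ac_eq e_eq)
lemma one_ac [simp]: "x \<in> carrier HP \<Longrightarrow> ac \<one>\<^bsub>H\<^esub> x = x" by (simp add: ac_eq)

lemma ac_closed [simp]: assumes h: "h \<in> carrier H" and a: "a \<in> carrier AP" shows "ac h a \<in> carrier AP"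
proof -
  have "\<forall>h\<in>carrier H. ac h a \<in> carrier AP"
  proof (rule apar_induct[OF a])
    fix m b assume mb: "m \<in> carrier H" "b \<in> carrier AP" and IH: "\<forall>h\<in>carrier H. ac h b \<in> carrier AP"
    then show "\<forall>h\<in>carrier H. ac h (e m \<cdot> b) \<in> carrier AP"
      by (auto simp: ac_e_mult intro!: tsw_AP_closed AP_closed)
  qed (use module.submoduleE[OF modHP AP_sub(2)] in \<open>auto simp: lin_hom_add[OF ac_linP2] lin_hom_smult[OF ac_linP2] AP_closed\<close>)
  then show ?thesis using h by blast
qed

text \<open>\<open>br_a\<close> moves \<open>a\<close> to the left of the first bracket, and the
  remaining factors are the action on \<open>b\<close>.\<close>

lemma ac_mult: assumes a: "a \<in> carrier AP" and b: "b \<in> carrier HP" and h: "h \<in> carrier H"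
  shows "ac h (a \<cdot> b) = cop HP h (\<lambda>h1 h2. ac h1 a \<cdot> ac h2 b)"
proof -
  have "ac h (a \<cdot> b) = cop HP h (\<lambda>x y. (brk x \<cdot> a) \<cdot> (b \<cdot> brk (S y)))" using assms by (simp add: ac_eq)
  also have "\<dots> = cop HP h (\<lambda>u y. ac u a \<cdot> ac y b)"
    using assms by (simp add: br_a ac_eq[of _ b] del: ring_assoc) simp
  finally show ?thesis .
qed

text \<open>The brackets to the right of \<open>a\<close> merge by \<open>a_br_S\<close>, those to
  the left by \<open>br_br\<close>; the latter leaves the factor \<open>e h1\<close> that
  distinguishes a partial from a global action.\<close>

lemma ac_ac: assumes a: "a \<in> carrier AP" and h: "h \<in> carrier H" and k: "k \<in> carrier H"
  shows "ac h (ac k a) = cop HP h (\<lambda>h1 h2. e h1 \<cdot> ac (h2 \<bullet> k) a)"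
proof -
  have "ac h (ac k a) = cop HP h (\<lambda>x y. brk x \<cdot> cop HP k (\<lambda>p q. brk p \<cdot> (a \<cdot> (brk (S q) \<cdot> brk (S y)))))"
    using assms by (simp add: ac_eq)
  also have "\<dots> = cop HP h (\<lambda>x y. brk x \<cdot> cop HP k (\<lambda>p q. brk p \<cdot> (a \<cdot> brk (S q \<bullet> S y))))"
    by (rule tsw_cong[OF refl]) (use a k in \<open>simp add: a_br_S\<close>)
  also have "\<dots> = cop HP h (\<lambda>x y. cop HP k (\<lambda>p q. (brk x \<cdot> brk p) \<cdot> (a \<cdot> brk (S q \<bullet> S y))))"
    using assms by simp
  also have "\<dots> = cop HP h (\<lambda>h1 h2. e h1 \<cdot> ac (h2 \<bullet> k) a)"
    using assms by (simp add: br_br ac_eq del: ring_assoc) simp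
  finally show ?thesis .
qed

text \<open>The mirror image of \<open>br_a\<close>, obtained by induction on \<open>a\<close> with
  \<open>e_br'\<close> for the factor split off.\<close>

lemma a_br: assumes a: "a \<in> carrier AP" and h: "h \<in> carrier H"
  shows "a \<cdot> brk h = cop HP h (\<lambda>h1 h2. brk h2 \<cdot> ac (Si h1) a)"
proof -
  \<comment> \<open>The sum over \<open>y\<close> and \<open>z\<close> collapses to a single
    bracket: this is \<open>e_br'\<close> for the unit of \<open>H\<close>.\<close>
  have 1: "cop HP h (\<lambda>x u. cop HP u (\<lambda>y z. brk z \<cdot> (e (Si y) \<cdot> B x))) = cop HP h (\<lambda>x z. brk z \<cdot> B x)"
    if B: "B \<in> lin_hom K H HP" and h: "h \<in> carrier H" for B h
  proof -
    note [simp] = lin_hom_closed[OF B] B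
    have *: "cop HP u (\<lambda>y z. brk z \<cdot> e (Si y)) = brk u" if u: "u \<in> carrier H" for u
      using e_br'[of "\<one>\<^bsub>H\<^esub>" u] u by simp
    have "cop HP h (\<lambda>x u. cop HP u (\<lambda>y z. brk z \<cdot> (e (Si y) \<cdot> B x))) = cop HP h (\<lambda>x u. cop HP u (\<lambda>y z. brk z \<cdot> e (Si y)) \<cdot> B x)"
      using h by simp
    then show ?thesis by (simp add: *)
  qed
  have "\<forall>h\<in>carrier H. a \<cdot> brk h = cop HP h (\<lambda>h1 h2. brk h2 \<cdot> ac (Si h1) a)"
  proof (rule apar_induct[OF a])
    interpret HP: assoc_algebra K HP by simp
    show "\<forall>h\<in>carrier H. (x \<oplus>\<^bsub>HP\<^esub> y) \<cdot> brk h = cop HP h (\<lambda>h1 h2. brk h2 \<cdot> ac (Si h1) (x \<oplus>\<^bsub>HP\<^esub> y))"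
      if "\<forall>h\<in>carrier H. x \<cdot> brk h = cop HP h (\<lambda>h1 h2. brk h2 \<cdot> ac (Si h1) x)" "\<forall>h\<in>carrier H. y \<cdot> brk h = cop HP h (\<lambda>h1 h2. brk h2 \<cdot> ac (Si h1) y)"
       "x \<in> carrier AP" "y \<in> carrier AP" for x y
      using that by (simp add: HP.l_distr HP.r_distr tsw_add lin_hom_add[OF ac_linP2])
    show "\<forall>h\<in>carrier H. (c \<odot>\<^bsub>HP\<^esub> x) \<cdot> brk h = cop HP h (\<lambda>h1 h2. brk h2 \<cdot> ac (Si h1) (c \<odot>\<^bsub>HP\<^esub> x))"
      if "\<forall>h\<in>carrier H. x \<cdot> brk h = cop HP h (\<lambda>h1 h2. brk h2 \<cdot> ac (Si h1) x)" "c \<in> carrier K" "x \<in> carrier AP" for c x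
      using that by (simp add: lin_hom_smult[OF ac_linP2])
    show "\<forall>h\<in>carrier H. \<one>\<^bsub>HP\<^esub> \<cdot> brk h = cop HP h (\<lambda>h1 h2. brk h2 \<cdot> ac (Si h1) \<one>\<^bsub>HP\<^esub>)"
    proof
      fix h assume "h \<in> carrier H"
      then show "\<one>\<^bsub>HP\<^esub> \<cdot> brk h = cop HP h (\<lambda>h1 h2. brk h2 \<cdot> ac (Si h1) \<one>\<^bsub>HP\<^esub>)"
        using e_br'[of "\<one>\<^bsub>H\<^esub>" h] by simp
    qed
    fix m b assume m: "m \<in> carrier H" and b: "b \<in> carrier AP"
      and IH: "\<forall>h\<in>carrier H. b \<cdot> brk h = cop HP h (\<lambda>h1 h2. brk h2 \<cdot> ac (Si h1) b)"
    show "\<forall>h\<in>carrier H. e m \<cdot> b \<cdot> brk h = cop HP h (\<lambda>h1 h2. brk h2 \<cdot> ac (Si h1) (e m \<cdot> b))"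
    proof
      fix h assume h: "h \<in> carrier H"
      have "e m \<cdot> b \<cdot> brk h = cop HP h (\<lambda>x z. (e m \<cdot> brk z) \<cdot> ac (Si x) b)" using m b h IH by simp
      also have "\<dots> = cop HP h (\<lambda>x u. cop HP u (\<lambda>y z. brk z \<cdot> (e (Si y \<bullet> m) \<cdot> ac (Si x) b)))"
        using m b h by (simp add: e_br' del: ring_assoc) simp
      also have "\<dots> = cop HP h (\<lambda>h1 h2. brk h2 \<cdot> ac (Si h1) (e m \<cdot> b))"
        using m b h by (simp add: ac_e_mult)
      finally show "e m \<cdot> b \<cdot> brk h = cop HP h (\<lambda>h1 h2. brk h2 \<cdot> ac (Si h1) (e m \<cdot> b))" .
    qed
  qed
  then show ?thesis using h by blast
qed

end

subsection \<open>Dual bases\<close>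

lemma submodule_finsum:
  assumes "module K V" "submodule U K V" "finite E" "\<And>x. x \<in> E \<Longrightarrow> f x \<in> U"
  shows "(\<Oplus>\<^bsub>V\<^esub>x\<in>E. f x) \<in> U"
proof -
  interpret V: module K V by fact
  note U = V.submoduleE[OF assms(2)]
  have z: "\<zero>\<^bsub>V\<^esub> \<in> U" using subgroup.one_closed[OF submodule.axioms(1)[OF assms(2)]] by simp
  show ?thesis using assms(3,4)
  proof (induction E)
    case empty then show ?case using z by simp
  next
    case (insert x E)
    then show ?case using U(1,5) by (subst V.M.finsum_insert) auto
  qed
qed

text \<open>The functionals are the coordinates with respect to a spanning set of least cardinality,
  which is automatically independent.\<close>

lemma dual_basis:
  assumes K: "field K" and V: "module K V" and fd: "finite_dimensional K V"
  shows "\<exists>E \<phi>. finite E \<and> E \<subseteq> carrier V \<and> (\<forall>x\<in>E. \<phi> x \<in> lin_hom K V (kmod K)) \<and>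
    (\<forall>v\<in>carrier V. v = (\<Oplus>\<^bsub>V\<^esub>x\<in>E. \<phi> x v \<odot>\<^bsub>V\<^esub> x))"
proof -
  interpret K: field K by fact
  interpret V: module K V by fact
  let ?S = "\<lambda>n. \<exists>B. finite B \<and> B \<subseteq> carrier V \<and> lin_span K V B = carrier V \<and> card B = n"
  define n where "n = (LEAST n. ?S n)"
  have "\<exists>n. ?S n" using fd by (auto simp: finite_dimensional_def)
  then have "?S n" unfolding n_def by (rule LeastI_ex)
  then obtain B where B: "finite B" "B \<subseteq> carrier V" "lin_span K V B = carrier V" "card B = n" by blast
  have least: "n \<le> card C" if "finite C" "C \<subseteq> carrier V" "lin_span K V C = carrier V" for C
    unfolding n_def by (rule Least_le) (use that in blast)
  let ?F = "free_mod K B" and ?f = "free_ext K V (\<lambda>x. x)"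
  interpret F: module K ?F by (rule free_mod_module) (rule K.is_cring)
  have f: "?f \<in> lin_hom K ?F V" by (rule free_ext_lin[OF V]) (use B in auto)
  have fsum: "?f c = (\<Oplus>\<^bsub>V\<^esub>x\<in>B. c x \<odot>\<^bsub>V\<^esub> x)" if "c \<in> carrier ?F" for c
    by (rule free_ext_superset[OF V that]) (use B free_mod_supp[OF that] in auto)
  have surj: "carrier V \<subseteq> ?f ` carrier ?F"
  proof -
    have "submodule (?f ` carrier ?F) K V"
    proof (rule V.submoduleI)
      show "\<zero>\<^bsub>V\<^esub> \<in> ?f ` carrier ?F" using lin_hom_zero[OF F.module_axioms V f] F.M.zero_closed by force
      show "\<ominus>\<^bsub>V\<^esub> a \<in> ?f ` carrier ?F" if a: "a \<in> ?f ` carrier ?F" for a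
      proof -
        obtain c where c: "c \<in> carrier ?F" "a = ?f c" using a by blast
        have "?f ((\<ominus>\<^bsub>K\<^esub> \<one>\<^bsub>K\<^esub>) \<odot>\<^bsub>?F\<^esub> c) = (\<ominus>\<^bsub>K\<^esub> \<one>\<^bsub>K\<^esub>) \<odot>\<^bsub>V\<^esub> a"
          using lin_hom_smult[OF f, of "\<ominus>\<^bsub>K\<^esub> \<one>\<^bsub>K\<^esub>" c] c by simp
        also have "\<dots> = \<ominus>\<^bsub>V\<^esub> a" using lin_hom_closed[OF f] c by (simp add: V.smult_l_minus)
        finally show ?thesis using c by (metis F.smult_closed K.add.inv_closed K.one_closed image_eqI)
      qed
      show "a \<oplus>\<^bsub>V\<^esub> b \<in> ?f ` carrier ?F" if "a \<in> ?f ` carrier ?F" "b \<in> ?f ` carrier ?F" for a b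
      proof -
        obtain c d where "c \<in> carrier ?F" "a = ?f c" "d \<in> carrier ?F" "b = ?f d" using \<open>a \<in> _\<close> \<open>b \<in> _\<close> by blast
        then show ?thesis using lin_hom_add[OF f] by (intro image_eqI[of _ _ "c \<oplus>\<^bsub>?F\<^esub> d"]) simp_all
      qed
      show "c \<odot>\<^bsub>V\<^esub> a \<in> ?f ` carrier ?F" if "c \<in> carrier K" "a \<in> ?f ` carrier ?F" for c a
      proof -
        obtain d where "d \<in> carrier ?F" "a = ?f d" using \<open>a \<in> _\<close> by blast
        then show ?thesis using lin_hom_smult[OF f] \<open>c \<in> _\<close> by (intro image_eqI[of _ _ "c \<odot>\<^bsub>?F\<^esub> d"]) simp_all
      qed
    qed (use lin_hom_closed[OF f] in blast)
    moreover have "B \<subseteq> ?f ` carrier ?F"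
    proof
      fix x assume x: "x \<in> B"
      have "?f (free_gen K x) = x" by (rule free_ext_gen[OF V]) (use x B in auto)
      then show "x \<in> ?f ` carrier ?F" using free_gen_closed[OF K.is_cring x] by (metis image_eqI)
    qed
    ultimately show ?thesis using lin_span_least[of "?f ` carrier ?F" K V B] B(3) by simp
  qed
  \<comment> \<open>A nonzero coefficient could be inverted, placing its vector in the span of the
    others; the smaller set would then still span, against the choice of \<open>n\<close>.\<close>
  have ker: "c x = \<zero>\<^bsub>K\<^esub>" if c: "c \<in> carrier ?F" "?f c = \<zero>\<^bsub>V\<^esub>" for c x
  proof (rule ccontr)
    assume nz: "c x \<noteq> \<zero>\<^bsub>K\<^esub>"
    have xB: "x \<in> B" using c(1) nz by (auto simp: free_mod_carrier)
    have ck: "c y \<in> carrier K" for y using c(1) by (simp add: free_mod_carrier)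
    let ?U = "lin_span K V (B - {x})"
    have U: "submodule ?U K V" by (rule lin_span_submodule[OF V]) (use B in auto)
    note UE = V.submoduleE[OF U]
    have sU: "(\<Oplus>\<^bsub>V\<^esub>y\<in>B - {x}. c y \<odot>\<^bsub>V\<^esub> y) \<in> ?U"
      by (rule submodule_finsum[OF V U]) (use B ck UE lin_span_mono_in[of "B - {x}" K V] in auto)
    have "\<zero>\<^bsub>V\<^esub> = (\<Oplus>\<^bsub>V\<^esub>y\<in>insert x (B - {x}). c y \<odot>\<^bsub>V\<^esub> y)" using c fsum xB by (simp add: insert_absorb)
    also have "\<dots> = c x \<odot>\<^bsub>V\<^esub> x \<oplus>\<^bsub>V\<^esub> (\<Oplus>\<^bsub>V\<^esub>y\<in>B - {x}. c y \<odot>\<^bsub>V\<^esub> y)"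
      using B xB ck by (subst V.M.finsum_insert) auto
    finally have "c x \<odot>\<^bsub>V\<^esub> x = \<ominus>\<^bsub>V\<^esub> (\<Oplus>\<^bsub>V\<^esub>y\<in>B - {x}. c y \<odot>\<^bsub>V\<^esub> y)"
      using sU UE(1) ck xB B by (intro V.M.minus_equality[symmetric]) auto
    then have "c x \<odot>\<^bsub>V\<^esub> x \<in> ?U" using sU UE(3) by simp
    moreover have ci: "inv\<^bsub>K\<^esub> (c x) \<in> carrier K" "inv\<^bsub>K\<^esub> (c x) \<otimes>\<^bsub>K\<^esub> c x = \<one>\<^bsub>K\<^esub>"
      using ck nz by (simp_all add: K.field_Units K.Units_inv_closed K.Units_l_inv)
    ultimately have "inv\<^bsub>K\<^esub> (c x) \<odot>\<^bsub>V\<^esub> (c x \<odot>\<^bsub>V\<^esub> x) \<in> ?U" by (metis UE(4))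
    also have "inv\<^bsub>K\<^esub> (c x) \<odot>\<^bsub>V\<^esub> (c x \<odot>\<^bsub>V\<^esub> x) = x"
      using ck xB B ci by (subst V.smult_assoc1[symmetric]) auto
    finally have "x \<in> ?U" .
    then have "B \<subseteq> ?U" using lin_span_mono_in[of "B - {x}" K V] by blast
    then have "?U = carrier V" using lin_span_least[OF U, of B] B(3) UE(1) by auto
    then have "n \<le> card (B - {x})" using B by (intro least) auto
    then show False using B xB by (metis card_Diff1_less not_less)
  qed
  have inj: "c = d" if "c \<in> carrier ?F" "d \<in> carrier ?F" "?f c = ?f d" for c d
  proof -
    have "?f (c \<ominus>\<^bsub>?F\<^esub> d) = \<zero>\<^bsub>V\<^esub>"
      using that lin_hom_minus[OF F.module_axioms V f that(1,2)] lin_hom_closed[OF f] by (simp add: V.M.minus_zero_iff)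
    then have "c \<ominus>\<^bsub>?F\<^esub> d = \<zero>\<^bsub>?F\<^esub>" using ker[of "c \<ominus>\<^bsub>?F\<^esub> d"] that by (auto simp: free_mod_simps)
    then show ?thesis using that by (simp add: F.M.minus_zero_iff)
  qed
  define g where "g v = inv_into (carrier ?F) ?f v" for v
  have g: "g v \<in> carrier ?F" "?f (g v) = v" if "v \<in> carrier V" for v
    using inv_into_into[of v ?f "carrier ?F"] f_inv_into_f[of v ?f "carrier ?F"] that surj unfolding g_def by blast+
  have gf: "g (?f c) = c" if "c \<in> carrier ?F" for c
    using inj[OF g(1) that] g(2) lin_hom_closed[OF f that] by simp
  have ga: "g (v \<oplus>\<^bsub>V\<^esub> w) = g v \<oplus>\<^bsub>?F\<^esub> g w" if "v \<in> carrier V" "w \<in> carrier V" for v w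
    using gf[of "g v \<oplus>\<^bsub>?F\<^esub> g w"] lin_hom_add[OF f] g that by simp
  have gs: "g (a \<odot>\<^bsub>V\<^esub> w) = a \<odot>\<^bsub>?F\<^esub> g w" if "a \<in> carrier K" "w \<in> carrier V" for a w
    using gf[of "a \<odot>\<^bsub>?F\<^esub> g w"] lin_hom_smult[OF f] g that by simp
  have gl: "(\<lambda>v. g v x) \<in> lin_hom K V (kmod K)" for x
    by (rule lin_homI) (use g(1) in \<open>auto simp: ga gs free_mod_simps free_mod_carrier\<close>)
  show ?thesis
    by (intro exI[of _ B] exI[of _ "\<lambda>x v. g v x"]) (use B gl g fsum in auto)
qed

lemma lin_finsum:
  assumes "module K W" "finite E" "\<And>i. i \<in> E \<Longrightarrow> f i \<in> lin_hom K U W"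
  shows "(\<lambda>x. \<Oplus>\<^bsub>W\<^esub>i\<in>E. f i x) \<in> lin_hom K U W"
proof -
  interpret W: module K W by fact
  note c = lin_hom_closed[OF assms(3)]
  show ?thesis
  proof (rule lin_homI)
    fix x assume x: "x \<in> carrier U"
    show "(\<Oplus>\<^bsub>W\<^esub>i\<in>E. f i x) \<in> carrier W" using c x by (intro W.M.finsum_closed) auto
    { fix y assume y: "y \<in> carrier U"
      have "(\<Oplus>\<^bsub>W\<^esub>i\<in>E. f i (x \<oplus>\<^bsub>U\<^esub> y)) = (\<Oplus>\<^bsub>W\<^esub>i\<in>E. f i x \<oplus>\<^bsub>W\<^esub> f i y)"
        by (rule W.M.finsum_cong') (use x y c lin_hom_add[OF assms(3)] in auto)
      also have "\<dots> = (\<Oplus>\<^bsub>W\<^esub>i\<in>E. f i x) \<oplus>\<^bsub>W\<^esub> (\<Oplus>\<^bsub>W\<^esub>i\<in>E. f i y)"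
        by (rule W.M.finsum_addf) (use x y c in auto)
      finally show "(\<Oplus>\<^bsub>W\<^esub>i\<in>E. f i (x \<oplus>\<^bsub>U\<^esub> y)) = (\<Oplus>\<^bsub>W\<^esub>i\<in>E. f i x) \<oplus>\<^bsub>W\<^esub> (\<Oplus>\<^bsub>W\<^esub>i\<in>E. f i y)" . }
    { fix a assume a: "a \<in> carrier K"
      have "(\<Oplus>\<^bsub>W\<^esub>i\<in>E. f i (a \<odot>\<^bsub>U\<^esub> x)) = (\<Oplus>\<^bsub>W\<^esub>i\<in>E. a \<odot>\<^bsub>W\<^esub> f i x)"
        by (rule W.M.finsum_cong') (use x a c lin_hom_smult[OF assms(3)] in auto)
      also have "\<dots> = a \<odot>\<^bsub>W\<^esub> (\<Oplus>\<^bsub>W\<^esub>i\<in>E. f i x)"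
        by (rule W.finsum_smult_ldistr[symmetric]) (use assms x a c in auto)
      finally show "(\<Oplus>\<^bsub>W\<^esub>i\<in>E. f i (a \<odot>\<^bsub>U\<^esub> x)) = a \<odot>\<^bsub>W\<^esub> (\<Oplus>\<^bsub>W\<^esub>i\<in>E. f i x)" . }
  qed
qed

section \<open>Slices along a finite-dimensional Hopf algebra\<close>

locale hopf_fd = hopf_bij K H for K :: "('k, 'a) ring_scheme" and H :: "('k, 'h) hopf" +
  assumes fd: "finite_dimensional K H"
begin

text \<open>A tensor is recovered from its slices along a dual basis; on pure tensors this is the
  expansion of the second factor.\<close>

lemma slice_expand:
  assumes M: "module K M" and E: "finite E" "E \<subseteq> carrier H" "\<And>x. x \<in> E \<Longrightarrow> \<phi> x \<in> lin_hom K H (kmod K)"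
    "\<And>v. v \<in> carrier H \<Longrightarrow> v = (\<Oplus>\<^bsub>H\<^esub>x\<in>E. \<phi> x v \<odot>\<^bsub>H\<^esub> x)"
    and t: "t \<in> carrier (tensor K M H)"
  shows "(\<Oplus>\<^bsub>tensor K M H\<^esub>x\<in>E. pure K M H (tsw K M H M t (\<lambda>m h. \<phi> x h \<odot>\<^bsub>M\<^esub> m)) x) = t"
proof -
  interpret TM: module K "tensor K M H" using M by simp
  have xH: "x \<in> carrier H" if "x \<in> E" for x using that E by auto
  have \<phi>c: "\<phi> x h \<in> carrier K" if "x \<in> E" "h \<in> carrier H" for x h using lin_hom_closed[OF E(3)[OF that(1)] that(2)] by simp
  have ll: "(\<lambda>h. \<phi> x h) \<in> lin_hom K H (kmod K)" if "x \<in> E" for x using E(3)[OF that] by simp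
  show ?thesis
  proof (rule tensor_ext[OF M modH TM.module_axioms t])
    show "(\<lambda>t. \<Oplus>\<^bsub>tensor K M H\<^esub>x\<in>E. pure K M H (tsw K M H M t (\<lambda>m h. \<phi> x h \<odot>\<^bsub>M\<^esub> m)) x) \<in> lin_hom K (tensor K M H) (tensor K M H)"
      by (rule lin_finsum[OF TM.module_axioms E(1)]) (use M xH ll \<phi>c in simp)
    fix m h assume m: "m \<in> carrier M" and h: "h \<in> carrier H"
    have "(\<Oplus>\<^bsub>tensor K M H\<^esub>x\<in>E. pure K M H (tsw K M H M (pure K M H m h) (\<lambda>m h. \<phi> x h \<odot>\<^bsub>M\<^esub> m)) x) =
       (\<Oplus>\<^bsub>tensor K M H\<^esub>x\<in>E. pure K M H m (\<phi> x h \<odot>\<^bsub>H\<^esub> x))"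
      by (rule TM.M.finsum_cong') (use M m h xH ll \<phi>c in \<open>simp_all add: Pi_iff\<close>)
    also have "\<dots> = pure K M H m (\<Oplus>\<^bsub>H\<^esub>x\<in>E. \<phi> x h \<odot>\<^bsub>H\<^esub> x)"
      by (rule lin_hom_finsum[OF modH TM.module_axioms pure_lin_r0[OF M modH m] E(1), symmetric]) (use h xH \<phi>c in simp)
    also have "\<dots> = pure K M H m h" using E(4)[OF h] by simp
    finally show "(\<Oplus>\<^bsub>tensor K M H\<^esub>x\<in>E. pure K M H (tsw K M H M (pure K M H m h) (\<lambda>m h. \<phi> x h \<odot>\<^bsub>M\<^esub> m)) x) = pure K M H m h" .
  qed simp
qed

text \<open>Functionals on \<open>H\<close> separate tensors. This reduces identities with an
  \<open>H\<close>-leg to identities without it, and later gives injectivity statements.\<close>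

lemma slice_eq:
  assumes M: "module K M" and t: "t \<in> carrier (tensor K M H)" and u: "u \<in> carrier (tensor K M H)"
    and eq: "\<And>\<phi>. \<phi> \<in> lin_hom K H (kmod K) \<Longrightarrow> tsw K M H M t (\<lambda>m h. \<phi> h \<odot>\<^bsub>M\<^esub> m) = tsw K M H M u (\<lambda>m h. \<phi> h \<odot>\<^bsub>M\<^esub> m)"
  shows "t = u"
proof -
  interpret TM: module K "tensor K M H" using M by simp
  obtain E \<phi> where *: "finite E \<and> E \<subseteq> carrier H \<and> (\<forall>x\<in>E. \<phi> x \<in> lin_hom K H (kmod K)) \<and>
      (\<forall>v\<in>carrier H. v = (\<Oplus>\<^bsub>H\<^esub>x\<in>E. \<phi> x v \<odot>\<^bsub>H\<^esub> x))"
    using dual_basis[OF field_axioms modH fd] by blast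
  then have E: "finite E" "E \<subseteq> carrier H" "\<And>x. x \<in> E \<Longrightarrow> \<phi> x \<in> lin_hom K H (kmod K)"
    "\<And>v. v \<in> carrier H \<Longrightarrow> v = (\<Oplus>\<^bsub>H\<^esub>x\<in>E. \<phi> x v \<odot>\<^bsub>H\<^esub> x)" by blast+
  have \<phi>c: "\<phi> x h \<in> carrier K" if "x \<in> E" "h \<in> carrier H" for x h using lin_hom_closed[OF E(3)[OF that(1)] that(2)] by simp
  have "t = (\<Oplus>\<^bsub>tensor K M H\<^esub>x\<in>E. pure K M H (tsw K M H M t (\<lambda>m h. \<phi> x h \<odot>\<^bsub>M\<^esub> m)) x)"
    by (rule slice_expand[OF M E t, symmetric])
  also have "\<dots> = (\<Oplus>\<^bsub>tensor K M H\<^esub>x\<in>E. pure K M H (tsw K M H M u (\<lambda>m h. \<phi> x h \<odot>\<^bsub>M\<^esub> m)) x)"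
    by (rule TM.M.finsum_cong') (use M t u E(2) \<phi>c eq[OF E(3)] in \<open>auto simp del: tsw_pure_l\<close>)
  also have "\<dots> = u" by (rule slice_expand[OF M E u])
  finally show ?thesis .
qed

end

subsection \<open>The coaction on \<open>A\<^sub>p\<^sub>a\<^sub>r\<close>\<close>

context hopf_bij
begin

text \<open>
  The algebra \<open>H\<^sub>p\<^sub>a\<^sub>r \<otimes> H\<close> is the smash product for the trivial action; \<open>h \<mapsto> [h\<^sub>(\<^sub>2\<^sub>)] \<otimes> h\<^sub>(\<^sub>1\<^sub>)\<close>
  is a partial representation in it, and composing with the inverse antipode in the second
  factor extends the coaction of \<open>A\<^sub>p\<^sub>a\<^sub>r\<close> to all of \<open>H\<^sub>p\<^sub>a\<^sub>r\<close>.
\<close>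

lemma hpar_coaction_exists:
  "\<exists>v. v \<in> lin_hom K HP (tensor K HP H) \<and>
     (\<forall>h\<in>carrier H. v (brk h) = cop (tensor K HP H) h (\<lambda>a b. pure K HP H (brk b) (Si a))) \<and>
     (\<forall>x\<in>carrier HP. \<forall>y\<in>carrier HP. v (x \<cdot> y) = tsw K HP H (tensor K HP H) (v x)
        (\<lambda>p h. tsw K HP H (tensor K HP H) (v y) (\<lambda>q l. pure K HP H (p \<cdot> q) (l \<bullet> h))))"
proof -
  let ?act = "\<lambda>h x. eps h \<odot>\<^bsub>HP\<^esub> x"
  have "left_hmodule_algebra K H HP ?act"
    unfolding left_hmodule_algebra_def left_hmodule_def
    by (simp add: sw_cop lin_smult[OF modHP lin_id])
  then interpret X: hmod_alg K H HP ?act by (simp add: hmod_alg_def hmod_alg_axioms_def hopf_bij_axioms)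
  note X.js [simp del] X.js' [simp del] X.act_alg [simp del] X.act_mult [simp del]
  have jsX: "X.j a \<otimes>\<^bsub>X.L\<^esub> (X.s v \<otimes>\<^bsub>X.L\<^esub> y) = X.s v \<otimes>\<^bsub>X.L\<^esub> (X.j a \<otimes>\<^bsub>X.L\<^esub> y)"
    if "a \<in> carrier H" "v \<in> carrier HP" "y \<in> carrier X.L" for a v y
    using that by (simp add: X.js')
  have jsX1: "X.j a \<otimes>\<^bsub>X.L\<^esub> X.s v = X.s v \<otimes>\<^bsub>X.L\<^esub> X.j a"
    if "a \<in> carrier H" "v \<in> carrier HP" for a v
    using that by (simp add: X.js)
  note [simp] = jsX jsX1
  define \<pi> where "\<pi> h = cop X.L h (\<lambda>a b. X.s (brk b) \<otimes>\<^bsub>X.L\<^esub> X.j a)" for h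
  have \<pi>_lin: "\<pi> \<in> lin_hom K H X.L" unfolding \<pi>_def[abs_def] by simp
  note [simp] = \<pi>_lin lin_comp[OF \<pi>_lin] lin_hom_closed[OF \<pi>_lin]
  \<comment> \<open>The image under \<open>\<pi>\<close> of the generator belonging to
    \<open>l\<close>, times \<open>x\<close>. The antipode reverses the legs of \<open>l2\<close>,
    so the inner legs form \<open>e w\<close> and the outer ones
    \<open>a \<bullet> S d\<close>.\<close>
  have A: "cop X.L l (\<lambda>l1 l2. \<pi> l1 \<otimes>\<^bsub>X.L\<^esub> (\<pi> (S l2) \<otimes>\<^bsub>X.L\<^esub> x)) =
    cop X.L l (\<lambda>a u. cop X.L u (\<lambda>w d. X.s (e w) \<otimes>\<^bsub>X.L\<^esub> (X.j (a \<bullet> S d) \<otimes>\<^bsub>X.L\<^esub> x)))"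
    if l: "l \<in> carrier H" and x: "x \<in> carrier X.L" for l x
  proof -
    have "cop X.L l (\<lambda>l1 l2. \<pi> l1 \<otimes>\<^bsub>X.L\<^esub> (\<pi> (S l2) \<otimes>\<^bsub>X.L\<^esub> x)) =
      cop X.L l (\<lambda>l1 l2. cop X.L l1 (\<lambda>a b. cop X.L l2 (\<lambda>c d. X.s (brk b \<cdot> brk (S c)) \<otimes>\<^bsub>X.L\<^esub> (X.j (a \<bullet> S d) \<otimes>\<^bsub>X.L\<^esub> x))))"
      by (rule tsw_cong[OF refl], simp add: \<pi>_def x, rule tsw_swap) (simp_all add: x)
    then show ?thesis using l x by (simp add: e_eq)
  qed
  have prep: "prep X.L \<pi>"
    unfolding prep_def
  proof (intro conjI ballI)
    fix h l assume h: "h \<in> carrier H" and l: "l \<in> carrier H"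
    have "cop X.L l (\<lambda>l1 l2. \<pi> h \<otimes>\<^bsub>X.L\<^esub> (\<pi> l1 \<otimes>\<^bsub>X.L\<^esub> \<pi> (S l2))) =
        \<pi> h \<otimes>\<^bsub>X.L\<^esub> cop X.L l (\<lambda>l1 l2. \<pi> l1 \<otimes>\<^bsub>X.L\<^esub> (\<pi> (S l2) \<otimes>\<^bsub>X.L\<^esub> \<one>\<^bsub>X.L\<^esub>))"
      using h l by simp
    also have "\<dots> = \<pi> h \<otimes>\<^bsub>X.L\<^esub> cop X.L l (\<lambda>a u. cop X.L u (\<lambda>w d. X.s (e w) \<otimes>\<^bsub>X.L\<^esub> X.j (a \<bullet> S d)))"
      unfolding A[OF l ring_one[OF X.ringL]] using h l by simp
    also have "\<dots> = cop X.L h (\<lambda>p q. cop X.L l (\<lambda>a u. cop X.L u (\<lambda>w d. X.s (brk q \<cdot> e w) \<otimes>\<^bsub>X.L\<^esub> X.j (p \<bullet> (a \<bullet> S d)))))"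
      unfolding \<pi>_def[of h] using h l by (simp, subst tsw_swap2[symmetric]) simp_all
    also have "\<dots> = cop X.L h (\<lambda>p q. cop X.L l (\<lambda>l1 l2. cop X.L l1 (\<lambda>a b. cop X.L l2 (\<lambda>c d. X.s (brk (q \<bullet> b) \<cdot> brk (S c)) \<otimes>\<^bsub>X.L\<^esub> X.j (p \<bullet> (a \<bullet> S d))))))"
      using h l by (simp add: br_e)
    also have "\<dots> = cop X.L l (\<lambda>l1 l2. cop X.L h (\<lambda>p q. cop X.L l1 (\<lambda>a b. cop X.L l2 (\<lambda>c d. X.s (brk (q \<bullet> b) \<cdot> brk (S c)) \<otimes>\<^bsub>X.L\<^esub> X.j (p \<bullet> (a \<bullet> S d))))))"
      by (rule tsw_swap) (use h l in simp_all)
    also have "\<dots> = cop X.L l (\<lambda>l1 l2. \<pi> (h \<bullet> l1) \<otimes>\<^bsub>X.L\<^esub> \<pi> (S l2))"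
      by (rule tsw_cong[OF refl], simp add: \<pi>_def h, rule tsw_swap2[symmetric]) (simp_all add: h)
    finally show "cop X.L l (\<lambda>l1 l2. \<pi> h \<otimes>\<^bsub>X.L\<^esub> (\<pi> l1 \<otimes>\<^bsub>X.L\<^esub> \<pi> (S l2))) = cop X.L l (\<lambda>l1 l2. \<pi> (h \<bullet> l1) \<otimes>\<^bsub>X.L\<^esub> \<pi> (S l2))" .
    have "cop X.L h (\<lambda>h1 h2. \<pi> h1 \<otimes>\<^bsub>X.L\<^esub> (\<pi> (S h2) \<otimes>\<^bsub>X.L\<^esub> \<pi> l)) = cop X.L h (\<lambda>a u. cop X.L u (\<lambda>w d. X.s (e w) \<otimes>\<^bsub>X.L\<^esub> (X.j (a \<bullet> S d) \<otimes>\<^bsub>X.L\<^esub> \<pi> l)))"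
      by (rule A[OF h]) (use l in simp)
    also have "\<dots> = cop X.L h (\<lambda>a u. cop X.L u (\<lambda>w d. cop X.L l (\<lambda>p q. X.s (e w \<cdot> brk q) \<otimes>\<^bsub>X.L\<^esub> X.j (a \<bullet> (S d \<bullet> p)))))"
      unfolding \<pi>_def[of l] using h l by simp
    also have "\<dots> = cop X.L h (\<lambda>h1 h2. cop X.L h1 (\<lambda>a b. cop X.L h2 (\<lambda>c d. cop X.L l (\<lambda>p q. X.s (brk b \<cdot> brk (S c \<bullet> q)) \<otimes>\<^bsub>X.L\<^esub> X.j (a \<bullet> (S d \<bullet> p))))))"
      using h l by (simp add: e_br)
    also have "\<dots> = cop X.L h (\<lambda>h1 h2. \<pi> h1 \<otimes>\<^bsub>X.L\<^esub> \<pi> (S h2 \<bullet> l))"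
      by (rule tsw_cong[OF refl], simp add: \<pi>_def l, rule tsw_swap2) (simp_all add: l)
    finally show "cop X.L h (\<lambda>h1 h2. \<pi> h1 \<otimes>\<^bsub>X.L\<^esub> (\<pi> (S h2) \<otimes>\<^bsub>X.L\<^esub> \<pi> l)) = cop X.L h (\<lambda>h1 h2. \<pi> h1 \<otimes>\<^bsub>X.L\<^esub> \<pi> (S h2 \<bullet> l))" .
  qed (simp_all add: \<pi>_def)
  have \<pi>T: "\<pi> h = cop X.T h (\<lambda>a b. pure K HP H (brk b) a)" for h
    unfolding \<pi>_def X.tsw_L by (rule tsw_cong[OF refl]) (simp add: X.sj)
  obtain f where f: "f \<in> alg_hom K HP X.L" "\<And>h. h \<in> carrier H \<Longrightarrow> f (brk h) = \<pi> h"
    using hpar_universal[OF prep] by blast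
  note fl = alg_homD(1)[OF f(1), unfolded X.lin_hom_L] and fc = alg_homD(4)[OF f(1), unfolded X.L_simps]
  \<comment> \<open>The inverse antipode on the second factor reverses products there, which
    accounts for the opposite multiplication in the result.\<close>
  let ?v = "\<lambda>x. tsw K HP H X.T (f x) (\<lambda>p h. pure K HP H p (Si h))"
  have mult: "x \<otimes>\<^bsub>X.L\<^esub> y = tsw K HP H X.T x (\<lambda>p h. tsw K HP H X.T y (\<lambda>q l. pure K HP H (p \<cdot> q) (h \<bullet> l)))"
    if "x \<in> carrier X.T" "y \<in> carrier X.T" for x y
    unfolding X.L_mult[OF that] by (rule tsw_cong[OF refl], rule tsw_cong[OF refl]) simp
  show ?thesis
  proof (intro exI[of _ ?v] conjI ballI)
    show "?v \<in> lin_hom K HP (tensor K HP H)" by (rule lin_tsw[OF modHP modH _ fl]) simp_all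
    show "?v (brk h) = cop X.T h (\<lambda>a b. pure K HP H (brk b) (Si a))" if "h \<in> carrier H" for h
      using that by (simp add: f(2) \<pi>T)
    show "?v (x \<cdot> y) = tsw K HP H X.T (?v x) (\<lambda>p h. tsw K HP H X.T (?v y) (\<lambda>q l. pure K HP H (p \<cdot> q) (l \<bullet> h)))"
      if "x \<in> carrier HP" "y \<in> carrier HP" for x y
      using that by (simp add: alg_homD(3)[OF f(1)] mult fc)
  qed
qed

abbreviation am (infixl "\<cdot>\<^sub>A" 70) where "x \<cdot>\<^sub>A y \<equiv> x \<otimes>\<^bsub>AP\<^esub> y"
abbreviation TP where "TP \<equiv> tensor K HP H"
abbreviation AH where "AH \<equiv> tensor K AP H"

section \<open>The coaction on all of \<open>hpar\<close>\<close>

definition Vm where "Vm = (SOME v. v \<in> lin_hom K HP TP \<and>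
     (\<forall>h\<in>carrier H. v (brk h) = cop TP h (\<lambda>a b. pure K HP H (brk b) (Si a))) \<and>
     (\<forall>x\<in>carrier HP. \<forall>y\<in>carrier HP. v (x \<cdot> y) = tsw K HP H TP (v x)
        (\<lambda>p h. tsw K HP H TP (v y) (\<lambda>q l. pure K HP H (p \<cdot> q) (l \<bullet> h)))))"

lemmas Vm_props = someI_ex[OF hpar_coaction_exists, folded Vm_def]

lemma Vm_lin0 [simp]: "Vm \<in> lin_hom K HP TP" using Vm_props by blast
lemma Vm_closed [simp]: "x \<in> carrier HP \<Longrightarrow> Vm x \<in> carrier TP" by (rule lin_hom_closed[OF Vm_lin0])
lemma Vm_tsw [simp]: "module K U \<Longrightarrow> module K W \<Longrightarrow> t \<in> carrier (tensor K U W) \<Longrightarrow>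
    (\<And>v w. v \<in> carrier U \<Longrightarrow> w \<in> carrier W \<Longrightarrow> B v w \<in> carrier HP) \<Longrightarrow>
    Vm (tsw K U W HP t B) = tsw K U W TP t (\<lambda>v w. Vm (B v w))"
  by (rule tsw_hom[OF _ _ _ _ Vm_lin0]) simp_all

abbreviation vsw where "vsw P x B \<equiv> tsw K HP H P (Vm x) B"

lemma vsw_br [simp]:
  assumes "h \<in> carrier H" "module K P" "\<And>z. z \<in> carrier H \<Longrightarrow> (\<lambda>x. B x z) \<in> lin_hom K HP P"
    "\<And>x. x \<in> carrier HP \<Longrightarrow> (\<lambda>z. B x z) \<in> lin_hom K H P"
  shows "vsw P (brk h) (\<lambda>x z. B x z) = cop P h (\<lambda>a b. B (brk b) (Si a))"
proof -
  have "Vm (brk h) = cop TP h (\<lambda>a b. pure K HP H (brk b) (Si a))" using Vm_props assms(1) by blast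
  then show ?thesis using assms by simp
qed

lemma vsw_mult [simp]:
  assumes "x \<in> carrier HP" "y \<in> carrier HP" "module K P" "\<And>z. z \<in> carrier H \<Longrightarrow> (\<lambda>x. B x z) \<in> lin_hom K HP P"
    "\<And>x. x \<in> carrier HP \<Longrightarrow> (\<lambda>z. B x z) \<in> lin_hom K H P"
  shows "vsw P (x \<cdot> y) (\<lambda>x z. B x z) = vsw P x (\<lambda>p h. vsw P y (\<lambda>q l. B (p \<cdot> q) (l \<bullet> h)))"
proof -
  have "Vm (x \<cdot> y) = vsw TP x (\<lambda>p h. vsw TP y (\<lambda>q l. pure K HP H (p \<cdot> q) (l \<bullet> h)))"
    using Vm_props assms(1,2) by blast
  then show ?thesis using assms by simp
qed

text \<open>The bracket of \<open>a\<close> contributes an inverse antipode, while in the bracket of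
  \<open>S b\<close> it cancels against \<open>S\<close>; this yields the prescribed coaction on a
  generator.\<close>

lemma vsw_e:
  assumes m: "m \<in> carrier H" and P: "module K P" and B: "\<And>z. z \<in> carrier H \<Longrightarrow> (\<lambda>x. B x z) \<in> lin_hom K HP P"
    "\<And>x. x \<in> carrier HP \<Longrightarrow> (\<lambda>z. B x z) \<in> lin_hom K H P"
  shows "vsw P (e m) (\<lambda>x z. B x z) = cop P m (\<lambda>m1 u. cop P u (\<lambda>w m3. B (e w) (m3 \<bullet> Si m1)))"
proof -
  note [simp] = lin_comp[OF B(1)] lin_comp[OF B(2)] B P
  have "B (e w) z = cop P w (\<lambda>a b. B (brk a \<cdot> brk (S b)) z)" if "w \<in> carrier H" "z \<in> carrier H" for w z
    unfolding e_eq[OF that(1)] by (rule tsw_hom[OF _ _ _ _ B(1)]) (use that in simp_all)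
  then have "cop P m (\<lambda>m1 u. cop P u (\<lambda>w m3. B (e w) (m3 \<bullet> Si m1))) =
     cop P m (\<lambda>m1 u. cop P u (\<lambda>w m3. cop P w (\<lambda>a b. B (brk a \<cdot> brk (S b)) (m3 \<bullet> Si m1))))"
    by (intro tsw_cong refl) simp
  also have "\<dots> = vsw P (e m) (\<lambda>x z. B x z)" using m by (simp add: e_eq)
  finally show ?thesis by simp
qed

lemma vsw_counit: assumes x: "x \<in> carrier HP" shows "vsw HP x (\<lambda>p h. eps h \<odot>\<^bsub>HP\<^esub> p) = x"
proof (rule hpar_induct[OF x])
  have l: "(\<lambda>x. vsw HP x (\<lambda>p h. eps h \<odot>\<^bsub>HP\<^esub> p)) \<in> lin_hom K HP HP" by simp
  show "vsw HP (x \<oplus>\<^bsub>HP\<^esub> y) (\<lambda>p h. eps h \<odot>\<^bsub>HP\<^esub> p) = x \<oplus>\<^bsub>HP\<^esub> y"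
    if "x \<in> carrier HP" "y \<in> carrier HP" "vsw HP x (\<lambda>p h. eps h \<odot>\<^bsub>HP\<^esub> p) = x" "vsw HP y (\<lambda>p h. eps h \<odot>\<^bsub>HP\<^esub> p) = y" for x y
    using lin_hom_add[OF l that(1,2)] that by simp
  show "vsw HP (a \<odot>\<^bsub>HP\<^esub> x) (\<lambda>p h. eps h \<odot>\<^bsub>HP\<^esub> p) = a \<odot>\<^bsub>HP\<^esub> x"
    if "a \<in> carrier K" "x \<in> carrier HP" "vsw HP x (\<lambda>p h. eps h \<odot>\<^bsub>HP\<^esub> p) = x" for a x
    using lin_hom_smult[OF l that(1,2)] that by simp
  show "vsw HP (x \<cdot> y) (\<lambda>p h. eps h \<odot>\<^bsub>HP\<^esub> p) = x \<cdot> y"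
    if "x \<in> carrier HP" "y \<in> carrier HP" "vsw HP x (\<lambda>p h. eps h \<odot>\<^bsub>HP\<^esub> p) = x" "vsw HP y (\<lambda>p h. eps h \<odot>\<^bsub>HP\<^esub> p) = y" for x y
  proof -
    have "vsw HP (x \<cdot> y) (\<lambda>p h. eps h \<odot>\<^bsub>HP\<^esub> p) = vsw HP x (\<lambda>p h. vsw HP y (\<lambda>q l. eps l \<odot>\<^bsub>HP\<^esub> (eps h \<odot>\<^bsub>HP\<^esub> (p \<cdot> q))))"
      using that by simp
    also have "\<dots> = vsw HP x (\<lambda>p h. vsw HP y (\<lambda>q l. eps h \<odot>\<^bsub>HP\<^esub> (eps l \<odot>\<^bsub>HP\<^esub> (p \<cdot> q))))"
      by (rule tsw_cong[OF refl], rule tsw_cong[OF refl], rule smult_comm) simp_all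
    also have "\<dots> = vsw HP x (\<lambda>p h. eps h \<odot>\<^bsub>HP\<^esub> (p \<cdot> y))"
    proof (rule tsw_cong[OF refl])
      fix p h assume p: "p \<in> carrier HP" and h: "h \<in> carrier H"
      have "vsw HP y (\<lambda>q l. eps l \<odot>\<^bsub>HP\<^esub> (p \<cdot> q)) = p \<cdot> vsw HP y (\<lambda>q l. eps l \<odot>\<^bsub>HP\<^esub> q)"
        using p that(2) by simp
      then show "vsw HP y (\<lambda>q l. eps h \<odot>\<^bsub>HP\<^esub> (eps l \<odot>\<^bsub>HP\<^esub> (p \<cdot> q))) = eps h \<odot>\<^bsub>HP\<^esub> (p \<cdot> y)"
        using p h that by simp
    qed
    also have "\<dots> = vsw HP x (\<lambda>p h. eps h \<odot>\<^bsub>HP\<^esub> p) \<cdot> y" using that(1,2) by simp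
    finally show ?thesis using that by simp
  qed
qed simp

lemma vsw_coassoc:
  assumes x: "x \<in> carrier HP" and P: "module K P"
    and F: "\<And>b c. b \<in> carrier H \<Longrightarrow> c \<in> carrier H \<Longrightarrow> (\<lambda>a. F a b c) \<in> lin_hom K HP P"
      "\<And>a c. a \<in> carrier HP \<Longrightarrow> c \<in> carrier H \<Longrightarrow> (\<lambda>b. F a b c) \<in> lin_hom K H P"
      "\<And>a b. a \<in> carrier HP \<Longrightarrow> b \<in> carrier H \<Longrightarrow> (\<lambda>c. F a b c) \<in> lin_hom K H P"
  shows "vsw P x (\<lambda>p h. vsw P p (\<lambda>q l. F q l h)) = vsw P x (\<lambda>p h. cop P h (\<lambda>l m. F p l m))"
proof -
  \<comment> \<open>The induction must range over all trilinear forms: in the product case the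
    hypothesis for \<open>x\<close> is applied to a form built from the coaction of
    \<open>y\<close>.\<close>
  define tri where "tri G \<longleftrightarrow> (\<forall>b\<in>carrier H. \<forall>c\<in>carrier H. (\<lambda>a. G a b c) \<in> lin_hom K HP P) \<and>
      (\<forall>a\<in>carrier HP. \<forall>c\<in>carrier H. (\<lambda>b. G a b c) \<in> lin_hom K H P) \<and>
      (\<forall>a\<in>carrier HP. \<forall>b\<in>carrier H. (\<lambda>c. G a b c) \<in> lin_hom K H P)" for G
  have "\<forall>G. tri G \<longrightarrow> vsw P x (\<lambda>p h. vsw P p (\<lambda>q l. G q l h)) = vsw P x (\<lambda>p h. cop P h (\<lambda>l m. G p l m))"
  proof (rule hpar_induct[OF x]; intro allI impI)
    fix G assume "tri G"
    then have G: "\<And>b c. b \<in> carrier H \<Longrightarrow> c \<in> carrier H \<Longrightarrow> (\<lambda>a. G a b c) \<in> lin_hom K HP P"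
      "\<And>a c. a \<in> carrier HP \<Longrightarrow> c \<in> carrier H \<Longrightarrow> (\<lambda>b. G a b c) \<in> lin_hom K H P"
      "\<And>a b. a \<in> carrier HP \<Longrightarrow> b \<in> carrier H \<Longrightarrow> (\<lambda>c. G a b c) \<in> lin_hom K H P" by (auto simp: tri_def)
    note [simp] = lin_comp[OF G(1)] lin_comp[OF G(2)] lin_comp[OF G(3)] G P lin_hom_closed[OF G(1)]
    have l1: "(\<lambda>x. vsw P x (\<lambda>p h. vsw P p (\<lambda>q l. G q l h))) \<in> lin_hom K HP P" by simp
    have l2: "(\<lambda>x. vsw P x (\<lambda>p h. cop P h (\<lambda>l m. G p l m))) \<in> lin_hom K HP P" by simp
    show "vsw P (brk h) (\<lambda>p h. vsw P p (\<lambda>q l. G q l h)) = vsw P (brk h) (\<lambda>p h. cop P h (\<lambda>l m. G p l m))"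
      if "h \<in> carrier H" for h using that by simp
    show "vsw P (x \<oplus>\<^bsub>HP\<^esub> y) (\<lambda>p h. vsw P p (\<lambda>q l. G q l h)) = vsw P (x \<oplus>\<^bsub>HP\<^esub> y) (\<lambda>p h. cop P h (\<lambda>l m. G p l m))"
      if "x \<in> carrier HP" "y \<in> carrier HP"
        "\<forall>G. tri G \<longrightarrow> vsw P x (\<lambda>p h. vsw P p (\<lambda>q l. G q l h)) = vsw P x (\<lambda>p h. cop P h (\<lambda>l m. G p l m))"
        "\<forall>G. tri G \<longrightarrow> vsw P y (\<lambda>p h. vsw P p (\<lambda>q l. G q l h)) = vsw P y (\<lambda>p h. cop P h (\<lambda>l m. G p l m))" for x y
      using lin_hom_add[OF l1 that(1,2)] lin_hom_add[OF l2 that(1,2)] that(3,4) \<open>tri G\<close> by metis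
    show "vsw P (a \<odot>\<^bsub>HP\<^esub> x) (\<lambda>p h. vsw P p (\<lambda>q l. G q l h)) = vsw P (a \<odot>\<^bsub>HP\<^esub> x) (\<lambda>p h. cop P h (\<lambda>l m. G p l m))"
      if "a \<in> carrier K" "x \<in> carrier HP"
        "\<forall>G. tri G \<longrightarrow> vsw P x (\<lambda>p h. vsw P p (\<lambda>q l. G q l h)) = vsw P x (\<lambda>p h. cop P h (\<lambda>l m. G p l m))" for a x
      using lin_hom_smult[OF l1 that(1,2)] lin_hom_smult[OF l2 that(1,2)] that(3) \<open>tri G\<close> by metis
    show "vsw P (x \<cdot> y) (\<lambda>p h. vsw P p (\<lambda>q l. G q l h)) = vsw P (x \<cdot> y) (\<lambda>p h. cop P h (\<lambda>l m. G p l m))"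
      if x: "x \<in> carrier HP" and y: "y \<in> carrier HP"
        and IHx: "\<forall>G. tri G \<longrightarrow> vsw P x (\<lambda>p h. vsw P p (\<lambda>q l. G q l h)) = vsw P x (\<lambda>p h. cop P h (\<lambda>l m. G p l m))"
        and IHy: "\<forall>G. tri G \<longrightarrow> vsw P y (\<lambda>p h. vsw P p (\<lambda>q l. G q l h)) = vsw P y (\<lambda>p h. cop P h (\<lambda>l m. G p l m))" for x y
    proof -
      have "vsw P (x \<cdot> y) (\<lambda>p h. vsw P p (\<lambda>q l. G q l h)) =
        vsw P x (\<lambda>p h. vsw P y (\<lambda>q l. vsw P p (\<lambda>p' h'. vsw P q (\<lambda>q' l'. G (p' \<cdot> q') (l' \<bullet> h') (l \<bullet> h)))))"
        using x y by simp
      also have "\<dots> = vsw P x (\<lambda>p h. vsw P p (\<lambda>p' h'. vsw P y (\<lambda>q l. vsw P q (\<lambda>q' l'. G (p' \<cdot> q') (l' \<bullet> h') (l \<bullet> h)))))"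
        by (rule tsw_cong[OF refl], rule tsw_swap) (use x y in simp_all)
      also have "\<dots> = vsw P x (\<lambda>p h. cop P h (\<lambda>h' h. vsw P y (\<lambda>q l. vsw P q (\<lambda>q' l'. G (p \<cdot> q') (l' \<bullet> h') (l \<bullet> h)))))"
        by (rule IHx[rule_format, where G = "\<lambda>p' h' h. vsw P y (\<lambda>q l. vsw P q (\<lambda>q' l'. G (p' \<cdot> q') (l' \<bullet> h') (l \<bullet> h)))"])
          (use x y in \<open>simp add: tri_def\<close>)
      also have "\<dots> = vsw P x (\<lambda>p h. cop P h (\<lambda>h' h. vsw P y (\<lambda>q l. cop P l (\<lambda>l' l. G (p \<cdot> q) (l' \<bullet> h') (l \<bullet> h)))))"
        by (rule tsw_cong[OF refl], rule tsw_cong[OF refl], rule IHy[rule_format, where G = "\<lambda>q' l' l. G (p \<cdot> q') (l' \<bullet> h') (l \<bullet> h)" for p h' h])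
          (use x y in \<open>simp add: tri_def\<close>)
      also have "\<dots> = vsw P x (\<lambda>p h. vsw P y (\<lambda>q l. cop P l (\<lambda>l' l. cop P h (\<lambda>h' h. G (p \<cdot> q) (l' \<bullet> h') (l \<bullet> h)))))"
        by (rule tsw_cong[OF refl], rule tsw_swap2) (use x y in simp_all)
      also have "\<dots> = vsw P (x \<cdot> y) (\<lambda>p h. cop P h (\<lambda>l m. G p l m))"
        using x y by simp
      finally show ?thesis .
    qed
  qed
  then show ?thesis using F by (simp add: tri_def)
qed

lemma AP_mult_eq: "x \<cdot>\<^sub>A y = x \<cdot> y" and AP_one_eq: "\<one>\<^bsub>AP\<^esub> = \<one>\<^bsub>HP\<^esub>" by (simp_all add: AP_simps)

lemma e_closedA [simp]: "h \<in> carrier H \<Longrightarrow> e h \<in> carrier AP" by (rule AP_closed(3))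
lemma lin_eA0 [simp]: "e \<in> lin_hom K H AP" by (auto simp: lin_AP)
lemma lin_acA1 [simp]: "f \<in> lin_hom K U H \<Longrightarrow> a \<in> carrier AP \<Longrightarrow> (\<lambda>x. ac (f x) a) \<in> lin_hom K U AP"
  by (auto simp: lin_AP lin_hom_closed)
lemma lin_acA2 [simp]: "h \<in> carrier H \<Longrightarrow> f \<in> lin_hom K U AP \<Longrightarrow> (\<lambda>x. ac h (f x)) \<in> lin_hom K U AP"
  by (simp add: lin_AP Pi_iff)
lemma lin_acA0 [simp]: "h \<in> carrier H \<Longrightarrow> ac h \<in> lin_hom K AP AP"
  using lin_acA2[OF _ lin_id] by simp
lemma ac_tswA [simp]: "module K U \<Longrightarrow> module K W \<Longrightarrow> t \<in> carrier (tensor K U W) \<Longrightarrow> h \<in> carrier H \<Longrightarrow>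
    (\<And>v w. v \<in> carrier U \<Longrightarrow> w \<in> carrier W \<Longrightarrow> B v w \<in> carrier AP) \<Longrightarrow>
    ac h (tsw K U W AP t B) = tsw K U W AP t (\<lambda>v w. ac h (B v w))"
  by (rule tsw_hom) simp_all
lemma ac_smultA [simp]: "h \<in> carrier H \<Longrightarrow> c \<in> carrier K \<Longrightarrow> a \<in> carrier AP \<Longrightarrow> ac h (c \<odot>\<^bsub>AP\<^esub> a) = c \<odot>\<^bsub>AP\<^esub> ac h a"
  by (rule lin_hom_smult[OF lin_acA0])
lemma ac_oneA [simp]: "h \<in> carrier H \<Longrightarrow> ac h \<one>\<^bsub>AP\<^esub> = e h" by (simp add: AP_one_eq)
lemma e_oneA [simp]: "e \<one>\<^bsub>H\<^esub> = \<one>\<^bsub>AP\<^esub>" by (simp add: AP_one_eq)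
declare e_one [simp del]
lemma ac_multA: "a \<in> carrier AP \<Longrightarrow> b \<in> carrier AP \<Longrightarrow> h \<in> carrier H \<Longrightarrow>
    ac h (a \<cdot>\<^sub>A b) = cop AP h (\<lambda>h1 h2. ac h1 a \<cdot>\<^sub>A ac h2 b)"
  by (simp add: AP_mult_eq ac_mult tsw_AP AP_closed)
lemma ac_acA: "a \<in> carrier AP \<Longrightarrow> h \<in> carrier H \<Longrightarrow> k \<in> carrier H \<Longrightarrow>
    ac h (ac k a) = cop AP h (\<lambda>h1 h2. e h1 \<cdot>\<^sub>A ac (h2 \<bullet> k) a)"
  by (simp add: AP_mult_eq ac_ac tsw_AP AP_closed)

definition iota where "iota x = tsw K AP H TP x (\<lambda>a h. pure K HP H a h)"

lemma lin_AP_restrict [simp]: "f \<in> lin_hom K HP P \<Longrightarrow> f \<in> lin_hom K AP P"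
  by (rule lin_comp[OF _ incl_AP])

lemma iota_lin: "iota \<in> lin_hom K AH TP" unfolding iota_def[abs_def] by simp
lemma iota_tsw [simp]: "module K U \<Longrightarrow> module K W \<Longrightarrow> t \<in> carrier (tensor K U W) \<Longrightarrow>
    (\<And>v w. v \<in> carrier U \<Longrightarrow> w \<in> carrier W \<Longrightarrow> B v w \<in> carrier AH) \<Longrightarrow>
    iota (tsw K U W AH t B) = tsw K U W TP t (\<lambda>v w. iota (B v w))"
  by (rule tsw_hom[OF _ _ _ _ iota_lin]) simp_all
lemma iota_pure [simp]: "a \<in> carrier AP \<Longrightarrow> h \<in> carrier H \<Longrightarrow> iota (pure K AP H a h) = pure K HP H a h"
  by (simp add: iota_def)

end

section \<open>Restriction of the coaction to \<open>apar\<close>\<close>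

context hopf_fd
begin

text \<open>Slicing along \<open>H\<close> turns \<open>iota\<close> into the inclusion of
  \<open>apar\<close> in \<open>hpar\<close>, and slices separate tensors.\<close>

lemma iota_inj: assumes x: "x \<in> carrier AH" and y: "y \<in> carrier AH" and eq: "iota x = iota y" shows "x = y"
proof (rule slice_eq[OF modAP x y])
  fix \<phi> assume \<phi>: "\<phi> \<in> lin_hom K H (kmod K)"
  note [simp] = \<phi> lin_comp[OF \<phi>] lin_hom_closed[OF \<phi>, simplified]
  have "tsw K AP H AP z (\<lambda>m h. \<phi> h \<odot>\<^bsub>AP\<^esub> m) = tsw K HP H HP (iota z) (\<lambda>m h. \<phi> h \<odot>\<^bsub>HP\<^esub> m)" if z: "z \<in> carrier AH" for z
  proof -
    have "tsw K HP H HP (iota z) (\<lambda>m h. \<phi> h \<odot>\<^bsub>HP\<^esub> m) = tsw K AP H HP z (\<lambda>m h. \<phi> h \<odot>\<^bsub>AP\<^esub> m)"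
      using z by (simp add: iota_def AP_simps(5))
    also have "\<dots> = tsw K AP H AP z (\<lambda>m h. \<phi> h \<odot>\<^bsub>AP\<^esub> m)" by (rule tsw_AP) (use z in simp_all)
    finally show ?thesis by simp
  qed
  then show "tsw K AP H AP x (\<lambda>m h. \<phi> h \<odot>\<^bsub>AP\<^esub> m) = tsw K AP H AP y (\<lambda>m h. \<phi> h \<odot>\<^bsub>AP\<^esub> m)" using x y eq by simp
qed

text \<open>The coaction of a generator has first leg in \<open>apar\<close> by
  \<open>vsw_e\<close>, and multiplicativity carries this to products of generators.\<close>

lemma Vm_image: assumes a: "a \<in> carrier AP" shows "\<exists>x\<in>carrier AH. iota x = Vm a"
proof (rule apar_induct[OF a])
  interpret AH: module K AH by simp
  show "\<exists>z\<in>carrier AH. iota z = Vm (x \<oplus>\<^bsub>HP\<^esub> y)"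
    if "\<exists>z\<in>carrier AH. iota z = Vm x" "\<exists>z\<in>carrier AH. iota z = Vm y" "x \<in> carrier AP" "y \<in> carrier AP" for x y
    using that lin_hom_add[OF iota_lin] lin_hom_add[OF Vm_lin0, of x y] by (metis AH.M.add.m_closed AP_HP)
  show "\<exists>z\<in>carrier AH. iota z = Vm (c \<odot>\<^bsub>HP\<^esub> x)" if "c \<in> carrier K" "\<exists>z\<in>carrier AH. iota z = Vm x" "x \<in> carrier AP" for c x
    using that lin_hom_smult[OF iota_lin] lin_hom_smult[OF Vm_lin0, of c x] by (metis AH.smult_closed AP_HP)
  have "Vm \<one>\<^bsub>HP\<^esub> = pure K HP H \<one>\<^bsub>HP\<^esub> \<one>\<^bsub>H\<^esub>"
    using tensor_id[of K HP H "Vm (brk \<one>\<^bsub>H\<^esub>)"] vsw_br[of "\<one>\<^bsub>H\<^esub>" TP "pure K HP H"] by simp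
  then show "\<exists>z\<in>carrier AH. iota z = Vm \<one>\<^bsub>HP\<^esub>"
    by (intro bexI[of _ "pure K AP H \<one>\<^bsub>AP\<^esub> \<one>\<^bsub>H\<^esub>"]) (simp_all add: AP_one_eq AP_closed(2))
  fix m b assume m: "m \<in> carrier H" and b: "b \<in> carrier AP" and "\<exists>z\<in>carrier AH. iota z = Vm b"
  then obtain z where z: "z \<in> carrier AH" "iota z = Vm b" by blast
  let ?Z = "cop AH m (\<lambda>m1 u. cop AH u (\<lambda>w m3. tsw K AP H AH z (\<lambda>x h. pure K AP H (e w \<cdot>\<^sub>A x) (h \<bullet> (m3 \<bullet> Si m1)))))"
  have "Vm (e m \<cdot> b) = vsw TP (e m \<cdot> b) (\<lambda>x z. pure K HP H x z)" using tensor_id[of K HP H "Vm (e m \<cdot> b)"] m b by simp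
  also have "\<dots> = cop TP m (\<lambda>m1 u. cop TP u (\<lambda>w m3. vsw TP b (\<lambda>q l. pure K HP H (e w \<cdot> q) (l \<bullet> (m3 \<bullet> Si m1)))))"
    using m b by (simp add: vsw_e)
  also have "\<dots> = iota ?Z" unfolding z(2)[symmetric] using m z(1) by (simp add: iota_def[of z] AP_mult_eq[symmetric]) (simp add: AP_mult_eq)
  finally show "\<exists>z\<in>carrier AH. iota z = Vm (e m \<cdot> b)" using m z(1) by (intro bexI[of _ ?Z]) simp_all
qed

definition dl where "dl a = (SOME x. x \<in> carrier AH \<and> iota x = Vm a)"

lemma dl_some: assumes a: "a \<in> carrier AP" shows "dl a \<in> carrier AH \<and> iota (dl a) = Vm a"
proof -
  have "\<exists>x. x \<in> carrier AH \<and> iota x = Vm a" using Vm_image[OF a] by blast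
  then show ?thesis unfolding dl_def by (rule someI_ex)
qed

lemma dl_closed [simp]: "a \<in> carrier AP \<Longrightarrow> dl a \<in> carrier AH" using dl_some by blast

lemma dl_eq: "a \<in> carrier AP \<Longrightarrow> z \<in> carrier AH \<Longrightarrow> iota z = Vm a \<Longrightarrow> dl a = z"
  using iota_inj[of "dl a" z] dl_some[of a] by simp

lemma dl_lin0 [simp]: "dl \<in> lin_hom K AP AH"
proof (rule lin_homI)
  interpret AP: module K AP by simp
  interpret AH: module K AH by simp
  show "dl (x \<oplus>\<^bsub>AP\<^esub> y) = dl x \<oplus>\<^bsub>AH\<^esub> dl y" if "x \<in> carrier AP" "y \<in> carrier AP" for x y
    by (rule dl_eq) (use that dl_some[OF that(1)] dl_some[OF that(2)] lin_hom_add[OF lin_AP_restrict[OF Vm_lin0] that] in \<open>simp_all add: lin_hom_add[OF iota_lin]\<close>)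
  show "dl (a \<odot>\<^bsub>AP\<^esub> x) = a \<odot>\<^bsub>AH\<^esub> dl x" if "a \<in> carrier K" "x \<in> carrier AP" for a x
    by (rule dl_eq) (use that dl_some[OF that(2)] lin_hom_smult[OF lin_AP_restrict[OF Vm_lin0] that] in \<open>simp_all add: lin_hom_smult[OF iota_lin]\<close>)
qed simp

lemma lin_dl [simp]: "f \<in> lin_hom K U AP \<Longrightarrow> (\<lambda>x. dl (f x)) \<in> lin_hom K U AH" by (rule lin_comp[OF dl_lin0])

lemma dl_tsw [simp]: "module K U \<Longrightarrow> module K W \<Longrightarrow> t \<in> carrier (tensor K U W) \<Longrightarrow>
    (\<And>v w. v \<in> carrier U \<Longrightarrow> w \<in> carrier W \<Longrightarrow> B v w \<in> carrier AP) \<Longrightarrow>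
    dl (tsw K U W AP t B) = tsw K U W AH t (\<lambda>v w. dl (B v w))"
  by (rule tsw_hom[OF _ _ _ _ dl_lin0]) simp_all

abbreviation dsw where "dsw P a B \<equiv> tsw K AP H P (dl a) B"

text \<open>For a form defined on all of \<open>hpar\<close> the extended and the restricted
  coaction give the same sum.\<close>

lemma vsw_dsw:
  assumes a: "a \<in> carrier AP" and P: "module K P" and B: "\<And>z. z \<in> carrier H \<Longrightarrow> (\<lambda>x. B x z) \<in> lin_hom K HP P"
    "\<And>x. x \<in> carrier HP \<Longrightarrow> (\<lambda>z. B x z) \<in> lin_hom K H P"
  shows "vsw P a (\<lambda>x z. B x z) = dsw P a (\<lambda>x z. B x z)"
proof -
  have "vsw P a (\<lambda>x z. B x z) = tsw K HP H P (iota (dl a)) (\<lambda>x z. B x z)" using dl_some[OF a] by simp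
  also have "\<dots> = dsw P a (\<lambda>x z. B x z)" using a P B by (simp add: iota_def)
  finally show ?thesis .
qed

lemma Vm_id: "x \<in> carrier HP \<Longrightarrow> Vm x = vsw TP x (\<lambda>x z. pure K HP H x z)"
  using tensor_id[of K HP H "Vm x"] by simp

text \<open>A form on \<open>apar\<close> comes with no extension to \<open>hpar\<close>, so
  \<open>vsw_dsw\<close> does not apply to it. The identity is first proved for the universal form,
  the pure tensor, where \<open>iota\<close> is injective, and \<open>B\<close> is applied
  afterwards; the other rules for \<open>dsw\<close> follow this pattern.\<close>

lemma dsw_mult [simp]:
  assumes a: "a \<in> carrier AP" and b: "b \<in> carrier AP" and P: "module K P" and B: "\<And>z. z \<in> carrier H \<Longrightarrow> (\<lambda>x. B x z) \<in> lin_hom K AP P"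
    "\<And>x. x \<in> carrier AP \<Longrightarrow> (\<lambda>z. B x z) \<in> lin_hom K H P"
  shows "dsw P (a \<cdot>\<^sub>A b) (\<lambda>x z. B x z) = dsw P a (\<lambda>x h. dsw P b (\<lambda>y l. B (x \<cdot>\<^sub>A y) (l \<bullet> h)))"
proof -
  have "iota (dsw AH a (\<lambda>x h. dsw AH b (\<lambda>y l. pure K AP H (x \<cdot>\<^sub>A y) (l \<bullet> h)))) = dsw TP a (\<lambda>x h. dsw TP b (\<lambda>y l. pure K HP H (x \<cdot> y) (l \<bullet> h)))"
    using a b by simp (simp add: AP_mult_eq)
  also have "\<dots> = dsw TP a (\<lambda>x h. vsw TP b (\<lambda>y l. pure K HP H (x \<cdot> y) (l \<bullet> h)))"
    by (rule tsw_cong[OF refl], rule vsw_dsw[symmetric]) (use b in simp_all)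
  also have "\<dots> = vsw TP a (\<lambda>x h. vsw TP b (\<lambda>y l. pure K HP H (x \<cdot> y) (l \<bullet> h)))"
    by (rule vsw_dsw[symmetric]) (use a b in simp_all)
  also have "\<dots> = Vm (a \<cdot>\<^sub>A b)" unfolding AP_mult_eq using a b by (subst Vm_id) simp_all
  finally have "dl (a \<cdot>\<^sub>A b) = dsw AH a (\<lambda>x h. dsw AH b (\<lambda>y l. pure K AP H (x \<cdot>\<^sub>A y) (l \<bullet> h)))"
    using a b by (intro dl_eq) simp_all
  then show ?thesis using a b P B lin_hom_closed[OF B(1)] by simp
qed

lemma dsw_e [simp]:
  assumes m: "m \<in> carrier H" and P: "module K P" and B: "\<And>z. z \<in> carrier H \<Longrightarrow> (\<lambda>x. B x z) \<in> lin_hom K AP P"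
    "\<And>x. x \<in> carrier AP \<Longrightarrow> (\<lambda>z. B x z) \<in> lin_hom K H P"
  shows "dsw P (e m) (\<lambda>x z. B x z) = cop P m (\<lambda>m1 u. cop P u (\<lambda>w m3. B (e w) (m3 \<bullet> Si m1)))"
proof -
  have "Vm (e m) = cop TP m (\<lambda>m1 u. cop TP u (\<lambda>w m3. pure K HP H (e w) (m3 \<bullet> Si m1)))"
    using m by (subst Vm_id) (simp_all add: vsw_e)
  then have "dl (e m) = cop AH m (\<lambda>m1 u. cop AH u (\<lambda>w m3. pure K AP H (e w) (m3 \<bullet> Si m1)))"
    using m by (intro dl_eq) simp_all
  then show ?thesis using m P B lin_hom_closed[OF B(1)] lin_comp[OF B(1) lin_eA0] by simp
qed

lemma dsw_one [simp]:
  assumes P: "module K P" and B: "\<And>z. z \<in> carrier H \<Longrightarrow> (\<lambda>x. B x z) \<in> lin_hom K AP P"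
    "\<And>x. x \<in> carrier AP \<Longrightarrow> (\<lambda>z. B x z) \<in> lin_hom K H P"
  shows "dsw P \<one>\<^bsub>AP\<^esub> (\<lambda>x z. B x z) = B \<one>\<^bsub>AP\<^esub> \<one>\<^bsub>H\<^esub>"
proof -
  note [simp] = lin_comp[OF B(1)] lin_comp[OF B(2)] B P
  show ?thesis using dsw_e[of "\<one>\<^bsub>H\<^esub>" P B] by simp
qed

lemma dsw_counit [simp]:
  assumes a: "a \<in> carrier AP" and P: "module K P" and F: "(\<lambda>x. F x) \<in> lin_hom K AP P"
  shows "dsw P a (\<lambda>x h. eps h \<odot>\<^bsub>P\<^esub> F x) = F a"
proof -
  have "dsw AP a (\<lambda>x h. eps h \<odot>\<^bsub>AP\<^esub> x) = dsw HP a (\<lambda>x h. eps h \<odot>\<^bsub>AP\<^esub> x)"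
    by (rule tsw_AP[symmetric]) (use a in simp_all)
  also have "\<dots> = a" using vsw_dsw[of a HP "\<lambda>x h. eps h \<odot>\<^bsub>HP\<^esub> x"] vsw_counit[of a] a by (simp add: AP_simps(5))
  finally have "F a = F (dsw AP a (\<lambda>x h. eps h \<odot>\<^bsub>AP\<^esub> x))" by simp
  also have "\<dots> = dsw P a (\<lambda>x h. F (eps h \<odot>\<^bsub>AP\<^esub> x))" by (rule tsw_hom[OF _ _ _ _ F]) (use a P in simp_all)
  also have "\<dots> = dsw P a (\<lambda>x h. eps h \<odot>\<^bsub>P\<^esub> F x)" by (rule tsw_cong[OF refl]) (simp add: lin_hom_smult[OF F])
  finally show ?thesis by simp
qed

text \<open>In the triple tensor product the outer \<open>H\<close>-leg is removed by slicing; what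
  remains lies in \<open>AH\<close>, where equality can be tested after \<open>iota\<close> and
  follows from the extended coaction.\<close>

lemma dsw_coassoc [simp]:
  assumes a: "a \<in> carrier AP" and P: "module K P"
    and F: "\<And>b c. b \<in> carrier H \<Longrightarrow> c \<in> carrier H \<Longrightarrow> (\<lambda>a. F a b c) \<in> lin_hom K AP P"
      "\<And>a c. a \<in> carrier AP \<Longrightarrow> c \<in> carrier H \<Longrightarrow> (\<lambda>b. F a b c) \<in> lin_hom K H P"
      "\<And>a b. a \<in> carrier AP \<Longrightarrow> b \<in> carrier H \<Longrightarrow> (\<lambda>c. F a b c) \<in> lin_hom K H P"
  shows "dsw P a (\<lambda>x h. dsw P x (\<lambda>y l. F y l h)) = dsw P a (\<lambda>x h. cop P h (\<lambda>l m. F x l m))"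
proof -
  let ?TT = "tensor K AH H" and ?p = "\<lambda>y l h. pure K AH H (pure K AP H y l) h"
  let ?X = "dsw ?TT a (\<lambda>x h. dsw ?TT x (\<lambda>y l. ?p y l h))" and ?Y = "dsw ?TT a (\<lambda>x h. cop ?TT h (\<lambda>l m. ?p x l m))"
  have "?X = ?Y"
  proof (rule slice_eq[where M = AH])
    fix \<phi> assume \<phi>: "\<phi> \<in> lin_hom K H (kmod K)"
    note [simp] = \<phi> lin_comp[OF \<phi>] lin_hom_closed[OF \<phi>, simplified]
    have 1: "tsw K AH H AH ?X (\<lambda>m h. \<phi> h \<odot>\<^bsub>AH\<^esub> m) = dsw AH a (\<lambda>x h. dsw AH x (\<lambda>y l. \<phi> h \<odot>\<^bsub>AH\<^esub> pure K AP H y l))" using a by simp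
    have 2: "tsw K AH H AH ?Y (\<lambda>m h. \<phi> h \<odot>\<^bsub>AH\<^esub> m) = dsw AH a (\<lambda>x h. cop AH h (\<lambda>l m. \<phi> m \<odot>\<^bsub>AH\<^esub> pure K AP H x l))" using a by simp
    have "iota (dsw AH a (\<lambda>x h. dsw AH x (\<lambda>y l. \<phi> h \<odot>\<^bsub>AH\<^esub> pure K AP H y l))) = dsw TP a (\<lambda>x h. dsw TP x (\<lambda>y l. \<phi> h \<odot>\<^bsub>TP\<^esub> pure K HP H y l))"
      using a by (simp add: lin_hom_smult[OF iota_lin])
    also have "\<dots> = dsw TP a (\<lambda>x h. vsw TP x (\<lambda>y l. \<phi> h \<odot>\<^bsub>TP\<^esub> pure K HP H y l))"
      by (rule tsw_cong[OF refl], rule vsw_dsw[symmetric]) simp_all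
    also have "\<dots> = vsw TP a (\<lambda>x h. vsw TP x (\<lambda>y l. \<phi> h \<odot>\<^bsub>TP\<^esub> pure K HP H y l))"
      by (rule vsw_dsw[symmetric]) (use a in simp_all)
    also have "\<dots> = vsw TP a (\<lambda>x h. cop TP h (\<lambda>l m. \<phi> m \<odot>\<^bsub>TP\<^esub> pure K HP H x l))"
      by (rule vsw_coassoc) (use a in simp_all)
    also have "\<dots> = dsw TP a (\<lambda>x h. cop TP h (\<lambda>l m. \<phi> m \<odot>\<^bsub>TP\<^esub> pure K HP H x l))"
      by (rule vsw_dsw) (use a in simp_all)
    also have "\<dots> = iota (dsw AH a (\<lambda>x h. cop AH h (\<lambda>l m. \<phi> m \<odot>\<^bsub>AH\<^esub> pure K AP H x l)))"
      using a by (simp add: lin_hom_smult[OF iota_lin])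
    finally show "tsw K AH H AH ?X (\<lambda>m h. \<phi> h \<odot>\<^bsub>AH\<^esub> m) = tsw K AH H AH ?Y (\<lambda>m h. \<phi> h \<odot>\<^bsub>AH\<^esub> m)"
      unfolding 1 2 by (rule iota_inj[rotated 2]) (use a in simp_all)
  qed (use a in simp_all)
  from arg_cong[OF this, of "\<lambda>t. tsw K AH H P t (\<lambda>u c. tsw K AP H P u (\<lambda>a b. F a b c))"]
  show ?thesis using a P F lin_hom_closed[OF F(1)] by simp
qed

text \<open>The action multiplies by brackets from both sides and the extended coaction is
  multiplicative. The left bracket contributes \<open>Si h1\<close>; in the right one the inverse
  antipode cancels \<open>S\<close> and leaves \<open>h3\<close>.\<close>

lemma dsw_ac [simp]:
  assumes a: "a \<in> carrier AP" and h: "h \<in> carrier H" and P: "module K P" and B: "\<And>z. z \<in> carrier H \<Longrightarrow> (\<lambda>x. B x z) \<in> lin_hom K AP P"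
    "\<And>x. x \<in> carrier AP \<Longrightarrow> (\<lambda>z. B x z) \<in> lin_hom K H P"
  shows "dsw P (ac h a) (\<lambda>x z. B x z) = cop P h (\<lambda>h1 u. cop P u (\<lambda>h2 h3. dsw P a (\<lambda>x l. B (ac h2 x) (h3 \<bullet> (l \<bullet> Si h1)))))"
proof -
  let ?Z = "cop AH h (\<lambda>h1 u. cop AH u (\<lambda>h2 h3. dsw AH a (\<lambda>x l. pure K AP H (ac h2 x) (h3 \<bullet> (l \<bullet> Si h1)))))"
  have "iota ?Z = cop TP h (\<lambda>h1 u. cop TP u (\<lambda>h2 h3. dsw TP a (\<lambda>x l. pure K HP H (ac h2 x) (h3 \<bullet> (l \<bullet> Si h1)))))"
    using a h by simp
  also have "\<dots> = cop TP h (\<lambda>h1 u. cop TP u (\<lambda>h2 h3. vsw TP a (\<lambda>x l. pure K HP H (ac h2 x) (h3 \<bullet> (l \<bullet> Si h1)))))"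
    by (rule tsw_cong[OF refl], rule tsw_cong[OF refl], rule vsw_dsw[symmetric]) (use a in simp_all)
  also have "\<dots> = cop TP h (\<lambda>h1 u. cop TP u (\<lambda>h2 h3. cop TP h2 (\<lambda>p q. vsw TP a (\<lambda>x l. pure K HP H (brk p \<cdot> (x \<cdot> brk (S q))) (h3 \<bullet> (l \<bullet> Si h1))))))"
    by (rule tsw_cong[OF refl], rule tsw_cong[OF refl], simp add: ac_eq, rule tsw_swap) (use a in simp_all)
  also have "\<dots> = cop TP h (\<lambda>u v. cop TP u (\<lambda>h1 p. cop TP v (\<lambda>q h3. vsw TP a (\<lambda>x l. pure K HP H (brk p \<cdot> (x \<cdot> brk (S q))) (h3 \<bullet> (l \<bullet> Si h1))))))"
    using a h by simp
  also have "\<dots> = cop TP h (\<lambda>u v. cop TP u (\<lambda>h1 p. vsw TP a (\<lambda>x l. cop TP v (\<lambda>q h3. pure K HP H (brk p \<cdot> (x \<cdot> brk (S q))) (h3 \<bullet> (l \<bullet> Si h1))))))"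
    by (rule tsw_cong[OF refl], rule tsw_cong[OF refl], rule tsw_swap) (use a in simp_all)
  also have "\<dots> = Vm (ac h a)" using a h by (subst Vm_id) (simp_all add: ac_eq)
  finally have "dl (ac h a) = ?Z" using a h by (intro dl_eq) simp_all
  then show ?thesis using a h P B lin_hom_closed[OF B(1)] lin_comp[OF B(1) lin_acA1[OF lin_id]] lin_comp[OF B(2)] by simp
qed

lemma is_apar_coaction_dl: "is_apar_coaction K H dl"
  unfolding is_apar_coaction_def
proof (intro conjI ballI)
  fix hs assume "hs \<in> lists (carrier H)"
  \<comment> \<open>Membership in \<open>apar\<close> is carried along because the rules for
    \<open>dl\<close> hold only there.\<close>
  then have "foldr (\<lambda>h a. e h \<cdot>\<^sub>A a) hs \<one>\<^bsub>AP\<^esub> \<in> carrier AP \<and> dl (foldr (\<lambda>h a. e h \<cdot>\<^sub>A a) hs \<one>\<^bsub>AP\<^esub>) = apar_coact_word K H hs"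
  proof (induction hs)
    case Nil
    have "dl \<one>\<^bsub>AP\<^esub> = dsw AH \<one>\<^bsub>AP\<^esub> (\<lambda>x z. pure K AP H x z)" using tensor_id[of K AP H "dl \<one>\<^bsub>AP\<^esub>"] by simp
    then show ?case by simp
  next
    case (Cons h hs)
    let ?a = "foldr (\<lambda>h a. e h \<cdot>\<^sub>A a) hs \<one>\<^bsub>AP\<^esub>"
    from Cons have h: "h \<in> carrier H" and a: "?a \<in> carrier AP" and eq: "dl ?a = apar_coact_word K H hs" by auto
    have "dl (e h \<cdot>\<^sub>A ?a) = dsw AH (e h \<cdot>\<^sub>A ?a) (\<lambda>x z. pure K AP H x z)" using tensor_id[of K AP H "dl (e h \<cdot>\<^sub>A ?a)"] h a by simp
    also have "\<dots> = cop AH h (\<lambda>h1 h'. cop AH h' (\<lambda>h2 h3. dsw AH ?a (\<lambda>a x. pure K AP H (e h2 \<cdot>\<^sub>A a) (x \<bullet> (h3 \<bullet> Si h1)))))"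
      using h a by simp
    also have "\<dots> = apar_coact_word K H (h # hs)"
    proof -
      have s: "sw K AH (dl ?a) B = dsw AH ?a B" if "\<And>a x. a \<in> carrier AP \<Longrightarrow> x \<in> carrier H \<Longrightarrow> B a x \<in> carrier AH" for B
        by (rule sw_finsum(1)) (use a that in simp_all)
      show ?thesis using h a by (simp add: eq[symmetric] sw_cop s)
    qed
    finally show ?case using h a by simp
  qed
  then show "dl (foldr (\<lambda>h a. e h \<cdot>\<^sub>A a) hs \<one>\<^bsub>AP\<^esub>) = apar_coact_word K H hs" by simp
qed simp

subsection \<open>The algebra of partial module maps\<close>

abbreviation BB where "BB \<equiv> apar_homs K H"
definition ev where "ev f l = f (pure K AP H \<one>\<^bsub>AP\<^esub> l)"
definition mk where "mk g = (\<lambda>x\<in>carrier AH. tsw K AP H AP x (\<lambda>a l. a \<cdot>\<^sub>A g l))"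
text \<open>
  \<open>equi\<close> is the condition \<open>h\<^sub>(\<^sub>1\<^sub>) \<bullet> g(S(h\<^sub>(\<^sub>2\<^sub>)) l) = h\<^sub>(\<^sub>1\<^sub>) \<bullet> (S(h\<^sub>(\<^sub>2\<^sub>)) \<bullet> g(l))\<close> of the paper in the
  form in which it is used, and \<open>mk\<close> is inverse to the evaluation \<open>f \<mapsto> f(1 \<otimes> -)\<close>.
\<close>

definition equi where "equi g \<longleftrightarrow> g \<in> lin_hom K H AP \<and>
  (\<forall>h\<in>carrier H. \<forall>l\<in>carrier H. ac h (g l) = cop AP h (\<lambda>h1 h2. e h1 \<cdot>\<^sub>A g (h2 \<bullet> l)))"

lemma BB_carrier: "carrier BB = pmod_hom K H AH (apar_H_act K H) AP ac"
  by (simp add: apar_homs_def Let_def)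

lemma hact_eq:
  assumes h: "h \<in> carrier H" and x: "x \<in> carrier AH"
  shows "apar_H_act K H h x = cop AH h (\<lambda>h1 h2. tsw K AP H AH x (\<lambda>a l. pure K AP H (ac h1 a) (h2 \<bullet> l)))"
proof -
  have "sw K AH x (\<lambda>a l. pure K AP H (ac h1 a) (h2 \<bullet> l)) = tsw K AP H AH x (\<lambda>a l. pure K AP H (ac h1 a) (h2 \<bullet> l))"
    if "h1 \<in> carrier H" "h2 \<in> carrier H" for h1 h2
    by (rule sw_finsum(1)) (use that x in simp_all)
  note e = this
  show ?thesis unfolding apar_H_act_def using h x by (subst sw_cop) (simp_all add: e)
qed

lemma BB_lin: "f \<in> carrier BB \<Longrightarrow> f \<in> lin_hom K AH AP"
  and BB_ext: "f \<in> carrier BB \<Longrightarrow> f \<in> extensional (carrier AH)"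
  and BB_equi: "f \<in> carrier BB \<Longrightarrow> h \<in> carrier H \<Longrightarrow> x \<in> carrier AH \<Longrightarrow> f (apar_H_act K H h x) = ac h (f x)"
  by (auto simp: BB_carrier pmod_hom_def)

lemma BB_tsw: "f \<in> carrier BB \<Longrightarrow> module K U \<Longrightarrow> module K W \<Longrightarrow> t \<in> carrier (tensor K U W) \<Longrightarrow>
    (\<And>v w. v \<in> carrier U \<Longrightarrow> w \<in> carrier W \<Longrightarrow> C v w \<in> carrier AH) \<Longrightarrow>
    f (tsw K U W AH t C) = tsw K U W AP t (\<lambda>v w. f (C v w))"
  by (rule tsw_hom[OF _ _ _ _ BB_lin]) simp_all

text \<open>By \<open>ac_acA\<close> the two actions merge at the cost of a generator, and the
  remaining two legs cancel.\<close>

lemma ac_S: assumes m: "m \<in> carrier H" and x: "x \<in> carrier AP"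
  shows "cop AP m (\<lambda>p y. ac p (ac (S y) x)) = e m \<cdot>\<^sub>A x"
proof -
  have "cop AP m (\<lambda>p y. ac p (ac (S y) x)) = cop AP m (\<lambda>p u. cop AP u (\<lambda>q y. e p \<cdot>\<^sub>A ac (q \<bullet> S y) x))"
    using m x by (simp add: ac_acA)
  also have "\<dots> = e m \<cdot>\<^sub>A ac \<one>\<^bsub>H\<^esub> x"
    by (rule chain_r_Sr[where G = "\<lambda>p w. e p \<cdot>\<^sub>A ac w x"]) (use m x in simp_all)
  finally show ?thesis using x by simp
qed

text \<open>The double action by \<open>m1\<close> and \<open>S m2\<close> on \<open>b\<close>
  tensor \<open>l\<close> multiplies \<open>b\<close> by \<open>e m\<close> and leaves
  \<open>l\<close> unchanged, since the legs on \<open>H\<close> cancel. A morphism commutes with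
  the action, and by \<open>ac_S\<close> the same operation in the target is multiplication by
  \<open>e m\<close>.\<close>

lemma BB_e:
  assumes f: "f \<in> carrier BB" and m: "m \<in> carrier H" and b: "b \<in> carrier AP" and l: "l \<in> carrier H"
  shows "f (pure K AP H (e m \<cdot>\<^sub>A b) l) = e m \<cdot>\<^sub>A f (pure K AP H b l)"
proof -
  note flin = BB_lin[OF f]
  note [simp] = lin_hom_closed[OF flin] lin_comp[OF flin]
  let ?ha = "apar_H_act K H"
  have hc: "?ha h x \<in> carrier AH" if "h \<in> carrier H" "x \<in> carrier AH" for h x
    using that by (simp add: hact_eq)
  have "cop AH m (\<lambda>m1 m2. ?ha m1 (?ha (S m2) (pure K AP H b l))) =
     cop AH m (\<lambda>p u. cop AH u (\<lambda>q z. cop AH z (\<lambda>x y. pure K AP H (ac p (ac (S y) b)) (q \<bullet> S x \<bullet> l))))"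
    using m b l by (simp add: hact_eq)
  also have "\<dots> = cop AH m (\<lambda>p y. pure K AP H (ac p (ac (S y) b)) (\<one>\<^bsub>H\<^esub> \<bullet> l))"
    by (rule tsw_cong[OF refl], rule chain_l_Sr[where G = "\<lambda>w y. pure K AP H (ac p (ac (S y) b)) (w \<bullet> l)" for p])
      (use m b l in simp_all)
  also have "\<dots> = pure K AP H (e m \<cdot>\<^sub>A b) l" unfolding ac_S[OF m b, symmetric] using m b l by simp
  finally have "f (pure K AP H (e m \<cdot>\<^sub>A b) l) = f (cop AH m (\<lambda>m1 m2. ?ha m1 (?ha (S m2) (pure K AP H b l))))" by simp
  also have "\<dots> = cop AP m (\<lambda>m1 m2. ac m1 (ac (S m2) (f (pure K AP H b l))))"
    using m b l f by (simp add: BB_tsw hc BB_equi)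
  also have "\<dots> = e m \<cdot>\<^sub>A f (pure K AP H b l)" by (rule ac_S) (use m b l in simp_all)
  finally show ?thesis .
qed

lemma ev_closed [simp]: "f \<in> carrier BB \<Longrightarrow> l \<in> carrier H \<Longrightarrow> ev f l \<in> carrier AP"
  unfolding ev_def by (rule lin_hom_closed[OF BB_lin]) simp_all

lemma lin_ev [simp]: "f \<in> carrier BB \<Longrightarrow> k \<in> lin_hom K U H \<Longrightarrow> (\<lambda>x. ev f (k x)) \<in> lin_hom K U AP"
  unfolding ev_def by (rule lin_comp[OF BB_lin]) simp_all

text \<open>Morphisms are left linear over \<open>apar\<close>: generators pass through by
  \<open>BB_e\<close>, and \<open>apar_induct\<close> covers the rest. Hence a morphism is
  determined by its values at 1 tensor \<open>l\<close>.\<close>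

lemma BB_pure:
  assumes f: "f \<in> carrier BB" and a: "a \<in> carrier AP" and l: "l \<in> carrier H"
  shows "f (pure K AP H a l) = a \<cdot>\<^sub>A ev f l"
proof -
  interpret AP: assoc_algebra K AP by simp
  note flin = BB_lin[OF f]
  have l1: "(\<lambda>a. f (pure K AP H a l)) \<in> lin_hom K AP AP" by (rule lin_comp[OF flin]) (use l in simp)
  have l2: "(\<lambda>a. a \<cdot>\<^sub>A ev f l) \<in> lin_hom K AP AP" using f l by simp
  show ?thesis
  proof (rule apar_induct[OF a, folded AP_simps(3,5) AP_mult_eq AP_one_eq])
    show "f (pure K AP H (e m \<cdot>\<^sub>A b) l) = e m \<cdot>\<^sub>A b \<cdot>\<^sub>A ev f l"
      if "m \<in> carrier H" "b \<in> carrier AP" "f (pure K AP H b l) = b \<cdot>\<^sub>A ev f l" for m b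
      using BB_e[OF f that(1,2) l] that f l by simp
    show "f (pure K AP H \<one>\<^bsub>AP\<^esub> l) = \<one>\<^bsub>AP\<^esub> \<cdot>\<^sub>A ev f l" using f l by (simp add: ev_def[symmetric])
  qed (use lin_hom_add[OF l1] lin_hom_add[OF l2] lin_hom_smult[OF l1] lin_hom_smult[OF l2] in simp_all)
qed

lemma BB_eq_mk: assumes f: "f \<in> carrier BB" shows "f = mk (ev f)"
proof (rule extensionalityI[OF BB_ext[OF f]])
  show "mk (ev f) \<in> extensional (carrier AH)" by (simp add: mk_def)
  fix x assume x: "x \<in> carrier AH"
  have "f x = f (tsw K AP H AH x (pure K AP H))" using tensor_id[of K AP H x] x by simp
  also have "\<dots> = mk (ev f) x" using f x by (simp add: BB_tsw BB_pure mk_def)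
  finally show "f x = mk (ev f) x" .
qed

lemma mk_cong: "(\<And>l. l \<in> carrier H \<Longrightarrow> g l = g' l) \<Longrightarrow> mk g = mk g'"
  unfolding mk_def by (rule restrict_ext) (simp cong: tsw_cong)

lemma BB_eqI: "f \<in> carrier BB \<Longrightarrow> f' \<in> carrier BB \<Longrightarrow> (\<And>l. l \<in> carrier H \<Longrightarrow> ev f l = ev f' l) \<Longrightarrow> f = f'"
  using BB_eq_mk[of f] BB_eq_mk[of f'] mk_cong[of "ev f" "ev f'"] by simp

lemma equi_ev: assumes f: "f \<in> carrier BB" shows "equi (ev f)"
  unfolding equi_def
proof (intro conjI ballI)
  fix h l assume h: "h \<in> carrier H" and l: "l \<in> carrier H"
  note [simp] = lin_hom_closed[OF BB_lin[OF f]]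
  have "ac h (ev f l) = f (apar_H_act K H h (pure K AP H \<one>\<^bsub>AP\<^esub> l))" unfolding ev_def using BB_equi[OF f] h l by simp
  also have "\<dots> = f (cop AH h (\<lambda>h1 h2. pure K AP H (e h1) (h2 \<bullet> l)))" using h l by (simp add: hact_eq)
  also have "\<dots> = cop AP h (\<lambda>h1 h2. e h1 \<cdot>\<^sub>A ev f (h2 \<bullet> l))" using f h l by (simp add: BB_tsw BB_pure)
  finally show "ac h (ev f l) = cop AP h (\<lambda>h1 h2. e h1 \<cdot>\<^sub>A ev f (h2 \<bullet> l))" .
qed (use f in simp)

lemma ac_ev: "f \<in> carrier BB \<Longrightarrow> h \<in> carrier H \<Longrightarrow> l \<in> carrier H \<Longrightarrow> ac h (ev f l) = cop AP h (\<lambda>h1 h2. e h1 \<cdot>\<^sub>A ev f (h2 \<bullet> l))"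
  using equi_ev by (simp add: equi_def)

lemma ac_times_e: assumes h: "h \<in> carrier H" and a: "a \<in> carrier AP"
  shows "cop AP h (\<lambda>h1 h2. ac h1 a \<cdot>\<^sub>A e h2) = ac h a"
  using ac_multA[OF a _ h, of "\<one>\<^bsub>AP\<^esub>"] a h by simp

text \<open>Equivariance of \<open>g\<close> produces a generator \<open>e h2\<close> directly
  behind the action on \<open>a\<close>, and this action absorbs it by
  \<open>ac_times_e\<close>.\<close>

lemma ac_equi_chain:
  assumes g: "equi g" and h: "h \<in> carrier H" and a: "a \<in> carrier AP" and l: "l \<in> carrier H"
  shows "cop AP h (\<lambda>h1 h2. ac h1 a \<cdot>\<^sub>A ac h2 (g l)) = cop AP h (\<lambda>h1 h2. ac h1 a \<cdot>\<^sub>A g (h2 \<bullet> l))"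
proof -
  have gl: "g \<in> lin_hom K H AP" using g by (simp add: equi_def)
  note [simp] = gl lin_comp[OF gl] lin_hom_closed[OF gl]
  have "cop AP h (\<lambda>h1 h2. ac h1 a \<cdot>\<^sub>A ac h2 (g l)) = cop AP h (\<lambda>u h3. cop AP u (\<lambda>h1 h2. ac h1 a \<cdot>\<^sub>A e h2) \<cdot>\<^sub>A g (h3 \<bullet> l))"
    using g h a l by (simp add: equi_def)
  also have "\<dots> = cop AP h (\<lambda>h1 h2. ac h1 a \<cdot>\<^sub>A g (h2 \<bullet> l))"
    by (rule tsw_cong[OF refl]) (use a in \<open>simp add: ac_times_e\<close>)
  finally show ?thesis .
qed

lemma mk_BB: assumes g: "equi g" shows "mk g \<in> carrier BB"
proof -
  have gl: "g \<in> lin_hom K H AP" using g by (simp add: equi_def)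
  note [simp] = gl lin_comp[OF gl] lin_hom_closed[OF gl]
  have fl: "(\<lambda>x. tsw K AP H AP x (\<lambda>a l. a \<cdot>\<^sub>A g l)) \<in> lin_hom K AH AP" by simp
  have ml: "mk g \<in> lin_hom K AH AP" unfolding mk_def by (rule lin_congI[OF fl]) simp_all
  have "mk g (apar_H_act K H h x) = ac h (mk g x)" if h: "h \<in> carrier H" and x: "x \<in> carrier AH" for h x
  proof -
    have "tsw K AP H AP (cop AH h (\<lambda>h1 h2. tsw K AP H AH x (\<lambda>a l. pure K AP H (ac h1 a) (h2 \<bullet> l)))) (\<lambda>a l. a \<cdot>\<^sub>A g l) =
       ac h (tsw K AP H AP x (\<lambda>a l. a \<cdot>\<^sub>A g l))"
    proof (rule tensor_ext[where P = AP and f = "\<lambda>x. tsw K AP H AP (cop AH h (\<lambda>h1 h2. tsw K AP H AH x (\<lambda>a l. pure K AP H (ac h1 a) (h2 \<bullet> l)))) (\<lambda>a l. a \<cdot>\<^sub>A g l)"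
          and g = "\<lambda>x. ac h (tsw K AP H AP x (\<lambda>a l. a \<cdot>\<^sub>A g l))", OF modAP modH _ x])
      fix a l assume a: "a \<in> carrier AP" and l: "l \<in> carrier H"
      show "tsw K AP H AP (cop AH h (\<lambda>h1 h2. tsw K AP H AH (pure K AP H a l) (\<lambda>a l. pure K AP H (ac h1 a) (h2 \<bullet> l)))) (\<lambda>a l. a \<cdot>\<^sub>A g l) =
         ac h (tsw K AP H AP (pure K AP H a l) (\<lambda>a l. a \<cdot>\<^sub>A g l))"
        using h a l by (simp add: ac_multA ac_equi_chain[OF g])
    qed (use h in simp_all)
    then show ?thesis using h x by (simp add: mk_def hact_eq)
  qed
  then show ?thesis using ml by (simp add: BB_carrier pmod_hom_def) (simp add: mk_def)
qed

lemma ev_mk [simp]: "equi g \<Longrightarrow> l \<in> carrier H \<Longrightarrow> ev (mk g) l = g l"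
proof -
  assume g: "equi g" and l: "l \<in> carrier H"
  have gl: "g \<in> lin_hom K H AP" using g by (simp add: equi_def)
  note [simp] = gl lin_comp[OF gl] lin_hom_closed[OF gl]
  show ?thesis using l by (simp add: ev_def mk_def)
qed

lemma hact_closed: "h \<in> carrier H \<Longrightarrow> x \<in> carrier AH \<Longrightarrow> apar_H_act K H h x \<in> carrier AH"
  by (simp add: hact_eq)

section \<open>The algebra structure and the action of \<open>H\<close> on partial module
  maps\<close>

lemma BB_restrict:
  assumes \<phi>: "\<phi> \<in> lin_hom K AH AP"
    and eq: "\<And>h x. h \<in> carrier H \<Longrightarrow> x \<in> carrier AH \<Longrightarrow> \<phi> (apar_H_act K H h x) = ac h (\<phi> x)"
  shows "(\<lambda>x\<in>carrier AH. \<phi> x) \<in> carrier BB"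
proof -
  have "(\<lambda>x\<in>carrier AH. \<phi> x) \<in> lin_hom K AH AP" by (rule lin_congI[OF \<phi>]) simp_all
  then show ?thesis using eq by (simp add: BB_carrier pmod_hom_def hact_closed)
qed

lemma BB_ops: "f \<oplus>\<^bsub>BB\<^esub> g = (\<lambda>x\<in>carrier AH. f x \<oplus>\<^bsub>AP\<^esub> g x)" "\<zero>\<^bsub>BB\<^esub> = (\<lambda>x\<in>carrier AH. \<zero>\<^bsub>AP\<^esub>)"
  "c \<odot>\<^bsub>BB\<^esub> f = (\<lambda>x\<in>carrier AH. c \<odot>\<^bsub>AP\<^esub> f x)"
  by (simp_all add: apar_homs_def Let_def)

lemma BB_closed: "f \<in> carrier BB \<Longrightarrow> x \<in> carrier AH \<Longrightarrow> f x \<in> carrier AP"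
  by (rule lin_hom_closed[OF BB_lin])

lemma BB_ops_closed:
  "f \<in> carrier BB \<Longrightarrow> g \<in> carrier BB \<Longrightarrow> f \<oplus>\<^bsub>BB\<^esub> g \<in> carrier BB"
  "\<zero>\<^bsub>BB\<^esub> \<in> carrier BB"
  "c \<in> carrier K \<Longrightarrow> f \<in> carrier BB \<Longrightarrow> c \<odot>\<^bsub>BB\<^esub> f \<in> carrier BB"
proof -
  show "f \<oplus>\<^bsub>BB\<^esub> g \<in> carrier BB" if "f \<in> carrier BB" "g \<in> carrier BB"
    unfolding BB_ops by (rule BB_restrict)
      (use that in \<open>simp_all add: BB_lin BB_equi BB_closed lin_hom_add[OF lin_acA0]\<close>)
  show "\<zero>\<^bsub>BB\<^esub> \<in> carrier BB" unfolding BB_ops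
    by (rule BB_restrict) (simp_all add: lin_hom_zero_map lin_hom_zero[OF modAP modAP lin_acA0])
  show "c \<odot>\<^bsub>BB\<^esub> f \<in> carrier BB" if "c \<in> carrier K" "f \<in> carrier BB"
    unfolding BB_ops by (rule BB_restrict) (use that in \<open>simp_all add: BB_lin BB_equi BB_closed\<close>)
qed

lemma BB_module [simp]: "module K BB"
proof -
  interpret AP: module K AP by simp
  interpret AHm: module K AH by simp
  note c = BB_ops_closed and [simp] = BB_ops_closed
  have pw: "(f \<oplus>\<^bsub>BB\<^esub> g) x = f x \<oplus>\<^bsub>AP\<^esub> g x" "\<zero>\<^bsub>BB\<^esub> x = \<zero>\<^bsub>AP\<^esub>" "(a \<odot>\<^bsub>BB\<^esub> f) x = a \<odot>\<^bsub>AP\<^esub> f x"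
    if "x \<in> carrier AH" for f g a x using that by (simp_all add: BB_ops)
  have eqI: "f = g" if "f \<in> carrier BB" "g \<in> carrier BB" "\<And>x. x \<in> carrier AH \<Longrightarrow> f x = g x" for f g
    by (rule extensionalityI[OF BB_ext[OF that(1)] BB_ext[OF that(2)] that(3)])
  have abelian: "abelian_group BB"
  proof (rule abelian_groupI)
    fix f assume f: "f \<in> carrier BB"
    show "\<exists>y\<in>carrier BB. y \<oplus>\<^bsub>BB\<^esub> f = \<zero>\<^bsub>BB\<^esub>"
    proof (rule bexI[where x = "(\<ominus>\<^bsub>K\<^esub> \<one>\<^bsub>K\<^esub>) \<odot>\<^bsub>BB\<^esub> f"])
      show "(\<ominus>\<^bsub>K\<^esub> \<one>\<^bsub>K\<^esub>) \<odot>\<^bsub>BB\<^esub> f \<oplus>\<^bsub>BB\<^esub> f = \<zero>\<^bsub>BB\<^esub>"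
        by (rule eqI) (use f c in \<open>simp_all add: pw BB_closed AP.smult_l_minus AP.M.l_neg\<close>)
    qed (use f c in simp)
  next
    fix f g h assume "f \<in> carrier BB" "g \<in> carrier BB" "h \<in> carrier BB"
    then show "f \<oplus>\<^bsub>BB\<^esub> g \<oplus>\<^bsub>BB\<^esub> h = f \<oplus>\<^bsub>BB\<^esub> (g \<oplus>\<^bsub>BB\<^esub> h)"
      by (intro eqI[of "f \<oplus>\<^bsub>BB\<^esub> g \<oplus>\<^bsub>BB\<^esub> h"] c) (simp_all add: pw BB_closed AP.M.a_assoc)
  next
    fix f g assume "f \<in> carrier BB" "g \<in> carrier BB"
    then show "f \<oplus>\<^bsub>BB\<^esub> g = g \<oplus>\<^bsub>BB\<^esub> f"
      by (intro eqI[of "f \<oplus>\<^bsub>BB\<^esub> g"] c) (simp_all add: pw BB_closed AP.M.a_comm)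
  next
    fix f assume "f \<in> carrier BB"
    then show "\<zero>\<^bsub>BB\<^esub> \<oplus>\<^bsub>BB\<^esub> f = f"
      by (intro eqI[of "\<zero>\<^bsub>BB\<^esub> \<oplus>\<^bsub>BB\<^esub> f"] c) (simp_all add: pw BB_closed)
  qed (use c in simp_all)
  show ?thesis
  proof (rule moduleI[OF cringK abelian])
    fix a b f assume *: "a \<in> carrier K" "b \<in> carrier K" "f \<in> carrier BB"
    show "(a \<oplus>\<^bsub>K\<^esub> b) \<odot>\<^bsub>BB\<^esub> f = a \<odot>\<^bsub>BB\<^esub> f \<oplus>\<^bsub>BB\<^esub> b \<odot>\<^bsub>BB\<^esub> f"
      by (rule eqI) (use * c in \<open>simp_all add: pw BB_closed AP.smult_l_distr\<close>)
    show "(a \<otimes>\<^bsub>K\<^esub> b) \<odot>\<^bsub>BB\<^esub> f = a \<odot>\<^bsub>BB\<^esub> (b \<odot>\<^bsub>BB\<^esub> f)"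
      by (rule eqI) (use * c in \<open>simp_all add: pw BB_closed\<close>)
  next
    fix a f g assume *: "a \<in> carrier K" "f \<in> carrier BB" "g \<in> carrier BB"
    show "a \<odot>\<^bsub>BB\<^esub> (f \<oplus>\<^bsub>BB\<^esub> g) = a \<odot>\<^bsub>BB\<^esub> f \<oplus>\<^bsub>BB\<^esub> a \<odot>\<^bsub>BB\<^esub> g"
      by (rule eqI) (use * c in \<open>simp_all add: pw BB_closed AP.smult_r_distr\<close>)
  next
    fix f assume *: "f \<in> carrier BB"
    show "\<one>\<^bsub>K\<^esub> \<odot>\<^bsub>BB\<^esub> f = f"
      by (rule eqI) (use * c in \<open>simp_all add: pw BB_closed\<close>)
  qed (use c in simp_all)
qed

lemma ev_add [simp]: "l \<in> carrier H \<Longrightarrow> ev (f \<oplus>\<^bsub>BB\<^esub> g) l = ev f l \<oplus>\<^bsub>AP\<^esub> ev g l"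
  and ev_smult [simp]: "l \<in> carrier H \<Longrightarrow> ev (c \<odot>\<^bsub>BB\<^esub> f) l = c \<odot>\<^bsub>AP\<^esub> ev f l"
  by (simp_all add: ev_def BB_ops)

text \<open>The evaluations at all \<open>l\<close> are linear and jointly injective, so linearity
  into \<open>BB\<close> can be tested after evaluation.\<close>

lemma lin_BBI:
  assumes "module K U" "\<And>u. u \<in> carrier U \<Longrightarrow> \<phi> u \<in> carrier BB" "\<And>l. l \<in> carrier H \<Longrightarrow> (\<lambda>u. ev (\<phi> u) l) \<in> lin_hom K U AP"
  shows "\<phi> \<in> lin_hom K U BB"
proof -
  interpret U: module K U by fact
  interpret BB: module K BB by simp
  show ?thesis
  proof (rule lin_homI)
    show "\<phi> (x \<oplus>\<^bsub>U\<^esub> y) = \<phi> x \<oplus>\<^bsub>BB\<^esub> \<phi> y" if "x \<in> carrier U" "y \<in> carrier U" for x y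
      by (rule BB_eqI) (use that assms lin_hom_add[OF assms(3)] in simp_all)
    show "\<phi> (a \<odot>\<^bsub>U\<^esub> x) = a \<odot>\<^bsub>BB\<^esub> \<phi> x" if "a \<in> carrier K" "x \<in> carrier U" for a x
      by (rule BB_eqI) (use that assms lin_hom_smult[OF assms(3)] in simp_all)
  qed (use assms in simp)
qed

lemma ev_lin0 [simp]: "l \<in> carrier H \<Longrightarrow> (\<lambda>f. ev f l) \<in> lin_hom K BB AP" by (rule lin_homI) simp_all
lemma ev_lin [simp]: "l \<in> carrier H \<Longrightarrow> \<phi> \<in> lin_hom K U BB \<Longrightarrow> (\<lambda>x. ev (\<phi> x) l) \<in> lin_hom K U AP"
  by (rule lin_comp[OF ev_lin0])

lemma ev_tsw [simp]: "module K U \<Longrightarrow> module K W \<Longrightarrow> t \<in> carrier (tensor K U W) \<Longrightarrow> l \<in> carrier H \<Longrightarrow>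
    (\<And>v w. v \<in> carrier U \<Longrightarrow> w \<in> carrier W \<Longrightarrow> C v w \<in> carrier BB) \<Longrightarrow>
    ev (tsw K U W BB t C) l = tsw K U W AP t (\<lambda>v w. ev (C v w) l)"
  by (rule tsw_hom[OF _ _ _ _ ev_lin0]) simp_all

text \<open>Acting on a convolution product produces a generator in each factor. The one from
  \<open>g\<close> is absorbed by the first factor through \<open>ac_equi_chain\<close>, so a single
  generator survives in front.\<close>

lemma equi_mult: assumes f: "f \<in> carrier BB" and g: "g \<in> carrier BB"
  shows "equi (\<lambda>l. cop AP l (\<lambda>l1 l2. ev f l1 \<cdot>\<^sub>A ev g l2))"
  unfolding equi_def
proof (intro conjI ballI)
  fix h l assume h: "h \<in> carrier H" and l: "l \<in> carrier H"
  have "ac h (cop AP l (\<lambda>l1 l2. ev f l1 \<cdot>\<^sub>A ev g l2)) = cop AP l (\<lambda>l1 l2. cop AP h (\<lambda>h1 h2. ac h1 (ev f l1) \<cdot>\<^sub>A ac h2 (ev g l2)))"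
    using f g h l by (simp add: ac_multA)
  also have "\<dots> = cop AP l (\<lambda>l1 l2. cop AP h (\<lambda>h1 h2. ac h1 (ev f l1) \<cdot>\<^sub>A ev g (h2 \<bullet> l2)))"
    by (rule tsw_cong[OF refl], rule ac_equi_chain[OF equi_ev[OF g]]) (use f h l in simp_all)
  also have "\<dots> = cop AP h (\<lambda>h1 h2. cop AP l (\<lambda>l1 l2. ac h1 (ev f l1) \<cdot>\<^sub>A ev g (h2 \<bullet> l2)))"
    by (rule tsw_swap) (use f g h l in simp_all)
  also have "\<dots> = cop AP h (\<lambda>u h2. cop AP l (\<lambda>l1 l2. cop AP u (\<lambda>h0 h1. e h0 \<cdot>\<^sub>A (ev f (h1 \<bullet> l1) \<cdot>\<^sub>A ev g (h2 \<bullet> l2)))))"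
    using f g h l by (simp add: ac_ev)
  also have "\<dots> = cop AP h (\<lambda>h1 h2. e h1 \<cdot>\<^sub>A cop AP (h2 \<bullet> l) (\<lambda>l1 l2. ev f l1 \<cdot>\<^sub>A ev g l2))"
    using f g h l by simp
  finally show "ac h (cop AP l (\<lambda>l1 l2. ev f l1 \<cdot>\<^sub>A ev g l2)) = cop AP h (\<lambda>h1 h2. e h1 \<cdot>\<^sub>A cop AP (h2 \<bullet> l) (\<lambda>l1 l2. ev f l1 \<cdot>\<^sub>A ev g l2))" .
qed (use f g in simp)

lemma BB_mult: assumes f: "f \<in> carrier BB" and g: "g \<in> carrier BB"
  shows "f \<otimes>\<^bsub>BB\<^esub> g = mk (\<lambda>l. cop AP l (\<lambda>l1 l2. ev f l1 \<cdot>\<^sub>A ev g l2))"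
proof -
  have i: "sw K AP (comult H h) (\<lambda>h1 h2. g (pure K AP H (f (pure K AP H a h1)) h2)) =
      a \<cdot>\<^sub>A cop AP h (\<lambda>h1 h2. ev f h1 \<cdot>\<^sub>A ev g h2)" if "a \<in> carrier AP" "h \<in> carrier H" for a h
    using that f g by (simp add: sw_cop BB_pure BB_closed)
  have "sw K AP x (\<lambda>a h. sw K AP (comult H h) (\<lambda>h1 h2. g (pure K AP H (f (pure K AP H a h1)) h2))) =
      tsw K AP H AP x (\<lambda>a h. sw K AP (comult H h) (\<lambda>h1 h2. g (pure K AP H (f (pure K AP H a h1)) h2)))" if "x \<in> carrier AH" for x
    by (rule sw_finsum(1)) (use that f g in \<open>simp_all add: i\<close>)
  then show ?thesis using f g by (simp add: apar_homs_def Let_def mk_def i cong: restrict_cong)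
qed

lemma BB_mult_closed [simp]: "f \<in> carrier BB \<Longrightarrow> g \<in> carrier BB \<Longrightarrow> f \<otimes>\<^bsub>BB\<^esub> g \<in> carrier BB"
  by (simp add: BB_mult mk_BB equi_mult)

lemma ev_mult [simp]: "f \<in> carrier BB \<Longrightarrow> g \<in> carrier BB \<Longrightarrow> l \<in> carrier H \<Longrightarrow>
    ev (f \<otimes>\<^bsub>BB\<^esub> g) l = cop AP l (\<lambda>l1 l2. ev f l1 \<cdot>\<^sub>A ev g l2)"
  by (simp add: BB_mult equi_mult)

lemma equi_one: "equi (\<lambda>l. eps l \<odot>\<^bsub>AP\<^esub> \<one>\<^bsub>AP\<^esub>)"
  unfolding equi_def
proof (intro conjI ballI)
  fix h l assume h: "h \<in> carrier H" and l: "l \<in> carrier H"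
  have "cop AP h (\<lambda>h1 h2. e h1 \<cdot>\<^sub>A (eps (h2 \<bullet> l) \<odot>\<^bsub>AP\<^esub> \<one>\<^bsub>AP\<^esub>)) = cop AP h (\<lambda>h1 h2. eps h2 \<odot>\<^bsub>AP\<^esub> (eps l \<odot>\<^bsub>AP\<^esub> e h1))"
    using h l by simp
  also have "\<dots> = eps l \<odot>\<^bsub>AP\<^esub> e h" by (rule counit_r') (use h l in simp_all)
  finally show "ac h (eps l \<odot>\<^bsub>AP\<^esub> \<one>\<^bsub>AP\<^esub>) = cop AP h (\<lambda>h1 h2. e h1 \<cdot>\<^sub>A (eps (h2 \<bullet> l) \<odot>\<^bsub>AP\<^esub> \<one>\<^bsub>AP\<^esub>))"
    using h l by simp
qed simp

lemma BB_one: "\<one>\<^bsub>BB\<^esub> = mk (\<lambda>l. eps l \<odot>\<^bsub>AP\<^esub> \<one>\<^bsub>AP\<^esub>)"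
proof -
  have "sw K AP x (\<lambda>a h. eps h \<odot>\<^bsub>AP\<^esub> a) = tsw K AP H AP x (\<lambda>a h. a \<cdot>\<^sub>A (eps h \<odot>\<^bsub>AP\<^esub> \<one>\<^bsub>AP\<^esub>))" if "x \<in> carrier AH" for x
    using sw_finsum(1)[OF modAP modH modAP that, of "\<lambda>a h. eps h \<odot>\<^bsub>AP\<^esub> a"] that by simp
  then show ?thesis by (simp add: apar_homs_def Let_def mk_def cong: restrict_cong)
qed

lemma BB_one_closed [simp]: "\<one>\<^bsub>BB\<^esub> \<in> carrier BB" by (simp add: BB_one mk_BB equi_one)
lemma ev_one [simp]: "l \<in> carrier H \<Longrightarrow> ev \<one>\<^bsub>BB\<^esub> l = eps l \<odot>\<^bsub>AP\<^esub> \<one>\<^bsub>AP\<^esub>" by (simp add: BB_one equi_one)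

lemma BB_alg [simp]: "assoc_algebra K BB"
proof -
  interpret AP: assoc_algebra K AP by simp
  interpret BB: module K BB by simp
  have ring: "ring BB"
  proof (rule ringI[OF BB.M.abelian_group_axioms])
    show "monoid BB"
    proof (rule monoidI)
      fix f g h assume *: "f \<in> carrier BB" "g \<in> carrier BB" "h \<in> carrier BB"
      show "f \<otimes>\<^bsub>BB\<^esub> g \<otimes>\<^bsub>BB\<^esub> h = f \<otimes>\<^bsub>BB\<^esub> (g \<otimes>\<^bsub>BB\<^esub> h)" by (rule BB_eqI) (use * in simp_all)
    next
      fix f assume f: "f \<in> carrier BB"
      show "\<one>\<^bsub>BB\<^esub> \<otimes>\<^bsub>BB\<^esub> f = f" by (rule BB_eqI) (use f in simp_all)
      show "f \<otimes>\<^bsub>BB\<^esub> \<one>\<^bsub>BB\<^esub> = f" by (rule BB_eqI) (use f in simp_all)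
    qed simp_all
    fix f g h assume *: "f \<in> carrier BB" "g \<in> carrier BB" "h \<in> carrier BB"
    show "(f \<oplus>\<^bsub>BB\<^esub> g) \<otimes>\<^bsub>BB\<^esub> h = f \<otimes>\<^bsub>BB\<^esub> h \<oplus>\<^bsub>BB\<^esub> g \<otimes>\<^bsub>BB\<^esub> h"
      by (rule BB_eqI) (use * in \<open>simp_all add: AP.l_distr tsw_add\<close>)
    show "h \<otimes>\<^bsub>BB\<^esub> (f \<oplus>\<^bsub>BB\<^esub> g) = h \<otimes>\<^bsub>BB\<^esub> f \<oplus>\<^bsub>BB\<^esub> h \<otimes>\<^bsub>BB\<^esub> g"
      by (rule BB_eqI) (use * in \<open>simp_all add: AP.r_distr tsw_add\<close>)
  qed
  show ?thesis
  proof (rule assoc_algebra.intro[OF BB_module ring])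
    show "assoc_algebra_axioms K BB"
    proof
      fix a f g assume *: "a \<in> carrier K" "f \<in> carrier BB" "g \<in> carrier BB"
      show "a \<odot>\<^bsub>BB\<^esub> f \<otimes>\<^bsub>BB\<^esub> g = a \<odot>\<^bsub>BB\<^esub> (f \<otimes>\<^bsub>BB\<^esub> g)" by (rule BB_eqI) (use * in simp_all)
      show "f \<otimes>\<^bsub>BB\<^esub> (a \<odot>\<^bsub>BB\<^esub> g) = a \<odot>\<^bsub>BB\<^esub> (f \<otimes>\<^bsub>BB\<^esub> g)" by (rule BB_eqI) (use * in simp_all)
    qed
  qed
qed

abbreviation bact where "bact \<equiv> apar_homs_act K H"

lemma equi_act: assumes f: "f \<in> carrier BB" and k: "k \<in> carrier H" shows "equi (\<lambda>l. ev f (l \<bullet> k))"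
  unfolding equi_def using f k by (simp add: ac_ev)

lemma bact_eq: assumes f: "f \<in> carrier BB" and k: "k \<in> carrier H" shows "bact k f = mk (\<lambda>l. ev f (l \<bullet> k))"
proof -
  have "sw K AP x (\<lambda>a h. f (pure K AP H a (h \<bullet> k))) = tsw K AP H AP x (\<lambda>a h. f (pure K AP H a (h \<bullet> k)))" if "x \<in> carrier AH" for x
    by (rule sw_finsum(1)) (use that f k in \<open>simp_all add: BB_closed\<close>)
  then show ?thesis using f k by (simp add: apar_homs_act_def mk_def BB_pure cong: restrict_cong)
qed

lemma bact_closed [simp]: "f \<in> carrier BB \<Longrightarrow> k \<in> carrier H \<Longrightarrow> bact k f \<in> carrier BB"
  by (simp add: bact_eq mk_BB equi_act)
lemma ev_act [simp]: "f \<in> carrier BB \<Longrightarrow> k \<in> carrier H \<Longrightarrow> l \<in> carrier H \<Longrightarrow> ev (bact k f) l = ev f (l \<bullet> k)"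
  by (simp add: bact_eq equi_act)

lemma BB_hmod: "left_hmodule_algebra K H BB bact"
proof -
  have "bact h f = eps h \<odot>\<^bsub>BB\<^esub> f" if "f = \<one>\<^bsub>BB\<^esub>" "h \<in> carrier H" for h f
    unfolding that(1) by (rule BB_eqI) (use that smult_comm[OF modAP] in simp_all)
  moreover have "bact h (f \<otimes>\<^bsub>BB\<^esub> g) = sw K BB (comult H h) (\<lambda>h1 h2. bact h1 f \<otimes>\<^bsub>BB\<^esub> bact h2 g)"
    if "h \<in> carrier H" "f \<in> carrier BB" "g \<in> carrier BB" for h f g
  proof -
    have "bact h (f \<otimes>\<^bsub>BB\<^esub> g) = cop BB h (\<lambda>h1 h2. bact h1 f \<otimes>\<^bsub>BB\<^esub> bact h2 g)"
    proof (rule BB_eqI)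
      fix l assume l: "l \<in> carrier H"
      show "ev (bact h (f \<otimes>\<^bsub>BB\<^esub> g)) l = ev (cop BB h (\<lambda>h1 h2. bact h1 f \<otimes>\<^bsub>BB\<^esub> bact h2 g)) l"
        using that l by simp (rule tsw_swap, simp_all)
    qed (use that in simp_all)
    then show ?thesis using that by (simp add: sw_cop)
  qed
  moreover have "bact h \<in> lin_hom K BB BB" if "h \<in> carrier H" for h
    by (rule lin_BBI) (use that in simp_all, rule lin_congI[OF ev_lin0], simp_all)
  moreover have "(\<lambda>h. bact h f) \<in> lin_hom K H BB" if "f \<in> carrier BB" for f
    by (rule lin_BBI) (use that in simp_all, rule lin_congI[OF lin_ev], simp_all)
  moreover have "bact \<one>\<^bsub>H\<^esub> f = f" if "f \<in> carrier BB" for f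
    by (rule BB_eqI) (use that in simp_all)
  moreover have "bact (h \<bullet> k) f = bact h (bact k f)" if "h \<in> carrier H" "k \<in> carrier H" "f \<in> carrier BB" for h k f
    by (rule BB_eqI) (use that in simp_all)
  ultimately show ?thesis by (simp add: left_hmodule_algebra_def left_hmodule_def)
qed

subsection \<open>The coaction on partial module maps\<close>

text \<open>\<open>dsw_ac\<close> solved for the action applied after the coaction: the two outer
  legs introduced there are cancelled one after the other.\<close>

lemma dsw_ac_swap:
  assumes a: "a \<in> carrier AP" and h: "h \<in> carrier H" and P: "module K P" and B: "\<And>z. z \<in> carrier H \<Longrightarrow> (\<lambda>x. B x z) \<in> lin_hom K AP P"
    "\<And>x. x \<in> carrier AP \<Longrightarrow> (\<lambda>z. B x z) \<in> lin_hom K H P"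
  shows "dsw P a (\<lambda>x k. B (ac h x) k) = cop P h (\<lambda>h1 u. cop P u (\<lambda>h2 h3. dsw P (ac h2 a) (\<lambda>x k. B x (Si h3 \<bullet> (k \<bullet> h1)))))"
proof -
  note [simp] = lin_comp[OF B(1)] lin_comp[OF B(2)] B P lin_hom_closed[OF B(1)]
  have "cop P h (\<lambda>h1 u. cop P u (\<lambda>h2 h3. dsw P (ac h2 a) (\<lambda>x k. B x (Si h3 \<bullet> (k \<bullet> h1))))) =
    cop P h (\<lambda>h1 u. cop P u (\<lambda>p1 w. cop P w (\<lambda>p2 z. cop P z (\<lambda>p3 h3. dsw P a (\<lambda>x l. B (ac p2 x) (Si h3 \<bullet> (p3 \<bullet> (l \<bullet> (Si p1 \<bullet> h1)))))))))"
    using a h by simp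
  also have "\<dots> = cop P h (\<lambda>p2 z. cop P z (\<lambda>p3 h3. dsw P a (\<lambda>x l. B (ac p2 x) (Si h3 \<bullet> (p3 \<bullet> (l \<bullet> \<one>\<^bsub>H\<^esub>))))))"
    by (rule chain_l_Sil[where G = "\<lambda>w z. cop P z (\<lambda>p2 z. cop P z (\<lambda>p3 h3. dsw P a (\<lambda>x l. B (ac p2 x) (Si h3 \<bullet> (p3 \<bullet> (l \<bullet> w))))))"])
      (use a h in simp_all)
  also have "\<dots> = dsw P a (\<lambda>x l. B (ac h x) (\<one>\<^bsub>H\<^esub> \<bullet> l))"
    by (rule chain_r_Sil[where G = "\<lambda>p w. dsw P a (\<lambda>x l. B (ac p x) (w \<bullet> l))"]) (use a h in simp_all)
  finally show ?thesis using a by simp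
qed

text \<open>Equivariance replaces the action on \<open>ev f l\<close> by a generator times a value
  of \<open>ev f\<close>. In the coaction of that generator the inverse antipode leg cancels against
  \<open>h1\<close>, and only its third leg \<open>q\<close> remains.\<close>

lemma dsw_ac_ev:
  assumes f: "f \<in> carrier BB" and l: "l \<in> carrier H" and h: "h \<in> carrier H" and P: "module K P" and B: "\<And>z. z \<in> carrier H \<Longrightarrow> (\<lambda>x. B x z) \<in> lin_hom K AP P"
    "\<And>x. x \<in> carrier AP \<Longrightarrow> (\<lambda>z. B x z) \<in> lin_hom K H P"
  shows "dsw P (ev f l) (\<lambda>x k. B (ac h x) k) =
    cop P h (\<lambda>p u. cop P u (\<lambda>q v. cop P v (\<lambda>r z. dsw P (ev f (r \<bullet> l)) (\<lambda>y s. B (e p \<cdot>\<^sub>A y) (Si z \<bullet> (s \<bullet> q))))))"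
proof -
  note [simp] = lin_comp[OF B(1)] lin_comp[OF B(2)] B P lin_hom_closed[OF B(1)]
  have "dsw P (ev f l) (\<lambda>x k. B (ac h x) k) = cop P h (\<lambda>h1 u. cop P u (\<lambda>h2 h3. dsw P (ac h2 (ev f l)) (\<lambda>x k. B x (Si h3 \<bullet> (k \<bullet> h1)))))"
    by (rule dsw_ac_swap) (use f l h in simp_all)
  also have "\<dots> = cop P h (\<lambda>h1 u. cop P u (\<lambda>w h3. cop P w (\<lambda>p t. dsw P (e p \<cdot>\<^sub>A ev f (t \<bullet> l)) (\<lambda>x k. B x (Si h3 \<bullet> (k \<bullet> h1))))))"
    using f l h by (simp add: ac_ev del: dsw_mult dsw_ac)
  also have "\<dots> = cop P h (\<lambda>h1 u. cop P u (\<lambda>p1 w. cop P w (\<lambda>p u. cop P u (\<lambda>q v. cop P v (\<lambda>r z. dsw P (ev f (r \<bullet> l)) (\<lambda>y s. B (e p \<cdot>\<^sub>A y) (Si z \<bullet> (s \<bullet> (q \<bullet> (Si p1 \<bullet> h1))))))))))"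
    using f l h by simp
  also have "\<dots> = cop P h (\<lambda>p u. cop P u (\<lambda>q v. cop P v (\<lambda>r z. dsw P (ev f (r \<bullet> l)) (\<lambda>y s. B (e p \<cdot>\<^sub>A y) (Si z \<bullet> (s \<bullet> (q \<bullet> \<one>\<^bsub>H\<^esub>)))))))"
    by (rule chain_l_Sil[where G = "\<lambda>g w. cop P w (\<lambda>p u. cop P u (\<lambda>q v. cop P v (\<lambda>r z. dsw P (ev f (r \<bullet> l)) (\<lambda>y s. B (e p \<cdot>\<^sub>A y) (Si z \<bullet> (s \<bullet> (q \<bullet> g)))))))"])
      (use f l h in simp_all)
  finally show ?thesis using f l h by simp
qed

text \<open>The threefold coproduct of a product, with either factor summed outermost.\<close>

lemma cop3_mult:
  assumes h: "h \<in> carrier H" and l: "l \<in> carrier H" and P: "module K P"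
    and F: "\<And>b c. b \<in> carrier H \<Longrightarrow> c \<in> carrier H \<Longrightarrow> (\<lambda>a. F a b c) \<in> lin_hom K H P"
      "\<And>a c. a \<in> carrier H \<Longrightarrow> c \<in> carrier H \<Longrightarrow> (\<lambda>b. F a b c) \<in> lin_hom K H P"
      "\<And>a b. a \<in> carrier H \<Longrightarrow> b \<in> carrier H \<Longrightarrow> (\<lambda>c. F a b c) \<in> lin_hom K H P"
  shows "cop P (h \<bullet> l) (\<lambda>x u. cop P u (\<lambda>y z. F x y z)) =
    cop P h (\<lambda>a v. cop P v (\<lambda>b c. cop P l (\<lambda>x u. cop P u (\<lambda>y z. F (a \<bullet> x) (b \<bullet> y) (c \<bullet> z)))))"
    "cop P (h \<bullet> l) (\<lambda>x u. cop P u (\<lambda>y z. F x y z)) =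
    cop P l (\<lambda>x u. cop P u (\<lambda>y z. cop P h (\<lambda>a v. cop P v (\<lambda>b c. F (a \<bullet> x) (b \<bullet> y) (c \<bullet> z)))))"
proof -
  note [simp] = lin_comp[OF F(1)] lin_comp[OF F(2)] lin_comp[OF F(3)] F P lin_hom_closed[OF F(1)]
  have "cop P (h \<bullet> l) (\<lambda>x u. cop P u (\<lambda>y z. F x y z)) =
    cop P h (\<lambda>a v. cop P l (\<lambda>x u. cop P v (\<lambda>b c. cop P u (\<lambda>y z. F (a \<bullet> x) (b \<bullet> y) (c \<bullet> z)))))"
    using h l by simp
  also have "\<dots> = cop P h (\<lambda>a v. cop P v (\<lambda>b c. cop P l (\<lambda>x u. cop P u (\<lambda>y z. F (a \<bullet> x) (b \<bullet> y) (c \<bullet> z)))))"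
    by (rule tsw_cong[OF refl], rule tsw_swap) (use l in simp_all)
  finally show 1: "cop P (h \<bullet> l) (\<lambda>x u. cop P u (\<lambda>y z. F x y z)) =
    cop P h (\<lambda>a v. cop P v (\<lambda>b c. cop P l (\<lambda>x u. cop P u (\<lambda>y z. F (a \<bullet> x) (b \<bullet> y) (c \<bullet> z)))))" .
  also have "\<dots> = cop P h (\<lambda>a v. cop P l (\<lambda>x u. cop P u (\<lambda>y z. cop P v (\<lambda>b c. F (a \<bullet> x) (b \<bullet> y) (c \<bullet> z)))))"
    by (rule tsw_cong[OF refl], rule tsw_swap2) (use l in simp_all)
  also have "\<dots> = cop P l (\<lambda>x u. cop P u (\<lambda>y z. cop P h (\<lambda>a v. cop P v (\<lambda>b c. F (a \<bullet> x) (b \<bullet> y) (c \<bullet> z)))))"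
    by (rule tsw_swap2) (use h l in simp_all)
  finally show "cop P (h \<bullet> l) (\<lambda>x u. cop P u (\<lambda>y z. F x y z)) =
    cop P l (\<lambda>x u. cop P u (\<lambda>y z. cop P h (\<lambda>a v. cop P v (\<lambda>b c. F (a \<bullet> x) (b \<bullet> y) (c \<bullet> z)))))" .
qed

text \<open>The right hand side \<open>f(l\<^sub>(\<^sub>2\<^sub>))\<^sup>(\<^sup>0\<^sup>) \<otimes> S\<^sup>-\<^sup>1(l\<^sub>(\<^sub>3\<^sub>)) f(l\<^sub>(\<^sub>2\<^sub>))\<^sup>(\<^sup>1\<^sup>) l\<^sub>(\<^sub>1\<^sub>)\<close> of the formula determining the coaction.\<close>

abbreviation rt where "rt P f l C \<equiv> cop P l (\<lambda>l1 u. cop P u (\<lambda>l2 l3. dsw P (ev f l2) (\<lambda>a k. C a (Si l3 \<bullet> (k \<bullet> l1)))))"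

text \<open>Equivariance of the required value of the coaction. The legs \<open>q\<close>,
  \<open>r\<close> and \<open>z\<close> left by \<open>dsw_ac_ev\<close> meet \<open>l1\<close>,
  \<open>l2\<close> and \<open>l3\<close> and complete them to the threefold coproduct of
  \<open>u \<bullet> l\<close>.\<close>

lemma rt_equi:
  assumes f: "f \<in> carrier BB" and l: "l \<in> carrier H" and h: "h \<in> carrier H" and P: "module K P" and C: "\<And>z. z \<in> carrier H \<Longrightarrow> (\<lambda>x. C x z) \<in> lin_hom K AP P"
    "\<And>x. x \<in> carrier AP \<Longrightarrow> (\<lambda>z. C x z) \<in> lin_hom K H P"
  shows "rt P f l (\<lambda>a k. C (ac h a) k) = cop P h (\<lambda>h1 h2. rt P f (h2 \<bullet> l) (\<lambda>a k. C (e h1 \<cdot>\<^sub>A a) k))"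
proof -
  note [simp] = lin_comp[OF C(1)] lin_comp[OF C(2)] C P lin_hom_closed[OF C(1)]
  have "rt P f l (\<lambda>a k. C (ac h a) k) = cop P l (\<lambda>l1 u. cop P u (\<lambda>l2 l3. cop P h (\<lambda>p u. cop P u (\<lambda>q v. cop P v (\<lambda>r z.
     dsw P (ev f (r \<bullet> l2)) (\<lambda>y s. C (e p \<cdot>\<^sub>A y) (Si l3 \<bullet> ((Si z \<bullet> (s \<bullet> q)) \<bullet> l1))))))))"
    by (rule tsw_cong[OF refl], rule tsw_cong[OF refl], rule dsw_ac_ev) (use f l h in simp_all)
  also have "\<dots> = cop P h (\<lambda>p u. cop P l (\<lambda>l1 w. cop P w (\<lambda>l2 l3. cop P u (\<lambda>q v. cop P v (\<lambda>r z.
     dsw P (ev f (r \<bullet> l2)) (\<lambda>y s. C (e p \<cdot>\<^sub>A y) (Si l3 \<bullet> ((Si z \<bullet> (s \<bullet> q)) \<bullet> l1))))))))"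
    by (rule tsw_swap2[symmetric]) (use f l h in simp_all)
  also have "\<dots> = cop P h (\<lambda>p u. rt P f (u \<bullet> l) (\<lambda>a k. C (e p \<cdot>\<^sub>A a) k))"
    by (rule tsw_cong[OF refl], subst cop3_mult(2)) (use f l in simp_all)
  finally show ?thesis .
qed

section \<open>Existence of the coaction on partial module maps\<close>

abbreviation BH where "BH \<equiv> tensor K BB H"

text \<open>Slicing removes the \<open>H\<close>-leg, after which equality in \<open>BB\<close> is
  tested by evaluation; slicing and evaluation commute.\<close>

lemma BH_eqI:
  assumes X: "X \<in> carrier BH" and Y: "Y \<in> carrier BH"
    and eq: "\<And>l. l \<in> carrier H \<Longrightarrow> tsw K BB H AH X (\<lambda>f h. pure K AP H (ev f l) h) = tsw K BB H AH Y (\<lambda>f h. pure K AP H (ev f l) h)"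
  shows "X = Y"
proof (rule slice_eq[OF BB_module X Y])
  fix \<phi> assume \<phi>: "\<phi> \<in> lin_hom K H (kmod K)"
  note [simp] = \<phi> lin_comp[OF \<phi>] lin_hom_closed[OF \<phi>, simplified]
  show "tsw K BB H BB X (\<lambda>m h. \<phi> h \<odot>\<^bsub>BB\<^esub> m) = tsw K BB H BB Y (\<lambda>m h. \<phi> h \<odot>\<^bsub>BB\<^esub> m)"
  proof (rule BB_eqI)
    fix l assume l: "l \<in> carrier H"
    from arg_cong[OF eq[OF l], of "\<lambda>t. tsw K AP H AP t (\<lambda>a h. \<phi> h \<odot>\<^bsub>AP\<^esub> a)"]
    show "ev (tsw K BB H BB X (\<lambda>m h. \<phi> h \<odot>\<^bsub>BB\<^esub> m)) l = ev (tsw K BB H BB Y (\<lambda>m h. \<phi> h \<odot>\<^bsub>BB\<^esub> m)) l"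
      using X Y l by simp
  qed (use X Y in simp_all)
qed

lemma rho_exists:
  assumes f: "f \<in> carrier BB"
  shows "\<exists>X\<in>carrier BH. \<forall>l\<in>carrier H. tsw K BB H AH X (\<lambda>f h. pure K AP H (ev f l) h) = rt AH f l (pure K AP H)"
proof -
  interpret BHm: module K BH by simp
  interpret AHm: module K AH by simp
  obtain E \<phi> where *: "finite E \<and> E \<subseteq> carrier H \<and> (\<forall>x\<in>E. \<phi> x \<in> lin_hom K H (kmod K)) \<and>
      (\<forall>v\<in>carrier H. v = (\<Oplus>\<^bsub>H\<^esub>x\<in>E. \<phi> x v \<odot>\<^bsub>H\<^esub> x))"
    using dual_basis[OF field_axioms modH fd] by blast
  then have E: "finite E" "E \<subseteq> carrier H" "\<And>x. x \<in> E \<Longrightarrow> \<phi> x \<in> lin_hom K H (kmod K)"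
    "\<And>v. v \<in> carrier H \<Longrightarrow> v = (\<Oplus>\<^bsub>H\<^esub>x\<in>E. \<phi> x v \<odot>\<^bsub>H\<^esub> x)" by blast+
  \<comment> \<open>The slice along \<open>\<phi> x\<close> of the value that the coaction must have
    at \<open>l\<close>; by \<open>rt_equi\<close> it is equivariant in \<open>l\<close> and hence
    defines a morphism.\<close>
  let ?g = "\<lambda>x l. rt AP f l (\<lambda>a k. \<phi> x k \<odot>\<^bsub>AP\<^esub> a)"
  have g: "equi (?g x)" if x: "x \<in> E" for x
    unfolding equi_def
  proof (intro conjI ballI)
    note [simp] = E(3)[OF x] lin_comp[OF E(3)[OF x]] lin_hom_closed[OF E(3)[OF x], simplified]
    show "?g x \<in> lin_hom K H AP" using f by simp
    fix h l assume h: "h \<in> carrier H" and l: "l \<in> carrier H"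
    have "ac h (?g x l) = rt AP f l (\<lambda>a k. \<phi> x k \<odot>\<^bsub>AP\<^esub> ac h a)" using f h l by simp
    also have "\<dots> = cop AP h (\<lambda>h1 h2. rt AP f (h2 \<bullet> l) (\<lambda>a k. \<phi> x k \<odot>\<^bsub>AP\<^esub> (e h1 \<cdot>\<^sub>A a)))"
      by (rule rt_equi) (use f h l in simp_all)
    also have "\<dots> = cop AP h (\<lambda>h1 h2. e h1 \<cdot>\<^sub>A ?g x (h2 \<bullet> l))"
      by (rule tsw_cong[OF refl]) (use f l in \<open>simp del: cop_mult\<close>)
    finally show "ac h (?g x l) = cop AP h (\<lambda>h1 h2. e h1 \<cdot>\<^sub>A ?g x (h2 \<bullet> l))" .
  qed
  \<comment> \<open>The tensor with these prescribed slices; \<open>slice_expand\<close> confirms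
    that its evaluations are the required ones.\<close>
  let ?X = "\<Oplus>\<^bsub>BH\<^esub>x\<in>E. pure K BB H (mk (?g x)) x"
  have m: "pure K BB H (mk (?g x)) x \<in> carrier BH" if "x \<in> E" for x using that E(2) mk_BB[OF g[OF that]] by auto
  have "tsw K BB H AH ?X (\<lambda>f h. pure K AP H (ev f l) h) = rt AH f l (pure K AP H)" if l: "l \<in> carrier H" for l
  proof -
    have L: "(\<lambda>X. tsw K BB H AH X (\<lambda>f h. pure K AP H (ev f l) h)) \<in> lin_hom K BH AH" using l by simp
    have "tsw K BB H AH ?X (\<lambda>f h. pure K AP H (ev f l) h) =
        (\<Oplus>\<^bsub>AH\<^esub>x\<in>E. tsw K BB H AH (pure K BB H (mk (?g x)) x) (\<lambda>f h. pure K AP H (ev f l) h))"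
      by (rule lin_hom_finsum[OF BHm.module_axioms AHm.module_axioms L E(1)]) (rule m)
    also have "\<dots> = (\<Oplus>\<^bsub>AH\<^esub>x\<in>E. pure K AP H (tsw K AP H AP (rt AH f l (pure K AP H)) (\<lambda>a k. \<phi> x k \<odot>\<^bsub>AP\<^esub> a)) x)"
    proof (rule AHm.M.finsum_cong')
      fix x assume x: "x \<in> E"
      note [simp] = E(3)[OF x] lin_comp[OF E(3)[OF x]] lin_hom_closed[OF E(3)[OF x], simplified]
      show "tsw K BB H AH (pure K BB H (mk (?g x)) x) (\<lambda>f h. pure K AP H (ev f l) h) =
         pure K AP H (tsw K AP H AP (rt AH f l (pure K AP H)) (\<lambda>a k. \<phi> x k \<odot>\<^bsub>AP\<^esub> a)) x"
        using x l E(2) f by (subst tsw_pure_eval) (auto simp: mk_BB[OF g] ev_mk[OF g])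
    next
      show "(\<lambda>x. pure K AP H (tsw K AP H AP (rt AH f l (pure K AP H)) (\<lambda>a k. \<phi> x k \<odot>\<^bsub>AP\<^esub> a)) x) \<in> E \<rightarrow> carrier AH"
      proof
        fix x assume x: "x \<in> E"
        note [simp] = E(3)[OF x] lin_comp[OF E(3)[OF x]] lin_hom_closed[OF E(3)[OF x], simplified]
        show "pure K AP H (tsw K AP H AP (rt AH f l (pure K AP H)) (\<lambda>a k. \<phi> x k \<odot>\<^bsub>AP\<^esub> a)) x \<in> carrier AH"
          using subsetD[OF E(2) x] l f by simp
      qed
    qed simp
    also have "\<dots> = rt AH f l (pure K AP H)"
      by (rule slice_expand[OF modAP E]) (use l f in simp_all)
    finally show ?thesis .
  qed
  moreover have "?X \<in> carrier BH" by (rule BHm.M.finsum_closed) (use m in blast)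
  ultimately show ?thesis by blast
qed

definition rho where "rho f = (SOME X. X \<in> carrier BH \<and> (\<forall>l\<in>carrier H. tsw K BB H AH X (\<lambda>f h. pure K AP H (ev f l) h) = rt AH f l (pure K AP H)))"

lemma rho_some: assumes f: "f \<in> carrier BB"
  shows "rho f \<in> carrier BH \<and> (\<forall>l\<in>carrier H. tsw K BB H AH (rho f) (\<lambda>f h. pure K AP H (ev f l) h) = rt AH f l (pure K AP H))"
proof -
  have "\<exists>X. X \<in> carrier BH \<and> (\<forall>l\<in>carrier H. tsw K BB H AH X (\<lambda>f h. pure K AP H (ev f l) h) = rt AH f l (pure K AP H))"
    using rho_exists[OF f] by blast
  then show ?thesis unfolding rho_def by (rule someI_ex)
qed

lemma rho_closed [simp]: "f \<in> carrier BB \<Longrightarrow> rho f \<in> carrier BH" using rho_some by blast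

abbreviation rsw where "rsw P f C \<equiv> tsw K BB H P (rho f) C"

lemma rho_pure: "f \<in> carrier BB \<Longrightarrow> l \<in> carrier H \<Longrightarrow> rsw AH f (\<lambda>f h. pure K AP H (ev f l) h) = rt AH f l (\<lambda>a k. pure K AP H a k)"
  using rho_some by blast

lemma rho_ev:
  assumes f: "f \<in> carrier BB" and l: "l \<in> carrier H" and P: "module K P" and C: "\<And>z. z \<in> carrier H \<Longrightarrow> (\<lambda>x. C x z) \<in> lin_hom K AP P"
    "\<And>x. x \<in> carrier AP \<Longrightarrow> (\<lambda>z. C x z) \<in> lin_hom K H P"
  shows "rsw P f (\<lambda>f0 f1. C (ev f0 l) f1) = rt P f l (\<lambda>a k. C a k)"
proof -
  note [simp] = lin_comp[OF C(1)] lin_comp[OF C(2)] C P lin_hom_closed[OF C(1)]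
  from arg_cong[OF rho_pure[OF f l], of "\<lambda>t. tsw K AP H P t (\<lambda>a h. C a h)"]
  show ?thesis using f l by simp
qed

lemma rho_lin0 [simp]: "rho \<in> lin_hom K BB BH"
proof (rule lin_homI)
  interpret BHm: module K BH by simp
  interpret BBm: module K BB by simp
  have L: "(\<lambda>X. tsw K BB H AH X (\<lambda>f h. pure K AP H (ev f l) h)) \<in> lin_hom K BH AH" if "l \<in> carrier H" for l using that by simp
  have R: "(\<lambda>f. rt AH f l (\<lambda>a k. pure K AP H a k)) \<in> lin_hom K BB AH" if "l \<in> carrier H" for l using that by simp
  show "rho (f \<oplus>\<^bsub>BB\<^esub> g) = rho f \<oplus>\<^bsub>BH\<^esub> rho g" if "f \<in> carrier BB" "g \<in> carrier BB" for f g
    by (rule BH_eqI) (use that in \<open>simp_all only: BHm.M.add.m_closed BBm.M.add.m_closed rho_closed rho_pure lin_hom_add[OF L] lin_hom_add[OF R]\<close>)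
  show "rho (c \<odot>\<^bsub>BB\<^esub> f) = c \<odot>\<^bsub>BH\<^esub> rho f" if "c \<in> carrier K" "f \<in> carrier BB" for c f
    by (rule BH_eqI) (use that in \<open>simp_all only: BHm.smult_closed BBm.smult_closed rho_closed rho_pure lin_hom_smult[OF L] lin_hom_smult[OF R]\<close>)
qed simp

lemma sw_BH: "x \<in> carrier BH \<Longrightarrow> module K P \<Longrightarrow> (\<And>v h. v \<in> carrier BB \<Longrightarrow> h \<in> carrier H \<Longrightarrow> B v h \<in> carrier P) \<Longrightarrow>
    sw K P x B = tsw K BB H P x B"
  by (rule sw_finsum(1)) simp_all

lemma sw_AH: "x \<in> carrier AH \<Longrightarrow> module K P \<Longrightarrow> (\<And>v h. v \<in> carrier AP \<Longrightarrow> h \<in> carrier H \<Longrightarrow> B v h \<in> carrier P) \<Longrightarrow>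
    sw K P x B = tsw K AP H P x B"
  by (rule sw_finsum(1)) simp_all

lemma is_apar_homs_coaction_rho: "is_apar_homs_coaction K H dl rho"
  unfolding is_apar_homs_coaction_def Let_def ev_def[symmetric]
proof (intro conjI ballI)
  fix f l assume f: "f \<in> carrier BB" and l: "l \<in> carrier H"
  have "sw K AH (rho f) (\<lambda>f0 f1. pure K AP H (ev f0 l) f1) = rt AH f l (\<lambda>a k. pure K AP H a k)"
    using f l by (simp add: sw_BH rho_pure)
  also have "\<dots> = sw K AH (comult H l) (\<lambda>l1 l'. sw K AH (comult H l') (\<lambda>l2 l3. sw K AH (dl (ev f l2))
           (\<lambda>a0 a1. pure K AP H a0 (Si l3 \<bullet> a1 \<bullet> l1))))"
  proof -
    have 1: "sw K AH (dl (ev f l2)) (\<lambda>a0 a1. pure K AP H a0 (Si l3 \<bullet> a1 \<bullet> l1)) = dsw AH (ev f l2) (\<lambda>a k. pure K AP H a (Si l3 \<bullet> (k \<bullet> l1)))"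
      if "l1 \<in> carrier H" "l2 \<in> carrier H" "l3 \<in> carrier H" for l1 l2 l3
      by (subst sw_AH) (use f that in simp_all)
    have 2: "sw K AH (comult H l') (\<lambda>l2 l3. sw K AH (dl (ev f l2)) (\<lambda>a0 a1. pure K AP H a0 (Si l3 \<bullet> a1 \<bullet> l1))) =
       cop AH l' (\<lambda>l2 l3. dsw AH (ev f l2) (\<lambda>a k. pure K AP H a (Si l3 \<bullet> (k \<bullet> l1))))" if "l1 \<in> carrier H" "l' \<in> carrier H" for l1 l'
      by (subst sw_cop) (use f that in \<open>simp_all add: 1\<close>)
    show ?thesis by (subst sw_cop) (use f l in \<open>simp_all add: 2\<close>)
  qed
  finally show "sw K AH (rho f) (\<lambda>f0 f1. pure K AP H (ev f0 l) f1) = sw K AH (comult H l) (\<lambda>l1 l'. sw K AH (comult H l') (\<lambda>l2 l3. sw K AH (dl (ev f l2))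
           (\<lambda>a0 a1. pure K AP H a0 (Si l3 \<bullet> a1 \<bullet> l1))))" .
qed simp

end

subsection \<open>Braided commutativity\<close>

lemma tsw_smult_arg:
  assumes "module K V" "module K W" "module K P" "a \<in> carrier K" "t \<in> carrier (tensor K V W)"
    "\<And>w. w \<in> carrier W \<Longrightarrow> (\<lambda>v. B v w) \<in> lin_hom K V P" "\<And>v. v \<in> carrier V \<Longrightarrow> (\<lambda>w. B v w) \<in> lin_hom K W P"
  shows "tsw K V W P (a \<odot>\<^bsub>tensor K V W\<^esub> t) (\<lambda>v w. B v w) = a \<odot>\<^bsub>P\<^esub> tsw K V W P t (\<lambda>v w. B v w)"
  by (rule lin_hom_smult[OF tsw_lin]) (use assms in simp_all)

context hopf_fd
begin

lemma ev_mult_hpar: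
  assumes f: "f \<in> carrier BB" and x: "x \<in> carrier HP" and l: "l \<in> carrier H"
  shows "ev f l \<cdot> x = vsw HP x (\<lambda>p h. p \<cdot> ev f (h \<bullet> l))"
proof -
  interpret HP: assoc_algebra K HP by simp
  have [simp]: "(\<lambda>x. ev f (k x)) \<in> lin_hom K U HP" if "k \<in> lin_hom K U H" for U :: "('k, 'u, 'z) module_scheme" and k
    by (rule lin_AP_HP) (use f that in simp)
  have ace: "ac h (ev f l) = cop HP h (\<lambda>h1 h2. e h1 \<cdot> ev f (h2 \<bullet> l))" if "h \<in> carrier H" "l \<in> carrier H" for h l
    using f that by (simp add: ac_ev AP_mult_eq tsw_AP AP_closed)
  have "\<forall>l\<in>carrier H. ev f l \<cdot> x = vsw HP x (\<lambda>p h. p \<cdot> ev f (h \<bullet> l))"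
  proof (rule hpar_induct[OF x]; intro ballI)
    fix h l assume h: "h \<in> carrier H" and l: "l \<in> carrier H"
    have *: "cop HP u (\<lambda>y z. brk z \<cdot> e (Si y)) = brk u" if "u \<in> carrier H" for u
      using e_br'[of "\<one>\<^bsub>H\<^esub>" u] that by (simp add: AP_one_eq)
    \<comment> \<open>\<open>a_br\<close> moves the bracket to the left, and equivariance of
      \<open>f\<close> turns the action of \<open>Si h1\<close> into a generator times a shifted
      value. Bracket and generator then merge by the local fact above.\<close>
    have "ev f l \<cdot> brk h = cop HP h (\<lambda>h1 h2. brk h2 \<cdot> ac (Si h1) (ev f l))" using f h l by (simp add: a_br)
    also have "\<dots> = cop HP h (\<lambda>a u. cop HP u (\<lambda>y z. brk z \<cdot> e (Si y)) \<cdot> ev f (Si a \<bullet> l))" using f h l by (simp add: ace)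
    also have "\<dots> = vsw HP (brk h) (\<lambda>p h. p \<cdot> ev f (h \<bullet> l))" using f h l by (simp add: *)
    finally show "ev f l \<cdot> brk h = vsw HP (brk h) (\<lambda>p h. p \<cdot> ev f (h \<bullet> l))" .
  next
    fix x y l assume x: "x \<in> carrier HP" and y: "y \<in> carrier HP" and l: "l \<in> carrier H"
      and IH: "\<forall>l\<in>carrier H. ev f l \<cdot> x = vsw HP x (\<lambda>p h. p \<cdot> ev f (h \<bullet> l))"
        "\<forall>l\<in>carrier H. ev f l \<cdot> y = vsw HP y (\<lambda>p h. p \<cdot> ev f (h \<bullet> l))"
    have L: "(\<lambda>x. vsw HP x (\<lambda>p h. p \<cdot> ev f (h \<bullet> l))) \<in> lin_hom K HP HP" using f l by simp
    show "ev f l \<cdot> (x \<oplus>\<^bsub>HP\<^esub> y) = vsw HP (x \<oplus>\<^bsub>HP\<^esub> y) (\<lambda>p h. p \<cdot> ev f (h \<bullet> l))"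
      using f x y l IH lin_hom_add[OF L x y] by (simp add: HP.r_distr)
    have "ev f l \<cdot> (x \<cdot> y) = ev f l \<cdot> x \<cdot> y" using f x y l by simp
    also have "\<dots> = vsw HP x (\<lambda>p h. p \<cdot> ev f (h \<bullet> l)) \<cdot> y" using IH(1) l by simp
    also have "\<dots> = vsw HP x (\<lambda>p h. p \<cdot> (ev f (h \<bullet> l) \<cdot> y))" using f x y l by simp
    also have "\<dots> = vsw HP x (\<lambda>p h. p \<cdot> vsw HP y (\<lambda>q k. q \<cdot> ev f (k \<bullet> (h \<bullet> l))))"
      by (rule tsw_cong[OF refl]) (use IH(2) l in simp)
    also have "\<dots> = vsw HP (x \<cdot> y) (\<lambda>p h. p \<cdot> ev f (h \<bullet> l))" using f x y l by simp
    finally show "ev f l \<cdot> (x \<cdot> y) = vsw HP (x \<cdot> y) (\<lambda>p h. p \<cdot> ev f (h \<bullet> l))" .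
  next
    fix a x l assume a: "a \<in> carrier K" and x: "x \<in> carrier HP" and l: "l \<in> carrier H"
      and IH: "\<forall>l\<in>carrier H. ev f l \<cdot> x = vsw HP x (\<lambda>p h. p \<cdot> ev f (h \<bullet> l))"
    have L: "(\<lambda>x. vsw HP x (\<lambda>p h. p \<cdot> ev f (h \<bullet> l))) \<in> lin_hom K HP HP" using f l by simp
    show "ev f l \<cdot> (a \<odot>\<^bsub>HP\<^esub> x) = vsw HP (a \<odot>\<^bsub>HP\<^esub> x) (\<lambda>p h. p \<cdot> ev f (h \<bullet> l))"
      using f a x l IH lin_hom_smult[OF L a x] by simp
  qed
  then show ?thesis using l by blast
qed

lemma ev_commute:
  assumes f: "f \<in> carrier BB" and a: "a \<in> carrier AP" and l: "l \<in> carrier H"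
  shows "dsw AP a (\<lambda>x h. x \<cdot>\<^sub>A ev f (h \<bullet> l)) = ev f l \<cdot>\<^sub>A a"
proof -
  have [simp]: "(\<lambda>x. ev f (k x)) \<in> lin_hom K U HP" if "k \<in> lin_hom K U H" for U :: "('k, 'u, 'z) module_scheme" and k
    by (rule lin_AP_HP) (use f that in simp)
  have "ev f l \<cdot> a = vsw HP a (\<lambda>x h. x \<cdot> ev f (h \<bullet> l))" by (rule ev_mult_hpar) (use f a l in simp_all)
  also have "\<dots> = dsw HP a (\<lambda>x h. x \<cdot> ev f (h \<bullet> l))" by (rule vsw_dsw) (use f a l in simp_all)
  also have "\<dots> = dsw AP a (\<lambda>x h. x \<cdot> ev f (h \<bullet> l))" by (rule tsw_AP) (use f a l in \<open>simp_all add: AP_closed\<close>)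
  finally show ?thesis by (simp add: AP_mult_eq)
qed

text \<open>In the evaluated product the action inserts the \<open>H\<close>-leg of the coaction
  behind \<open>m\<close>, so that \<open>m\<close> meets \<open>Si l3\<close> and both cancel. The
  rest is the exchange rule \<open>ev_commute\<close> under the convolution sum.\<close>

lemma braided_commutative_BB: "braided_commutative K BB bact rho"
  unfolding braided_commutative_def
proof (intro ballI)
  fix f g assume f: "f \<in> carrier BB" and g: "g \<in> carrier BB"
  have "rsw BB f (\<lambda>v0 v1. v0 \<otimes>\<^bsub>BB\<^esub> bact v1 g) = g \<otimes>\<^bsub>BB\<^esub> f"
  proof (rule BB_eqI)
    fix l assume l: "l \<in> carrier H"
    have "ev (rsw BB f (\<lambda>v0 v1. v0 \<otimes>\<^bsub>BB\<^esub> bact v1 g)) l = rsw AP f (\<lambda>v0 v1. cop AP l (\<lambda>x m. ev v0 x \<cdot>\<^sub>A ev g (m \<bullet> v1)))"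
      using f g l by simp
    also have "\<dots> = cop AP l (\<lambda>x m. rsw AP f (\<lambda>v0 v1. ev v0 x \<cdot>\<^sub>A ev g (m \<bullet> v1)))"
      by (rule tsw_swap) (use f g l in simp_all)
    also have "\<dots> = cop AP l (\<lambda>x m. rt AP f x (\<lambda>a k. a \<cdot>\<^sub>A ev g (m \<bullet> k)))"
      by (rule tsw_cong[OF refl], rule rho_ev) (use f g l in simp_all)
    also have "\<dots> = cop AP l (\<lambda>l1 u. cop AP u (\<lambda>l2 v. cop AP v (\<lambda>l3 m. dsw AP (ev f l2) (\<lambda>a k. a \<cdot>\<^sub>A ev g (m \<bullet> (Si l3 \<bullet> (k \<bullet> l1)))))))"
      using f g l by simp
    also have "\<dots> = cop AP l (\<lambda>l1 u. dsw AP (ev f u) (\<lambda>a k. a \<cdot>\<^sub>A ev g (\<one>\<^bsub>H\<^esub> \<bullet> (k \<bullet> l1))))"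
      by (rule tsw_cong[OF refl], rule chain_r_Sir[where G = "\<lambda>z w. dsw AP (ev f z) (\<lambda>a k. a \<cdot>\<^sub>A ev g (w \<bullet> (k \<bullet> l1)))" for l1])
        (use f g l in simp_all)
    also have "\<dots> = ev (g \<otimes>\<^bsub>BB\<^esub> f) l" using f g l by (simp add: ev_commute)
    finally show "ev (rsw BB f (\<lambda>v0 v1. v0 \<otimes>\<^bsub>BB\<^esub> bact v1 g)) l = ev (g \<otimes>\<^bsub>BB\<^esub> f) l" .
  qed (use f g in simp_all)
  then show "sw K BB (rho f) (\<lambda>v0 v1. v0 \<otimes>\<^bsub>BB\<^esub> bact v1 g) = g \<otimes>\<^bsub>BB\<^esub> f" using f g by (simp add: sw_BH)
qed

section \<open>The comodule algebra axioms and the Yetter-Drinfeld condition\<close>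

lemma rho_coassoc_ev:
  assumes f: "f \<in> carrier BB" and l: "l \<in> carrier H" and P: "module K P"
    and F: "\<And>b c. b \<in> carrier H \<Longrightarrow> c \<in> carrier H \<Longrightarrow> (\<lambda>a. F a b c) \<in> lin_hom K AP P"
      "\<And>a c. a \<in> carrier AP \<Longrightarrow> c \<in> carrier H \<Longrightarrow> (\<lambda>b. F a b c) \<in> lin_hom K H P"
      "\<And>a b. a \<in> carrier AP \<Longrightarrow> b \<in> carrier H \<Longrightarrow> (\<lambda>c. F a b c) \<in> lin_hom K H P"
  shows "rsw P f (\<lambda>v0 v1. rt P v0 l (\<lambda>a k. F a k v1)) = rsw P f (\<lambda>v0 v1. cop P v1 (\<lambda>x y. F (ev v0 l) x y))"
proof -
  note [simp] = lin_comp[OF F(1)] lin_comp[OF F(2)] lin_comp[OF F(3)] F P lin_hom_closed[OF F(1)]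
  \<comment> \<open>The coproduct of \<open>Si l3 \<bullet> (k \<bullet> l1)\<close> taken factor by
    factor, where the inverse antipode reverses the legs of \<open>l3\<close>. The sums over the
    legs of \<open>l1\<close> and \<open>l3\<close> are moved outward so that they join the
    coproduct of \<open>l\<close>.\<close>
  have 1: "dsw P (ev f l2) (\<lambda>a k. cop P (Si l3 \<bullet> (k \<bullet> l1)) (\<lambda>x y. F a x y)) =
      cop P l1 (\<lambda>t w. cop P l3 (\<lambda>p q. dsw P (ev f l2) (\<lambda>a k. cop P k (\<lambda>r s. F a (Si q \<bullet> (r \<bullet> t)) (Si p \<bullet> (s \<bullet> w))))))"
    if l123: "l1 \<in> carrier H" "l2 \<in> carrier H" "l3 \<in> carrier H" for l1 l2 l3
  proof -
    have "cop P l1 (\<lambda>t w. cop P l3 (\<lambda>p q. dsw P (ev f l2) (\<lambda>a k. cop P k (\<lambda>r s. F a (Si q \<bullet> (r \<bullet> t)) (Si p \<bullet> (s \<bullet> w)))))) =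
       cop P l3 (\<lambda>p q. dsw P (ev f l2) (\<lambda>a k. cop P l1 (\<lambda>t w. cop P k (\<lambda>r s. F a (Si q \<bullet> (r \<bullet> t)) (Si p \<bullet> (s \<bullet> w))))))"
      by (rule tsw_swap2) (use f l123 in simp_all)
    also have "\<dots> = dsw P (ev f l2) (\<lambda>a k. cop P l3 (\<lambda>p q. cop P l1 (\<lambda>t w. cop P k (\<lambda>r s. F a (Si q \<bullet> (r \<bullet> t)) (Si p \<bullet> (s \<bullet> w))))))"
      by (rule tsw_swap) (use f l123 in simp_all)
    also have "\<dots> = dsw P (ev f l2) (\<lambda>a k. cop P l3 (\<lambda>p q. cop P k (\<lambda>r s. cop P l1 (\<lambda>t w. F a (Si q \<bullet> (r \<bullet> t)) (Si p \<bullet> (s \<bullet> w))))))"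
      by (rule tsw_cong[OF refl], rule tsw_cong[OF refl], rule tsw_swap) (use f l123 in simp_all)
    finally show ?thesis using f l123 by simp
  qed
  have "rsw P f (\<lambda>v0 v1. rt P v0 l (\<lambda>a k. F a k v1)) =
    cop P l (\<lambda>l1 u. cop P u (\<lambda>l2 l3. rsw P f (\<lambda>v0 v1. dsw P (ev v0 l2) (\<lambda>a k. F a (Si l3 \<bullet> (k \<bullet> l1)) v1))))"
    by (rule tsw_swap2) (use f l in simp_all)
  also have "\<dots> = cop P l (\<lambda>l1 u. cop P u (\<lambda>l2 l3. rt P f l2 (\<lambda>b m. dsw P b (\<lambda>a k. F a (Si l3 \<bullet> (k \<bullet> l1)) m))))"
    by (rule tsw_cong[OF refl], rule tsw_cong[OF refl], rule rho_ev) (use f l in simp_all)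
  also have "\<dots> = cop P l (\<lambda>l1 u. cop P u (\<lambda>m1 v. cop P v (\<lambda>m2 w. cop P w (\<lambda>m3 l3.
      dsw P (ev f m2) (\<lambda>a h. cop P h (\<lambda>k m. F a (Si l3 \<bullet> (k \<bullet> l1)) (Si m3 \<bullet> (m \<bullet> m1))))))))"
    using f l by simp
  also have "\<dots> = cop P l (\<lambda>l1 u. cop P u (\<lambda>l2 l3. cop P l1 (\<lambda>t w. cop P l3 (\<lambda>p q.
      dsw P (ev f l2) (\<lambda>a k. cop P k (\<lambda>r s. F a (Si q \<bullet> (r \<bullet> t)) (Si p \<bullet> (s \<bullet> w))))))))"
    using f l by simp
  also have "\<dots> = rt P f l (\<lambda>a r. cop P r (\<lambda>x y. F a x y))"
    by (rule tsw_cong[OF refl], rule tsw_cong[OF refl], rule 1[symmetric])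
  also have "\<dots> = rsw P f (\<lambda>v0 v1. cop P v1 (\<lambda>x y. F (ev v0 l) x y))"
    by (rule rho_ev[symmetric]) (use f l in simp_all)
  finally show ?thesis .
qed

text \<open>A slice removes the outer \<open>H\<close>-leg, and evaluation reduces equality in
  \<open>BH\<close> to one in \<open>AH\<close>, which is \<open>rho_coassoc_ev\<close> for a scaled
  pure tensor.\<close>

lemma rho_coassoc:
  assumes f: "f \<in> carrier BB"
  shows "rsw (tensor K BH H) f (\<lambda>v0 v1. pure K BH H (rho v0) v1) =
    rsw (tensor K BH H) f (\<lambda>v0 v1. cop (tensor K BH H) v1 (\<lambda>x y. pure K BH H (pure K BB H v0 x) y))" (is "?X = ?Y")
proof (rule slice_eq)
  fix \<phi> assume \<phi>: "\<phi> \<in> lin_hom K H (kmod K)"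
  note [simp] = \<phi> lin_comp[OF \<phi>] lin_hom_closed[OF \<phi>, simplified]
  have "rsw BH f (\<lambda>v0 v1. \<phi> v1 \<odot>\<^bsub>BH\<^esub> rho v0) = rsw BH f (\<lambda>v0 v1. cop BH v1 (\<lambda>x y. \<phi> y \<odot>\<^bsub>BH\<^esub> pure K BB H v0 x))"
  proof (rule BH_eqI)
    fix l assume l: "l \<in> carrier H"
    have "tsw K BB H AH (rsw BH f (\<lambda>v0 v1. \<phi> v1 \<odot>\<^bsub>BH\<^esub> rho v0)) (\<lambda>f h. pure K AP H (ev f l) h) =
       rsw AH f (\<lambda>v0 v1. rt AH v0 l (\<lambda>a k. \<phi> v1 \<odot>\<^bsub>AH\<^esub> pure K AP H a k))"
      using f l by (simp add: tsw_smult_arg rho_pure)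
    also have "\<dots> = rsw AH f (\<lambda>v0 v1. cop AH v1 (\<lambda>x y. \<phi> y \<odot>\<^bsub>AH\<^esub> pure K AP H (ev v0 l) x))"
      by (rule rho_coassoc_ev) (use f l in simp_all)
    also have "\<dots> = tsw K BB H AH (rsw BH f (\<lambda>v0 v1. cop BH v1 (\<lambda>x y. \<phi> y \<odot>\<^bsub>BH\<^esub> pure K BB H v0 x))) (\<lambda>f h. pure K AP H (ev f l) h)"
      using f l by (simp add: tsw_smult_arg)
    finally show "tsw K BB H AH (rsw BH f (\<lambda>v0 v1. \<phi> v1 \<odot>\<^bsub>BH\<^esub> rho v0)) (\<lambda>f h. pure K AP H (ev f l) h) =
      tsw K BB H AH (rsw BH f (\<lambda>v0 v1. cop BH v1 (\<lambda>x y. \<phi> y \<odot>\<^bsub>BH\<^esub> pure K BB H v0 x))) (\<lambda>f h. pure K AP H (ev f l) h)" .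
  qed (use f in simp_all)
  then show "tsw K BH H BH ?X (\<lambda>m h. \<phi> h \<odot>\<^bsub>BH\<^esub> m) = tsw K BH H BH ?Y (\<lambda>m h. \<phi> h \<odot>\<^bsub>BH\<^esub> m)" using f by simp
qed (use f in simp_all)

lemma rho_counit:
  assumes f: "f \<in> carrier BB" shows "rsw BB f (\<lambda>v0 v1. eps v1 \<odot>\<^bsub>BB\<^esub> v0) = f"
proof (rule BB_eqI)
  fix l assume l: "l \<in> carrier H"
  have "ev (rsw BB f (\<lambda>v0 v1. eps v1 \<odot>\<^bsub>BB\<^esub> v0)) l = rsw AP f (\<lambda>v0 v1. eps v1 \<odot>\<^bsub>AP\<^esub> ev v0 l)" using f l by simp
  also have "\<dots> = rt AP f l (\<lambda>a k. eps k \<odot>\<^bsub>AP\<^esub> a)" by (rule rho_ev) (use f l in simp_all)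
  also have "\<dots> = cop AP l (\<lambda>l1 u. cop AP u (\<lambda>l2 l3. eps l3 \<odot>\<^bsub>AP\<^esub> (eps l1 \<odot>\<^bsub>AP\<^esub> ev f l2)))"
  proof (rule tsw_cong[OF refl], rule tsw_cong[OF refl])
    fix l1 l2 l3 assume l123: "l1 \<in> carrier H" "l2 \<in> carrier H" "l3 \<in> carrier H"
    have "dsw AP (ev f l2) (\<lambda>a k. eps (Si l3 \<bullet> (k \<bullet> l1)) \<odot>\<^bsub>AP\<^esub> a) = dsw AP (ev f l2) (\<lambda>a k. eps l3 \<odot>\<^bsub>AP\<^esub> (eps l1 \<odot>\<^bsub>AP\<^esub> (eps k \<odot>\<^bsub>AP\<^esub> a)))"
      by (rule tsw_cong[OF refl]) (use l123 in \<open>simp add: smult_comm[OF modAP, of "eps _" "eps l1"]\<close>)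
    also have "\<dots> = eps l3 \<odot>\<^bsub>AP\<^esub> (eps l1 \<odot>\<^bsub>AP\<^esub> dsw AP (ev f l2) (\<lambda>a k. eps k \<odot>\<^bsub>AP\<^esub> a))"
      using f l123 by (simp del: dsw_counit)
    finally show "dsw AP (ev f l2) (\<lambda>a k. eps (Si l3 \<bullet> (k \<bullet> l1)) \<odot>\<^bsub>AP\<^esub> a) = eps l3 \<odot>\<^bsub>AP\<^esub> (eps l1 \<odot>\<^bsub>AP\<^esub> ev f l2)"
      using f l123 by simp
  qed
  also have "\<dots> = ev f l" using f l by simp
  finally show "ev (rsw BB f (\<lambda>v0 v1. eps v1 \<odot>\<^bsub>BB\<^esub> v0)) l = ev f l" .
qed (use f in simp_all)

lemma rho_one: "rho \<one>\<^bsub>BB\<^esub> = pure K BB H \<one>\<^bsub>BB\<^esub> \<one>\<^bsub>H\<^esub>"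
proof (rule BH_eqI)
  fix l assume l: "l \<in> carrier H"
  have "rsw AH \<one>\<^bsub>BB\<^esub> (\<lambda>f h. pure K AP H (ev f l) h) = cop AH l (\<lambda>l1 u. cop AH u (\<lambda>l2 l3. eps l2 \<odot>\<^bsub>AH\<^esub> pure K AP H \<one>\<^bsub>AP\<^esub> (Si l3 \<bullet> l1)))"
    using l by (simp add: rho_pure lin_hom_smult[OF dl_lin0] tsw_smult_arg)
  also have "\<dots> = cop AH l (\<lambda>x y. pure K AP H \<one>\<^bsub>AP\<^esub> (Si y \<bullet> x))" using l by simp
  also have "\<dots> = eps l \<odot>\<^bsub>AH\<^esub> pure K AP H \<one>\<^bsub>AP\<^esub> \<one>\<^bsub>H\<^esub>" by (rule contract0(3)) (use l in simp_all)
  also have "\<dots> = tsw K BB H AH (pure K BB H \<one>\<^bsub>BB\<^esub> \<one>\<^bsub>H\<^esub>) (\<lambda>f h. pure K AP H (ev f l) h)" using l by simp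
  finally show "rsw AH \<one>\<^bsub>BB\<^esub> (\<lambda>f h. pure K AP H (ev f l) h) = tsw K BB H AH (pure K BB H \<one>\<^bsub>BB\<^esub> \<one>\<^bsub>H\<^esub>) (\<lambda>f h. pure K AP H (ev f l) h)" .
qed simp_all

text \<open>Evaluated at \<open>l\<close>, the two coactions contribute the \<open>H\<close>-leg
  \<open>Si y3 \<bullet> (s \<bullet> y1)\<close> followed by
  \<open>Si x3 \<bullet> (r \<bullet> x1)\<close>. The adjacent \<open>y1\<close> and
  \<open>Si x3\<close> cancel, which leaves the coaction of the convolution product.\<close>

lemma rho_mult:
  assumes f: "f \<in> carrier BB" and g: "g \<in> carrier BB"
  shows "rho (f \<otimes>\<^bsub>BB\<^esub> g) = rsw BH f (\<lambda>v0 v1. rsw BH g (\<lambda>w0 w1. pure K BB H (v0 \<otimes>\<^bsub>BB\<^esub> w0) (w1 \<bullet> v1)))"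
proof (rule BH_eqI)
  fix l assume l: "l \<in> carrier H"
  have "tsw K BB H AH (rsw BH f (\<lambda>v0 v1. rsw BH g (\<lambda>w0 w1. pure K BB H (v0 \<otimes>\<^bsub>BB\<^esub> w0) (w1 \<bullet> v1)))) (\<lambda>f h. pure K AP H (ev f l) h) =
     rsw AH f (\<lambda>v0 v1. rsw AH g (\<lambda>w0 w1. cop AH l (\<lambda>x y. pure K AP H (ev v0 x \<cdot>\<^sub>A ev w0 y) (w1 \<bullet> v1))))"
    using f g l by simp
  also have "\<dots> = cop AH l (\<lambda>x y. rsw AH f (\<lambda>v0 v1. rsw AH g (\<lambda>w0 w1. pure K AP H (ev v0 x \<cdot>\<^sub>A ev w0 y) (w1 \<bullet> v1))))"
    by (rule tsw_swap2[symmetric]) (use f g l in simp_all)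
  also have "\<dots> = cop AH l (\<lambda>x y. rsw AH f (\<lambda>v0 v1. rt AH g y (\<lambda>b s. pure K AP H (ev v0 x \<cdot>\<^sub>A b) (s \<bullet> v1))))"
    by (rule tsw_cong[OF refl], rule tsw_cong[OF refl], rule rho_ev) (use f g l in simp_all)
  also have "\<dots> = cop AH l (\<lambda>x y. rt AH f x (\<lambda>a r. rt AH g y (\<lambda>b s. pure K AP H (a \<cdot>\<^sub>A b) (s \<bullet> r))))"
    by (rule tsw_cong[OF refl], rule rho_ev[where C = "\<lambda>a r. rt AH g y (\<lambda>b s. pure K AP H (a \<cdot>\<^sub>A b) (s \<bullet> r))" for y])
      (use f g l in simp_all)
  also have "\<dots> = cop AH l (\<lambda>x y. cop AH x (\<lambda>x1 u. cop AH u (\<lambda>x2 x3. cop AH y (\<lambda>y1 v. cop AH v (\<lambda>y2 y3.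
      dsw AH (ev f x2) (\<lambda>a r. dsw AH (ev g y2) (\<lambda>b s. pure K AP H (a \<cdot>\<^sub>A b) ((Si y3 \<bullet> (s \<bullet> y1)) \<bullet> (Si x3 \<bullet> (r \<bullet> x1))))))))))"
    by (rule tsw_cong[OF refl], rule tsw_cong[OF refl], rule tsw_cong[OF refl], rule tsw_swap2) (use f g l in simp_all)
  also have "\<dots> = cop AH l (\<lambda>x1 u. cop AH u (\<lambda>x2 v. cop AH v (\<lambda>x3 w. cop AH w (\<lambda>y1 z. cop AH z (\<lambda>y2 y3.
      dsw AH (ev f x2) (\<lambda>a r. dsw AH (ev g y2) (\<lambda>b s. pure K AP H (a \<cdot>\<^sub>A b) (Si y3 \<bullet> (s \<bullet> (y1 \<bullet> (Si x3 \<bullet> (r \<bullet> x1))))))))))))"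
    using f g l by simp
  also have "\<dots> = cop AH l (\<lambda>x1 u. cop AH u (\<lambda>x2 v. cop AH v (\<lambda>y2 y3.
      dsw AH (ev f x2) (\<lambda>a r. dsw AH (ev g y2) (\<lambda>b s. pure K AP H (a \<cdot>\<^sub>A b) (Si y3 \<bullet> (s \<bullet> (\<one>\<^bsub>H\<^esub> \<bullet> (r \<bullet> x1)))))))))"
    by (rule tsw_cong[OF refl], rule tsw_cong[OF refl], rule chain_l_Sir[where G = "\<lambda>w z. cop AH z (\<lambda>y2 y3.
      dsw AH (ev f x2) (\<lambda>a r. dsw AH (ev g y2) (\<lambda>b s. pure K AP H (a \<cdot>\<^sub>A b) (Si y3 \<bullet> (s \<bullet> (w \<bullet> (r \<bullet> x1)))))))" for x1 x2])
      (use f g l in simp_all)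
  also have "\<dots> = rt AH (f \<otimes>\<^bsub>BB\<^esub> g) l (\<lambda>a k. pure K AP H a k)" using f g l by simp
  finally show "rsw AH (f \<otimes>\<^bsub>BB\<^esub> g) (\<lambda>f h. pure K AP H (ev f l) h) =
     tsw K BB H AH (rsw BH f (\<lambda>v0 v1. rsw BH g (\<lambda>w0 w1. pure K BB H (v0 \<otimes>\<^bsub>BB\<^esub> w0) (w1 \<bullet> v1)))) (\<lambda>f h. pure K AP H (ev f l) h)"
    using f g l by (simp only: rho_pure BB_mult_closed)
qed (use f g in simp_all)

text \<open>Evaluation takes place at \<open>l \<bullet> h2\<close>, whose threefold coproduct
  contributes \<open>x\<close> and \<open>Si z\<close> to the \<open>H\<close>-leg. They cancel
  against \<open>Si h1\<close> at the right end and \<open>h3\<close> at the left end, and the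
  remaining leg of \<open>h\<close> shifts the argument of \<open>f\<close>.\<close>

lemma rho_act:
  assumes f: "f \<in> carrier BB" and h: "h \<in> carrier H"
  shows "rho (bact h f) = cop BH h (\<lambda>h1 u. cop BH u (\<lambda>h2 h3. rsw BH f (\<lambda>v0 v1. pure K BB H (bact h2 v0) (h3 \<bullet> (v1 \<bullet> Si h1)))))"
proof (rule BH_eqI)
  fix l assume l: "l \<in> carrier H"
  have "tsw K BB H AH (cop BH h (\<lambda>h1 u. cop BH u (\<lambda>h2 h3. rsw BH f (\<lambda>v0 v1. pure K BB H (bact h2 v0) (h3 \<bullet> (v1 \<bullet> Si h1)))))) (\<lambda>f h. pure K AP H (ev f l) h) =
     cop AH h (\<lambda>h1 u. cop AH u (\<lambda>h2 h3. rsw AH f (\<lambda>v0 v1. pure K AP H (ev v0 (l \<bullet> h2)) (h3 \<bullet> (v1 \<bullet> Si h1)))))"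
    using f h l by simp
  also have "\<dots> = cop AH h (\<lambda>h1 u. cop AH u (\<lambda>h2 h3. rt AH f (l \<bullet> h2) (\<lambda>a k. pure K AP H a (h3 \<bullet> (k \<bullet> Si h1)))))"
    by (rule tsw_cong[OF refl], rule tsw_cong[OF refl], rule rho_ev) (use f h l in simp_all)
  also have "\<dots> = cop AH h (\<lambda>h1 u. cop AH u (\<lambda>h2 h3. cop AH h2 (\<lambda>x v. cop AH v (\<lambda>y z. cop AH l (\<lambda>l1 w. cop AH w (\<lambda>l2 l3.
      dsw AH (ev f (l2 \<bullet> y)) (\<lambda>a k. pure K AP H a (h3 \<bullet> ((Si (l3 \<bullet> z) \<bullet> (k \<bullet> (l1 \<bullet> x))) \<bullet> Si h1)))))))))"
    by (rule tsw_cong[OF refl], rule tsw_cong[OF refl], rule cop3_mult(2)) (use f h l in simp_all)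
  also have "\<dots> = cop AH h (\<lambda>h1 u. cop AH u (\<lambda>x v. cop AH v (\<lambda>y w. cop AH w (\<lambda>z h3. cop AH l (\<lambda>l1 w. cop AH w (\<lambda>l2 l3.
      dsw AH (ev f (l2 \<bullet> y)) (\<lambda>a k. pure K AP H a (h3 \<bullet> (Si z \<bullet> (Si l3 \<bullet> (k \<bullet> (l1 \<bullet> (x \<bullet> Si h1)))))))))))))"
    using f h l by simp
  also have "\<dots> = cop AH h (\<lambda>y w. cop AH w (\<lambda>z h3. cop AH l (\<lambda>l1 w. cop AH w (\<lambda>l2 l3.
      dsw AH (ev f (l2 \<bullet> y)) (\<lambda>a k. pure K AP H a (h3 \<bullet> (Si z \<bullet> (Si l3 \<bullet> (k \<bullet> (l1 \<bullet> \<one>\<^bsub>H\<^esub>))))))))))"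
    by (rule chain_l_Sir[where G = "\<lambda>g v. cop AH v (\<lambda>y w. cop AH w (\<lambda>z h3. cop AH l (\<lambda>l1 w. cop AH w (\<lambda>l2 l3.
      dsw AH (ev f (l2 \<bullet> y)) (\<lambda>a k. pure K AP H a (h3 \<bullet> (Si z \<bullet> (Si l3 \<bullet> (k \<bullet> (l1 \<bullet> g)))))))))) "]) (use f h l in simp_all)
  also have "\<dots> = cop AH l (\<lambda>l1 w. cop AH w (\<lambda>l2 l3. dsw AH (ev f (l2 \<bullet> h)) (\<lambda>a k. pure K AP H a (\<one>\<^bsub>H\<^esub> \<bullet> (Si l3 \<bullet> (k \<bullet> (l1 \<bullet> \<one>\<^bsub>H\<^esub>)))))))"
    by (rule chain_r_Sir[where G = "\<lambda>y g. cop AH l (\<lambda>l1 w. cop AH w (\<lambda>l2 l3.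
      dsw AH (ev f (l2 \<bullet> y)) (\<lambda>a k. pure K AP H a (g \<bullet> (Si l3 \<bullet> (k \<bullet> (l1 \<bullet> \<one>\<^bsub>H\<^esub>)))))))"]) (use f h l in simp_all)
  also have "\<dots> = rt AH (bact h f) l (\<lambda>a k. pure K AP H a k)" using f h l by simp
  finally show "rsw AH (bact h f) (\<lambda>f h. pure K AP H (ev f l) h) =
     tsw K BB H AH (cop BH h (\<lambda>h1 u. cop BH u (\<lambda>h2 h3. rsw BH f (\<lambda>v0 v1. pure K BB H (bact h2 v0) (h3 \<bullet> (v1 \<bullet> Si h1)))))) (\<lambda>f h. pure K AP H (ev f l) h)"
    using f h l by (simp only: rho_pure bact_closed)
qed (use f h in simp_all)

lemma yetter_drinfeld_algebra_BB: "yetter_drinfeld_algebra K H BB bact rho"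
proof -
  have c: "right_hcomodule K H BB rho"
    unfolding right_hcomodule_def
  proof (intro conjI ballI)
    fix f assume f: "f \<in> carrier BB"
    have "sw K (tensor K BH H) (comult H v1) (\<lambda>x y. pure K BH H (pure K BB H v0 x) y) =
       cop (tensor K BH H) v1 (\<lambda>x y. pure K BH H (pure K BB H v0 x) y)" if "v0 \<in> carrier BB" "v1 \<in> carrier H" for v0 v1
      using that by (simp add: sw_cop)
    then show "sw K (tensor K BH H) (rho f) (\<lambda>v0 v1. pure K BH H (rho v0) v1) =
        sw K (tensor K BH H) (rho f) (\<lambda>v0 v1. sw K (tensor K BH H) (comult H v1) (\<lambda>x y. pure K BH H (pure K BB H v0 x) y))"
      using rho_coassoc[OF f] f by (simp add: sw_BH)
    show "sw K BB (rho f) (\<lambda>v0 v1. eps v1 \<odot>\<^bsub>BB\<^esub> v0) = f" using rho_counit[OF f] f by (simp add: sw_BH)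
  qed simp_all
  have "rho (f \<otimes>\<^bsub>BB\<^esub> g) = sw K BH (rho f) (\<lambda>v0 v1. sw K BH (rho g) (\<lambda>w0 w1. pure K BB H (v0 \<otimes>\<^bsub>BB\<^esub> w0) (w1 \<bullet> v1)))"
    if "f \<in> carrier BB" "g \<in> carrier BB" for f g
    using that by (simp add: rho_mult sw_BH)
  then have ca: "right_hop_comodule_algebra K H BB rho" using c by (simp add: right_hop_comodule_algebra_def rho_one)
  have "rho (bact h f) = sw K BH (comult H h) (\<lambda>h1 l'. sw K BH (comult H l')
          (\<lambda>h2 h3. sw K BH (rho f) (\<lambda>v0 v1. pure K BB H (bact h2 v0) (h3 \<bullet> v1 \<bullet> Si h1))))"
    if f: "f \<in> carrier BB" and h: "h \<in> carrier H" for f h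
  proof -
    have 1: "sw K BH (rho f) (\<lambda>v0 v1. pure K BB H (bact h2 v0) (h3 \<bullet> v1 \<bullet> Si h1)) = rsw BH f (\<lambda>v0 v1. pure K BB H (bact h2 v0) (h3 \<bullet> (v1 \<bullet> Si h1)))"
      if "h1 \<in> carrier H" "h2 \<in> carrier H" "h3 \<in> carrier H" for h1 h2 h3 by (subst sw_BH) (use f that in simp_all)
    have 2: "sw K BH (comult H u) (\<lambda>h2 h3. sw K BH (rho f) (\<lambda>v0 v1. pure K BB H (bact h2 v0) (h3 \<bullet> v1 \<bullet> Si h1))) =
       cop BH u (\<lambda>h2 h3. rsw BH f (\<lambda>v0 v1. pure K BB H (bact h2 v0) (h3 \<bullet> (v1 \<bullet> Si h1))))" if "h1 \<in> carrier H" "u \<in> carrier H" for h1 u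
      by (subst sw_cop) (use f that in \<open>simp_all add: 1\<close>)
    show ?thesis by (subst sw_cop) (use f h in \<open>simp_all add: 2 rho_act\<close>)
  qed
  then show ?thesis using BB_hmod c ca by (simp add: yetter_drinfeld_algebra_def yetter_drinfeld_def left_hmodule_algebra_def)
qed

end

theorem theorem5p6:
  fixes K :: "'k ring" and H :: "('k, 'h) hopf"
  assumes "hopf_algebra K H"
    and "bij_betw (antipode H) (carrier H) (carrier H)"
    and "finite_dimensional K H"
  shows "\<exists>\<delta> \<rho>. is_apar_coaction K H \<delta> \<and> is_apar_homs_coaction K H \<delta> \<rho> \<and>
    yetter_drinfeld_algebra K H (apar_homs K H) (apar_homs_act K H) \<rho> \<and>
    braided_commutative K (apar_homs K H) (apar_homs_act K H) \<rho> \<and>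
    (\<exists>\<tau>. lu_hopf_algebroid K (apar_homs K H)
       (smash K H (apar_homs K H) (apar_homs_act K H))
       (smash_source K H (apar_homs K H)) \<rho>
       (smash_comult K H (apar_homs K H) (apar_homs_act K H) \<rho>)
       (smash_counit K H (apar_homs K H)) \<tau>)"
proof -
  interpret hopf_algebra K H by fact
  interpret hopf_fd K H by unfold_locales (fact assms)+
  interpret Y: yd_alg K H BB bact rho
    by unfold_locales (fact BB_hmod yetter_drinfeld_algebra_BB braided_commutative_BB)+
  show ?thesis
    using is_apar_coaction_dl is_apar_homs_coaction_rho yetter_drinfeld_algebra_BB braided_commutative_BB
      Y.smash_lu_hopf_algebroid by blast
qed

end
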